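(* Let $\alpha\ge-1$, $0<p<\infty$, $m,n\in\mathbb{N}$ with $n\ge2$, and $s=\frac mn+1$. Then there is a constant $C>0$ independent of $g$ such that $$\|g\|^{sn}_{\mathscr{B}^s_\alpha}\le C\,|||S_g^mT_g^n|||_{\alpha,p}\qquad(g\in\mathcal{H}(\mathbb{D})).$$
   Context: $\mathbb{D}$ unit disc, $\mathcal{H}(\mathbb{D})$ analytic functions, $dA$ normalized area measure. For $\alpha>-1$, $A^p_\alpha$ is the set of $f\in\mathcal{H}(\mathbb{D})$ with $\|f\|_{\alpha,p}^p=(\alpha+1)\int_{\mathbb{D}}|f|^p(1-|z|^2)^\alpha dA<\infty$; $A^p_{-1}=H^p$ with the Hardy norm. $A^p_\alpha(0)=\{f\in A^p_\alpha:f(0)=0\}$. $T_gf(z)=\int_0^zfg'$, $S_gf(z)=\int_0^zf'g$. $|||L|||_{\alpha,p}=\sup\{\|Lf\|_{\alpha,p}:f\in A^p_\alpha(0),\|f\|_{\alpha,p}\le1\}$. $|\nabla\psi|(z)=\limsup_{w\to z}|\psi(w)-\psi(z)|/|w-z|$, $\phi_a(z)=\frac{a-z}{1-\bar az}$. For $q\ge1$, $\|g\|_{\mathscr{B}^q}^q=\sup_z(1-|z|^2)|\nabla|g|^q|(z)$, $\|g\|_{BMOA^q}^{2q}=\sup_a\int_{\mathbb{D}}(1-|\phi_a|^2)|\nabla|g|^q|^2dA$; $\|\cdot\|_{\mathscr{B}^q_\alpha}=\|\cdot\|_{\mathscr{B}^q}$ for $\alpha>-1$ and $=\|\cdot\|_{BMOA^q}$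 for $\alpha=-1$. *)

theory Defs
  imports "HOL-Complex_Analysis.Complex_Analysis"
begin

abbreviation disc :: "complex set" where "disc \<equiv> ball 0 1"

text \<open>Extended real power of a value in [0,\<infinity>] (r > 0); \<infinity> stays \<infinity>.\<close>
definition enn_powr :: "ennreal \<Rightarrow> real \<Rightarrow> ennreal" where
  "enn_powr x r = (if x = \<infinity> then \<infinity> else ennreal (enn2real x powr r))"

text \<open>p-th power of the weighted Bergman norm, with dA = Lebesgue measure / pi.\<close>
definition bergman_pow :: "real \<Rightarrow> real \<Rightarrow> (complex \<Rightarrow> complex) \<Rightarrow> ennreal" where
  "bergman_pow \<alpha> p f =
     ennreal (\<alpha> + 1) *
     (\<integral>\<^sup>+ z \<in> disc. ennreal (cmod (f z) powr p * (1 - (cmod z)\<^sup>2) powr \<alpha>) \<partial>lborel)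
     / ennreal pi"

definition hardy_pow :: "real \<Rightarrow> (complex \<Rightarrow> complex) \<Rightarrow> ennreal" where
  "hardy_pow p f =
     (SUP r \<in> {0<..<1}.
        (\<integral>\<^sup>+ t \<in> {0..2*pi}. ennreal (cmod (f (of_real r * cis t)) powr p) \<partial>lborel)
        / ennreal (2 * pi))"

definition Apnorm_pow :: "real \<Rightarrow> real \<Rightarrow> (complex \<Rightarrow> complex) \<Rightarrow> ennreal" where
  "Apnorm_pow \<alpha> p f = (if \<alpha> = -1 then hardy_pow p f else bergman_pow \<alpha> p f)"

definition Apnorm :: "real \<Rightarrow> real \<Rightarrow> (complex \<Rightarrow> complex) \<Rightarrow> ennreal" where
  "Apnorm \<alpha> p f = enn_powr (Apnorm_pow \<alpha> p f) (1 / p)"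

definition Ap :: "real \<Rightarrow> real \<Rightarrow> (complex \<Rightarrow> complex) set" where
  "Ap \<alpha> p = {f. f holomorphic_on disc \<and> Apnorm_pow \<alpha> p f < \<infinity>}"

definition Ap0 :: "real \<Rightarrow> real \<Rightarrow> (complex \<Rightarrow> complex) set" where
  "Ap0 \<alpha> p = {f \<in> Ap \<alpha> p. f 0 = 0}"

definition Tg :: "(complex \<Rightarrow> complex) \<Rightarrow> (complex \<Rightarrow> complex) \<Rightarrow> complex \<Rightarrow> complex" where
  "Tg g f z = contour_integral (linepath 0 z) (\<lambda>w. f w * deriv g w)"

definition Sg :: "(complex \<Rightarrow> complex) \<Rightarrow> (complex \<Rightarrow> complex) \<Rightarrow> complex \<Rightarrow> complex" where
  "Sg g f z = contour_integral (linepath 0 z) (\<lambda>w. deriv f w * g w)"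

definition opnorm :: "real \<Rightarrow> real \<Rightarrow> ((complex \<Rightarrow> complex) \<Rightarrow> (complex \<Rightarrow> complex)) \<Rightarrow> ennreal" where
  "opnorm \<alpha> p L = (SUP f \<in> {f \<in> Ap0 \<alpha> p. Apnorm \<alpha> p f \<le> 1}. Apnorm \<alpha> p (L f))"

definition grad_abs :: "(complex \<Rightarrow> real) \<Rightarrow> complex \<Rightarrow> ennreal" where
  "grad_abs \<psi> z = Limsup (at z) (\<lambda>w. ennreal (\<bar>\<psi> w - \<psi> z\<bar> / cmod (w - z)))"

definition phi :: "complex \<Rightarrow> complex \<Rightarrow> complex" where
  "phi a z = (a - z) / (1 - cnj a * z)"

definition bloch_pow :: "real \<Rightarrow> (complex \<Rightarrow> complex) \<Rightarrow> ennreal" where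
  "bloch_pow q g = (SUP z \<in> disc. ennreal (1 - (cmod z)\<^sup>2) * grad_abs (\<lambda>w. cmod (g w) powr q) z)"

definition bmoa_pow :: "real \<Rightarrow> (complex \<Rightarrow> complex) \<Rightarrow> ennreal" where
  "bmoa_pow q g = (SUP a \<in> disc.
      (\<integral>\<^sup>+ z \<in> disc. ennreal (1 - (cmod (phi a z))\<^sup>2) *
            (grad_abs (\<lambda>w. cmod (g w) powr q) z)\<^sup>2 \<partial>lborel) / ennreal pi)"

definition Bq_alpha_norm :: "real \<Rightarrow> real \<Rightarrow> (complex \<Rightarrow> complex) \<Rightarrow> ennreal" where
  "Bq_alpha_norm \<alpha> q g =
     (if \<alpha> = -1 then enn_powr (bmoa_pow q g) (1 / (2 * q)) else enn_powr (bloch_pow q g) (1 / q))"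

end

theory Submission
  imports Defs
begin

text \<open>Let \<open>L = S_g^m T_g^n\<close> and \<open>u = \<bar>g\<bar>^(m/n) \<bar>g'\<bar>\<close>. Integrating one step at a time, the iterates \<open>L^j f\<close> form a chain
  \<open>F_0 = f\<close>, \<open>F_i' = g^(m_i) g' F_(i-1)\<close>, where \<open>m_i\<close> is \<open>m\<close> if \<open>n\<close> divides \<open>i\<close> and \<open>0\<close> otherwise, so that
  \<open>L^j f = F_K\<close> for \<open>K = n j\<close>. Put \<open>l = (\<bar>F_K\<bar> / \<bar>F_0\<bar>)^(1/K)\<close>. At every point the products of \<open>\<bar>F_i'/F_i\<bar>\<close> with suitably
  weighted ratios \<open>\<bar>F_i / F_(i-1)\<bar>\<close> all equal \<open>u / l\<close>, and this makes it possible to build an explicit function \<open>V\<close>,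
  comparable to \<open>l\<^sup>2\<close> from above, whose Laplacian dominates \<open>u\<^sup>2\<close> up to an error \<open>l\<^sup>2 \<bar>f'/f\<bar>\<^sup>2\<close>. Green's formula with a kernel \<open>v\<close>
  turns this into a bound of \<open>\<integral> v u\<^sup>2\<close> by integrals of \<open>l\<^sup>2\<close>, and for \<open>2/K \<le> p\<close> Young's inequality bounds those by the norm of
  \<open>L^j f\<close>, hence by the norm of \<open>L\<close>. The test functions are \<open>f(z) = z (1 - cnj a z)^(-c)\<close>. In the Hardy case \<open>v\<close> is
  \<open>1 - \<bar>\<phi>_a\<bar>\<^sup>2\<close> on dilated discs; in the Bergman case \<open>v = (1 - \<bar>w\<bar>\<^sup>2)\<^sup>2\<close> on the disc of radius \<open>(1 - \<bar>a\<bar>)/2\<close> about \<open>a\<close>.\<close>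

text \<open>The obstacle is that \<open>F_K / F_0\<close> records only the product of K ratios,
  while single ratios may be far from their geometric mean, so \<open>u\<close> has no pointwise
  bound by \<open>l\<close>. After division by \<open>l\<close> and balancing of the powers of
  \<open>g\<close>, the ratios \<open>\<rho> 1\<close>, ..., \<open>\<rho> K\<close> have product 1,
  and each satisfies \<open>cmod (\<Lambda> i) * \<rho> i = u / l\<close>. Either some ratio of
  index below K drops under its threshold \<open>\<epsilon>^(i+1)\<close>; then the first such index
  has a logarithmic derivative that dominates all earlier ones. Or none does; then the last ratio is
  bounded because the product is 1, and \<open>u / l\<close> is bounded by the logarithmic
  derivatives of \<open>l\<close> and \<open>f\<close>. The potential has one summand per index, of
  the form \<open>- l^2 q^(-\<kappa>)\<close> up to a constant, where \<open>q\<close> stays bounded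
  at the first small index; there its Laplacian is large. The second alternative is paid for by a
  multiple of \<open>l^2\<close> and by the error in \<open>f'/f\<close>. Iterating the operator
  lowers the exponent 2/K of \<open>F_K\<close> below p. A single application does not suffice for
  small p, and no triangle inequality is available when p < 1.\<close>

section \<open>Functions with a continuous Laplacian\<close>

text \<open>In Wirtinger notation \<open>D = 2 \<partial>V\<close>, and \<open>a\<close>, \<open>b\<close> are the two derivatives of \<open>D\<close>; thus \<open>2 b\<close> is the Laplacian of \<open>V\<close>.\<close>

definition lap2 :: "complex set \<Rightarrow> (complex \<Rightarrow> real) \<Rightarrow> (complex \<Rightarrow> complex) \<Rightarrow> (complex \<Rightarrow> complex)
    \<Rightarrow> (complex \<Rightarrow> real) \<Rightarrow> bool" where
  "lap2 S V D a b \<longleftrightarrow> open S \<and> continuous_on S a \<and> continuous_on S b \<and>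
     (\<forall>z\<in>S. (V has_derivative (\<lambda>e. Re (e * D z))) (at z) \<and>
            (D has_derivative (\<lambda>e. a z * e + of_real (b z) * cnj e)) (at z))"

lemma lap2_subset: "lap2 S V D a b \<Longrightarrow> open T \<Longrightarrow> T \<subseteq> S \<Longrightarrow> lap2 T V D a b"
  by (simp add: lap2_def continuous_on_subset[of S _ T] subset_iff)

lemma lap2_continuous:
  assumes "lap2 S V D a b"
  shows "continuous_on S V" "continuous_on S D" "continuous_on S a" "continuous_on S b" "open S"
proof -
  have "isCont V z" "isCont D z" if "z \<in> S" for z
    using assms that has_derivative_continuous[of V "\<lambda>e. Re (e * D z)" z UNIV]
     has_derivative_continuous[of D "\<lambda>e. a z * e + of_real (b z) * cnj e" z UNIV] unfolding lap2_def by auto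
  then show "continuous_on S V" "continuous_on S D"
    by (simp_all add: continuous_at_imp_continuous_on)
qed (use assms in \<open>simp_all add: lap2_def\<close>)

text \<open>Glues a truncated function, which is identically 0 near a singularity, to its smooth
  expression elsewhere.\<close>

lemma lap2_local:
  assumes "\<And>z. z \<in> S \<Longrightarrow> \<exists>T. z \<in> T \<and> T \<subseteq> S \<and> lap2 T V D a b"
  shows "lap2 S V D a b"
proof -
  obtain T where T: "\<And>z. z \<in> S \<Longrightarrow> z \<in> T z \<and> T z \<subseteq> S \<and> lap2 (T z) V D a b"
    using assms by metis
  have "S = (\<Union>z\<in>S. T z)" using T by auto
  moreover have op: "open (T z)" if "z \<in> S" for z using T[OF that] lap2_def by auto
  ultimately have "open S" by (metis open_UN)
  moreover have "continuous_on S a \<and> continuous_on S b"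
  proof -
    have "continuous_on (\<Union>z\<in>S. T z) a" "continuous_on (\<Union>z\<in>S. T z) b"
      using T op lap2_continuous(3,4)[of "T z" V D a b for z] by (auto intro!: continuous_on_open_UN)
    then show ?thesis using \<open>S = (\<Union>z\<in>S. T z)\<close> by simp
  qed
  moreover have "(V has_derivative (\<lambda>e. Re (e * D z))) (at z)"
     "(D has_derivative (\<lambda>e. a z * e + of_real (b z) * cnj e)) (at z)" if "z \<in> S" for z
    using T[OF that] unfolding lap2_def by auto
  ultimately show ?thesis unfolding lap2_def by simp
qed

lemma lap2_transform:
  assumes "lap2 S V D a b" "\<And>z. z \<in> S \<Longrightarrow> V' z = V z" "\<And>z. z \<in> S \<Longrightarrow> D' z = D z"
    "\<And>z. z \<in> S \<Longrightarrow> a' z = a z" "\<And>z. z \<in> S \<Longrightarrow> b' z = b z"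
  shows "lap2 S V' D' a' b'"
proof -
  have "open S" using assms(1) lap2_def by auto
  have "(V' has_derivative (\<lambda>e. Re (e * D' z))) (at z)" if "z \<in> S" for z
    using assms that \<open>open S\<close> has_derivative_transform_within_open[of V "\<lambda>e. Re (e * D z)" z UNIV S V']
    unfolding lap2_def by auto
  moreover have "(D' has_derivative (\<lambda>e. a' z * e + of_real (b' z) * cnj e)) (at z)" if "z \<in> S" for z
    using assms that \<open>open S\<close> has_derivative_transform_within_open[of D "\<lambda>e. a z * e + of_real (b z) * cnj e" z UNIV S D']
    unfolding lap2_def by auto
  moreover have "continuous_on S a'" "continuous_on S b'"
    using assms(1,4,5) unfolding lap2_def by (metis continuous_on_cong)+
  ultimately show ?thesis using \<open>open S\<close> unfolding lap2_def by blast
qed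

lemma lap2_const: "open S \<Longrightarrow> lap2 S (\<lambda>z. c) (\<lambda>z. 0) (\<lambda>z. 0) (\<lambda>z. 0)"
  unfolding lap2_def by auto

lemma lap2_add:
  assumes "lap2 S V D a b" "lap2 S V' D' a' b'"
  shows "lap2 S (\<lambda>z. V z + V' z) (\<lambda>z. D z + D' z) (\<lambda>z. a z + a' z) (\<lambda>z. b z + b' z)"
proof -
  have "((\<lambda>z. V z + V' z) has_derivative (\<lambda>e. Re (e * (D z + D' z)))) (at z)"
    "((\<lambda>z. D z + D' z) has_derivative (\<lambda>e. (a z + a' z) * e + of_real (b z + b' z) * cnj e)) (at z)" if "z \<in> S" for z
  proof -
    have 1: "(V has_derivative (\<lambda>e. Re (e * D z))) (at z)" "(V' has_derivative (\<lambda>e. Re (e * D' z))) (at z)"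
      "(D has_derivative (\<lambda>e. a z * e + of_real (b z) * cnj e)) (at z)"
      "(D' has_derivative (\<lambda>e. a' z * e + of_real (b' z) * cnj e)) (at z)"
      using assms that unfolding lap2_def by auto
    show "((\<lambda>z. V z + V' z) has_derivative (\<lambda>e. Re (e * (D z + D' z)))) (at z)"
      using has_derivative_add[OF 1(1,2)] by (simp add: algebra_simps)
    show "((\<lambda>z. D z + D' z) has_derivative (\<lambda>e. (a z + a' z) * e + of_real (b z + b' z) * cnj e)) (at z)"
      using has_derivative_add[OF 1(3,4)] by (simp add: algebra_simps)
  qed
  then show ?thesis using assms unfolding lap2_def by (simp add: continuous_on_add)
qed

lemma lap2_cmult:
  assumes "lap2 S V D a b"
  shows "lap2 S (\<lambda>z. c * V z) (\<lambda>z. of_real c * D z) (\<lambda>z. of_real c * a z) (\<lambda>z. c * b z)"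
proof -
  have "((\<lambda>z. c * V z) has_derivative (\<lambda>e. Re (e * (of_real c * D z)))) (at z)"
    "((\<lambda>z. of_real c * D z) has_derivative (\<lambda>e. of_real c * a z * e + of_real (c * b z) * cnj e)) (at z)" if "z \<in> S" for z
  proof -
    have 1: "(V has_derivative (\<lambda>e. Re (e * D z))) (at z)" 
      "(D has_derivative (\<lambda>e. a z * e + of_real (b z) * cnj e)) (at z)"
      using assms that unfolding lap2_def by auto
    show "((\<lambda>z. c * V z) has_derivative (\<lambda>e. Re (e * (of_real c * D z)))) (at z)"
      using has_derivative_mult_right[OF 1(1), of c] by (simp add: algebra_simps)
    show "((\<lambda>z. of_real c * D z) has_derivative (\<lambda>e. of_real c * a z * e + of_real (c * b z) * cnj e)) (at z)"
      using has_derivative_mult_right[OF 1(2), of "of_real c"] by (simp add: algebra_simps)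
  qed
  then show ?thesis using assms unfolding lap2_def by (simp add: continuous_on_mult_left)
qed

lemma lap2_sum:
  assumes "open S" "finite I" "\<And>i. i \<in> I \<Longrightarrow> lap2 S (V i) (D i) (a i) (b i)"
  shows "lap2 S (\<lambda>z. \<Sum>i\<in>I. V i z) (\<lambda>z. \<Sum>i\<in>I. D i z) (\<lambda>z. \<Sum>i\<in>I. a i z) (\<lambda>z. \<Sum>i\<in>I. b i z)"
  using assms(2,3)
proof (induction I rule: finite_induct)
  case empty then show ?case using lap2_const[OF assms(1), of 0] by simp
next
  case (insert x F)
  then show ?case using lap2_add by simp
qed

text \<open>The chain rule for the Laplacian: the new \<open>b\<close> is the old one times the
  first derivative plus the second derivative times half the squared modulus of \<open>D\<close>,
  which is a squared gradient.\<close>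

lemma lap2_compose:
  assumes V: "lap2 S V D a b"
    and \<phi>1: "\<And>t. t \<in> I \<Longrightarrow> (\<phi> has_real_derivative \<phi>1 t) (at t)"
    and \<phi>2: "\<And>t. t \<in> I \<Longrightarrow> (\<phi>1 has_real_derivative \<phi>2 t) (at t)"
    and c: "continuous_on I \<phi>2" and I: "\<And>z. z \<in> S \<Longrightarrow> V z \<in> I"
  shows "lap2 S (\<lambda>z. \<phi> (V z)) (\<lambda>z. of_real (\<phi>1 (V z)) * D z)
     (\<lambda>z. of_real (\<phi>2 (V z)) * (D z)\<^sup>2 / 2 + of_real (\<phi>1 (V z)) * a z)
     (\<lambda>z. \<phi>2 (V z) * (cmod (D z))\<^sup>2 / 2 + \<phi>1 (V z) * b z)"
proof -
  have sub: "V ` S \<subseteq> I" using I by auto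
  have c1: "continuous_on I \<phi>1" using \<phi>2
    by (meson DERIV_continuous continuous_at_imp_continuous_on)
  note cc = lap2_continuous[OF V]
  have k1: "continuous_on S (\<lambda>z. \<phi>1 (V z))" "continuous_on S (\<lambda>z. \<phi>2 (V z))"
    using continuous_on_compose2[OF c1 cc(1) sub] continuous_on_compose2[OF c cc(1) sub] by auto
  have e1: "((\<lambda>z. \<phi> (V z)) has_derivative (\<lambda>e. Re (e * (of_real (\<phi>1 (V z)) * D z)))) (at z)" if "z \<in> S" for z
  proof -
    have 1: "(V has_derivative (\<lambda>e. Re (e * D z))) (at z)" using V that lap2_def by auto
    have 2: "(\<phi> has_derivative (\<lambda>h. \<phi>1 (V z) * h)) (at (V z))"
      using \<phi>1[OF I[OF that]] has_field_derivative_def by blast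
    show ?thesis using has_derivative_compose[OF 1 2]
      by (simp add: algebra_simps)
  qed
  have e2: "((\<lambda>z. of_real (\<phi>1 (V z)) * D z) has_derivative (\<lambda>e. (of_real (\<phi>2 (V z)) * (D z)\<^sup>2 / 2 + of_real (\<phi>1 (V z)) * a z) * e
     + of_real (\<phi>2 (V z) * (cmod (D z))\<^sup>2 / 2 + \<phi>1 (V z) * b z) * cnj e)) (at z)" if "z \<in> S" for z
  proof -
    have 1: "(V has_derivative (\<lambda>e. Re (e * D z))) (at z)" using V that lap2_def by auto
    have 3: "(D has_derivative (\<lambda>e. a z * e + of_real (b z) * cnj e)) (at z)" using V that lap2_def by auto
    have 2: "(\<phi>1 has_derivative (\<lambda>h. \<phi>2 (V z) * h)) (at (V z))"
      using \<phi>2[OF I[OF that]] has_field_derivative_def by blast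
    have 4: "((\<lambda>z. \<phi>1 (V z)) has_derivative (\<lambda>e. \<phi>2 (V z) * Re (e * D z))) (at z)"
      using has_derivative_compose[OF 1 2] by simp
    have 5: "((\<lambda>z. complex_of_real (\<phi>1 (V z)) * D z) has_derivative
       (\<lambda>e. of_real (\<phi>1 (V z)) * (a z * e + of_real (b z) * cnj e) + of_real (\<phi>2 (V z) * Re (e * D z)) * D z)) (at z)"
      by (rule derivative_eq_intros 3 4 refl)+ 
    \<comment> \<open>Writing the real part as half the sum of \<open>e * D z\<close> and its
      conjugate splits this real-linear map into its complex-linear and its antilinear part.\<close>
    have 6: "of_real (Re (e * D z)) * D z = (D z)\<^sup>2 / 2 * e + of_real ((cmod (D z))\<^sup>2 / 2) * cnj e" for e
    proof -
      have "of_real (Re (e * D z)) = (e * D z + cnj e * cnj (D z)) / 2"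
        using complex_add_cnj[of "e * D z"] by simp
      then have "of_real (Re (e * D z)) * D z = (e * D z * D z + cnj e * (D z * cnj (D z))) / 2"
        by (simp add: algebra_simps)
      also have "D z * cnj (D z) = of_real ((cmod (D z))\<^sup>2)" by (rule complex_norm_square[symmetric, THEN trans]) simp
      finally show ?thesis by (simp add: power2_eq_square algebra_simps add_divide_distrib)
    qed
    have "of_real (\<phi>1 (V z)) * (a z * e + of_real (b z) * cnj e) + of_real (\<phi>2 (V z) * Re (e * D z)) * D z
      = (of_real (\<phi>2 (V z)) * (D z)\<^sup>2 / 2 + of_real (\<phi>1 (V z)) * a z) * e
     + of_real (\<phi>2 (V z) * (cmod (D z))\<^sup>2 / 2 + \<phi>1 (V z) * b z) * cnj e" for e
    proof -
      have "of_real (\<phi>2 (V z) * Re (e * D z)) * D z = of_real (\<phi>2 (V z)) * (of_real (Re (e * D z)) * D z)" by simp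
      then show ?thesis unfolding 6 by (simp add: algebra_simps)
    qed
    then show ?thesis using 5 by (simp only:)
  qed
  show ?thesis unfolding lap2_def
  proof (intro conjI ballI)
    show "open S" using cc by auto
    show "continuous_on S (\<lambda>z. of_real (\<phi>2 (V z)) * (D z)\<^sup>2 / 2 + of_real (\<phi>1 (V z)) * a z)"
      by (intro continuous_intros k1 cc) auto
    show "continuous_on S (\<lambda>z. \<phi>2 (V z) * (cmod (D z))\<^sup>2 / 2 + \<phi>1 (V z) * b z)"
      by (intro continuous_intros k1 cc) auto
  qed (use e1 e2 in auto)
qed

text \<open>Locally this is the real part of a branch of log h, hence harmonic, and its
  \<open>D\<close> is the logarithmic derivative. The chain potential is assembled from such
  functions.\<close>

lemma lap2_ln_cmod:
  assumes h: "h holomorphic_on S" and S: "open S" and nz: "\<And>z. z \<in> S \<Longrightarrow> h z \<noteq> 0"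
  shows "lap2 S (\<lambda>z. ln (cmod (h z))) (\<lambda>z. deriv h z / h z) (deriv (\<lambda>z. deriv h z / h z)) (\<lambda>z. 0)"
proof -
  have hol: "(\<lambda>z. deriv h z / h z) holomorphic_on S"
    using h S nz by (intro holomorphic_intros holomorphic_deriv) auto
  have c: "continuous_on S (deriv (\<lambda>z. deriv h z / h z))"
    using holomorphic_deriv[OF hol S] holomorphic_on_imp_continuous_on by blast
  have 1: "((\<lambda>z. ln (cmod (h z))) has_derivative (\<lambda>e. Re (e * (deriv h z / h z)))) (at z)" if "z \<in> S" for z
  proof -
    have d: "(h has_derivative (\<lambda>e. deriv h z * e)) (at z)"
      using holomorphic_derivI[OF h S that] by (simp add: has_field_derivative_def)
    have n: "(norm has_derivative (\<lambda>e. e \<bullet> sgn (h z))) (at (h z))"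
      by (rule has_derivative_norm[OF nz[OF that]])
    have l: "(ln has_derivative (\<lambda>t. inverse (cmod (h z)) * t)) (at (cmod (h z)))"
      using DERIV_ln[of "cmod (h z)"] nz[OF that] by (simp add: has_field_derivative_def)
    have "((\<lambda>z. ln (cmod (h z))) has_derivative (\<lambda>e. inverse (cmod (h z)) * ((deriv h z * e) \<bullet> sgn (h z)))) (at z)"
      using has_derivative_compose[OF has_derivative_compose[OF d n] l] by simp
    moreover have "inverse (cmod (h z)) * ((deriv h z * e) \<bullet> sgn (h z)) = Re (e * (deriv h z / h z))" for e
    proof -
      have "Re (e * (deriv h z / h z)) = Re (deriv h z * e * (cnj (h z) / (h z * cnj (h z))))"
        using nz[OF that] by (simp add: divide_simps mult.commute)
      also have "h z * cnj (h z) = of_real ((cmod (h z))\<^sup>2)" using complex_norm_square by metis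
      also have "deriv h z * e * (cnj (h z) / of_real ((cmod (h z))\<^sup>2)) = (deriv h z * e * cnj (h z)) / of_real ((cmod (h z))\<^sup>2)" by simp
      also have "Re \<dots> = Re (deriv h z * e * cnj (h z)) / (cmod (h z))\<^sup>2" by (rule Re_divide_of_real)
      finally have X: "Re (e * (deriv h z / h z)) = Re (deriv h z * e * cnj (h z)) / (cmod (h z))\<^sup>2" .
      show ?thesis unfolding X sgn_div_norm inner_scaleR_right
        by (simp add: inner_complex_def power2_eq_square divide_inverse)
    qed
    ultimately show ?thesis by (simp only:)
  qed
  have 2: "((\<lambda>z. deriv h z / h z) has_derivative (\<lambda>e. deriv (\<lambda>z. deriv h z / h z) z * e + of_real 0 * cnj e)) (at z)" if "z \<in> S" for z
    using holomorphic_derivI[OF hol S that] by (simp add: has_field_derivative_def)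
  show ?thesis unfolding lap2_def using S c 1 2 by simp
qed

lemma lap2_cmod_square:
  assumes "open S"
  shows "lap2 S (\<lambda>z. (cmod z)\<^sup>2) (\<lambda>z. 2 * cnj z) (\<lambda>z. 0) (\<lambda>z. 2)"
proof -
  have 1: "((\<lambda>z. (cmod z)\<^sup>2) has_derivative (\<lambda>e. Re (e * (2 * cnj z)))) (at z)" for z :: complex
  proof -
    have "((\<lambda>z::complex. z \<bullet> z) has_derivative (\<lambda>e. z \<bullet> e + e \<bullet> z)) (at z)"
      by (rule derivative_eq_intros refl)+
    then show ?thesis by (simp add: power2_norm_eq_inner inner_complex_def algebra_simps)
  qed
  have 2: "((\<lambda>z. 2 * cnj z) has_derivative (\<lambda>e. 0 * e + of_real 2 * cnj e)) (at z)" for z :: complex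
    by (auto intro!: derivative_eq_intros)
  show ?thesis unfolding lap2_def using 1 2 assms by auto
qed

section \<open>Green's formula on the unit disc\<close>

lemma lborel_complex: "distr (lborel \<Otimes>\<^sub>M lborel) borel (\<lambda>(x, y). Complex x y) = lborel"
proof (rule lborel_eqI[symmetric])
  have m: "(\<lambda>(x, y). Complex x y) \<in> borel_measurable (lborel \<Otimes>\<^sub>M lborel)"
  proof -
    have "continuous_on UNIV (\<lambda>p::real\<times>real. Complex (fst p) (snd p))"
      by (intro continuous_intros)
    then have "(\<lambda>p::real\<times>real. Complex (fst p) (snd p)) \<in> borel_measurable (borel \<Otimes>\<^sub>M borel)"
      using borel_measurable_continuous_onI borel_prod by metis
    then show ?thesis by (simp add: case_prod_beta')
  qed
  fix l u :: complex assume *: "\<And>b. b \<in> Basis \<Longrightarrow> l \<bullet> b \<le> u \<bullet> b"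
  have le: "Re l \<le> Re u" "Im l \<le> Im u"
    using *[of 1] *[of \<i>] by (auto simp: Basis_complex_def inner_complex_def)
  have "(\<lambda>(x, y). Complex x y) -` box l u \<inter> space (lborel \<Otimes>\<^sub>M lborel) = {Re l<..<Re u} \<times> {Im l<..<Im u}"
    by (auto simp: in_box_complex_iff space_pair_measure)
  then have "emeasure (distr (lborel \<Otimes>\<^sub>M lborel) borel (\<lambda>(x, y). Complex x y)) (box l u)
    = emeasure (lborel \<Otimes>\<^sub>M lborel) ({Re l<..<Re u} \<times> {Im l<..<Im u})"
    using m by (subst emeasure_distr) auto
  also have "\<dots> = ennreal (Re u - Re l) * ennreal (Im u - Im l)"
    using le by (subst lborel.emeasure_pair_measure_Times) auto
  also have "\<dots> = ennreal (\<Prod>b\<in>Basis. (u - l) \<bullet> b)"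
    using le by (simp add: Basis_complex_def inner_complex_def ennreal_mult)
  finally show "emeasure (distr (lborel \<Otimes>\<^sub>M lborel) borel (\<lambda>(x, y). Complex x y)) (box l u)
     = ennreal (\<Prod>b\<in>Basis. (u - l) \<bullet> b)" .
qed simp

lemma norm_Complex_le_1:
  "cmod (Complex x y) \<le> 1 \<longleftrightarrow> \<bar>y\<bar> \<le> 1 \<and> - sqrt (1 - y\<^sup>2) \<le> x \<and> x \<le> sqrt (1 - y\<^sup>2)"
proof -
  have "cmod (Complex x y) \<le> 1 \<longleftrightarrow> x\<^sup>2 + y\<^sup>2 \<le> 1" by (simp add: cmod_def)
  also have "\<dots> \<longleftrightarrow> y\<^sup>2 \<le> 1 \<and> x\<^sup>2 \<le> 1 - y\<^sup>2" by (smt (verit) zero_le_power2)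
  also have "\<dots> \<longleftrightarrow> \<bar>y\<bar> \<le> 1 \<and> \<bar>x\<bar> \<le> sqrt (1 - y\<^sup>2)"
    by (metis abs_le_square_iff abs_one diff_ge_0_iff_ge one_power2 real_sqrt_abs real_sqrt_le_iff)
  finally show ?thesis by (simp add: abs_le_iff minus_le_iff) argo
qed

lemma norm_Complex_le_1':
  "cmod (Complex x y) \<le> 1 \<longleftrightarrow> \<bar>x\<bar> \<le> 1 \<and> - sqrt (1 - x\<^sup>2) \<le> y \<and> y \<le> sqrt (1 - x\<^sup>2)"
  using norm_Complex_le_1[of y x] by (simp add: cmod_def add.commute)

text \<open>Both orders of integration are wanted: Green's formula integrates the second
  x-derivative along horizontal chords and the second y-derivative along vertical ones.\<close>

lemma disc_integral_chords:
  fixes h :: "complex \<Rightarrow> real"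
  assumes h: "continuous_on (cball 0 1) h"
  shows "(\<integral>z. indicator (cball 0 1) z * h z \<partial>lborel)
           = integral {-1..1} (\<lambda>y. integral {- sqrt (1 - y\<^sup>2)..sqrt (1 - y\<^sup>2)} (\<lambda>x. h (Complex x y)))" (is ?A)
    and "(\<integral>z. indicator (cball 0 1) z * h z \<partial>lborel)
           = integral {-1..1} (\<lambda>x. integral {- sqrt (1 - x\<^sup>2)..sqrt (1 - x\<^sup>2)} (\<lambda>y. h (Complex x y)))" (is ?B)
    and "integrable lborel (\<lambda>z. indicator (cball 0 1) z * h z)"
proof -
  define f where "f z = indicator (cball 0 1) z * h z" for z :: complex
  define g where "g = (\<lambda>(x, y). f (Complex x y))"
  have int: "integrable lborel f"
    using borel_integrable_compact[OF compact_cball h] by (simp add: f_def[abs_def])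
  then show "integrable lborel (\<lambda>z. indicator (cball 0 1) z * h z)" by (simp add: f_def[abs_def])
  have m: "(\<lambda>(x, y). Complex x y) \<in> measurable (lborel \<Otimes>\<^sub>M lborel) borel"
  proof -
    have "continuous_on UNIV (\<lambda>p::real\<times>real. Complex (fst p) (snd p))"
      by (intro continuous_intros)
    then have "(\<lambda>p::real\<times>real. Complex (fst p) (snd p)) \<in> borel_measurable (borel \<Otimes>\<^sub>M borel)"
      using borel_measurable_continuous_onI borel_prod by metis
    then show ?thesis by (simp add: case_prod_beta')
  qed
  have fb: "f \<in> borel_measurable borel" using int by simp
  have gi: "integrable (lborel \<Otimes>\<^sub>M lborel) g"
    using int integrable_distr_eq[OF m fb] unfolding lborel_complex
    by (simp add: g_def case_prod_beta' comp_def)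
  have fg: "integral\<^sup>L lborel f = integral\<^sup>L (lborel \<Otimes>\<^sub>M lborel) g"
    using integral_distr[OF m fb] unfolding lborel_complex by (simp add: g_def case_prod_beta')
  have set: "integral\<^sup>L lborel (\<lambda>x. indicator {a..b} x * k x) = integral {a..b} k"
    if "integrable lborel (\<lambda>x. indicator {a..b} x * k x)" for a b :: real and k :: "real \<Rightarrow> real"
    using set_borel_integral_eq_integral(2)[of "{a..b}" k] that
    by (simp add: set_integrable_def set_lebesgue_integral_def)
  have ch: "g (x, y) = indicator {- sqrt (1 - y\<^sup>2)..sqrt (1 - y\<^sup>2)} x * h (Complex x y)" if "\<bar>y\<bar> \<le> 1" for x y
    using that unfolding g_def f_def by (auto simp: norm_Complex_le_1 indicator_def split: if_splits)
  have ch0: "g (x, y) = 0" if "\<not> \<bar>y\<bar> \<le> 1" for x y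
    using that unfolding g_def f_def by (auto simp: norm_Complex_le_1 indicator_def split: if_splits)
  have ch': "g (x, y) = indicator {- sqrt (1 - x\<^sup>2)..sqrt (1 - x\<^sup>2)} y * h (Complex x y)" if "\<bar>x\<bar> \<le> 1" for x y
    using that unfolding g_def f_def by (auto simp: norm_Complex_le_1' indicator_def split: if_splits)
  have ch0': "g (x, y) = 0" if "\<not> \<bar>x\<bar> \<le> 1" for x y
    using that unfolding g_def f_def by (auto simp: norm_Complex_le_1' indicator_def split: if_splits)
  have c1: "continuous_on {- sqrt (1 - y\<^sup>2)..sqrt (1 - y\<^sup>2)} (\<lambda>x. h (Complex x y))" if "\<bar>y\<bar> \<le> 1" for y
    using that by (intro continuous_on_compose2[OF h] continuous_intros) (auto simp: norm_Complex_le_1)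
  have c2: "continuous_on {- sqrt (1 - x\<^sup>2)..sqrt (1 - x\<^sup>2)} (\<lambda>y. h (Complex x y))" if "\<bar>x\<bar> \<le> 1" for x
    using that by (intro continuous_on_compose2[OF h] continuous_intros) (auto simp: norm_Complex_le_1')
  have in1: "integral\<^sup>L lborel (\<lambda>x. g (x, y)) = indicator {-1..1} y * integral {- sqrt (1 - y\<^sup>2)..sqrt (1 - y\<^sup>2)} (\<lambda>x. h (Complex x y))" for y
  proof (cases "\<bar>y\<bar> \<le> 1")
    case True
    have "integrable lborel (\<lambda>x. indicator {- sqrt (1 - y\<^sup>2)..sqrt (1 - y\<^sup>2)} x * h (Complex x y))"
      using borel_integrable_compact[OF compact_Icc c1[OF True]] by simp
    then show ?thesis using set True by (simp add: ch indicator_def abs_le_iff)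
  next
    case False then show ?thesis by (auto simp: ch0 indicator_def)
  qed
  have in2: "integral\<^sup>L lborel (\<lambda>y. g (x, y)) = indicator {-1..1} x * integral {- sqrt (1 - x\<^sup>2)..sqrt (1 - x\<^sup>2)} (\<lambda>y. h (Complex x y))" for x
  proof (cases "\<bar>x\<bar> \<le> 1")
    case True
    have "integrable lborel (\<lambda>y. indicator {- sqrt (1 - x\<^sup>2)..sqrt (1 - x\<^sup>2)} y * h (Complex x y))"
      using borel_integrable_compact[OF compact_Icc c2[OF True]] by simp
    then show ?thesis using set True by (simp add: ch' indicator_def abs_le_iff)
  next
    case False then show ?thesis by (auto simp: ch0' indicator_def)
  qed
  have "integral\<^sup>L lborel f = (\<integral>y. (\<integral>x. g (x, y) \<partial>lborel) \<partial>lborel)"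
    unfolding fg using lborel_pair.integral_snd[of "\<lambda>x y. g (x, y)"] gi by (simp add: case_prod_beta')
  moreover have "integrable lborel (\<lambda>y. \<integral>x. g (x, y) \<partial>lborel)"
    using lborel_pair.integrable_snd[of "\<lambda>x y. g (x, y)"] gi by (simp add: case_prod_beta')
  ultimately show ?A using set unfolding in1 by (simp add: f_def[abs_def])
  have "integral\<^sup>L lborel f = (\<integral>x. (\<integral>y. g (x, y) \<partial>lborel) \<partial>lborel)"
    unfolding fg using lborel_pair.integral_fst'[of g] gi by (simp add: case_prod_beta')
  moreover have "integrable lborel (\<lambda>x. \<integral>y. g (x, y) \<partial>lborel)"
    using lborel_pair.integrable_fst'[of g] gi by (simp add: case_prod_beta')
  ultimately show ?B using set unfolding in2 by (simp add: f_def[abs_def])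
qed

text \<open>The end points of the chords sweep out the circle. The substitution x = cos t is made on
  the upper and the lower half circle, and y = sin t on the arcs where cos has constant sign; these
  turn boundary terms on chords into integrals over the angle.\<close>

lemma circle_integral_chords:
  fixes A :: "complex \<Rightarrow> real"
  assumes A: "continuous_on (sphere 0 1) A"
  shows "integral {0..2*pi} (\<lambda>t. sin t * A (cis t)) =
     integral {-1..1} (\<lambda>x. A (Complex x (sqrt (1 - x\<^sup>2))) - A (Complex x (- sqrt (1 - x\<^sup>2))))" (is ?S)
    and "integral {0..2*pi} (\<lambda>t. cos t * A (cis t)) =
     integral {-1..1} (\<lambda>y. A (Complex (sqrt (1 - y\<^sup>2)) y) - A (Complex (- sqrt (1 - y\<^sup>2)) y))" (is ?C)
proof -
  have sq: "0 \<le> 1 - x\<^sup>2" if "x \<in> {-1..1::real}" for x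
    using that by (simp add: abs_square_le_1 abs_le_iff)
  have nrm: "cmod (Complex x (sqrt (1 - x\<^sup>2))) = 1" "cmod (Complex x (- sqrt (1 - x\<^sup>2))) = 1"
    "cmod (Complex (sqrt (1 - x\<^sup>2)) x) = 1" "cmod (Complex (- sqrt (1 - x\<^sup>2)) x) = 1" if "x \<in> {-1..1}" for x
    using sq[OF that] by (simp_all add: cmod_def)
  define T B R L where "T = (\<lambda>x. A (Complex x (sqrt (1 - x\<^sup>2))))" and "B = (\<lambda>x. A (Complex x (- sqrt (1 - x\<^sup>2))))"
    and "R = (\<lambda>x. A (Complex (sqrt (1 - x\<^sup>2)) x))" and "L = (\<lambda>x. A (Complex (- sqrt (1 - x\<^sup>2)) x))"
  have cT: "continuous_on {-1..1} T" "continuous_on {-1..1} B" "continuous_on {-1..1} R" "continuous_on {-1..1} L"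
    unfolding T_def B_def R_def L_def
    by (intro continuous_on_compose2[OF A] continuous_intros; use nrm in auto)+
  note ti = integrable_continuous_real[OF cT(1)] integrable_continuous_real[OF cT(2)]
     integrable_continuous_real[OF cT(3)] integrable_continuous_real[OF cT(4)]
  have cA: "continuous_on X (\<lambda>t. A (cis t))" for X
    by (intro continuous_on_compose2[OF A] continuous_intros) auto
  have emp: "integral {1..-1::real} f = 0" for f :: "real \<Rightarrow> real" by simp
  \<comment> \<open>The substitution reverses orientation, so the integral over
    \<open>{cos 0..cos pi}\<close> is over an empty interval and vanishes; the other one carries the
    sign.\<close>
  have s1: "((\<lambda>t. - sin t *\<^sub>R T (cos t)) has_integral (integral {cos 0..cos pi} T - integral {cos pi..cos 0} T)) {0..pi}"
    by (rule has_integral_substitution_general[of "{}" _ _ _ "-1" 1])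
       (auto intro!: derivative_eq_intros continuous_intros cT)
  have s2: "((\<lambda>t. - sin t *\<^sub>R B (cos t)) has_integral (integral {cos pi..cos (2*pi)} B - integral {cos (2*pi)..cos pi} B)) {pi..2*pi}"
    by (rule has_integral_substitution_general[of "{}" _ _ _ "-1" 1])
       (auto intro!: derivative_eq_intros continuous_intros cT)
  have e1: "T (cos t) = A (cis t)" if "t \<in> {0..pi}" for t
  proof -
    have "sqrt (1 - (cos t)\<^sup>2) = sin t" using that sin_ge_zero[of t] by (simp flip: sin_squared_eq)
    then show ?thesis by (simp add: T_def cis.code)
  qed
  have e2: "B (cos t) = A (cis t)" if "t \<in> {pi..2*pi}" for t
  proof -
    have "sqrt (1 - (cos t)\<^sup>2) = - sin t" using that sin_le_zero[of t] by (cases "t = 2*pi") (auto simp flip: sin_squared_eq)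
    then show ?thesis by (simp add: B_def cis.code)
  qed
  have i1: "((\<lambda>t. sin t * A (cis t)) has_integral (integral {-1..1} T)) {0..pi}"
  proof -
    have "((\<lambda>t. - (- sin t *\<^sub>R T (cos t))) has_integral (- (integral {cos 0..cos pi} T - integral {cos pi..cos 0} T))) {0..pi}"
      using s1 by (rule has_integral_neg)
    then have "((\<lambda>t. - (- sin t *\<^sub>R T (cos t))) has_integral (integral {-1..1} T)) {0..pi}" by simp
    then show ?thesis by (rule has_integral_eq[rotated]) (use e1 in auto)
  qed
  have i2: "((\<lambda>t. sin t * A (cis t)) has_integral (- integral {-1..1} B)) {pi..2*pi}"
  proof -
    have "((\<lambda>t. - (- sin t *\<^sub>R B (cos t))) has_integral (- (integral {cos pi..cos (2*pi)} B - integral {cos (2*pi)..cos pi} B))) {pi..2*pi}"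
      using s2 by (rule has_integral_neg)
    then have "((\<lambda>t. - (- sin t *\<^sub>R B (cos t))) has_integral (- integral {-1..1} B)) {pi..2*pi}" by simp
    then show ?thesis by (rule has_integral_eq[rotated]) (use e2 in auto)
  qed
  have "((\<lambda>t. sin t * A (cis t)) has_integral (integral {-1..1} T + (- integral {-1..1} B))) {0..2*pi}"
    by (rule has_integral_combine[OF _ _ i1 i2]) auto
  then show ?S using ti
    by (simp add: integral_unique integral_diff T_def B_def)
  have sin32: "sin (3 * pi / 2) = -1" "sin (pi / 2 * 3) = -1"
    using sin_3over2_pi by (simp_all add: mult.commute)
  have u1: "((\<lambda>t. cos t *\<^sub>R R (sin t)) has_integral (integral {sin 0..sin (pi/2)} R - integral {sin (pi/2)..sin 0} R)) {0..pi/2}"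
    by (rule has_integral_substitution_general[of "{}" _ _ _ "-1" 1])
       (auto intro!: derivative_eq_intros continuous_intros cT)
  have u2: "((\<lambda>t. cos t *\<^sub>R L (sin t)) has_integral (integral {sin (pi/2)..sin (3*pi/2)} L - integral {sin (3*pi/2)..sin (pi/2)} L)) {pi/2..3*pi/2}"
    by (rule has_integral_substitution_general[of "{}" _ _ _ "-1" 1])
       (auto intro!: derivative_eq_intros continuous_intros cT)
  have u3: "((\<lambda>t. cos t *\<^sub>R R (sin t)) has_integral (integral {sin (3*pi/2)..sin (2*pi)} R - integral {sin (2*pi)..sin (3*pi/2)} R)) {3*pi/2..2*pi}"
    by (rule has_integral_substitution_general[of "{}" _ _ _ "-1" 1])
       (auto intro!: derivative_eq_intros continuous_intros cT)
  have f1: "R (sin t) = A (cis t)" if "0 \<le> cos t" for t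
  proof -
    have "sqrt (1 - (sin t)\<^sup>2) = cos t" using that by (simp flip: cos_squared_eq)
    then show ?thesis by (simp add: R_def cis.code)
  qed
  have f2: "L (sin t) = A (cis t)" if "cos t \<le> 0" for t
  proof -
    have "sqrt (1 - (sin t)\<^sup>2) = - cos t" using that by (simp flip: cos_squared_eq)
    then show ?thesis by (simp add: L_def cis.code)
  qed
  have p1: "0 \<le> cos t" if "t \<in> {0..pi/2}" for t using that by (intro cos_ge_zero) auto
  have p2: "cos t \<le> 0" if "t \<in> {pi/2..3*pi/2}" for t
    using that cos_ge_zero[of "t - pi"] by auto
  have p3: "0 \<le> cos t" if "t \<in> {3*pi/2..2*pi}" for t
  proof -
    have "0 \<le> cos (t - 2*pi)" using that by (intro cos_ge_zero) auto
    then show ?thesis by (simp add: cos_diff)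
  qed
  have w1: "((\<lambda>t. cos t * A (cis t)) has_integral (integral {0..1} R)) {0..pi/2}"
  proof -
    have "((\<lambda>t. cos t *\<^sub>R R (sin t)) has_integral (integral {0..1} R)) {0..pi/2}" using u1 sin32 by simp
    then show ?thesis by (rule has_integral_eq[rotated]) (use f1 p1 in auto)
  qed
  have w2: "((\<lambda>t. cos t * A (cis t)) has_integral (- integral {-1..1} L)) {pi/2..3*pi/2}"
  proof -
    have "((\<lambda>t. cos t *\<^sub>R L (sin t)) has_integral (- integral {-1..1} L)) {pi/2..3*pi/2}" using u2 sin32 by simp
    then show ?thesis by (rule has_integral_eq[rotated]) (use f2 p2 sin32 in auto)
  qed
  have w3: "((\<lambda>t. cos t * A (cis t)) has_integral (integral {-1..0} R)) {3*pi/2..2*pi}"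
  proof -
    have "((\<lambda>t. cos t *\<^sub>R R (sin t)) has_integral (integral {-1..0} R)) {3*pi/2..2*pi}" using u3 sin32 by simp
    then show ?thesis by (rule has_integral_eq[rotated]) (use f1 p3 sin32 in auto)
  qed
  have "((\<lambda>t. cos t * A (cis t)) has_integral ((integral {0..1} R + (- integral {-1..1} L)) + integral {-1..0} R)) {0..2*pi}"
    by (rule has_integral_combine[OF _ _ has_integral_combine[OF _ _ w1 w2] w3]) auto
  moreover have "integral {-1..0} R + integral {0..1} R = integral {-1..1} R"
    by (rule Henstock_Kurzweil_Integration.integral_combine) (use ti in auto)
  ultimately show ?C using ti
    by (simp add: integral_unique integral_diff R_def L_def)
qed

text \<open>Restricting the derivative of \<open>D\<close> to real increments gives the second
  x-derivative \<open>Re a + b\<close>. The companion for y gives \<open>b - Re a\<close>, so the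
  Laplacian is \<open>2 * b\<close>.\<close>

lemma lap2_DERIV_x:
  assumes V: "lap2 S V D a b" and z: "Complex x y \<in> S"
  shows "((\<lambda>x. V (Complex x y)) has_real_derivative Re (D (Complex x y))) (at x)"
    and "((\<lambda>x. Re (D (Complex x y))) has_real_derivative (Re (a (Complex x y)) + b (Complex x y))) (at x)"
proof -
  have c: "((\<lambda>x. Complex x y) has_derivative (\<lambda>h. of_real h)) (at x)"
  proof -
    have "((\<lambda>x. of_real x + \<i> * of_real y) has_derivative (\<lambda>h. of_real h)) (at x)"
      by (auto intro!: derivative_eq_intros)
    then show ?thesis by (simp add: Complex_eq)
  qed
  have 1: "(V has_derivative (\<lambda>e. Re (e * D (Complex x y)))) (at (Complex x y))"
    "(D has_derivative (\<lambda>e. a (Complex x y) * e + of_real (b (Complex x y)) * cnj e)) (at (Complex x y))"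
    using V z unfolding lap2_def by auto
  show "((\<lambda>x. V (Complex x y)) has_real_derivative Re (D (Complex x y))) (at x)"
    using has_derivative_compose[OF c 1(1)] unfolding has_field_derivative_def
    by (rule has_derivative_eq_rhs) (simp add: fun_eq_iff)
  show "((\<lambda>x. Re (D (Complex x y))) has_real_derivative (Re (a (Complex x y)) + b (Complex x y))) (at x)"
    using has_derivative_Re[OF has_derivative_compose[OF c 1(2)]] unfolding has_field_derivative_def
    by (rule has_derivative_eq_rhs) (simp add: fun_eq_iff algebra_simps)
qed

lemma lap2_DERIV_y:
  assumes V: "lap2 S V D a b" and z: "Complex x y \<in> S"
  shows "((\<lambda>y. V (Complex x y)) has_real_derivative - Im (D (Complex x y))) (at y)"
    and "((\<lambda>y. - Im (D (Complex x y))) has_real_derivative (b (Complex x y) - Re (a (Complex x y)))) (at y)"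
proof -
  have c: "((\<lambda>y. Complex x y) has_derivative (\<lambda>h. \<i> * of_real h)) (at y)"
  proof -
    have "((\<lambda>y. of_real x + \<i> * of_real y) has_derivative (\<lambda>h. \<i> * of_real h)) (at y)"
      by (auto intro!: derivative_eq_intros)
    then show ?thesis by (simp add: Complex_eq)
  qed
  have 1: "(V has_derivative (\<lambda>e. Re (e * D (Complex x y)))) (at (Complex x y))"
    "(D has_derivative (\<lambda>e. a (Complex x y) * e + of_real (b (Complex x y)) * cnj e)) (at (Complex x y))"
    using V z unfolding lap2_def by auto
  show "((\<lambda>y. V (Complex x y)) has_real_derivative - Im (D (Complex x y))) (at y)"
    using has_derivative_compose[OF c 1(1)] unfolding has_field_derivative_def
    by (rule has_derivative_eq_rhs) (simp add: fun_eq_iff)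
  show "((\<lambda>y. - Im (D (Complex x y))) has_real_derivative (b (Complex x y) - Re (a (Complex x y)))) (at y)"
    using has_derivative_minus[OF has_derivative_Im[OF has_derivative_compose[OF c 1(2)]]] unfolding has_field_derivative_def
    by (rule has_derivative_eq_rhs) (simp add: fun_eq_iff algebra_simps)
qed

text \<open>The Laplacians are split into their x- and y-parts, and each part is integrated along
  its own chords. As \<open>v\<close> vanishes on the circle, only the term with \<open>V\<close>
  and the gradient of \<open>v\<close> survives at the ends, and
  \<open>Re (cis t * D (cis t))\<close> is the radial derivative of \<open>v\<close>.\<close>

lemma green_disc:
  assumes V: "lap2 S V E p q" and v: "lap2 S v D a b"
    and S: "cball 0 1 \<subseteq> S" and v0: "\<And>z. cmod z = 1 \<Longrightarrow> v z = 0"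
  shows "(\<integral>z. indicator (cball 0 1) z * (2 * (v z * q z - V z * b z)) \<partial>lborel)
           = - integral {0..2*pi} (\<lambda>t. Re (cis t * D (cis t)) * V (cis t))"
proof -
  note cc = lap2_continuous(1-4)[OF V] lap2_continuous(1-4)[OF v]
  note cb = cc[THEN continuous_on_subset, OF S]
  \<comment> \<open>\<open>h1\<close> is the x-derivative of v V_x - V v_x and \<open>h2\<close> the
    y-derivative of v V_y - V v_y, so the fundamental theorem applies on every chord.\<close>
  define h1 where "h1 z = v z * (Re (p z) + q z) - V z * (Re (a z) + b z)" for z
  define h2 where "h2 z = v z * (q z - Re (p z)) - V z * (b z - Re (a z))" for z
  have ch: "continuous_on (cball 0 1) h1" "continuous_on (cball 0 1) h2"
    unfolding h1_def h2_def by (intro continuous_intros cb)+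
  have sq: "0 \<le> 1 - x\<^sup>2" if "x \<in> {-1..1::real}" for x
    using that by (simp add: abs_square_le_1 abs_le_iff)
  have nrm: "cmod (Complex x (sqrt (1 - x\<^sup>2))) = 1" "cmod (Complex x (- sqrt (1 - x\<^sup>2))) = 1"
    "cmod (Complex (sqrt (1 - x\<^sup>2)) x) = 1" "cmod (Complex (- sqrt (1 - x\<^sup>2)) x) = 1" if "x \<in> {-1..1}" for x
    using sq[OF that] by (simp_all add: cmod_def)
  define A where "A z = - Re (D z) * V z" for z
  define B where "B z = Im (D z) * V z" for z
  have sp: "sphere 0 1 \<subseteq> S" using S by auto
  have cAB: "continuous_on (sphere 0 1) A" "continuous_on (sphere 0 1) B"
    unfolding A_def B_def using sp by (intro continuous_intros cc[THEN continuous_on_subset] sp)+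
  have I1: "integral {- sqrt (1 - y\<^sup>2)..sqrt (1 - y\<^sup>2)} (\<lambda>x. h1 (Complex x y))
     = A (Complex (sqrt (1 - y\<^sup>2)) y) - A (Complex (- sqrt (1 - y\<^sup>2)) y)" if y: "y \<in> {-1..1}" for y
  proof -
    let ?X = "sqrt (1 - y\<^sup>2)"
    let ?G = "\<lambda>x. v (Complex x y) * Re (E (Complex x y)) - V (Complex x y) * Re (D (Complex x y))"
    have "((\<lambda>x. h1 (Complex x y)) has_integral (?G ?X - ?G (- ?X))) {- ?X..?X}"
    proof (rule fundamental_theorem_of_calculus)
      show "- ?X \<le> ?X" using sq[OF y] by simp
      fix x assume "x \<in> {- ?X..?X}"
      then have "Complex x y \<in> S" using S y norm_Complex_le_1[of x y] by (auto simp: abs_le_iff)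
      then have "(?G has_real_derivative h1 (Complex x y)) (at x)"
        unfolding h1_def
        by (intro DERIV_cong[OF DERIV_diff[OF DERIV_mult[OF lap2_DERIV_x(1)[OF v] lap2_DERIV_x(2)[OF V]]
              DERIV_mult[OF lap2_DERIV_x(1)[OF V] lap2_DERIV_x(2)[OF v]]]]) (simp_all add: algebra_simps)
      then show "(?G has_vector_derivative h1 (Complex x y)) (at x within {- ?X..?X})"
        by (simp add: has_real_derivative_iff_has_vector_derivative has_vector_derivative_at_within)
    qed
    then show ?thesis using v0 nrm(3,4)[OF y] by (simp add: integral_unique A_def mult.commute)
  qed
  have I2: "integral {- sqrt (1 - x\<^sup>2)..sqrt (1 - x\<^sup>2)} (\<lambda>y. h2 (Complex x y))
     = B (Complex x (sqrt (1 - x\<^sup>2))) - B (Complex x (- sqrt (1 - x\<^sup>2)))" if x: "x \<in> {-1..1}" for x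
  proof -
    let ?X = "sqrt (1 - x\<^sup>2)"
    let ?G = "\<lambda>y. v (Complex x y) * (- Im (E (Complex x y))) - V (Complex x y) * (- Im (D (Complex x y)))"
    have "((\<lambda>y. h2 (Complex x y)) has_integral (?G ?X - ?G (- ?X))) {- ?X..?X}"
    proof (rule fundamental_theorem_of_calculus)
      show "- ?X \<le> ?X" using sq[OF x] by simp
      fix y assume "y \<in> {- ?X..?X}"
      then have "Complex x y \<in> S" using S x norm_Complex_le_1'[of x y] by (auto simp: abs_le_iff)
      then have "(?G has_real_derivative h2 (Complex x y)) (at y)"
        unfolding h2_def
        by (intro DERIV_cong[OF DERIV_diff[OF DERIV_mult[OF lap2_DERIV_y(1)[OF v] lap2_DERIV_y(2)[OF V]]
              DERIV_mult[OF lap2_DERIV_y(1)[OF V] lap2_DERIV_y(2)[OF v]]]]) (simp_all add: algebra_simps)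
      then show "(?G has_vector_derivative h2 (Complex x y)) (at y within {- ?X..?X})"
        by (simp add: has_real_derivative_iff_has_vector_derivative has_vector_derivative_at_within)
    qed
    then show ?thesis using v0 nrm(1,2)[OF x] by (simp add: integral_unique B_def mult.commute)
  qed
  have "(\<integral>z. indicator (cball 0 1) z * h1 z \<partial>lborel) = integral {0..2*pi} (\<lambda>t. cos t * A (cis t))"
    unfolding disc_integral_chords(1)[OF ch(1)] circle_integral_chords(2)[OF cAB(1)]
    by (rule integral_cong) (rule I1)
  moreover have "(\<integral>z. indicator (cball 0 1) z * h2 z \<partial>lborel) = integral {0..2*pi} (\<lambda>t. sin t * B (cis t))"
    unfolding disc_integral_chords(2)[OF ch(2)] circle_integral_chords(1)[OF cAB(2)]
    by (rule integral_cong) (rule I2)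
  moreover have "(\<integral>z. indicator (cball 0 1) z * h1 z \<partial>lborel) + (\<integral>z. indicator (cball 0 1) z * h2 z \<partial>lborel)
     = (\<integral>z. indicator (cball 0 1) z * h1 z + indicator (cball 0 1) z * h2 z \<partial>lborel)"
    by (rule Bochner_Integration.integral_add[symmetric]) (intro disc_integral_chords(3) ch)+
  moreover have "indicator (cball 0 1) z * h1 z + indicator (cball 0 1) z * h2 z
     = indicator (cball 0 1) z * (2 * (v z * q z - V z * b z))" for z
    unfolding h1_def h2_def by (simp add: algebra_simps indicator_def)
  ultimately have "(\<integral>z. indicator (cball 0 1) z * (2 * (v z * q z - V z * b z)) \<partial>lborel)
     = integral {0..2*pi} (\<lambda>t. cos t * A (cis t)) + integral {0..2*pi} (\<lambda>t. sin t * B (cis t))"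
    by simp
  also have "\<dots> = integral {0..2*pi} (\<lambda>t. cos t * A (cis t) + sin t * B (cis t))"
    by (rule Henstock_Kurzweil_Integration.integral_add[symmetric];
        intro integrable_continuous_real continuous_intros continuous_on_compose2[OF cAB(1)] continuous_on_compose2[OF cAB(2)]) auto
  also have "\<dots> = integral {0..2*pi} (\<lambda>t. - (Re (cis t * D (cis t)) * V (cis t)))"
    by (rule integral_cong) (simp add: A_def B_def algebra_simps)
  finally show ?thesis by simp
qed

section \<open>Convex truncation and isolated singularities\<close>

text \<open>A convex, twice continuously differentiable approximation of the positive part.\<close>

definition ramp :: "real \<Rightarrow> real \<Rightarrow> real" where
  "ramp d t = (if t \<le> 0 then 0 else t ^ 3 / (t + d)\<^sup>2)"
definition ramp' :: "real \<Rightarrow> real \<Rightarrow> real" where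
  "ramp' d t = (if t \<le> 0 then 0 else t\<^sup>2 * (t + 3 * d) / (t + d) ^ 3)"
definition ramp'' :: "real \<Rightarrow> real \<Rightarrow> real" where
  "ramp'' d t = 6 * max 0 t * d\<^sup>2 / (max 0 t + d) ^ 4"

text \<open>For the gluing at 0, where the nonzero branches of \<open>ramp\<close> and
  \<open>ramp'\<close> are of orders t^3 and t^2, so that both are differentiable there with
  derivative 0.\<close>

lemma DERIV_zero_if_quotient_bound:
  fixes f :: "real \<Rightarrow> real"
  assumes "f 0 = 0" "\<And>h. h \<noteq> 0 \<Longrightarrow> \<bar>f h / h\<bar> \<le> C * \<bar>h\<bar>"
  shows "(f has_real_derivative 0) (at 0)"
proof -
  have "((\<lambda>h. f h / h) \<longlongrightarrow> 0) (at 0)"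
  proof (rule Lim_null_comparison)
    show "\<forall>\<^sub>F h in at 0. norm (f h / h) \<le> C * \<bar>h\<bar>"
      using assms(2) by (auto simp: eventually_at_filter)
    show "((\<lambda>h. C * \<bar>h\<bar>) \<longlongrightarrow> 0) (at (0::real))"
      by (rule tendsto_eq_intros refl | simp)+
  qed
  then show ?thesis using assms(1) by (simp add: DERIV_def)
qed

lemma DERIV_ramp:
  assumes "d > 0" shows "(ramp d has_real_derivative ramp' d t) (at t)"
proof -
  consider "t < 0" | "t = 0" | "t > 0" by linarith
  then show ?thesis
  proof cases
    case 1
    have "((\<lambda>_. 0) has_real_derivative 0) (at t)" by simp
    then have "(ramp d has_real_derivative 0) (at t)"
      by (rule has_field_derivative_transform_within_open[where S="{..<0}"]) (use 1 in \<open>auto simp: ramp_def\<close>)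
    then show ?thesis using 1 by (simp add: ramp'_def)
  next
    case 2
    have "\<bar>ramp d h / h\<bar> \<le> (1 / d) * \<bar>h\<bar>" if "h \<noteq> 0" for h
    proof (cases "h > 0")
      case True
      have "ramp d h / h = h * (h / (h + d)\<^sup>2)" using True by (simp add: ramp_def power3_eq_cube power2_eq_square)
      moreover have "h / (h + d)\<^sup>2 \<le> 1 / d"
      proof -
        have "h * d \<le> (h + d)\<^sup>2" using True assms by (simp add: power2_eq_square algebra_simps)
        then show ?thesis using True assms by (simp add: divide_simps)
      qed
      ultimately show ?thesis using True assms mult_left_mono[of "h / (h + d)\<^sup>2" "1 / d" h]
        by (simp add: abs_mult)
    qed (use assms in \<open>auto simp: ramp_def divide_nonpos_pos\<close>)
    then have "(ramp d has_real_derivative 0) (at 0)"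
      by (intro DERIV_zero_if_quotient_bound[where C="1 / d"]) (simp_all add: ramp_def)
    then show ?thesis using 2 by (simp add: ramp'_def)
  next
    case 3
    have "((\<lambda>t. t ^ 3 / (t + d)\<^sup>2) has_real_derivative
        ((3 * t\<^sup>2) * (t + d)\<^sup>2 - t ^ 3 * (2 * (t + d))) / ((t + d)\<^sup>2 * (t + d)\<^sup>2)) (at t)"
      using 3 assms by (auto intro!: derivative_eq_intros simp: power2_eq_square)
    moreover have "((3 * t\<^sup>2) * (t + d)\<^sup>2 - t ^ 3 * (2 * (t + d))) / ((t + d)\<^sup>2 * (t + d)\<^sup>2)
        = t\<^sup>2 * (t + 3 * d) / (t + d) ^ 3"
      using 3 assms by (simp add: divide_simps) (simp add: eval_nat_numeral algebra_simps)
    ultimately have "((\<lambda>t. t ^ 3 / (t + d)\<^sup>2) has_real_derivative t\<^sup>2 * (t + 3 * d) / (t + d) ^ 3) (at t)" by simp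
    then have "(ramp d has_real_derivative t\<^sup>2 * (t + 3 * d) / (t + d) ^ 3) (at t)"
      by (rule has_field_derivative_transform_within_open[where S="{0<..}"]) (use 3 in \<open>auto simp: ramp_def\<close>)
    then show ?thesis using 3 by (simp add: ramp'_def)
  qed
qed

lemma DERIV_ramp':
  assumes "d > 0" shows "(ramp' d has_real_derivative ramp'' d t) (at t)"
proof -
  consider "t < 0" | "t = 0" | "t > 0" by linarith
  then show ?thesis
  proof cases
    case 1
    have "((\<lambda>_. 0) has_real_derivative 0) (at t)" by simp
    then have "(ramp' d has_real_derivative 0) (at t)"
      by (rule has_field_derivative_transform_within_open[where S="{..<0}"]) (use 1 in \<open>auto simp: ramp'_def\<close>)
    then show ?thesis using 1 by (simp add: ramp''_def)
  next
    case 2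
    have "\<bar>ramp' d h / h\<bar> \<le> (3 / d\<^sup>2) * \<bar>h\<bar>" if "h \<noteq> 0" for h
    proof (cases "h > 0")
      case True
      have "ramp' d h / h = h * ((h + 3 * d) / (h + d) ^ 3)" using True by (simp add: ramp'_def power2_eq_square)
      moreover have "(h + 3 * d) / (h + d) ^ 3 \<le> 3 / d\<^sup>2"
      proof -
        have "(h + 3 * d) * d\<^sup>2 \<le> 3 * (h + d) * (h + d)\<^sup>2"
          using True assms by (intro mult_mono power_mono) auto
        then show ?thesis using True assms by (simp add: divide_simps power3_eq_cube power2_eq_square mult_ac)
      qed
      ultimately show ?thesis using True assms mult_left_mono[of "(h + 3 * d) / (h + d) ^ 3" "3 / d\<^sup>2" h]
        by (simp add: abs_mult mult.commute)
    qed (use assms in \<open>auto simp: ramp'_def divide_nonpos_pos\<close>)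
    then have "(ramp' d has_real_derivative 0) (at 0)"
      by (intro DERIV_zero_if_quotient_bound[where C="3 / d\<^sup>2"]) (simp_all add: ramp'_def)
    then show ?thesis using 2 by (simp add: ramp''_def)
  next
    case 3
    have "((\<lambda>t. t\<^sup>2 * (t + 3 * d) / (t + d) ^ 3) has_real_derivative
        ((2 * t * (t + 3 * d) + t\<^sup>2) * (t + d) ^ 3 - t\<^sup>2 * (t + 3 * d) * (3 * (t + d)\<^sup>2)) / ((t + d) ^ 3 * (t + d) ^ 3)) (at t)"
      using 3 assms by (auto intro!: derivative_eq_intros simp: power2_eq_square algebra_simps)
    moreover have "((2 * t * (t + 3 * d) + t\<^sup>2) * (t + d) ^ 3 - t\<^sup>2 * (t + 3 * d) * (3 * (t + d)\<^sup>2)) / ((t + d) ^ 3 * (t + d) ^ 3)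
        = 6 * t * d\<^sup>2 / (t + d) ^ 4"
    proof -
      have "(2 * t * (t + 3 * d) + t\<^sup>2) * (t + d) ^ 3 - t\<^sup>2 * (t + 3 * d) * (3 * (t + d)\<^sup>2) = 6 * t * d\<^sup>2 * (t + d)\<^sup>2"
        by (simp add: power2_eq_square power3_eq_cube algebra_simps)
      moreover have "(t + d) ^ 3 * (t + d) ^ 3 = (t + d) ^ 4 * (t + d)\<^sup>2" by (simp flip: power_add)
      moreover have nz: "(t + d)\<^sup>2 \<noteq> 0" using 3 assms by simp
      ultimately show ?thesis by (simp only: nonzero_mult_divide_mult_cancel_right[OF nz])
    qed
    ultimately have "((\<lambda>t. t\<^sup>2 * (t + 3 * d) / (t + d) ^ 3) has_real_derivative 6 * t * d\<^sup>2 / (t + d) ^ 4) (at t)" by simp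
    then have "(ramp' d has_real_derivative 6 * t * d\<^sup>2 / (t + d) ^ 4) (at t)"
      by (rule has_field_derivative_transform_within_open[where S="{0<..}"]) (use 3 in \<open>auto simp: ramp'_def\<close>)
    then show ?thesis using 3 by (simp add: ramp''_def)
  qed
qed

lemma continuous_ramp'': "d > 0 \<Longrightarrow> continuous_on A (ramp'' d)"
  unfolding ramp''_def by (intro continuous_intros) (auto simp: add_nonneg_pos less_imp_neq max_def add_pos_pos)

lemma ramp_bounds:
  assumes "d > 0"
  shows "0 \<le> ramp d t" "t \<ge> 0 \<Longrightarrow> ramp d t \<le> t" "0 \<le> ramp' d t" "0 \<le> ramp'' d t"
proof -
  show "0 \<le> ramp d t" "0 \<le> ramp' d t" "0 \<le> ramp'' d t" using assms by (auto simp: ramp_def ramp'_def ramp''_def)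
  show "ramp d t \<le> t" if "t \<ge> 0"
  proof (cases "t = 0")
    case False
    have "t ^ 3 \<le> t * (t + d)\<^sup>2" using that assms by (simp add: power2_eq_square power3_eq_cube algebra_simps)
    then show ?thesis using that False assms by (simp add: ramp_def divide_simps)
  qed (simp add: ramp_def)
qed

lemma ramp_mono: "d > 0 \<Longrightarrow> s \<le> t \<Longrightarrow> ramp d s \<le> ramp d t"
  using DERIV_nonneg_imp_nondecreasing[of s t "ramp d"] DERIV_ramp ramp_bounds(3) by metis

lemma ramp_tendsto:
  assumes "(W \<longlongrightarrow> L) sequentially" "L > 0" "(d \<longlongrightarrow> 0) sequentially"
  shows "(\<lambda>k. ramp (d k) (W k)) \<longlonglongrightarrow> L" "(\<lambda>k. ramp' (d k) (W k)) \<longlonglongrightarrow> 1"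
proof -
  have ev: "\<forall>\<^sub>F k in sequentially. W k > 0" using assms by (simp add: order_tendsto_iff)
  have "(\<lambda>k. W k ^ 3 / (W k + d k)\<^sup>2) \<longlonglongrightarrow> L ^ 3 / (L + 0)\<^sup>2"
    using assms by (intro tendsto_intros) auto
  moreover have "L ^ 3 / (L + 0)\<^sup>2 = L" using assms(2) by (simp add: power2_eq_square power3_eq_cube)
  ultimately show "(\<lambda>k. ramp (d k) (W k)) \<longlonglongrightarrow> L"
    using ev by (auto elim!: Lim_transform_eventually eventually_mono simp: ramp_def)
  have "(\<lambda>k. (W k)\<^sup>2 * (W k + 3 * d k) / (W k + d k) ^ 3) \<longlonglongrightarrow> L\<^sup>2 * (L + 3 * 0) / (L + 0) ^ 3"
    using assms by (intro tendsto_intros) auto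
  moreover have "L\<^sup>2 * (L + 3 * 0) / (L + 0) ^ 3 = 1" using assms(2) by (simp add: power2_eq_square power3_eq_cube)
  ultimately show "(\<lambda>k. ramp' (d k) (W k)) \<longlonglongrightarrow> 1"
    using ev by (auto elim!: Lim_transform_eventually eventually_mono simp: ramp'_def)
qed

text \<open>Isolated singularities at which \<open>V\<close> stays bounded above do not matter: \<open>V + \<eta> \<Sum> ln \<bar>z - \<zeta>\<bar>\<close> tends to
  \<open>-\<infinity>\<close> there, so its composition with a convex function that vanishes on the negative axis is smooth.\<close>

lemma truncated_at_singularities:
  assumes S: "open S" "finite Z" "Z \<subseteq> S" and V: "lap2 (S - Z) V D a b"
    and M: "\<And>z. z \<in> S - Z \<Longrightarrow> V z \<le> M" and d: "d > 0"
  defines "W \<equiv> \<lambda>z. V z + d * (\<Sum>\<zeta>\<in>Z. ln (cmod ((z - \<zeta>) / 2)))"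
  shows "\<exists>D' a' b'. lap2 S (\<lambda>z. if z \<in> Z then 0 else ramp d (W z)) D' a' b' \<and>
     (\<forall>z\<in>S - Z. b' z \<ge> ramp' d (W z) * b z) \<and> (\<forall>z\<in>Z. b' z = 0)"
proof -
  have oSZ: "open (S - Z)" using S by (simp add: finite_imp_closed open_Diff)
  have "lap2 (S - Z) (\<lambda>z. ln (cmod ((z - \<zeta>) / 2))) (\<lambda>z. deriv (\<lambda>z. (z - \<zeta>) / 2) z / ((z - \<zeta>) / 2))
      (deriv (\<lambda>z. deriv (\<lambda>z. (z - \<zeta>) / 2) z / ((z - \<zeta>) / 2))) (\<lambda>z. 0)" if "\<zeta> \<in> Z" for \<zeta>
    by (rule lap2_ln_cmod[OF _ oSZ]) (use that in \<open>auto intro!: holomorphic_intros\<close>)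
  then have "lap2 (S - Z) (\<lambda>z. \<Sum>\<zeta>\<in>Z. ln (cmod ((z - \<zeta>) / 2))) (\<lambda>z. \<Sum>\<zeta>\<in>Z. deriv (\<lambda>z. (z - \<zeta>) / 2) z / ((z - \<zeta>) / 2))
      (\<lambda>z. \<Sum>\<zeta>\<in>Z. deriv (\<lambda>z. deriv (\<lambda>z. (z - \<zeta>) / 2) z / ((z - \<zeta>) / 2)) z) (\<lambda>z. \<Sum>\<zeta>\<in>Z. 0)"
    by (rule lap2_sum[OF oSZ S(2)])
  from lap2_add[OF V lap2_cmult[OF this, where c=d]]
  obtain DW aW where "lap2 (S - Z) W DW aW (\<lambda>z. b z + d * (\<Sum>\<zeta>\<in>Z. 0))"
    unfolding W_def by blast
  then have W: "lap2 (S - Z) W DW aW b" by simp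
  let ?D = "\<lambda>z. of_real (ramp' d (W z)) * DW z"
  let ?a = "\<lambda>z. of_real (ramp'' d (W z)) * (DW z)\<^sup>2 / 2 + of_real (ramp' d (W z)) * aW z"
  let ?b = "\<lambda>z. ramp'' d (W z) * (cmod (DW z))\<^sup>2 / 2 + ramp' d (W z) * b z"
  have U: "lap2 (S - Z) (\<lambda>z. ramp d (W z)) ?D ?a ?b"
    by (rule lap2_compose[OF W, of UNIV]) (use d DERIV_ramp DERIV_ramp' continuous_ramp'' in auto)
  define D' where "D' z = (if z \<in> Z then 0 else ?D z)" for z
  define a' where "a' z = (if z \<in> Z then 0 else ?a z)" for z
  define b' where "b' z = (if z \<in> Z then 0 else ?b z)" for z
  have "lap2 S (\<lambda>z. if z \<in> Z then 0 else ramp d (W z)) D' a' b'"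
  proof (rule lap2_local)
    fix z assume z: "z \<in> S"
    show "\<exists>T. z \<in> T \<and> T \<subseteq> S \<and> lap2 T (\<lambda>z. if z \<in> Z then 0 else ramp d (W z)) D' a' b'"
    proof (cases "z \<in> Z")
      case False
      have "lap2 (S - Z) (\<lambda>z. if z \<in> Z then 0 else ramp d (W z)) D' a' b'"
        by (rule lap2_transform[OF U]) (auto simp: D'_def a'_def b'_def)
      then show ?thesis using z False by (intro exI[of _ "S - Z"]) auto
    next
      case True
      \<comment> \<open>\<open>B\<close> bounds \<open>W\<close> near \<open>z\<close> apart from
        the logarithm singular at \<open>z\<close> itself. The radius is small enough for that
        logarithm, times \<open>d\<close>, to be at most \<open>- (\<bar>B\<bar> + 1)\<close>; hence
        \<open>W\<close> is negative and the truncation vanishes on a whole punctured ball.\<close>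
      define B where "B = M + d * (\<Sum>\<zeta>\<in>Z. cmod (z - \<zeta>) + 1)"
      define \<rho> where "\<rho> = min 1 (2 * exp (- (\<bar>B\<bar> + 1) / d))"
      have rp: "\<rho> > 0" by (simp add: \<rho>_def)
      have Wneg: "W x \<le> 0" if x: "x \<in> ball z \<rho> \<inter> S - Z" for x
      proof -
        have dx: "cmod (x - z) < \<rho>" using x by (simp add: dist_norm norm_minus_commute)
        have xz: "x \<noteq> z" using x True by auto
        have "(\<Sum>\<zeta>\<in>Z. ln (cmod ((x - \<zeta>) / 2))) = ln (cmod ((x - z) / 2)) + (\<Sum>\<zeta>\<in>Z - {z}. ln (cmod ((x - \<zeta>) / 2)))"
          using S(2) True by (rule sum.remove)
        also have "(\<Sum>\<zeta>\<in>Z - {z}. ln (cmod ((x - \<zeta>) / 2))) \<le> (\<Sum>\<zeta>\<in>Z - {z}. cmod (z - \<zeta>) + 1)"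
        proof (rule sum_mono)
          fix \<zeta> assume "\<zeta> \<in> Z - {z}"
          then have "x \<noteq> \<zeta>" using x by auto
          then have "ln (cmod ((x - \<zeta>) / 2)) \<le> cmod ((x - \<zeta>) / 2)"
            by (intro ln_bound) simp
          also have "\<dots> \<le> cmod (x - \<zeta>)" by (simp add: norm_divide)
          also have "\<dots> \<le> cmod (z - \<zeta>) + cmod (x - z)" using norm_triangle_ineq[of "z - \<zeta>" "x - z"] by simp
          also have "\<dots> \<le> cmod (z - \<zeta>) + 1" using dx by (simp add: \<rho>_def)
          finally show "ln (cmod ((x - \<zeta>) / 2)) \<le> cmod (z - \<zeta>) + 1" .
        qed
        also have "\<dots> \<le> (\<Sum>\<zeta>\<in>Z. cmod (z - \<zeta>) + 1)"
          by (rule sum_mono2[OF S(2)]) (auto intro: add_nonneg_nonneg)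
        finally have 1: "(\<Sum>\<zeta>\<in>Z. ln (cmod ((x - \<zeta>) / 2))) \<le> ln (cmod ((x - z) / 2)) + (\<Sum>\<zeta>\<in>Z. cmod (z - \<zeta>) + 1)" by simp
        have "cmod ((x - z) / 2) \<le> exp (- (\<bar>B\<bar> + 1) / d)" using dx by (simp add: norm_divide \<rho>_def)
        then have "ln (cmod ((x - z) / 2)) \<le> - (\<bar>B\<bar> + 1) / d"
          using xz ln_le_cancel_iff[of "cmod ((x - z) / 2)" "exp (- (\<bar>B\<bar> + 1) / d)"] by simp
        then have 2: "d * ln (cmod ((x - z) / 2)) \<le> - (\<bar>B\<bar> + 1)" using d by (simp add: field_simps)
        have "W x \<le> M + d * (ln (cmod ((x - z) / 2)) + (\<Sum>\<zeta>\<in>Z. cmod (z - \<zeta>) + 1))"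
          unfolding W_def using M[of x] x d 1 by (intro add_mono mult_left_mono) auto
        also have "\<dots> = B + d * ln (cmod ((x - z) / 2))" by (simp add: B_def algebra_simps)
        finally show ?thesis using 2 by linarith
      qed
      have op: "open (ball z \<rho> \<inter> S)" using S by auto
      have "lap2 (ball z \<rho> \<inter> S) (\<lambda>z. if z \<in> Z then 0 else ramp d (W z)) D' a' b'"
        by (rule lap2_transform[OF lap2_const[OF op, of 0]])
          (use Wneg in \<open>auto simp: D'_def a'_def b'_def ramp_def ramp'_def ramp''_def\<close>)
      then show ?thesis using z rp by (intro exI[of _ "ball z \<rho> \<inter> S"]) auto
    qed
  qed
  moreover have "b' z \<ge> ramp' d (W z) * b z" if "z \<in> S - Z" for z
    using that ramp_bounds(4)[OF d] by (auto simp: b'_def)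
  ultimately show ?thesis by (metis b'_def)
qed

lemma integral_circle_le_nn_integral:
  assumes "continuous_on {0..2*pi} f" "\<And>t. t \<in> {0..2*pi} \<Longrightarrow> 0 \<le> f t"
  shows "ennreal (integral {0..2*pi} f) = (\<integral>\<^sup>+t\<in>{0..2*pi}. ennreal (f t) \<partial>lborel)"
proof -
  have i: "integrable lborel (\<lambda>t. indicator {0..2*pi} t *\<^sub>R f t)"
    by (rule borel_integrable_compact) (use assms in auto)
  have "integral {0..2*pi} f = (\<integral>t. indicator {0..2*pi} t *\<^sub>R f t \<partial>lborel)"
    using set_borel_integral_eq_integral(2)[of "{0..2*pi}" f] i
    by (simp add: set_integrable_def set_lebesgue_integral_def)
  also have "ennreal \<dots> = (\<integral>\<^sup>+t. ennreal (indicator {0..2*pi} t *\<^sub>R f t) \<partial>lborel)"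
    by (rule nn_integral_eq_integral[symmetric, OF i]) (use assms in \<open>auto simp: indicator_def\<close>)
  also have "\<dots> = (\<integral>\<^sup>+t\<in>{0..2*pi}. ennreal (f t) \<partial>lborel)"
    by (rule nn_integral_cong) (auto simp: indicator_def)
  finally show ?thesis .
qed

lemma integral_cball_eq_nn_integral:
  fixes h :: "complex \<Rightarrow> real"
  assumes "continuous_on (cball 0 1) h" "\<And>z. z \<in> cball 0 1 \<Longrightarrow> 0 \<le> h z"
  shows "ennreal (\<integral>z. indicator (cball 0 1) z * h z \<partial>lborel) = (\<integral>\<^sup>+z\<in>cball 0 1. ennreal (h z) \<partial>lborel)"
proof -
  have "ennreal (\<integral>z. indicator (cball 0 1) z * h z \<partial>lborel) = (\<integral>\<^sup>+z. ennreal (indicator (cball 0 1) z * h z) \<partial>lborel)"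
    by (rule nn_integral_eq_integral[symmetric, OF disc_integral_chords(3)]) (use assms in \<open>auto simp: indicator_def\<close>)
  also have "\<dots> = (\<integral>\<^sup>+z\<in>cball 0 1. ennreal (h z) \<partial>lborel)"
    by (rule nn_integral_cong) (auto simp: indicator_def)
  finally show ?thesis .
qed

text \<open>Green's formula is exact for the truncations, which are smooth across the singular set.
  They are dominated by \<open>Y\<close> uniformly in the truncation parameter, which settles the
  right side; the left side passes to the limit by Fatou. For this the Laplacian of the kernel is
  split as \<open>m1 - m2\<close> with both parts nonnegative, \<open>m2\<close> going to the
  left.\<close>

lemma green_disc_singular:
  assumes S: "open S" "finite Z" "cball 0 1 \<subseteq> S" and V: "lap2 (S - Z) V D a b"
    and pos: "\<And>z. z \<in> S - Z \<Longrightarrow> 0 < V z" and M: "\<And>z. z \<in> S - Z \<Longrightarrow> V z \<le> M"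
    and w: "\<And>z. z \<in> cball 0 1 - Z \<Longrightarrow> 0 \<le> w z \<and> w z \<le> 2 * b z"
    and Y: "\<And>z. z \<in> cball 0 1 - Z \<Longrightarrow> V z \<le> Y z" "\<And>z. 0 \<le> Y z"
    and v: "lap2 S v Dv av bv" and v0: "\<And>z. z \<in> cball 0 1 \<Longrightarrow> 0 \<le> v z" "\<And>z. cmod z = 1 \<Longrightarrow> v z = 0"
    and m: "\<And>z. z \<in> cball 0 1 \<Longrightarrow> 2 * bv z = m1 z - m2 z" "\<And>z. z \<in> cball 0 1 \<Longrightarrow> 0 \<le> m1 z"
      "\<And>z. z \<in> cball 0 1 \<Longrightarrow> 0 \<le> m2 z" "continuous_on (cball 0 1) m1" "continuous_on (cball 0 1) m2"
    and P: "\<And>t. 0 \<le> P t" "\<And>t. - Re (cis t * Dv (cis t)) = P t"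
  shows "(\<integral>\<^sup>+z\<in>cball 0 1. ennreal (v z * w z + V z * m2 z) \<partial>lborel)
     \<le> (\<integral>\<^sup>+z\<in>cball 0 1. ennreal (Y z * m1 z) \<partial>lborel) + (\<integral>\<^sup>+t\<in>{0..2*pi}. ennreal (P t * Y (cis t)) \<partial>lborel)"
proof -
  \<comment> \<open>Only the singularities in the closed disc are compensated by logarithms; those
    outside are cut out of the domain. The sign of the logarithms is available only for points at
    distance at most 2.\<close>
  define Z' where "Z' = Z \<inter> cball 0 1"
  define S' where "S' = S - (Z - cball 0 1)"
  have S': "open S'" "finite Z'" "Z' \<subseteq> S'" "cball 0 1 \<subseteq> S'" "S' - Z' = S - Z"
    using S by (auto simp: S'_def Z'_def finite_imp_closed open_Diff)
  define \<epsilon> where "\<epsilon> k = 1 / real (Suc k)" for k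
  have \<epsilon>: "\<epsilon> k > 0" for k by (simp add: \<epsilon>_def)
  have \<epsilon>0: "\<epsilon> \<longlonglongrightarrow> 0" unfolding \<epsilon>_def by (rule LIMSEQ_Suc[OF lim_1_over_n])
  define W where "W k z = V z + \<epsilon> k * (\<Sum>\<zeta>\<in>Z'. ln (cmod ((z - \<zeta>) / 2)))" for k z
  define U where "U k z = (if z \<in> Z' then 0 else ramp (\<epsilon> k) (W k z))" for k z
  have "\<exists>D' a' b'. lap2 S' (U k) D' a' b' \<and> (\<forall>z\<in>S' - Z'. b' z \<ge> ramp' (\<epsilon> k) (W k z) * b z) \<and> (\<forall>z\<in>Z'. b' z = 0)" for k
    unfolding U_def W_def
    by (rule truncated_at_singularities[of S' Z' V D a b M]) (use S' V M \<epsilon> in auto)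
  then obtain D' a' b' where U: "\<And>k. lap2 S' (U k) (D' k) (a' k) (b' k)"
    "\<And>k z. z \<in> S' - Z' \<Longrightarrow> b' k z \<ge> ramp' (\<epsilon> k) (W k z) * b z" "\<And>k z. z \<in> Z' \<Longrightarrow> b' k z = 0"
    by metis
  have v': "lap2 S' v Dv av bv" by (rule lap2_subset[OF v]) (use S' in \<open>auto simp: S'_def\<close>)
  note cb = lap2_continuous(1-4)[OF U(1), THEN continuous_on_subset, OF S'(4)]
    lap2_continuous(1-4)[OF v', THEN continuous_on_subset, OF S'(4)]
  have sp: "sphere 0 1 \<subseteq> cball (0::complex) 1" by auto
  \<comment> \<open>The closed disc has diameter 2, so the halving inside the logarithms makes them
    nonpositive and the correction only lowers \<open>V\<close>.\<close>
  have WV: "W k z \<le> V z" if "z \<in> cball 0 1 - Z" for k z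
  proof -
    have "(\<Sum>\<zeta>\<in>Z'. ln (cmod ((z - \<zeta>) / 2))) \<le> 0"
    proof (rule sum_nonpos)
      fix \<zeta> assume "\<zeta> \<in> Z'"
      then have "cmod (z - \<zeta>) \<le> 2" "z \<noteq> \<zeta>" using that norm_triangle_ineq4[of z \<zeta>] by (auto simp: Z'_def)
      then show "ln (cmod ((z - \<zeta>) / 2)) \<le> 0" by (intro ln_le_zero_iff[THEN iffD2]) (auto simp: norm_divide)
    qed
    then show ?thesis using \<epsilon>[of k] by (simp add: W_def mult_nonneg_nonpos)
  qed
  have zin: "z \<in> S - Z" if "z \<in> cball 0 1 - Z" for z using that S by auto
  have U0: "0 \<le> U k z" for k z using ramp_bounds(1)[OF \<epsilon>] by (simp add: U_def)
  have UY: "U k z \<le> Y z" if "z \<in> cball 0 1" for k z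
  proof (cases "z \<in> Z")
    case True then show ?thesis using that Y(2) by (simp add: U_def Z'_def)
  next
    case False
    then have "U k z \<le> ramp (\<epsilon> k) (V z)"
      using that WV[of z k] ramp_mono[OF \<epsilon>] by (auto simp: U_def Z'_def)
    also have "\<dots> \<le> V z" using that False zin pos[of z] ramp_bounds(2)[OF \<epsilon>] by (simp add: less_imp_le)
    also have "\<dots> \<le> Y z" using that False Y(1) by auto
    finally show ?thesis .
  qed
  have b0: "0 \<le> b' k z" if "z \<in> cball 0 1" for k z
  proof (cases "z \<in> Z")
    case False
    then have "0 \<le> b z" using w[of z] that by auto
    then have "0 \<le> ramp' (\<epsilon> k) (W k z) * b z" using ramp_bounds(3)[OF \<epsilon>] by simp
    then show ?thesis using U(2)[of z k] S'(5) zin that False by fastforce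
  qed (use U(3) that Z'_def in auto)
  let ?R = "(\<integral>\<^sup>+z\<in>cball 0 1. ennreal (Y z * m1 z) \<partial>lborel) + (\<integral>\<^sup>+t\<in>{0..2*pi}. ennreal (P t * Y (cis t)) \<partial>lborel)"
  define G where "G k z = 2 * (v z * b' k z) + U k z * m2 z" for k z
  have Gc: "continuous_on (cball 0 1) (G k)" for k
    unfolding G_def by (intro continuous_intros cb m)
  have G0: "0 \<le> G k z" if "z \<in> cball 0 1" for k z
    unfolding G_def using that v0 b0 U0 m by (auto intro!: add_nonneg_nonneg mult_nonneg_nonneg)
  have GR: "(\<integral>\<^sup>+z\<in>cball 0 1. ennreal (G k z) \<partial>lborel) \<le> ?R" for k
  proof -
    have cP: "continuous_on {0..2*pi} (\<lambda>t. P t * U k (cis t))"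
      unfolding P(2)[symmetric]
      by (intro continuous_intros continuous_on_compose2[OF cb(1)] continuous_on_compose2[OF cb(6)]) auto
    have e1: "indicator (cball 0 1) z * (2 * (v z * b' k z - U k z * bv z)) =
        indicator (cball 0 1) z * G k z - indicator (cball 0 1) z * (U k z * m1 z)" for z
    proof (cases "z \<in> cball 0 1")
      case True
      have "2 * (U k z * bv z) = U k z * (2 * bv z)" by simp
      also have "\<dots> = U k z * m1 z - U k z * m2 z" unfolding m(1)[OF True] by (rule right_diff_distrib)
      finally show ?thesis using True by (simp add: G_def algebra_simps)
    qed auto
    have "- integral {0..2*pi} (\<lambda>t. Re (cis t * Dv (cis t)) * U k (cis t)) = integral {0..2*pi} (\<lambda>t. P t * U k (cis t))"
      unfolding P(2)[symmetric] mult_minus_left Henstock_Kurzweil_Integration.integral_neg by (rule refl)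
    then have "(\<integral>z. indicator (cball 0 1) z * G k z - indicator (cball 0 1) z * (U k z * m1 z) \<partial>lborel)
       = integral {0..2*pi} (\<lambda>t. P t * U k (cis t))"
      using green_disc[OF U(1)[of k] v' S'(4) v0(2)] unfolding e1 by simp
    moreover have "(\<integral>z. indicator (cball 0 1) z * G k z - indicator (cball 0 1) z * (U k z * m1 z) \<partial>lborel)
       = (\<integral>z. indicator (cball 0 1) z * G k z \<partial>lborel) - (\<integral>z. indicator (cball 0 1) z * (U k z * m1 z) \<partial>lborel)"
      by (rule Bochner_Integration.integral_diff; rule disc_integral_chords(3)) (intro Gc continuous_intros cb m)+
    ultimately have "(\<integral>z. indicator (cball 0 1) z * G k z \<partial>lborel)
      = (\<integral>z. indicator (cball 0 1) z * (U k z * m1 z) \<partial>lborel) + integral {0..2*pi} (\<lambda>t. P t * U k (cis t))" by simp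
    moreover have "0 \<le> (\<integral>z. indicator (cball 0 1) z * (U k z * m1 z) \<partial>lborel)"
      using U0 m(2) by (intro Bochner_Integration.integral_nonneg) (auto simp: indicator_def)
    moreover have "0 \<le> integral {0..2*pi} (\<lambda>t. P t * U k (cis t))"
      using P(1) U0 by (intro integral_nonneg integrable_continuous_real cP) auto
    ultimately have "ennreal (\<integral>z. indicator (cball 0 1) z * G k z \<partial>lborel)
      = ennreal (\<integral>z. indicator (cball 0 1) z * (U k z * m1 z) \<partial>lborel) + ennreal (integral {0..2*pi} (\<lambda>t. P t * U k (cis t)))"
      by simp
    also have "ennreal (integral {0..2*pi} (\<lambda>t. P t * U k (cis t))) = (\<integral>\<^sup>+t\<in>{0..2*pi}. ennreal (P t * U k (cis t)) \<partial>lborel)"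
      using P(1) U0 by (intro integral_circle_le_nn_integral cP) auto
    also have "ennreal (\<integral>z. indicator (cball 0 1) z * (U k z * m1 z) \<partial>lborel) = (\<integral>\<^sup>+z\<in>cball 0 1. ennreal (U k z * m1 z) \<partial>lborel)"
      using U0 m(2) by (intro integral_cball_eq_nn_integral continuous_intros cb m) auto
    also have "(\<integral>\<^sup>+z\<in>cball 0 1. ennreal (U k z * m1 z) \<partial>lborel) \<le> (\<integral>\<^sup>+z\<in>cball 0 1. ennreal (Y z * m1 z) \<partial>lborel)"
      using UY m(2) by (intro nn_integral_mono) (auto simp: indicator_def intro!: ennreal_leI mult_right_mono)
    also have "(\<integral>\<^sup>+t\<in>{0..2*pi}. ennreal (P t * U k (cis t)) \<partial>lborel) \<le> (\<integral>\<^sup>+t\<in>{0..2*pi}. ennreal (P t * Y (cis t)) \<partial>lborel)"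
      using UY P(1) by (intro nn_integral_mono) (auto simp: indicator_def intro!: ennreal_leI mult_left_mono)
    finally show ?thesis
      using integral_cball_eq_nn_integral[OF Gc G0] by (simp add: add_mono)
  qed
  \<comment> \<open>Off the singular set the correction tends to 0 and, as \<open>V\<close> is
    positive there, the truncation converges to \<open>V\<close> and its slope to 1.\<close>
  have lim: "ennreal (v z * w z + V z * m2 z) \<le> liminf (\<lambda>k. ennreal (G k z))" if z: "z \<in> cball 0 1 - Z" for z
  proof -
    have zZ': "z \<notin> Z'" using z by (simp add: Z'_def)
    have "(\<lambda>k. W k z) \<longlonglongrightarrow> V z + 0 * (\<Sum>\<zeta>\<in>Z'. ln (cmod ((z - \<zeta>) / 2)))"
      unfolding W_def by (intro tendsto_intros \<epsilon>0)
    then have Wl: "(\<lambda>k. W k z) \<longlonglongrightarrow> V z" by simp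
    note rt = ramp_tendsto[OF Wl pos[OF zin[OF z]] \<epsilon>0]
    have "(\<lambda>k. v z * (ramp' (\<epsilon> k) (W k z) * w z) + ramp (\<epsilon> k) (W k z) * m2 z) \<longlonglongrightarrow> v z * (1 * w z) + V z * m2 z"
      by (intro tendsto_intros rt)
    then have "(\<lambda>k. ennreal (v z * (ramp' (\<epsilon> k) (W k z) * w z) + ramp (\<epsilon> k) (W k z) * m2 z)) \<longlonglongrightarrow> ennreal (v z * w z + V z * m2 z)"
      by (intro tendsto_ennrealI) simp
    then have "ennreal (v z * w z + V z * m2 z) = liminf (\<lambda>k. ennreal (v z * (ramp' (\<epsilon> k) (W k z) * w z) + ramp (\<epsilon> k) (W k z) * m2 z))"
      by (simp add: lim_imp_Liminf)
    also have "\<dots> \<le> liminf (\<lambda>k. ennreal (G k z))"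
    proof (intro Liminf_mono always_eventually allI ennreal_leI)
      fix k
      have "ramp' (\<epsilon> k) (W k z) * w z \<le> ramp' (\<epsilon> k) (W k z) * (2 * b z)"
        using w[OF z] ramp_bounds(3)[OF \<epsilon>] by (intro mult_left_mono) auto
      also have "\<dots> \<le> 2 * b' k z" using U(2)[of z k] S'(5) zin[OF z] by fastforce
      finally have "v z * (ramp' (\<epsilon> k) (W k z) * w z) \<le> v z * (2 * b' k z)"
        using v0(1)[of z] z by (intro mult_left_mono) auto
      then show "v z * (ramp' (\<epsilon> k) (W k z) * w z) + ramp (\<epsilon> k) (W k z) * m2 z \<le> G k z"
        using zZ' by (simp add: G_def U_def)
    qed
    finally show ?thesis .
  qed
  have meas: "(\<lambda>z. ennreal (G k z) * indicator (cball 0 1) z) \<in> borel_measurable lborel" for k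
  proof -
    have "(\<lambda>z. indicator (cball 0 1) z * G k z) \<in> borel_measurable lborel"
      using disc_integral_chords(3)[OF Gc[of k]] by simp
    then have "(\<lambda>z. ennreal (indicator (cball 0 1) z * G k z)) \<in> borel_measurable lborel" by simp
    moreover have "ennreal (indicator (cball 0 1) z * G k z) = ennreal (G k z) * indicator (cball 0 1) z" for z
      by (simp add: indicator_def)
    ultimately show ?thesis by simp
  qed
  have aeZ: "AE z in lborel. z \<notin> Z"
    by (rule AE_not_in) (simp add: S(2) finite_imp_null_set_lborel)
  have "(\<integral>\<^sup>+z\<in>cball 0 1. ennreal (v z * w z + V z * m2 z) \<partial>lborel)
     \<le> (\<integral>\<^sup>+z. liminf (\<lambda>k. ennreal (G k z) * indicator (cball 0 1) z) \<partial>lborel)"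
    using aeZ by (intro nn_integral_mono_AE) (auto elim!: eventually_mono simp: indicator_def lim)
  also have "\<dots> \<le> liminf (\<lambda>k. \<integral>\<^sup>+z. ennreal (G k z) * indicator (cball 0 1) z \<partial>lborel)"
    by (rule nn_integral_liminf[OF meas])
  also have "\<dots> \<le> ?R"
    using GR by (intro Liminf_le always_eventually allI) auto
  finally show ?thesis .
qed

section \<open>A potential for chains of primitives\<close>

lemma cauchy_sum_square:
  fixes f :: "nat \<Rightarrow> real"
  shows "(\<Sum>l<n. f l)\<^sup>2 \<le> real n * (\<Sum>l<n. (f l)\<^sup>2)"
  using sum_squared_le_sum_of_squares[of f "{..<n}"] by (simp add: mult.commute)

text \<open>The pointwise inequality behind the potential. There \<open>\<Lambda> 0 = g'/g\<close>, \<open>\<Lambda> i = F_i'/F_i\<close> for \<open>i > 0\<close>, \<open>\<theta> = f'/f\<close>,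
  \<open>\<mu>\<close> is the logarithmic derivative of \<open>l\<close>, and \<open>\<omega> = u / l\<close>; the ratios \<open>\<rho> i\<close> are scaled so that their product is \<open>1\<close>.
  Each \<open>T i\<close> is, up to a factor comparable to \<open>l\<^sup>2\<close>, a lower bound for the Laplacian of one summand of the potential.\<close>

lemma small_ratio_estimate:
  fixes K :: nat and \<kappa> \<epsilon> \<delta> B \<omega> :: real and \<rho> d :: "nat \<Rightarrow> real" and \<Lambda> \<Gamma> :: "nat \<Rightarrow> complex" and \<theta> \<mu> :: complex
  assumes K: "K \<ge> 2" and B: "B \<ge> 1" and \<kappa>: "0 < \<kappa>" "\<kappa> \<le> 1 / (4 * (real K + 2))"
    and \<epsilon>: "0 < \<epsilon>" "\<epsilon> \<le> 1" "(1 + real K / \<kappa>\<^sup>2) * real K * \<epsilon>\<^sup>2 \<le> \<kappa>" "B * real K * \<epsilon> \<le> 1 / 4"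
    and \<delta>: "0 < \<delta>" "\<delta> \<le> 1 / 8" "(real K + 1) * \<delta> \<le> \<epsilon> ^ (K * K)"
    and \<rho>: "\<And>i. i \<le> K \<Longrightarrow> 0 < \<rho> i" "\<And>i. i \<le> K \<Longrightarrow> cmod (\<Lambda> i) * \<rho> i = \<omega>" "(\<Prod>i=1..K. \<rho> i) = 1"
    and \<omega>: "0 \<le> \<omega>" and \<Lambda>K: "\<Lambda> K = of_nat K * \<mu> + \<theta>"
    and d: "\<And>i. i < K \<Longrightarrow> 1 \<le> d i \<and> d i \<le> B"
    and \<Gamma>: "\<And>i. i < K \<Longrightarrow> cmod (\<Gamma> i - of_real (d i) * \<Lambda> i) \<le> B * (\<Sum>l<i. cmod (\<Lambda> l)) + cmod \<theta> + cmod \<mu>"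
  defines "q \<equiv> \<lambda>i. 1 + (\<rho> i / \<epsilon> ^ Suc i)\<^sup>2 + (\<Sum>l<i. (\<epsilon> ^ Suc l / \<rho> l) powr (2 / \<kappa>))"
  defines "Q \<equiv> \<lambda>i. ((\<rho> i / \<epsilon> ^ Suc i)\<^sup>2 * (cmod (\<Gamma> i))\<^sup>2 + (\<Sum>l<i. (\<epsilon> ^ Suc l / \<rho> l) powr (2 / \<kappa>) * ((cmod (\<Gamma> l))\<^sup>2 / \<kappa>\<^sup>2))) / q i"
  defines "T \<equiv> \<lambda>i. (\<epsilon> ^ Suc i)\<^sup>2 * q i powr (- \<kappa>) * ((1 / q i - 2 * \<kappa>) * Q i - 2 * (cmod \<mu>)\<^sup>2 / \<kappa>)"
  defines "D \<equiv> 3 * B\<^sup>2 * real K"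
  defines "X \<equiv> (cmod \<theta>)\<^sup>2 + (cmod \<mu>)\<^sup>2"
  shows "\<And>i. i < K \<Longrightarrow> T i \<ge> - (6 * D * \<kappa>\<^sup>2 * \<omega>\<^sup>2 + 2 * D * (1 + real K / \<kappa>\<^sup>2) * X + 2 * (cmod \<mu>)\<^sup>2 / \<kappa>)"
    and "cmod \<mu> \<le> \<delta> * \<omega> \<Longrightarrow> cmod \<theta> \<le> \<delta> * \<omega> \<Longrightarrow> 0 < \<omega> \<Longrightarrow>
      \<exists>i<K. T i \<ge> \<omega>\<^sup>2 / (8 * (real K + 2) ^ 3) - 2 * (cmod \<mu>)\<^sup>2 / \<kappa>"
proof -
  have \<kappa>1: "\<kappa> \<le> 1" using \<kappa> K by (smt (verit) divide_le_eq_1_pos of_nat_0_le_iff)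
  have e0: "0 < \<epsilon> ^ Suc i" "\<epsilon> ^ Suc i \<le> 1" for i using \<epsilon>(1,2) by (auto intro: power_le_one simp del: power_Suc)
  have q1: "1 \<le> q i" if "i < K" for i
    unfolding q_def by (auto intro!: add_nonneg_nonneg sum_nonneg)
  have p1: "0 < q i powr (- \<kappa>)" "q i powr (- \<kappa>) \<le> 1" if "i < K" for i
  proof -
    show "0 < q i powr (- \<kappa>)" using q1[OF that] by simp
    have "q i powr (- \<kappa>) \<le> q i powr 0" using q1[OF that] \<kappa> by (intro powr_mono) auto
    then show "q i powr (- \<kappa>) \<le> 1" using q1[OF that] by simp
  qed
  have ql: "(\<epsilon> ^ Suc l / \<rho> l) powr (2 / \<kappa>) \<le> q i" if "l < i" "i < K" for l i
  proof -
    have "(\<epsilon> ^ Suc l / \<rho> l) powr (2 / \<kappa>) \<le> (\<Sum>l<i. (\<epsilon> ^ Suc l / \<rho> l) powr (2 / \<kappa>))"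
      using that by (intro member_le_sum) auto
    then show ?thesis unfolding q_def by (smt (verit) zero_le_power2)
  qed
  have qi: "(\<rho> i / \<epsilon> ^ Suc i)\<^sup>2 \<le> q i" if "i < K" for i
    unfolding q_def by (smt (verit) powr_ge_zero sum_nonneg)
  have \<Lambda>\<rho>: "cmod (\<Lambda> i) = \<omega> / \<rho> i" if "i \<le> K" for i using \<rho>(1,2)[OF that] by (simp add: field_simps)
  \<comment> \<open>The exponent 2/\<kappa> in \<open>q\<close> is made for this: raised to the
    power -\<kappa>, the summand of index \<open>l\<close> becomes the square of
    \<open>\<rho> l / \<epsilon> ^ Suc l\<close>, which cancels the blow-up of
    \<open>cmod (\<Lambda> l)\<close> = \<open>\<omega> / \<rho> l\<close>.\<close>
  have b: "q i powr (- \<kappa>) * (cmod (\<Lambda> l))\<^sup>2 \<le> \<omega>\<^sup>2 / (\<epsilon> ^ Suc l)\<^sup>2" if "l < i" "i < K" for l i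
  proof -
    have r: "0 < \<rho> l" using \<rho>(1) that by auto
    have pos: "0 < \<epsilon> ^ Suc l / \<rho> l" using r e0 by simp
    have "q i powr (- \<kappa>) \<le> ((\<epsilon> ^ Suc l / \<rho> l) powr (2 / \<kappa>)) powr (- \<kappa>)"
      using ql[OF that] pos \<kappa> by (intro powr_mono2') auto
    also have "\<dots> = (\<epsilon> ^ Suc l / \<rho> l) powr (- 2)" using \<kappa> by (simp add: powr_powr)
    also have "\<dots> = (\<rho> l / \<epsilon> ^ Suc l)\<^sup>2" 
      using pos r e0[of l] by (simp add: powr_minus powr_numeral power_divide divide_simps del: power_Suc)
    finally have "q i powr (- \<kappa>) * (cmod (\<Lambda> l))\<^sup>2 \<le> (\<rho> l / \<epsilon> ^ Suc l)\<^sup>2 * (\<omega> / \<rho> l)\<^sup>2"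
      using \<Lambda>\<rho>[of l] that by (intro mult_mono) auto
    also have "\<dots> = \<omega>\<^sup>2 / (\<epsilon> ^ Suc l)\<^sup>2" using r by (simp add: power_divide)
    finally show ?thesis .
  qed
  have D3: "3 \<le> D" 
  proof -
    have "1 * 1 \<le> B\<^sup>2 * real K" using B K by (intro mult_mono) (auto simp: one_le_power)
    then show ?thesis by (simp add: D_def)
  qed
  have dd: "(cmod (\<Gamma> i))\<^sup>2 \<le> D * ((\<Sum>l<Suc i. (cmod (\<Lambda> l))\<^sup>2) + X)" if "i < K" for i
  proof -
    have "cmod (\<Gamma> i) \<le> cmod (of_real (d i) * \<Lambda> i) + cmod (\<Gamma> i - of_real (d i) * \<Lambda> i)"
      by (metis add.commute diff_add_cancel norm_triangle_ineq)
    also have "\<dots> \<le> B * cmod (\<Lambda> i) + (B * (\<Sum>l<i. cmod (\<Lambda> l)) + cmod \<theta> + cmod \<mu>)"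
      using d[OF that] by (intro add_mono \<Gamma> that) (auto simp: norm_mult intro!: mult_right_mono)
    also have "\<dots> = B * (\<Sum>l<Suc i. cmod (\<Lambda> l)) + cmod \<theta> + cmod \<mu>" by (simp add: algebra_simps)
    finally have "(cmod (\<Gamma> i))\<^sup>2 \<le> (B * (\<Sum>l<Suc i. cmod (\<Lambda> l)) + cmod \<theta> + cmod \<mu>)\<^sup>2"
      by (intro power_mono) auto
    also have "\<dots> \<le> 3 * ((B * (\<Sum>l<Suc i. cmod (\<Lambda> l)))\<^sup>2 + (cmod \<theta>)\<^sup>2 + (cmod \<mu>)\<^sup>2)"
    proof -
      have "(x + y + z)\<^sup>2 \<le> 3 * (x\<^sup>2 + y\<^sup>2 + z\<^sup>2)" for x y z :: real
      proof -
        have "0 \<le> (x - y)\<^sup>2 + (y - z)\<^sup>2 + (x - z)\<^sup>2" by simp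
        then show ?thesis by (simp add: power2_eq_square algebra_simps)
      qed
      then show ?thesis by blast
    qed
    also have "(B * (\<Sum>l<Suc i. cmod (\<Lambda> l)))\<^sup>2 \<le> B\<^sup>2 * (real K * (\<Sum>l<Suc i. (cmod (\<Lambda> l))\<^sup>2))"
    proof -
      have "(\<Sum>l<Suc i. cmod (\<Lambda> l))\<^sup>2 \<le> real (Suc i) * (\<Sum>l<Suc i. (cmod (\<Lambda> l))\<^sup>2)" by (rule cauchy_sum_square)
      also have "\<dots> \<le> real K * (\<Sum>l<Suc i. (cmod (\<Lambda> l))\<^sup>2)"
        using that by (intro mult_right_mono sum_nonneg) auto
      finally show ?thesis by (simp add: power_mult_distrib mult_left_mono)
    qed
    finally have "(cmod (\<Gamma> i))\<^sup>2 \<le> D * (\<Sum>l<Suc i. (cmod (\<Lambda> l))\<^sup>2) + 3 * X"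
      by (simp add: D_def X_def algebra_simps)
    also have "\<dots> \<le> D * (\<Sum>l<Suc i. (cmod (\<Lambda> l))\<^sup>2) + D * X" using mult_right_mono[OF D3, of X] by (simp add: X_def)
    finally show ?thesis by (simp add: algebra_simps)
  qed
  \<comment> \<open>Each later threshold is smaller by at least a factor \<epsilon>; this is what
    makes the contribution of earlier indices negligible.\<close>
  have ratio: "(\<epsilon> ^ Suc i)\<^sup>2 * (\<omega>\<^sup>2 / (\<epsilon> ^ Suc l)\<^sup>2) \<le> \<epsilon>\<^sup>2 * \<omega>\<^sup>2" if "l < i" for l i
  proof -
    have "\<epsilon> ^ Suc i = \<epsilon> ^ Suc l * \<epsilon> ^ (i - l)" using that by (simp flip: power_add del: power_Suc)
    moreover have "(x * y)\<^sup>2 * (w / x\<^sup>2) = y\<^sup>2 * w" if "x > 0" for x y w :: real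
      using that by (simp add: power_mult_distrib field_simps)
    ultimately have "(\<epsilon> ^ Suc i)\<^sup>2 * (\<omega>\<^sup>2 / (\<epsilon> ^ Suc l)\<^sup>2) = (\<epsilon> ^ (i - l))\<^sup>2 * \<omega>\<^sup>2"
      using e0[of l] by (simp only:)
    also have "\<dots> \<le> (\<epsilon> ^ 1)\<^sup>2 * \<omega>\<^sup>2"
      using that \<epsilon> by (intro mult_right_mono power_mono power_decreasing) auto
    finally show ?thesis by simp
  qed
  have X0: "0 \<le> X" by (simp add: X_def)
  have Lsum: "(\<epsilon> ^ Suc i)\<^sup>2 * q i powr (- \<kappa>) * (\<Sum>l<j. (cmod (\<Lambda> l))\<^sup>2) \<le> real K * \<epsilon>\<^sup>2 * \<omega>\<^sup>2" if "j \<le> i" "i < K" for i j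
  proof -
    have "(\<epsilon> ^ Suc i)\<^sup>2 * q i powr (- \<kappa>) * (\<Sum>l<j. (cmod (\<Lambda> l))\<^sup>2) = (\<Sum>l<j. (\<epsilon> ^ Suc i)\<^sup>2 * (q i powr (- \<kappa>) * (cmod (\<Lambda> l))\<^sup>2))"
      by (simp add: sum_distrib_left mult.assoc)
    also have "\<dots> \<le> (\<Sum>l<j. \<epsilon>\<^sup>2 * \<omega>\<^sup>2)"
    proof (rule sum_mono)
      fix l assume "l \<in> {..<j}"
      then have l: "l < i" using that by auto
      have "(\<epsilon> ^ Suc i)\<^sup>2 * (q i powr (- \<kappa>) * (cmod (\<Lambda> l))\<^sup>2) \<le> (\<epsilon> ^ Suc i)\<^sup>2 * (\<omega>\<^sup>2 / (\<epsilon> ^ Suc l)\<^sup>2)"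
        by (intro mult_left_mono b l that) auto
      then show "(\<epsilon> ^ Suc i)\<^sup>2 * (q i powr (- \<kappa>) * (cmod (\<Lambda> l))\<^sup>2) \<le> \<epsilon>\<^sup>2 * \<omega>\<^sup>2" using ratio[OF l] by linarith
    qed
    also have "\<dots> = real j * \<epsilon>\<^sup>2 * \<omega>\<^sup>2" by simp
    also have "\<dots> \<le> real K * \<epsilon>\<^sup>2 * \<omega>\<^sup>2" using that by (intro mult_right_mono) auto
    finally show ?thesis .
  qed
  have ep1: "(\<epsilon> ^ Suc i)\<^sup>2 * q i powr (- \<kappa>) \<le> 1" if "i < K" for i
  proof -
    have "(\<epsilon> ^ Suc i)\<^sup>2 \<le> 1" using e0[of i] by (simp add: power_le_one del: power_Suc)
    then show ?thesis using p1[OF that] by (intro mult_le_one) auto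
  qed
  have Q0: "0 \<le> Q i" if "i < K" for i
    unfolding Q_def using q1[OF that] by (intro divide_nonneg_nonneg add_nonneg_nonneg sum_nonneg) auto
  \<comment> \<open>Every weight divided by \<open>q i\<close> is at most 1. Of the resulting
    squares of logarithmic derivatives, the one of index \<open>i\<close> gives
    \<open>\<omega>^2 / q i\<close>, and the earlier ones are of order
    \<open>\<epsilon>^2 * \<omega>^2\<close> by \<open>Lsum\<close>.\<close>
  have Qb: "(\<epsilon> ^ Suc i)\<^sup>2 * q i powr (- \<kappa>) * Q i \<le> D * (\<omega>\<^sup>2 / q i + (1 + real K / \<kappa>\<^sup>2) * (real K * \<epsilon>\<^sup>2 * \<omega>\<^sup>2 + X))" if i: "i < K" for i
  proof -
    define E where "E = (\<epsilon> ^ Suc i)\<^sup>2 * q i powr (- \<kappa>)"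
    have E: "0 \<le> E" "E \<le> 1" using ep1[OF i] by (auto simp: E_def)
    have qpos: "0 < q i" using q1[OF i] by simp
    have w1: "(\<rho> i / \<epsilon> ^ Suc i)\<^sup>2 / q i \<le> 1" using qi[OF i] qpos by (simp add: divide_le_eq_1)
    have wl: "(\<epsilon> ^ Suc l / \<rho> l) powr (2 / \<kappa>) / q i \<le> 1" if "l < i" for l using ql[OF that i] qpos by (simp add: divide_le_eq_1)
    have A: "E * ((\<rho> i / \<epsilon> ^ Suc i)\<^sup>2 / q i * (cmod (\<Gamma> i))\<^sup>2) \<le> D * (\<omega>\<^sup>2 / q i + (real K * \<epsilon>\<^sup>2 * \<omega>\<^sup>2 + X))"
    proof -
      let ?w = "(\<rho> i / \<epsilon> ^ Suc i)\<^sup>2 / q i"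
      have gen: "(e\<^sup>2 * p) * ((r / e)\<^sup>2 / t * l\<^sup>2) = p * ((l * r)\<^sup>2 / t)" if "e > 0" for e p r t l :: real
        using that by (simp add: power_divide power_mult_distrib)
      have w0: "0 \<le> ?w" using qpos by simp
      have "E * (?w * (cmod (\<Gamma> i))\<^sup>2) \<le> E * (?w * (D * ((\<Sum>l<Suc i. (cmod (\<Lambda> l))\<^sup>2) + X)))"
        using E w0 dd[OF i] by (intro mult_left_mono) auto
      also have "\<dots> = D * (E * (?w * (cmod (\<Lambda> i))\<^sup>2) + ?w * (E * (\<Sum>l<i. (cmod (\<Lambda> l))\<^sup>2)) + ?w * (E * X))"
        by (simp add: algebra_simps)
      also have "\<dots> \<le> D * (\<omega>\<^sup>2 / q i + 1 * (real K * \<epsilon>\<^sup>2 * \<omega>\<^sup>2) + 1 * (1 * X))"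
      proof -
        have "E * (?w * (cmod (\<Lambda> i))\<^sup>2) = q i powr (- \<kappa>) * (\<omega>\<^sup>2 / q i)"
          unfolding E_def \<rho>(2)[OF less_imp_le[OF i], symmetric] by (rule gen[OF e0(1)])
        also have "\<dots> \<le> 1 * (\<omega>\<^sup>2 / q i)" using p1[OF i] qpos by (intro mult_right_mono) auto
        finally have f1: "E * (?w * (cmod (\<Lambda> i))\<^sup>2) \<le> \<omega>\<^sup>2 / q i" by simp
        have f0: "E * (\<Sum>l<i. (cmod (\<Lambda> l))\<^sup>2) \<le> real K * \<epsilon>\<^sup>2 * \<omega>\<^sup>2" unfolding E_def using Lsum[of i i] i by simp
        have f2: "?w * (E * (\<Sum>l<i. (cmod (\<Lambda> l))\<^sup>2)) \<le> 1 * (real K * \<epsilon>\<^sup>2 * \<omega>\<^sup>2)"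
          by (rule mult_mono[OF w1 f0]) (use E in \<open>auto intro!: mult_nonneg_nonneg sum_nonneg\<close>)
        have f3: "?w * (E * X) \<le> 1 * (1 * X)"
          by (rule mult_mono[OF w1 mult_right_mono[OF E(2) X0]]) (use E X0 in auto)
        show ?thesis using f1 f2 f3 D3 by (intro mult_left_mono add_mono) auto
      qed
      finally show ?thesis by (simp add: add.assoc)
    qed
    have Bb: "E * ((\<epsilon> ^ Suc l / \<rho> l) powr (2 / \<kappa>) / q i * (cmod (\<Gamma> l))\<^sup>2) \<le> D * (real K * \<epsilon>\<^sup>2 * \<omega>\<^sup>2 + X)" if l: "l < i" for l
    proof -
      let ?w = "(\<epsilon> ^ Suc l / \<rho> l) powr (2 / \<kappa>) / q i"
      have w0: "0 \<le> ?w" using qpos by simp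
      have "E * (?w * (cmod (\<Gamma> l))\<^sup>2) \<le> E * (1 * (D * ((\<Sum>l<Suc l. (cmod (\<Lambda> l))\<^sup>2) + X)))"
        using E w0 wl[OF l] dd[of l] l i by (intro mult_left_mono mult_mono) auto
      also have "\<dots> = D * (E * (\<Sum>l<Suc l. (cmod (\<Lambda> l))\<^sup>2) + E * X)"
        by (simp only: mult_1 distrib_left mult.left_commute)
      also have "\<dots> \<le> D * (real K * \<epsilon>\<^sup>2 * \<omega>\<^sup>2 + 1 * X)"
      proof -
        have f0: "E * (\<Sum>l<Suc l. (cmod (\<Lambda> l))\<^sup>2) \<le> real K * \<epsilon>\<^sup>2 * \<omega>\<^sup>2" unfolding E_def using Lsum[of "Suc l" i] l i by simp
        show ?thesis using add_mono[OF f0 mult_right_mono[OF E(2) X0]] D3 by (intro mult_left_mono) auto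
      qed
      finally show ?thesis by simp
    qed
    have "E * Q i = E * ((\<rho> i / \<epsilon> ^ Suc i)\<^sup>2 / q i * (cmod (\<Gamma> i))\<^sup>2)
        + (\<Sum>l<i. (E * ((\<epsilon> ^ Suc l / \<rho> l) powr (2 / \<kappa>) / q i * (cmod (\<Gamma> l))\<^sup>2)) / \<kappa>\<^sup>2)"
      unfolding Q_def by (simp add: add_divide_distrib sum_divide_distrib sum_distrib_left distrib_left mult_ac)
    also have "\<dots> \<le> D * (\<omega>\<^sup>2 / q i + (real K * \<epsilon>\<^sup>2 * \<omega>\<^sup>2 + X)) + (\<Sum>l<i. D * (real K * \<epsilon>\<^sup>2 * \<omega>\<^sup>2 + X) / \<kappa>\<^sup>2)"
      using \<kappa> by (intro add_mono A sum_mono divide_right_mono Bb) auto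
    also have "(\<Sum>l<i. D * (real K * \<epsilon>\<^sup>2 * \<omega>\<^sup>2 + X) / \<kappa>\<^sup>2) = real i * (D * (real K * \<epsilon>\<^sup>2 * \<omega>\<^sup>2 + X) / \<kappa>\<^sup>2)" by simp
    also have "\<dots> \<le> real K * (D * (real K * \<epsilon>\<^sup>2 * \<omega>\<^sup>2 + X) / \<kappa>\<^sup>2)"
      using i D3 X0 by (intro mult_right_mono) auto
    finally show ?thesis by (simp add: E_def algebra_simps add_divide_distrib)
  qed
  have lower: "(\<epsilon> ^ Suc i)\<^sup>2 * q i powr (- \<kappa>) * ((1 / q i - 2 * \<kappa>) * Q i) \<ge> - (6 * D * \<kappa>\<^sup>2 * \<omega>\<^sup>2 + 2 * D * (1 + real K / \<kappa>\<^sup>2) * X)" if i: "i < K" for i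
  proof -
    define E where "E = (\<epsilon> ^ Suc i)\<^sup>2 * q i powr (- \<kappa>)"
    have E: "0 \<le> E" by (auto simp: E_def)
    have rhs0: "0 \<le> 6 * D * \<kappa>\<^sup>2 * \<omega>\<^sup>2 + 2 * D * (1 + real K / \<kappa>\<^sup>2) * X"
      using D3 X0 by (intro add_nonneg_nonneg mult_nonneg_nonneg) auto
    show ?thesis
    \<comment> \<open>The term can be negative only where 1/q is below 2 \<kappa>. There the bound
      \<open>Qb\<close> is about 3 \<kappa> \<omega>^2, so after the prefactor 2 \<kappa> the loss
      is of second order in \<kappa>, whence the 6 \<kappa>^2.\<close>
    proof (cases "1 / q i \<ge> 2 * \<kappa>")
      case True
      then have "0 \<le> E * ((1 / q i - 2 * \<kappa>) * Q i)" using E Q0[OF i] by (intro mult_nonneg_nonneg) auto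
      then show ?thesis using rhs0 unfolding E_def by linarith
    next
      case False
      have "E * ((1 / q i - 2 * \<kappa>) * Q i) \<ge> E * ((- 2 * \<kappa>) * Q i)"
        using E Q0[OF i] q1[OF i] by (intro mult_left_mono mult_right_mono) auto
      moreover have "2 * \<kappa> * (E * Q i) \<le> 6 * D * \<kappa>\<^sup>2 * \<omega>\<^sup>2 + 2 * D * (1 + real K / \<kappa>\<^sup>2) * X"
      proof -
        have "E * Q i \<le> D * (\<omega>\<^sup>2 / q i + (1 + real K / \<kappa>\<^sup>2) * (real K * \<epsilon>\<^sup>2 * \<omega>\<^sup>2 + X))" unfolding E_def by (rule Qb[OF i])
        also have "\<dots> = D * (\<omega>\<^sup>2 * (1 / q i) + ((1 + real K / \<kappa>\<^sup>2) * real K * \<epsilon>\<^sup>2) * \<omega>\<^sup>2 + (1 + real K / \<kappa>\<^sup>2) * X)"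
          by (simp add: algebra_simps)
        also have "\<dots> \<le> D * (\<omega>\<^sup>2 * (2 * \<kappa>) + \<kappa> * \<omega>\<^sup>2 + (1 + real K / \<kappa>\<^sup>2) * X)"
          using D3 False \<epsilon>(3) by (intro mult_left_mono add_mono mult_right_mono) auto
        finally have "2 * \<kappa> * (E * Q i) \<le> 2 * \<kappa> * (D * (\<omega>\<^sup>2 * (2 * \<kappa>) + \<kappa> * \<omega>\<^sup>2 + (1 + real K / \<kappa>\<^sup>2) * X))"
          using \<kappa> by (intro mult_left_mono) auto
        also have "\<dots> = 6 * D * \<kappa>\<^sup>2 * \<omega>\<^sup>2 + \<kappa> * (2 * D * (1 + real K / \<kappa>\<^sup>2) * X)"
          by (simp add: algebra_simps power2_eq_square)
        also have "\<kappa> * (2 * D * (1 + real K / \<kappa>\<^sup>2) * X) \<le> 1 * (2 * D * (1 + real K / \<kappa>\<^sup>2) * X)"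
          using \<kappa>1 D3 X0 by (intro mult_right_mono mult_nonneg_nonneg) auto
        finally show ?thesis by simp
      qed
      ultimately show ?thesis unfolding E_def by (simp add: mult_ac)
    qed
  qed
  have mub: "(\<epsilon> ^ Suc i)\<^sup>2 * q i powr (- \<kappa>) * (2 * (cmod \<mu>)\<^sup>2 / \<kappa>) \<le> 2 * (cmod \<mu>)\<^sup>2 / \<kappa>" if i: "i < K" for i
    using mult_right_mono[OF ep1[OF i], of "2 * (cmod \<mu>)\<^sup>2 / \<kappa>"] \<kappa> by simp
  show "T i \<ge> - (6 * D * \<kappa>\<^sup>2 * \<omega>\<^sup>2 + 2 * D * (1 + real K / \<kappa>\<^sup>2) * X + 2 * (cmod \<mu>)\<^sup>2 / \<kappa>)" if i: "i < K" for i
    using lower[OF i] mub[OF i] unfolding T_def right_diff_distrib by linarith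
  assume mu: "cmod \<mu> \<le> \<delta> * \<omega>" and th: "cmod \<theta> \<le> \<delta> * \<omega>" and \<omega>p: "0 < \<omega>"
  \<comment> \<open>If no ratio were small, the product condition would bound
    \<open>\<rho> K\<close> by an inverse power of \<epsilon>. Then
    \<open>cmod (\<Lambda> K)\<close> would be a fixed fraction of \<omega>, contradicting the
    smallness of \<mu> and \<theta>.\<close>
  have "\<exists>i<K. \<rho> i \<le> \<epsilon> ^ Suc i"
  proof (rule ccontr)
    assume neg: "\<not> (\<exists>i<K. \<rho> i \<le> \<epsilon> ^ Suc i)"
    have "cmod (\<Lambda> K) \<le> cmod (of_nat K * \<mu>) + cmod \<theta>" unfolding \<Lambda>K by (rule norm_triangle_ineq)
    also have "\<dots> \<le> real K * (\<delta> * \<omega>) + \<delta> * \<omega>" using mu th by (auto simp: norm_mult intro!: add_mono mult_left_mono)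
    finally have "\<omega> \<le> (real K + 1) * \<delta> * \<omega> * \<rho> K"
      using \<rho>(2)[of K] \<rho>(1)[of K] mult_right_mono[of "cmod (\<Lambda> K)" "real K * (\<delta> * \<omega>) + \<delta> * \<omega>" "\<rho> K"] by (simp add: algebra_simps)
    then have 1: "1 \<le> (real K + 1) * \<delta> * \<rho> K" using \<omega>p by (simp add: mult.commute mult.left_commute)
    have "(\<Prod>i=1..K. \<rho> i) = (\<Prod>i=1..<K. \<rho> i) * \<rho> K"
    proof -
      have "{1..K} = insert K {1..<K}" using K by auto
      then show ?thesis by (simp add: mult.commute)
    qed
    then have 2: "(\<Prod>i=1..<K. \<rho> i) * \<rho> K = 1" using \<rho>(3) by simp
    have "(\<Prod>i=1..<K. \<epsilon> ^ K) < (\<Prod>i=1..<K. \<rho> i)"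
    proof (rule prod_mono_strict[of 1])
      have lt: "\<epsilon> ^ K < \<rho> i" if "i \<in> {1..<K}" for i
      proof -
        have "\<epsilon> ^ K \<le> \<epsilon> ^ Suc i" using that \<epsilon> by (intro power_decreasing) auto
        also have "\<dots> < \<rho> i" using neg that by (simp add: not_le del: power_Suc)
        finally show ?thesis .
      qed
      show "1 \<in> {1..<K}" using K by auto
      then show "\<epsilon> ^ K < \<rho> 1" by (rule lt)
      show "0 \<le> \<epsilon> ^ K \<and> \<epsilon> ^ K \<le> \<rho> i" if "i \<in> {1..<K}" for i using lt[OF that] \<epsilon> by simp
      show "0 < \<rho> i" if "i \<in> {1..<K}" for i using \<rho>(1)[of i] that by simp
    qed simp
    moreover have "\<epsilon> ^ (K * K) \<le> (\<Prod>i=1..<K. \<epsilon> ^ K)"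
    proof -
      have "(\<Prod>i=1..<K. \<epsilon> ^ K) = \<epsilon> ^ (K * (K - 1))" by (simp flip: power_mult)
      then show ?thesis using \<epsilon> by (auto intro!: power_decreasing)
    qed
    ultimately have "(real K + 1) * \<delta> < (\<Prod>i=1..<K. \<rho> i)" using \<delta>(3) by linarith
    then have "(real K + 1) * \<delta> * \<rho> K < (\<Prod>i=1..<K. \<rho> i) * \<rho> K" using \<rho>(1)[of K] by (intro mult_strict_right_mono) auto
    then show False using 1 2 by linarith
  qed
  \<comment> \<open>At the first small index all summands of \<open>q i\<close> are at most 1, so
    \<open>q i\<close> is bounded by K + 2, while \<open>\<Lambda> i\<close> exceeds every earlier
    \<open>\<Lambda> l\<close> by a factor 1/\<epsilon>.\<close>
  then obtain i where i: "i < K" "\<rho> i \<le> \<epsilon> ^ Suc i" and least: "\<And>l. l < i \<Longrightarrow> \<not> (l < K \<and> \<rho> l \<le> \<epsilon> ^ Suc l)"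
    using exists_least_iff[of "\<lambda>i. i < K \<and> \<rho> i \<le> \<epsilon> ^ Suc i"] by auto
  have ri: "0 < \<rho> i" using \<rho>(1) i by simp
  have l\<rho>: "\<epsilon> ^ Suc l < \<rho> l" if "l < i" for l using least[OF that] that i by auto
  have qK: "q i \<le> real K + 2"
  proof -
    have "(\<Sum>l<i. (\<epsilon> ^ Suc l / \<rho> l) powr (2 / \<kappa>)) \<le> (\<Sum>l<i. 1)"
    proof (rule sum_mono)
      fix l assume "l \<in> {..<i}"
      then have "\<epsilon> ^ Suc l / \<rho> l \<le> 1" "0 < \<epsilon> ^ Suc l / \<rho> l" using l\<rho>[of l] e0[of l] by (auto simp del: power_Suc)
      then have "(\<epsilon> ^ Suc l / \<rho> l) powr (2 / \<kappa>) \<le> 1 powr (2 / \<kappa>)" using \<kappa> by (intro powr_mono2) auto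
      then show "(\<epsilon> ^ Suc l / \<rho> l) powr (2 / \<kappa>) \<le> 1" by simp
    qed
    moreover have "(\<rho> i / \<epsilon> ^ Suc i)\<^sup>2 \<le> 1" using i ri e0[of i] by (intro power_le_one) (auto simp del: power_Suc)
    ultimately show ?thesis using i unfolding q_def by simp
  qed
  have LL: "cmod (\<Lambda> l) \<le> \<epsilon> * cmod (\<Lambda> i)" if l: "l < i" for l
  proof -
    have "\<epsilon> ^ Suc i \<le> \<epsilon> * \<epsilon> ^ Suc l" using l \<epsilon> power_decreasing[of "Suc (Suc l)" "Suc i" \<epsilon>] by simp
    also have "\<dots> \<le> \<epsilon> * \<rho> l" using l\<rho>[OF l] \<epsilon> by (intro mult_left_mono) auto
    finally have "\<rho> i \<le> \<epsilon> * \<rho> l" using i by linarith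
    then have "\<omega> * \<rho> i \<le> \<omega> * (\<epsilon> * \<rho> l)" using \<omega> by (rule mult_left_mono)
    then have "\<omega> / \<rho> l \<le> \<epsilon> * (\<omega> / \<rho> i)" using ri \<rho>(1)[of l] l i by (simp add: field_simps)
    then show ?thesis using \<Lambda>\<rho>[of l] \<Lambda>\<rho>[of i] l i by simp
  qed
  have \<omega>\<Lambda>: "\<omega> \<le> cmod (\<Lambda> i)"
  proof -
    have "\<rho> i \<le> 1" using i e0[of i] by linarith
    then have "cmod (\<Lambda> i) * \<rho> i \<le> cmod (\<Lambda> i) * 1" by (intro mult_left_mono) auto
    then show ?thesis using \<rho>(2)[of i] i by simp
  qed
  \<comment> \<open>The perturbation consumes at most half of \<open>cmod (\<Lambda> i)\<close>: a
    quarter from the earlier indices and an eighth each from \<theta> and \<mu>.\<close>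
  have \<Gamma>i: "cmod (\<Gamma> i) \<ge> cmod (\<Lambda> i) / 2"
  proof -
    have "cmod (\<Lambda> i) \<le> d i * cmod (\<Lambda> i)" using d[OF i(1)] by (simp add: mult_le_cancel_right1)
    also have "\<dots> = cmod (of_real (d i) * \<Lambda> i)" using d[OF i(1)] by (simp add: norm_mult)
    also have "\<dots> \<le> cmod (\<Gamma> i) + cmod (\<Gamma> i - of_real (d i) * \<Lambda> i)"
      by (metis add.commute norm_minus_commute norm_triangle_sub)
    also have "\<dots> \<le> cmod (\<Gamma> i) + (B * (\<Sum>l<i. cmod (\<Lambda> l)) + cmod \<theta> + cmod \<mu>)" using \<Gamma>[OF i(1)] by simp
    also have "(\<Sum>l<i. cmod (\<Lambda> l)) \<le> (\<Sum>l<i. \<epsilon> * cmod (\<Lambda> i))" by (intro sum_mono LL) auto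
    also have "(\<Sum>l<i. \<epsilon> * cmod (\<Lambda> i)) = real i * (\<epsilon> * cmod (\<Lambda> i))" by simp
    also have "\<dots> \<le> real K * (\<epsilon> * cmod (\<Lambda> i))" using i \<epsilon> by (intro mult_right_mono) auto
    finally have "cmod (\<Lambda> i) \<le> cmod (\<Gamma> i) + (B * (real K * (\<epsilon> * cmod (\<Lambda> i))) + cmod \<theta> + cmod \<mu>)" using B by simp
    moreover have "B * (real K * (\<epsilon> * cmod (\<Lambda> i))) \<le> 1 / 4 * cmod (\<Lambda> i)"
      using mult_right_mono[OF \<epsilon>(4), of "cmod (\<Lambda> i)"] by (simp add: mult_ac)
    moreover have "\<delta> * \<omega> \<le> 1 / 8 * cmod (\<Lambda> i)" using \<delta> \<omega>\<Lambda> \<omega> by (intro mult_mono) auto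
    ultimately show ?thesis using mu th by simp
  qed
  have qp: "0 < q i" using q1[OF i(1)] by simp
  \<comment> \<open>The gain: with 2 \<kappa> at most 1/(2q), the factors q^(-\<kappa>), 1/q - 2
    \<kappa> and Q contribute at least 1/q, 1/(2q) and a quarter of \<open>\<omega>^2 / q\<close>
    (after the thresholds cancel), and q is at most K + 2.\<close>
  have "\<omega>\<^sup>2 / (8 * (real K + 2) ^ 3) \<le> \<omega>\<^sup>2 / (8 * q i ^ 3)"
    using qp qK by (intro divide_left_mono mult_left_mono power_mono mult_pos_pos) auto
  also have "\<dots> = (\<epsilon> ^ Suc i)\<^sup>2 * (1 / q i) * ((1 / (2 * q i)) * ((\<rho> i / \<epsilon> ^ Suc i)\<^sup>2 * (cmod (\<Lambda> i) / 2)\<^sup>2 / q i))"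
  proof -
    have "(l * r)\<^sup>2 / (8 * t ^ 3) = e\<^sup>2 * (1 / t) * ((1 / (2 * t)) * ((r / e)\<^sup>2 * (l / 2)\<^sup>2 / t))" if "e > 0" "t > 0" for e r t l :: real
      using that by (simp add: power_divide power_mult_distrib field_simps power3_eq_cube power2_eq_square)
    from this[OF e0(1)[of i] qp] show ?thesis unfolding \<rho>(2)[OF less_imp_le[OF i(1)], symmetric] by blast
  qed
  also have "\<dots> \<le> (\<epsilon> ^ Suc i)\<^sup>2 * q i powr (- \<kappa>) * ((1 / q i - 2 * \<kappa>) * Q i)"
  proof (intro mult_mono mult_left_mono)
    have "q i powr (- 1) \<le> q i powr (- \<kappa>)" using q1[OF i(1)] \<kappa>1 by (intro powr_mono) auto
    then show "1 / q i \<le> q i powr (- \<kappa>)" using qp by (simp add: powr_minus_divide)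
    have "2 * \<kappa> \<le> 1 / (2 * (real K + 2))" using \<kappa>(2) by (simp add: field_simps)
    also have "\<dots> \<le> 1 / (2 * q i)" using qp qK by (intro divide_left_mono) auto
    finally show "1 / (2 * q i) \<le> 1 / q i - 2 * \<kappa>" by simp
    have "(\<rho> i / \<epsilon> ^ Suc i)\<^sup>2 * (cmod (\<Lambda> i) / 2)\<^sup>2 \<le> (\<rho> i / \<epsilon> ^ Suc i)\<^sup>2 * (cmod (\<Gamma> i))\<^sup>2"
      using \<Gamma>i by (intro mult_left_mono power_mono) auto
    moreover have "0 \<le> (\<Sum>l<i. (\<epsilon> ^ Suc l / \<rho> l) powr (2 / \<kappa>) * ((cmod (\<Gamma> l))\<^sup>2 / \<kappa>\<^sup>2))"
      by (intro sum_nonneg) auto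
    ultimately show "(\<rho> i / \<epsilon> ^ Suc i)\<^sup>2 * (cmod (\<Lambda> i) / 2)\<^sup>2 / q i \<le> Q i"
      unfolding Q_def using qp by (intro divide_right_mono) auto
    then show "0 \<le> 1 / q i - 2 * \<kappa>" using \<open>1 / (2 * q i) \<le> 1 / q i - 2 * \<kappa>\<close> qp by (smt (verit) divide_pos_pos)
  qed (use qp in auto)
  finally show "\<exists>i<K. T i \<ge> \<omega>\<^sup>2 / (8 * (real K + 2) ^ 3) - 2 * (cmod \<mu>)\<^sup>2 / \<kappa>"
    using mub[OF i(1)] i(1) unfolding T_def right_diff_distrib by (intro exI[of _ i]) auto
qed


text \<open>Fixes the constants in dependence on K and B alone and combines the two alternatives: a
  small ratio gives the gain, and otherwise \<mu> or \<theta> is comparable to \<omega> and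
  pays.\<close>

lemma small_ratio_constants:
  fixes K :: nat and B :: real
  assumes K: "K \<ge> 2" and B: "B \<ge> 1"
  obtains \<kappa> \<epsilon> c A C :: real where "0 < \<kappa>" "0 < \<epsilon>" "\<epsilon> \<le> 1" "0 < c" "0 \<le> A" "0 \<le> C"
    and "\<And>\<rho> d \<Lambda> \<Gamma> \<theta> \<mu> \<omega> q Q. (\<And>i. i \<le> K \<Longrightarrow> 0 < \<rho> i) \<Longrightarrow> (\<And>i. i \<le> K \<Longrightarrow> cmod (\<Lambda> i) * \<rho> i = \<omega>) \<Longrightarrow>
       (\<Prod>i=1..K. \<rho> i) = 1 \<Longrightarrow> 0 \<le> \<omega> \<Longrightarrow> \<Lambda> K = of_nat K * \<mu> + \<theta> \<Longrightarrow>
       (\<And>i. i < K \<Longrightarrow> 1 \<le> d i \<and> d i \<le> B) \<Longrightarrow>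
       (\<And>i. i < K \<Longrightarrow> cmod (\<Gamma> i - of_real (d i) * \<Lambda> i) \<le> B * (\<Sum>l<i. cmod (\<Lambda> l)) + cmod \<theta> + cmod \<mu>) \<Longrightarrow>
       (\<And>i. q i = 1 + (\<rho> i / \<epsilon> ^ Suc i)\<^sup>2 + (\<Sum>l<i. (\<epsilon> ^ Suc l / \<rho> l) powr (2 / \<kappa>))) \<Longrightarrow>
       (\<And>i. Q i = ((\<rho> i / \<epsilon> ^ Suc i)\<^sup>2 * (cmod (\<Gamma> i))\<^sup>2 + (\<Sum>l<i. (\<epsilon> ^ Suc l / \<rho> l) powr (2 / \<kappa>) * ((cmod (\<Gamma> l))\<^sup>2 / \<kappa>\<^sup>2))) / q i) \<Longrightarrow>
       c * \<omega>\<^sup>2 - C * (cmod \<theta>)\<^sup>2 \<le> A * (cmod \<mu>)\<^sup>2 +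
         (\<Sum>i<K. (\<epsilon> ^ Suc i)\<^sup>2 * q i powr (- \<kappa>) * ((1 / q i - 2 * \<kappa>) * Q i - 2 * (cmod \<mu>)\<^sup>2 / \<kappa>))"
proof -
  define D where "D = 3 * B\<^sup>2 * real K"
  \<comment> \<open>The order matters. \<open>\<eta>\<close> is the gain at the first small index;
    \<open>\<kappa>\<close> makes the K second-order losses at most \<open>\<eta> / 4\<close>;
    \<open>\<epsilon>\<close>, chosen after \<open>\<kappa>\<close>, satisfies the smallness
    conditions that contain 1/\<kappa>^2; \<open>H\<close> collects the coefficients of the squares
    of \<mu> and \<theta>; and \<open>\<delta>\<close> is small against all of these.\<close>
  define \<eta> where "\<eta> = 1 / (8 * (real K + 2) ^ 3)"
  define \<kappa> where "\<kappa> = \<eta> / (24 * real K * D)"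
  define \<epsilon> where "\<epsilon> = \<kappa>\<^sup>2 / (4 * B * (real K)\<^sup>2)"
  define H where "H = real K * (2 * D * (1 + real K / \<kappa>\<^sup>2) + 2 / \<kappa>)"
  define \<delta> where "\<delta> = min (1 / 8) (min (\<epsilon> ^ (K * K) / (real K + 1)) (\<eta> / (12 * (H + 1 / \<kappa> + 1))))"
  have D3: "3 \<le> D"
  proof -
    have "1 * 1 \<le> B\<^sup>2 * real K" using B K by (intro mult_mono) (auto simp: one_le_power)
    then show ?thesis by (simp add: D_def)
  qed
  have \<eta>: "0 < \<eta>" "\<eta> \<le> 1 / (8 * (real K + 2))"
  proof -
    have "(real K + 2) ^ 1 \<le> (real K + 2) ^ 3" by (intro power_increasing) auto
    then show "\<eta> \<le> 1 / (8 * (real K + 2))" unfolding \<eta>_def by (intro divide_left_mono) auto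
  qed (auto simp: \<eta>_def)
  have kd: "24 * real K * D \<ge> 1"
  proof -
    have "1 * 1 \<le> (24 * real K) * D" using K D3 by (intro mult_mono) auto
    then show ?thesis by simp
  qed
  have \<kappa>: "0 < \<kappa>" "\<kappa> \<le> 1 / (4 * (real K + 2))" "\<kappa> \<le> 1"
  proof -
    have kdp: "0 < 24 * real K * D" using kd by linarith
    then show k0: "0 < \<kappa>" unfolding \<kappa>_def by (rule divide_pos_pos[OF \<eta>(1)])
    have "\<kappa> \<le> \<eta> / 1" unfolding \<kappa>_def using \<eta> kd kdp by (intro divide_left_mono) auto
    also have "\<eta> / 1 \<le> 1 / (8 * (real K + 2))" using \<eta> by simp
    also have "\<dots> \<le> 1 / (4 * (real K + 2))" by (intro divide_left_mono) auto
    finally show k1: "\<kappa> \<le> 1 / (4 * (real K + 2))" .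
    also have "\<dots> \<le> 1" by (simp add: divide_le_eq)
    finally show "\<kappa> \<le> 1" .
  qed
  have k2: "6 * real K * D * \<kappa>\<^sup>2 \<le> \<eta> / 4"
  proof -
    have "6 * real K * D * \<kappa>\<^sup>2 = (24 * real K * D * \<kappa>) * \<kappa> / 4" by (simp add: power2_eq_square)
    also have "24 * real K * D * \<kappa> = \<eta>" unfolding \<kappa>_def using D3 K by simp
    also have "\<eta> * \<kappa> / 4 \<le> \<eta> * 1 / 4" using \<eta> \<kappa> by (intro divide_right_mono mult_left_mono) auto
    finally show ?thesis by simp
  qed
  have \<epsilon>: "0 < \<epsilon>" "\<epsilon> \<le> 1" "(1 + real K / \<kappa>\<^sup>2) * real K * \<epsilon>\<^sup>2 \<le> \<kappa>" "B * real K * \<epsilon> \<le> 1 / 4"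
  proof -
    show e0: "0 < \<epsilon>" unfolding \<epsilon>_def using \<kappa> B K by simp
    have bk: "1 \<le> B * real K" using B K mult_mono[of 1 B 1 "real K"] by simp
    have "B * real K * \<epsilon> = \<kappa>\<^sup>2 / (4 * real K)" unfolding \<epsilon>_def using B K by (simp add: power2_eq_square field_simps)
    also have "\<dots> \<le> 1 / 4"
    proof -
      have "\<kappa>\<^sup>2 \<le> 1" using \<kappa> by (simp add: power_le_one)
      then show ?thesis using K by (simp add: divide_simps)
    qed
    finally show e4: "B * real K * \<epsilon> \<le> 1 / 4" .
    have "1 * \<epsilon> \<le> B * real K * \<epsilon>" using bk e0 by (intro mult_right_mono) auto
    then show "\<epsilon> \<le> 1" using e4 by linarith
    have e5: "\<epsilon> \<le> \<kappa>\<^sup>2 / (4 * (real K)\<^sup>2)" unfolding \<epsilon>_def using \<kappa> B K by (intro divide_left_mono) auto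
    have "\<epsilon>\<^sup>2 = \<epsilon> * \<epsilon>" by (rule power2_eq_square)
    also have "\<dots> \<le> \<kappa>\<^sup>2 / (4 * (real K)\<^sup>2) * (\<kappa>\<^sup>2 / (4 * (real K)\<^sup>2))" using e5 e0 by (intro mult_mono) auto
    finally have e6: "\<epsilon>\<^sup>2 \<le> \<kappa>\<^sup>2 / (4 * (real K)\<^sup>2) * (\<kappa>\<^sup>2 / (4 * (real K)\<^sup>2))" .
    have "1 \<le> real K / \<kappa>\<^sup>2"
    proof -
      have "\<kappa>\<^sup>2 \<le> 1" using \<kappa> by (simp add: power_le_one)
      then show ?thesis using K \<kappa> by (simp add: divide_simps)
    qed
    then have "(1 + real K / \<kappa>\<^sup>2) * real K \<le> (real K / \<kappa>\<^sup>2 + real K / \<kappa>\<^sup>2) * real K" by (intro mult_right_mono) auto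
    also have "\<dots> = 2 * (real K)\<^sup>2 / \<kappa>\<^sup>2" by (simp add: power2_eq_square)
    finally have "(1 + real K / \<kappa>\<^sup>2) * real K * \<epsilon>\<^sup>2 \<le> 2 * (real K)\<^sup>2 / \<kappa>\<^sup>2 * (\<kappa>\<^sup>2 / (4 * (real K)\<^sup>2) * (\<kappa>\<^sup>2 / (4 * (real K)\<^sup>2)))"
      using e6 by (intro mult_mono) auto
    also have "\<dots> = \<kappa> * (\<kappa> / (8 * (real K)\<^sup>2))" using \<kappa> K by (simp add: power2_eq_square field_simps)
    also have "\<dots> \<le> \<kappa> * 1"
    proof (intro mult_left_mono)
      have "1 \<le> real K * real K" using K mult_mono[of 1 "real K" 1 "real K"] by simp
      then show "\<kappa> / (8 * (real K)\<^sup>2) \<le> 1" using \<kappa> by (simp add: power2_eq_square divide_simps)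
    qed (use \<kappa> in auto)
    finally show "(1 + real K / \<kappa>\<^sup>2) * real K * \<epsilon>\<^sup>2 \<le> \<kappa>" by simp
  qed
  have H0: "0 \<le> H" unfolding H_def using D3 \<kappa> by (intro mult_nonneg_nonneg add_nonneg_nonneg) auto
  have Hk: "0 < H + 1 / \<kappa> + 1" using H0 \<kappa> by (simp add: add_nonneg_pos)
  have \<delta>: "0 < \<delta>" "\<delta> \<le> 1 / 8" "(real K + 1) * \<delta> \<le> \<epsilon> ^ (K * K)" "(H + 1 / \<kappa>) * \<delta> \<le> \<eta> / 12"
  proof -
    show d0: "0 < \<delta>" unfolding \<delta>_def using \<epsilon>(1) \<eta>(1) Hk by simp
    show "\<delta> \<le> 1 / 8" unfolding \<delta>_def by (rule min.cobounded1)
    have "(real K + 1) * \<delta> \<le> (real K + 1) * (\<epsilon> ^ (K * K) / (real K + 1))" unfolding \<delta>_def by (intro mult_left_mono) auto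
    then show "(real K + 1) * \<delta> \<le> \<epsilon> ^ (K * K)" by simp
    have "(H + 1 / \<kappa>) * \<delta> \<le> (H + 1 / \<kappa> + 1) * (\<eta> / (12 * (H + 1 / \<kappa> + 1)))"
      using d0 H0 \<kappa> unfolding \<delta>_def by (intro mult_mono) auto
    also have "\<dots> = \<eta> / 12"
    proof -
      have "x * (\<eta> / (12 * x)) = \<eta> / 12" if "x > 0" for x :: real using that by simp
      then show ?thesis using Hk by blast
    qed
    finally show "(H + 1 / \<kappa>) * \<delta> \<le> \<eta> / 12" .
  qed
  define c where "c = \<eta> / 4"
  define C where "C = H + (\<eta> / 2) / \<delta>\<^sup>2"
  show ?thesis
  proof (rule that[of \<kappa> \<epsilon> c C C])
    fix \<rho> d :: "nat \<Rightarrow> real" and \<Lambda> \<Gamma> :: "nat \<Rightarrow> complex" and \<theta> \<mu> :: complex and \<omega> :: real and q Q :: "nat \<Rightarrow> real"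
    assume h: "\<And>i. i \<le> K \<Longrightarrow> 0 < \<rho> i" "\<And>i. i \<le> K \<Longrightarrow> cmod (\<Lambda> i) * \<rho> i = \<omega>"
       "(\<Prod>i=1..K. \<rho> i) = 1" "0 \<le> \<omega>" "\<Lambda> K = of_nat K * \<mu> + \<theta>"
       "\<And>i. i < K \<Longrightarrow> 1 \<le> d i \<and> d i \<le> B"
       "\<And>i. i < K \<Longrightarrow> cmod (\<Gamma> i - of_real (d i) * \<Lambda> i) \<le> B * (\<Sum>l<i. cmod (\<Lambda> l)) + cmod \<theta> + cmod \<mu>"
    assume q: "\<And>i. q i = 1 + (\<rho> i / \<epsilon> ^ Suc i)\<^sup>2 + (\<Sum>l<i. (\<epsilon> ^ Suc l / \<rho> l) powr (2 / \<kappa>))"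
    assume Q: "\<And>i. Q i = ((\<rho> i / \<epsilon> ^ Suc i)\<^sup>2 * (cmod (\<Gamma> i))\<^sup>2 + (\<Sum>l<i. (\<epsilon> ^ Suc l / \<rho> l) powr (2 / \<kappa>) * ((cmod (\<Gamma> l))\<^sup>2 / \<kappa>\<^sup>2))) / q i"
    define T where "T i = (\<epsilon> ^ Suc i)\<^sup>2 * q i powr (- \<kappa>) * ((1 / q i - 2 * \<kappa>) * Q i - 2 * (cmod \<mu>)\<^sup>2 / \<kappa>)" for i
    define X where "X = (cmod \<theta>)\<^sup>2 + (cmod \<mu>)\<^sup>2"
    define N where "N = 6 * D * \<kappa>\<^sup>2 * \<omega>\<^sup>2 + 2 * D * (1 + real K / \<kappa>\<^sup>2) * X + 2 * (cmod \<mu>)\<^sup>2 / \<kappa>"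
    have X0: "0 \<le> X" by (simp add: X_def)
    have N0: "0 \<le> N" unfolding N_def using D3 \<kappa> X0 by (intro add_nonneg_nonneg mult_nonneg_nonneg) auto
    have KN: "real K * N \<le> \<eta> / 4 * \<omega>\<^sup>2 + H * X"
    proof -
      have "real K * N = 6 * real K * D * \<kappa>\<^sup>2 * \<omega>\<^sup>2 + real K * (2 * D * (1 + real K / \<kappa>\<^sup>2) * X + 2 / \<kappa> * (cmod \<mu>)\<^sup>2)"
        by (simp add: N_def algebra_simps)
      also have "\<dots> \<le> \<eta> / 4 * \<omega>\<^sup>2 + real K * (2 * D * (1 + real K / \<kappa>\<^sup>2) * X + 2 / \<kappa> * X)"
        using k2 \<kappa> unfolding X_def by (intro add_mono mult_right_mono mult_left_mono) auto
      finally show ?thesis by (simp add: H_def algebra_simps)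
    qed
    have TN: "T i \<ge> - N" if "i < K" for i
      using small_ratio_estimate(1)[OF K B \<kappa>(1,2) \<epsilon> \<delta>(1-3) h that]
      unfolding T_def N_def D_def X_def q Q .
    have sumT: "(\<Sum>i<K. T i) \<ge> - (real K * N)"
    proof -
      have "(\<Sum>i<K. - N) \<le> (\<Sum>i<K. T i)" using TN by (intro sum_mono) auto
      then show ?thesis by simp
    qed
    have "c * \<omega>\<^sup>2 - C * (cmod \<theta>)\<^sup>2 \<le> C * (cmod \<mu>)\<^sup>2 + (\<Sum>i<K. T i)"
    \<comment> \<open>If \<mu> and \<theta> are below \<open>\<delta> * \<omega>\<close>, one
      summand gives the full gain and the other K - 1 lose little. Otherwise \<omega>^2 is at most
      \<open>X / \<delta>^2\<close> and is absorbed by the constant \<open>C\<close>.\<close>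
    proof (cases "cmod \<mu> \<le> \<delta> * \<omega> \<and> cmod \<theta> \<le> \<delta> * \<omega> \<and> 0 < \<omega>")
      case True
      then obtain i where i: "i < K" "T i \<ge> \<eta> * \<omega>\<^sup>2 - 2 * (cmod \<mu>)\<^sup>2 / \<kappa>"
        using small_ratio_estimate(2)[OF K B \<kappa>(1,2) \<epsilon> \<delta>(1-3) h]
        unfolding T_def q Q \<eta>_def by auto
      have "0 \<le> T j + N" if "j < K" for j using TN[OF that] by linarith
      then have "T i + N \<le> (\<Sum>i<K. T i + N)" using i by (intro member_le_sum) auto
      then have 1: "T i - real K * N \<le> (\<Sum>i<K. T i)" using N0 by (simp add: sum.distrib)
      have m2: "(cmod \<mu>)\<^sup>2 \<le> \<delta> * \<omega>\<^sup>2" "(cmod \<theta>)\<^sup>2 \<le> \<delta> * \<omega>\<^sup>2"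
      proof -
        have dd: "\<delta>\<^sup>2 \<le> \<delta>" using \<delta> by (simp add: power2_eq_square mult_le_cancel_left1)
        have "(cmod \<mu>)\<^sup>2 \<le> (\<delta> * \<omega>)\<^sup>2" "(cmod \<theta>)\<^sup>2 \<le> (\<delta> * \<omega>)\<^sup>2" using True by (auto intro!: power_mono)
        moreover have "(\<delta> * \<omega>)\<^sup>2 \<le> \<delta> * \<omega>\<^sup>2" using dd by (simp add: power_mult_distrib mult_right_mono)
        ultimately show "(cmod \<mu>)\<^sup>2 \<le> \<delta> * \<omega>\<^sup>2" "(cmod \<theta>)\<^sup>2 \<le> \<delta> * \<omega>\<^sup>2" by auto
      qed
      have "H * X + 2 * (cmod \<mu>)\<^sup>2 / \<kappa> \<le> H * (2 * (\<delta> * \<omega>\<^sup>2)) + 2 * (\<delta> * \<omega>\<^sup>2) / \<kappa>"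
        using H0 \<kappa> m2 unfolding X_def by (intro add_mono mult_left_mono divide_right_mono) auto
      also have "\<dots> = 2 * ((H + 1 / \<kappa>) * \<delta>) * \<omega>\<^sup>2" by (simp add: algebra_simps)
      also have "\<dots> \<le> 2 * (\<eta> / 12) * \<omega>\<^sup>2" using \<delta>(4) by (intro mult_right_mono mult_left_mono) auto
      finally have 2: "H * X + 2 * (cmod \<mu>)\<^sup>2 / \<kappa> \<le> \<eta> / 6 * \<omega>\<^sup>2" by simp
      have "\<eta> / 4 * \<omega>\<^sup>2 \<le> \<eta> * \<omega>\<^sup>2 - \<eta> / 4 * \<omega>\<^sup>2 - \<eta> / 6 * \<omega>\<^sup>2" using \<eta>(1) by (simp add: algebra_simps)
      then have "c * \<omega>\<^sup>2 \<le> (\<Sum>i<K. T i)" using 1 2 i(2) KN unfolding c_def by linarith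
      moreover have "0 \<le> C" unfolding C_def using H0 \<eta> by auto
      ultimately show ?thesis by (smt (verit) mult_nonneg_nonneg zero_le_power2)
    next
      case False
      have "\<omega>\<^sup>2 \<le> X / \<delta>\<^sup>2"
      proof (cases "\<omega> = 0")
        case False
        then have "\<delta> * \<omega> \<le> cmod \<mu> \<or> \<delta> * \<omega> \<le> cmod \<theta>" using \<open>\<not> (cmod \<mu> \<le> \<delta> * \<omega> \<and> cmod \<theta> \<le> \<delta> * \<omega> \<and> 0 < \<omega>)\<close> h(4) by auto
        then have "(\<delta> * \<omega>)\<^sup>2 \<le> X"
          unfolding X_def using \<delta>(1) h(4) power_mono[of "\<delta> * \<omega>" "cmod \<mu>" 2] power_mono[of "\<delta> * \<omega>" "cmod \<theta>" 2]
          by (smt (verit) mult_nonneg_nonneg zero_le_power2)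
        then show ?thesis using \<delta>(1) by (simp add: power_mult_distrib field_simps)
      qed (use X0 in simp)
      then have "\<eta> / 2 * \<omega>\<^sup>2 \<le> \<eta> / 2 * (X / \<delta>\<^sup>2)" using \<eta> by (intro mult_left_mono) auto
      then have "\<eta> / 2 * \<omega>\<^sup>2 + H * X \<le> C * X" by (simp add: C_def algebra_simps)
      then have "c * \<omega>\<^sup>2 + real K * N \<le> C * X" using KN \<eta> unfolding c_def by (simp add: algebra_simps)
      then show ?thesis using sumT by (simp add: X_def algebra_simps)
    qed
    then show "c * \<omega>\<^sup>2 - C * (cmod \<theta>)\<^sup>2 \<le> C * (cmod \<mu>)\<^sup>2 + (\<Sum>i<K. (\<epsilon> ^ Suc i)\<^sup>2 * q i powr (- \<kappa>) * ((1 / q i - 2 * \<kappa>) * Q i - 2 * (cmod \<mu>)\<^sup>2 / \<kappa>))"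
      unfolding T_def .
  qed (use \<kappa> \<epsilon> \<eta> H0 in \<open>auto simp: c_def C_def\<close>)
qed

section \<open>Negative powers of sums of exponentials\<close>

text \<open>Relative to the reference point \<beta> k the variance is \<open>R - (cmod s)^2\<close>.
  The index k contributes nothing to s, so Cauchy-Schwarz over the others saves the factor 1 - w k
  and the variance is at least \<open>w k * R\<close>. The surplus \<kappa> times the squared mean
  costs 2 \<kappa> times R plus the squared reference value.\<close>

lemma weighted_variance_bound:
  fixes \<beta> :: "nat \<Rightarrow> complex" and w :: "nat \<Rightarrow> real"
  assumes w: "\<And>j. j < N \<Longrightarrow> 0 \<le> w j" "(\<Sum>j<N. w j) = 1" and k: "k < N" and \<kappa>: "0 \<le> \<kappa>"
  shows "(w k - 2 * \<kappa>) * (\<Sum>j<N. w j * (cmod (\<beta> j - \<beta> k))\<^sup>2) - 2 * \<kappa> * (cmod (\<beta> k))\<^sup>2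
    \<le> (\<Sum>j<N. w j * (cmod (\<beta> j))\<^sup>2) - (1 + \<kappa>) * (cmod (\<Sum>j<N. of_real (w j) * \<beta> j))\<^sup>2"
proof -
  define t where "t j = \<beta> j - \<beta> k" for j
  define s where "s = (\<Sum>j<N. of_real (w j) * t j)"
  define R where "R = (\<Sum>j<N. w j * (cmod (t j))\<^sup>2)"
  have R0: "0 \<le> R" unfolding R_def using w by (intro sum_nonneg) auto
  have cw: "(\<Sum>j<N. complex_of_real (w j)) = 1" using w(2) by (metis of_real_1 of_real_sum)
  have mean: "(\<Sum>j<N. of_real (w j) * \<beta> j) = s + \<beta> k"
  proof -
    have "s = (\<Sum>j<N. of_real (w j) * \<beta> j) - (\<Sum>j<N. of_real (w j)) * \<beta> k"
      unfolding s_def t_def by (simp add: algebra_simps sum_subtractf sum_distrib_left sum_distrib_right)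
    then show ?thesis by (simp add: cw)
  qed
  have sq: "(cmod (x + y))\<^sup>2 = (cmod x)\<^sup>2 + 2 * Re (x * cnj y) + (cmod y)\<^sup>2" for x y :: complex
    by (simp add: cmod_power2) (simp add: power2_eq_square algebra_simps)
  have sec: "(\<Sum>j<N. w j * (cmod (\<beta> j))\<^sup>2) = R + 2 * Re (s * cnj (\<beta> k)) + (cmod (\<beta> k))\<^sup>2"
  proof -
    have "w j * (cmod (\<beta> j))\<^sup>2 = w j * (cmod (t j))\<^sup>2 + 2 * Re (of_real (w j) * t j * cnj (\<beta> k)) + w j * (cmod (\<beta> k))\<^sup>2" for j
    proof -
      have 1: "(cmod (\<beta> j))\<^sup>2 = (cmod (t j))\<^sup>2 + 2 * Re (t j * cnj (\<beta> k)) + (cmod (\<beta> k))\<^sup>2"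
        using sq[of "t j" "\<beta> k"] by (simp add: t_def)
      have 2: "Re (of_real (w j) * t j * cnj (\<beta> k)) = w j * Re (t j * cnj (\<beta> k))" by (simp add: algebra_simps)
      have 3: "x * (y + 2 * z + v) = x * y + 2 * (x * z) + x * v" for x y z v :: real by (simp add: algebra_simps)
      show ?thesis unfolding 1 2 by (rule 3)
    qed
    then have "(\<Sum>j<N. w j * (cmod (\<beta> j))\<^sup>2) = R + (\<Sum>j<N. 2 * Re (of_real (w j) * t j * cnj (\<beta> k))) + (\<Sum>j<N. w j) * (cmod (\<beta> k))\<^sup>2"
      by (simp add: R_def sum.distrib sum_distrib_right)
    moreover have "(\<Sum>j<N. 2 * Re (of_real (w j) * t j * cnj (\<beta> k))) = 2 * Re (s * cnj (\<beta> k))"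
      unfolding s_def by (simp only: sum_distrib_right Re_sum sum_distrib_left)
    ultimately show ?thesis using w(2) by simp
  qed
  have cs: "(cmod s)\<^sup>2 \<le> (1 - w k) * R"
  proof -
    have s': "s = (\<Sum>j\<in>{..<N} - {k}. of_real (w j) * t j)"
      unfolding s_def using k by (subst sum.remove[of _ k]) (auto simp: t_def)
    have "cmod s \<le> (\<Sum>j\<in>{..<N} - {k}. w j * cmod (t j))"
      unfolding s' using w by (intro sum_norm_le) (auto simp: norm_mult)
    also have "\<dots> = (\<Sum>j\<in>{..<N} - {k}. sqrt (w j) * (sqrt (w j) * cmod (t j)))"
      using w by (intro sum.cong) auto
    finally have "(cmod s)\<^sup>2 \<le> (\<Sum>j\<in>{..<N} - {k}. sqrt (w j) * (sqrt (w j) * cmod (t j)))\<^sup>2"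
      by (intro power_mono) auto
    also have "\<dots> \<le> (\<Sum>j\<in>{..<N} - {k}. (sqrt (w j))\<^sup>2) * (\<Sum>j\<in>{..<N} - {k}. (sqrt (w j) * cmod (t j))\<^sup>2)"
      by (rule Cauchy_Schwarz_ineq_sum)
    also have "(\<Sum>j\<in>{..<N} - {k}. (sqrt (w j))\<^sup>2) = (\<Sum>j\<in>{..<N} - {k}. w j)" using w by (intro sum.cong) auto
    also have "\<dots> = 1 - w k" using w(2) k by (simp add: sum_diff1)
    also have "(\<Sum>j\<in>{..<N} - {k}. (sqrt (w j) * cmod (t j))\<^sup>2) = (\<Sum>j\<in>{..<N} - {k}. w j * (cmod (t j))\<^sup>2)"
      using w by (intro sum.cong) (auto simp: power_mult_distrib)
    also have "\<dots> = R" unfolding R_def using k by (subst (2) sum.remove[of _ k]) (auto simp: t_def)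
    finally show ?thesis .
  qed
  have "0 \<le> w k" using w k by auto
  then have cs': "(cmod s)\<^sup>2 \<le> R" using cs R0 by (smt (verit) mult_left_le_one_le mult_nonneg_nonneg left_diff_distrib)
  have "(cmod (s + \<beta> k))\<^sup>2 \<le> 2 * (cmod s)\<^sup>2 + 2 * (cmod (\<beta> k))\<^sup>2"
  proof -
    have "(cmod (s + \<beta> k))\<^sup>2 \<le> (cmod s + cmod (\<beta> k))\<^sup>2" by (intro power_mono norm_triangle_ineq) auto
    also have "\<dots> \<le> 2 * (cmod s)\<^sup>2 + 2 * (cmod (\<beta> k))\<^sup>2"
      using zero_le_power2[of "cmod s - cmod (\<beta> k)"] by (simp add: power2_eq_square algebra_simps)
    finally show ?thesis .
  qed
  then have "\<kappa> * (cmod (s + \<beta> k))\<^sup>2 \<le> \<kappa> * (2 * R + 2 * (cmod (\<beta> k))\<^sup>2)" using cs' \<kappa> by (intro mult_left_mono) auto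
  moreover have "(\<Sum>j<N. w j * (cmod (\<beta> j))\<^sup>2) - (cmod (s + \<beta> k))\<^sup>2 = R - (cmod s)\<^sup>2"
    unfolding sec sq by simp
  ultimately show ?thesis using cs unfolding mean t_def[symmetric] R_def[symmetric]
    by (simp add: algebra_simps)
qed

lemma lap2_exp:
  assumes "lap2 S x \<beta> a b"
  shows "\<exists>a'. lap2 S (\<lambda>z. exp (2 * x z)) (\<lambda>z. of_real (2 * exp (2 * x z)) * \<beta> z) a'
     (\<lambda>z. 2 * exp (2 * x z) * (cmod (\<beta> z))\<^sup>2 + 2 * exp (2 * x z) * b z)"
proof -
  have L: "lap2 S (\<lambda>z. exp (2 * x z)) (\<lambda>z. of_real (2 * exp (2 * x z)) * \<beta> z)
    (\<lambda>z. of_real (4 * exp (2 * x z)) * (\<beta> z)\<^sup>2 / 2 + of_real (2 * exp (2 * x z)) * a z)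
    (\<lambda>z. 4 * exp (2 * x z) * (cmod (\<beta> z))\<^sup>2 / 2 + 2 * exp (2 * x z) * b z)"
    by (rule lap2_compose[OF assms, of UNIV]) (auto intro!: derivative_eq_intros continuous_intros)
  show ?thesis by (rule exI, rule lap2_transform[OF L]) auto
qed

text \<open>With weights \<open>exp (2 * x j z) / E z\<close>, the Laplacian of - E^(-\<kappa>) is a
  positive multiple of the second moment of the \<beta> j minus 1 + \<kappa> times their squared
  mean. This is nearly a variance, so a common gradient is cheap and differences of gradients
  count.\<close>

lemma lap2_neg_powr_sum_exp:
  fixes x :: "nat \<Rightarrow> complex \<Rightarrow> real" and \<kappa> :: real
  assumes x: "\<And>j. j < N \<Longrightarrow> lap2 S (x j) (\<beta> j) (a j) (\<lambda>z. 0)" and S: "open S" and k: "k < N" and \<kappa>: "\<kappa> > 0"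
  defines "E \<equiv> \<lambda>z. \<Sum>j<N. exp (2 * x j z)"
  shows "\<exists>D a' b. lap2 S (\<lambda>z. - (E z powr - \<kappa>)) D a' b \<and> (\<forall>z\<in>S. b z \<ge> 2 * \<kappa> * E z powr - \<kappa> *
     ((exp (2 * x k z) / E z - 2 * \<kappa>) * (\<Sum>j<N. exp (2 * x j z) / E z * (cmod (\<beta> j z - \<beta> k z))\<^sup>2) - 2 * \<kappa> * (cmod (\<beta> k z))\<^sup>2))"
proof -
  have "\<forall>j\<in>{..<N}. \<exists>a'. lap2 S (\<lambda>z. exp (2 * x j z)) (\<lambda>z. of_real (2 * exp (2 * x j z)) * \<beta> j z) a'
     (\<lambda>z. 2 * exp (2 * x j z) * (cmod (\<beta> j z))\<^sup>2 + 2 * exp (2 * x j z) * 0)"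
    using lap2_exp[OF x] by simp
  from bchoice[OF this] obtain a' where "\<forall>j\<in>{..<N}. lap2 S (\<lambda>z. exp (2 * x j z)) (\<lambda>z. of_real (2 * exp (2 * x j z)) * \<beta> j z) (a' j)
     (\<lambda>z. 2 * exp (2 * x j z) * (cmod (\<beta> j z))\<^sup>2 + 2 * exp (2 * x j z) * 0)" ..
  then have a': "\<And>j. j \<in> {..<N} \<Longrightarrow> lap2 S (\<lambda>z. exp (2 * x j z)) (\<lambda>z. of_real (2 * exp (2 * x j z)) * \<beta> j z) (a' j)
     (\<lambda>z. 2 * exp (2 * x j z) * (cmod (\<beta> j z))\<^sup>2 + 2 * exp (2 * x j z) * 0)"
    by (rule bspec)
  define DE where "DE z = (\<Sum>j<N. of_real (2 * exp (2 * x j z)) * \<beta> j z)" for z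
  define bE where "bE z = (\<Sum>j<N. 2 * exp (2 * x j z) * (cmod (\<beta> j z))\<^sup>2)" for z
  have E: "lap2 S E DE (\<lambda>z. \<Sum>j<N. a' j z) bE"
    using lap2_sum[OF S finite_lessThan a'] unfolding E_def DE_def[abs_def] bE_def[abs_def] by simp
  have Epos: "0 < E z" for z unfolding E_def using k by (intro sum_pos) auto
  have L: "lap2 S (\<lambda>z. - (E z powr - \<kappa>)) (\<lambda>z. of_real (\<kappa> * E z powr (- \<kappa> - 1)) * DE z)
     (\<lambda>z. of_real (- \<kappa> * (\<kappa> + 1) * E z powr (- \<kappa> - 2)) * (DE z)\<^sup>2 / 2 + of_real (\<kappa> * E z powr (- \<kappa> - 1)) * (\<Sum>j<N. a' j z))
     (\<lambda>z. (- \<kappa> * (\<kappa> + 1) * E z powr (- \<kappa> - 2)) * (cmod (DE z))\<^sup>2 / 2 + \<kappa> * E z powr (- \<kappa> - 1) * bE z)"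
  proof (rule lap2_compose[OF E, of "{0<..}" "\<lambda>t. - (t powr - \<kappa>)" "\<lambda>t. \<kappa> * t powr (- \<kappa> - 1)" "\<lambda>t. - \<kappa> * (\<kappa> + 1) * t powr (- \<kappa> - 2)"])
    fix t :: real assume t: "t \<in> {0<..}"
    show "((\<lambda>t. - (t powr - \<kappa>)) has_real_derivative \<kappa> * t powr (- \<kappa> - 1)) (at t)"
      using t by (auto intro!: derivative_eq_intros)
    have "((\<lambda>t. \<kappa> * t powr (- \<kappa> - 1)) has_real_derivative \<kappa> * ((- \<kappa> - 1) * t powr (- \<kappa> - 1 - 1))) (at t)"
      using t by (intro DERIV_cmult has_real_derivative_powr) auto
    moreover have "\<kappa> * ((- \<kappa> - 1) * t powr (- \<kappa> - 1 - 1)) = - \<kappa> * (\<kappa> + 1) * t powr (- \<kappa> - 2)"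
      by (simp add: algebra_simps)
    ultimately show "((\<lambda>t. \<kappa> * t powr (- \<kappa> - 1)) has_real_derivative - \<kappa> * (\<kappa> + 1) * t powr (- \<kappa> - 2)) (at t)"
      by (simp only:)
  qed (use Epos in \<open>auto intro!: continuous_intros\<close>)
  have "(- \<kappa> * (\<kappa> + 1) * E z powr (- \<kappa> - 2)) * (cmod (DE z))\<^sup>2 / 2 + \<kappa> * E z powr (- \<kappa> - 1) * bE z
     \<ge> 2 * \<kappa> * E z powr - \<kappa> * ((exp (2 * x k z) / E z - 2 * \<kappa>) * (\<Sum>j<N. exp (2 * x j z) / E z * (cmod (\<beta> j z - \<beta> k z))\<^sup>2) - 2 * \<kappa> * (cmod (\<beta> k z))\<^sup>2)" (is "?l z \<ge> ?r z") for z
  proof -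
    define w where "w j = exp (2 * x j z) / E z" for j
    have w: "0 \<le> w j" for j using Epos[of z] by (simp add: w_def)
    have w1: "(\<Sum>j<N. w j) = 1" using Epos[of z] unfolding w_def sum_divide_distrib[symmetric] by (simp add: E_def)
    have ew: "exp (2 * x j z) = E z * w j" for j using Epos[of z] by (simp add: w_def)
    have 1: "DE z = of_real (2 * E z) * (\<Sum>j<N. of_real (w j) * \<beta> j z)"
      unfolding DE_def ew by (simp add: sum_distrib_left mult_ac)
    have 2: "bE z = 2 * E z * (\<Sum>j<N. w j * (cmod (\<beta> j z))\<^sup>2)"
      unfolding bE_def ew by (simp add: sum_distrib_left mult_ac)
    have 3: "E z powr (- \<kappa> - 2) * (E z)\<^sup>2 = E z powr - \<kappa>" "E z powr (- \<kappa> - 1) * E z = E z powr - \<kappa>"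
      using Epos[of z] powr_add[of "E z" "- \<kappa> - 2" 2] powr_add[of "E z" "- \<kappa> - 1" 1] by (simp_all add: powr_numeral)
    have 4: "(cmod (DE z))\<^sup>2 = 4 * (E z)\<^sup>2 * (cmod (\<Sum>j<N. of_real (w j) * \<beta> j z))\<^sup>2"
      unfolding 1 by (simp add: norm_mult power_mult_distrib)
    have "(- \<kappa> * (\<kappa> + 1) * E z powr (- \<kappa> - 2)) * (cmod (DE z))\<^sup>2 / 2 + \<kappa> * E z powr (- \<kappa> - 1) * bE z
       = - \<kappa> * (\<kappa> + 1) * 2 * (E z powr (- \<kappa> - 2) * (E z)\<^sup>2) * (cmod (\<Sum>j<N. of_real (w j) * \<beta> j z))\<^sup>2
         + \<kappa> * 2 * (E z powr (- \<kappa> - 1) * E z) * (\<Sum>j<N. w j * (cmod (\<beta> j z))\<^sup>2)"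
      unfolding 2 4 by (simp only: mult_ac)
    also have "\<dots> = 2 * \<kappa> * E z powr - \<kappa> * ((\<Sum>j<N. w j * (cmod (\<beta> j z))\<^sup>2) - (1 + \<kappa>) * (cmod (\<Sum>j<N. of_real (w j) * \<beta> j z))\<^sup>2)"
      unfolding 3 by (simp add: algebra_simps)
    also have "\<dots> \<ge> 2 * \<kappa> * E z powr - \<kappa> * ((w k - 2 * \<kappa>) * (\<Sum>j<N. w j * (cmod (\<beta> j z - \<beta> k z))\<^sup>2) - 2 * \<kappa> * (cmod (\<beta> k z))\<^sup>2)"
      using weighted_variance_bound[OF w w1 k, of \<kappa> "\<lambda>j. \<beta> j z"] \<kappa> by (intro mult_left_mono) auto
    finally show ?thesis unfolding w_def .
  qed
  note ineq = this
  show ?thesis by (rule exI, rule exI, rule exI, rule conjI, rule L, rule ballI, rule ineq)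
qed

section \<open>The potential of a chain\<close>

text \<open>In terms of the ratios, \<open>V\<close> is \<open>A * l^2\<close> minus the sum over i
  < K of \<open>(\<epsilon> ^ Suc i)^2 / \<kappa> * l^2 * q i powr - \<kappa>\<close>. Its Laplacian
  is then bounded below by the pointwise inequality times \<open>l^2\<close>, and
  \<open>l^2 * \<omega>^2 = u^2\<close>. The condition on the exponents \<open>m i\<close> removes
  the powers of \<open>g\<close> from the product of the ratios.\<close>

lemma chain_potential:
  fixes K :: nat and m :: "nat \<Rightarrow> nat" and \<sigma> :: real
  assumes K: "K \<ge> 2" and m: "(\<Sum>i=1..K. real (m i)) = \<sigma> * real K"
  obtains c A C :: real where "0 < c" "0 < A" "0 \<le> C"
    "\<And>S g F. open S \<Longrightarrow> g holomorphic_on S \<Longrightarrow> (\<And>i. i \<le> K \<Longrightarrow> F i holomorphic_on S) \<Longrightarrow>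
      (\<And>z. z \<in> S \<Longrightarrow> g z \<noteq> 0) \<Longrightarrow> (\<And>i z. i \<le> K \<Longrightarrow> z \<in> S \<Longrightarrow> F i z \<noteq> 0) \<Longrightarrow>
      (\<And>i z. i < K \<Longrightarrow> z \<in> S \<Longrightarrow> deriv (F (Suc i)) z = g z ^ m (Suc i) * deriv g z * F i z) \<Longrightarrow>
      \<exists>V D a b. lap2 S V D a b \<and> (\<forall>z\<in>S. 0 < V z \<and> V z \<le> A * (cmod (F K z) / cmod (F 0 z)) powr (2 / K) \<and>
        c * (cmod (g z) powr \<sigma> * cmod (deriv g z))\<^sup>2
          - C * (cmod (F K z) / cmod (F 0 z)) powr (2 / K) * (cmod (deriv (F 0) z / F 0 z))\<^sup>2 \<le> b z)"
proof -
  \<comment> \<open>Large enough for the coefficients 1 + \<sigma> and \<sigma> - m i with which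
    g'/g enters the logarithmic derivatives of the ratios.\<close>
  define B where "B = 2 + \<sigma> + (\<Sum>i=1..K. real (m i))"
  have \<sigma>: "0 \<le> \<sigma>"
  proof -
    have "0 \<le> \<sigma> * real K" unfolding m[symmetric] by (intro sum_nonneg) auto
    then show ?thesis using K by (simp add: zero_le_mult_iff)
  qed
  have mB: "real (m i) \<le> (\<Sum>i=1..K. real (m i))" if "i \<in> {1..K}" for i
    using that by (intro member_le_sum) auto
  have B1: "B \<ge> 1" unfolding B_def using \<sigma> by (simp add: add_nonneg_nonneg sum_nonneg)
  show thesis
  proof (rule small_ratio_constants[OF K B1])
  fix \<kappa> \<epsilon> c0 A0 C0 :: real
  assume con: "0 < \<kappa>" "0 < \<epsilon>" "\<epsilon> \<le> 1" "0 < c0" "0 \<le> A0" "0 \<le> C0"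
    and main: "\<And>\<rho> d \<Lambda> \<Gamma> \<theta> \<mu> \<omega> q Q. (\<And>i. i \<le> K \<Longrightarrow> 0 < \<rho> i) \<Longrightarrow> (\<And>i. i \<le> K \<Longrightarrow> cmod (\<Lambda> i) * \<rho> i = \<omega>) \<Longrightarrow>
       (\<Prod>i=1..K. \<rho> i) = 1 \<Longrightarrow> 0 \<le> \<omega> \<Longrightarrow> \<Lambda> K = of_nat K * \<mu> + \<theta> \<Longrightarrow>
       (\<And>i. i < K \<Longrightarrow> 1 \<le> d i \<and> d i \<le> B) \<Longrightarrow>
       (\<And>i. i < K \<Longrightarrow> cmod (\<Gamma> i - of_real (d i) * \<Lambda> i) \<le> B * (\<Sum>l<i. cmod (\<Lambda> l)) + cmod \<theta> + cmod \<mu>) \<Longrightarrow>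
       (\<And>i. q i = 1 + (\<rho> i / \<epsilon> ^ Suc i)\<^sup>2 + (\<Sum>l<i. (\<epsilon> ^ Suc l / \<rho> l) powr (2 / \<kappa>))) \<Longrightarrow>
       (\<And>i. Q i = ((\<rho> i / \<epsilon> ^ Suc i)\<^sup>2 * (cmod (\<Gamma> i))\<^sup>2 + (\<Sum>l<i. (\<epsilon> ^ Suc l / \<rho> l) powr (2 / \<kappa>) * ((cmod (\<Gamma> l))\<^sup>2 / \<kappa>\<^sup>2))) / q i) \<Longrightarrow>
       c0 * \<omega>\<^sup>2 - C0 * (cmod \<theta>)\<^sup>2 \<le> A0 * (cmod \<mu>)\<^sup>2 +
         (\<Sum>i<K. (\<epsilon> ^ Suc i)\<^sup>2 * q i powr (- \<kappa>) * ((1 / q i - 2 * \<kappa>) * Q i - 2 * (cmod \<mu>)\<^sup>2 / \<kappa>))"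
  \<comment> \<open>\<open>A0\<close> absorbs the squared gradient of log l, and
    \<open>K / \<kappa> + 1\<close> keeps \<open>V\<close> positive, since each of the K negative
    summands is at most \<open>l^2 / \<kappa>\<close> in size.\<close>
  define A where "A = A0 + real K / \<kappa> + 1"
  have A: "0 < A" "A0 \<le> A" unfolding A_def using con by (auto simp: add_nonneg_pos)
  show thesis
  proof (rule that[of "2 * c0" A "2 * C0"])
    fix S g F
    assume S: "open S" and g: "g holomorphic_on S" and F: "\<And>i. i \<le> K \<Longrightarrow> F i holomorphic_on S"
      and gnz: "\<And>z. z \<in> S \<Longrightarrow> g z \<noteq> 0" and Fnz: "\<And>i z. i \<le> K \<Longrightarrow> z \<in> S \<Longrightarrow> F i z \<noteq> 0"
      and chain: "\<And>i z. i < K \<Longrightarrow> z \<in> S \<Longrightarrow> deriv (F (Suc i)) z = g z ^ m (Suc i) * deriv g z * F i z"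
    define G where "G z = ln (cmod (g z))" for z
    define L where "L i z = ln (cmod (F i z))" for i z
    define lg where "lg z = deriv g z / g z" for z
    define la where "la i z = deriv (F i) z / F i z" for i z
    define y where "y z = (1 / real K) * (L K z + (- 1) * L 0 z)" for z
    define \<mu> where "\<mu> z = of_real (1 / real K) * (la K z + of_real (- 1) * la 0 z)" for z
    \<comment> \<open>\<open>x i\<close> is the logarithm of \<open>\<rho> i\<close>. Index 0, with
      \<rho> 0 = |g|^(1+\<sigma>) / l, is not part of the product; it is included because g'/g
      occurs in the logarithmic derivatives of the other ratios and must be controlled
      first.\<close>
    define x where "x i z = (if i = 0 then (1 + \<sigma>) * G z + (- 1) * y z
        else ((\<sigma> - real (m i)) * G z + L i z) + ((- 1) * L (i - 1) z + (- 1) * y z))" for i z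
    define \<Gamma> where "\<Gamma> i z = (if i = 0 then of_real (1 + \<sigma>) * lg z + of_real (- 1) * \<mu> z
        else (of_real (\<sigma> - real (m i)) * lg z + la i z) + (of_real (- 1) * la (i - 1) z + of_real (- 1) * \<mu> z))" for i z
    \<comment> \<open>The common summand - y/\<kappa> makes the sum of exponentials equal to
      \<open>l powr (- 2 / \<kappa>) * q i\<close>, whose power -\<kappa> is
      \<open>l^2 * q i powr - \<kappa>\<close>.\<close>
    define X where "X i j z = (- 1 / \<kappa>) * y z + (if j < i then (- 1 / \<kappa>) * (x j z + - ln (\<epsilon> ^ Suc j)) else if j = i then x i z + - ln (\<epsilon> ^ Suc i) else 0)" for i j z
    define \<beta> where "\<beta> i j z = of_real (- 1 / \<kappa>) * \<mu> z + (if j < i then of_real (- 1 / \<kappa>) * (\<Gamma> j z + 0) else if j = i then \<Gamma> i z + 0 else 0)" for i j z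
    have hG: "\<exists>a. lap2 S G lg a (\<lambda>z. 0)"
      unfolding G_def[abs_def] lg_def[abs_def] by (rule exI, rule lap2_ln_cmod[OF g S gnz])
    have hL: "\<exists>a. lap2 S (L i) (la i) a (\<lambda>z. 0)" if "i \<le> K" for i
      unfolding L_def[abs_def] la_def[abs_def] by (rule exI, rule lap2_ln_cmod[OF F[OF that] S Fnz[OF that]])
    have hadd: "\<exists>a. lap2 S (\<lambda>z. u z + v z) (\<lambda>z. p z + q z) a (\<lambda>z. 0)"
      if u: "\<exists>a. lap2 S u p a (\<lambda>z. 0)" and v: "\<exists>a. lap2 S v q a (\<lambda>z. 0)" for u v p q
    proof -
      obtain a where 1: "lap2 S u p a (\<lambda>z. 0)" using u ..
      obtain a' where 2: "lap2 S v q a' (\<lambda>z. 0)" using v ..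
      show ?thesis by (rule exI, rule lap2_transform[OF lap2_add[OF 1 2]]) auto
    qed
    have hmul: "\<exists>a. lap2 S (\<lambda>z. r * u z) (\<lambda>z. of_real r * p z) a (\<lambda>z. 0)"
      if u: "\<exists>a. lap2 S u p a (\<lambda>z. 0)" for u p r
    proof -
      obtain a where 1: "lap2 S u p a (\<lambda>z. 0)" using u ..
      show ?thesis by (rule exI, rule lap2_transform[OF lap2_cmult[OF 1, where c=r]]) auto
    qed
    have hcon: "\<exists>a. lap2 S (\<lambda>z. r) (\<lambda>z. 0) a (\<lambda>z. 0)" for r by (rule exI, rule lap2_const[OF S])
    have hy: "\<exists>a. lap2 S y \<mu> a (\<lambda>z. 0)"
      unfolding y_def[abs_def] \<mu>_def[abs_def] by (intro hmul hadd hL) auto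
    have hx: "\<exists>a. lap2 S (x i) (\<Gamma> i) a (\<lambda>z. 0)" if "i \<le> K" for i
    proof (cases "i = 0")
      case True
      show ?thesis unfolding x_def[abs_def] \<Gamma>_def[abs_def] if_P[OF True] by (intro hadd hmul hG hy)
    next
      case False
      show ?thesis unfolding x_def[abs_def] \<Gamma>_def[abs_def] if_not_P[OF False] using that by (intro hadd hmul hG hy hL) auto
    qed
    have hX: "\<exists>a. lap2 S (X i j) (\<beta> i j) a (\<lambda>z. 0)" if "i < K" for i j
    proof -
      consider "j < i" | "j = i" | "j > i" by linarith
      then show ?thesis
      proof cases
        case 1
        have "\<exists>a. lap2 S (\<lambda>z. (- 1 / \<kappa>) * y z + (- 1 / \<kappa>) * (x j z + - ln (\<epsilon> ^ Suc j)))
           (\<lambda>z. of_real (- 1 / \<kappa>) * \<mu> z + of_real (- 1 / \<kappa>) * (\<Gamma> j z + 0)) a (\<lambda>z. 0)"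
          using that 1 by (intro hadd hmul hy hx hcon) auto
        then show ?thesis using 1 unfolding X_def[abs_def] \<beta>_def[abs_def] by (simp only: if_True)
      next
        case 2
        have "\<exists>a. lap2 S (\<lambda>z. (- 1 / \<kappa>) * y z + (x i z + - ln (\<epsilon> ^ Suc i)))
           (\<lambda>z. of_real (- 1 / \<kappa>) * \<mu> z + (\<Gamma> i z + 0)) a (\<lambda>z. 0)"
          using that 2 by (intro hadd hmul hy hx hcon) auto
        then show ?thesis using 2 unfolding X_def[abs_def] \<beta>_def[abs_def] by (simp only: if_True less_irrefl if_False simp_thms)
      next
        case 3
        have "\<exists>a. lap2 S (\<lambda>z. (- 1 / \<kappa>) * y z + 0)
           (\<lambda>z. of_real (- 1 / \<kappa>) * \<mu> z + 0) a (\<lambda>z. 0)"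
          by (intro hadd hmul hy hcon)
        moreover have "\<not> j < i" "j \<noteq> i" using 3 by auto
        ultimately show ?thesis unfolding X_def[abs_def] \<beta>_def[abs_def] by (simp only: if_False)
      qed
    qed
    \<comment> \<open>The last summand, of index \<open>Suc i\<close>, serves as the reference: its
      exponent is - y/\<kappa> alone, so the differences of gradients are free of \<mu>, and its
      weight is 1 / q i.\<close>
    define E where "E i z = (\<Sum>j<Suc (Suc i). exp (2 * X i j z))" for i z
    define bl where "bl i z = 2 * \<kappa> * E i z powr - \<kappa> *
       ((exp (2 * X i (Suc i) z) / E i z - 2 * \<kappa>) * (\<Sum>j<Suc (Suc i). exp (2 * X i j z) / E i z * (cmod (\<beta> i j z - \<beta> i (Suc i) z))\<^sup>2) - 2 * \<kappa> * (cmod (\<beta> i (Suc i) z))\<^sup>2)" for i z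
    have "\<exists>D a b. lap2 S (\<lambda>z. - (E i z powr - \<kappa>)) D a b \<and> (\<forall>z\<in>S. b z \<ge> bl i z)" if i: "i < K" for i
    proof -
      have "\<forall>j. \<exists>a. lap2 S (X i j) (\<beta> i j) a (\<lambda>z. 0)" using hX[OF i] by simp
      from choice[OF this] obtain a where "\<forall>j. lap2 S (X i j) (\<beta> i j) (a j) (\<lambda>z. 0)" ..
      then have a: "\<And>j. j < Suc (Suc i) \<Longrightarrow> lap2 S (X i j) (\<beta> i j) (a j) (\<lambda>z. 0)" by simp
      show ?thesis unfolding bl_def E_def
        by (rule lap2_neg_powr_sum_exp[OF a S _ con(1)]) auto
    qed
    then have "\<forall>i\<in>{..<K}. \<exists>t. lap2 S (\<lambda>z. - (E i z powr - \<kappa>)) (fst t) (fst (snd t)) (snd (snd t)) \<and> (\<forall>z\<in>S. snd (snd t) z \<ge> bl i z)"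
      by (simp only: split_paired_Ex fst_conv snd_conv lessThan_iff Ball_def) simp
    from bchoice[OF this] obtain t where "\<forall>i\<in>{..<K}. lap2 S (\<lambda>z. - (E i z powr - \<kappa>)) (fst (t i)) (fst (snd (t i))) (snd (snd (t i))) \<and> (\<forall>z\<in>S. snd (snd (t i)) z \<ge> bl i z)" ..
    then have hE': "\<And>i. i \<in> {..<K} \<Longrightarrow> lap2 S (\<lambda>z. - (E i z powr - \<kappa>)) (fst (t i)) (fst (snd (t i))) (snd (snd (t i)))"
       "\<And>i z. i < K \<Longrightarrow> z \<in> S \<Longrightarrow> snd (snd (t i)) z \<ge> bl i z" by simp_all
    define DE where "DE i = fst (t i)" for i
    define aE where "aE i = fst (snd (t i))" for i
    define bE where "bE i = snd (snd (t i))" for i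
    note hE = hE'[folded DE_def aE_def bE_def]
    obtain ay where hy': "lap2 S y \<mu> ay (\<lambda>z. 0)" using hy ..
    obtain ae where he: "lap2 S (\<lambda>z. exp (2 * y z)) (\<lambda>z. of_real (2 * exp (2 * y z)) * \<mu> z) ae (\<lambda>z. 2 * exp (2 * y z) * (cmod (\<mu> z))\<^sup>2 + 2 * exp (2 * y z) * 0)"
      using lap2_exp[OF hy'] ..
    define V where "V z = A * exp (2 * y z) + (\<Sum>i<K. (\<epsilon> ^ Suc i)\<^sup>2 / \<kappa> * (- (E i z powr - \<kappa>)))" for z
    define b where "b z = A * (2 * exp (2 * y z) * (cmod (\<mu> z))\<^sup>2 + 2 * exp (2 * y z) * 0) + (\<Sum>i<K. (\<epsilon> ^ Suc i)\<^sup>2 / \<kappa> * bE i z)" for z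
    have "\<exists>D a. lap2 S V D a b"
      unfolding V_def[abs_def] b_def[abs_def]
      by (rule exI, rule exI, rule lap2_add[OF lap2_cmult[OF he] lap2_sum[OF S finite_lessThan lap2_cmult[OF hE(1)]]])
    then obtain D a where hV: "lap2 S V D a b" by (elim exE)
    have pw: "0 < V z \<and> V z \<le> A * (cmod (F K z) / cmod (F 0 z)) powr (2 / K) \<and>
        2 * c0 * (cmod (g z) powr \<sigma> * cmod (deriv g z))\<^sup>2
          - 2 * C0 * (cmod (F K z) / cmod (F 0 z)) powr (2 / K) * (cmod (deriv (F 0) z / F 0 z))\<^sup>2 \<le> b z" if z: "z \<in> S" for z
    proof -
      have gp: "0 < cmod (g z)" using gnz[OF z] by simp
      have Fp: "0 < cmod (F i z)" if "i \<le> K" for i using Fnz[OF that z] by simp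
      have e2y: "exp (2 * y z) = (cmod (F K z) / cmod (F 0 z)) powr (2 / K)"
        using Fp[of K] Fp[of 0] by (simp add: powr_def y_def L_def ln_div algebra_simps)
      define \<rho> where "\<rho> i = exp (x i z)" for i
      define \<Lambda> where "\<Lambda> i = (if i = 0 then lg z else la i z)" for i
      define \<omega> where "\<omega> = cmod (g z) powr \<sigma> * cmod (deriv g z) * exp (- y z)"
      define d where "d i = (if i = (0::nat) then 1 + \<sigma> else 1)" for i
      define q where "q i = 1 + (\<rho> i / \<epsilon> ^ Suc i)\<^sup>2 + (\<Sum>l<i. (\<epsilon> ^ Suc l / \<rho> l) powr (2 / \<kappa>))" for i
      define Q where "Q i = ((\<rho> i / \<epsilon> ^ Suc i)\<^sup>2 * (cmod (\<Gamma> i z))\<^sup>2 + (\<Sum>l<i. (\<epsilon> ^ Suc l / \<rho> l) powr (2 / \<kappa>) * ((cmod (\<Gamma> l z))\<^sup>2 / \<kappa>\<^sup>2))) / q i" for i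
      define T where "T i = (\<epsilon> ^ Suc i)\<^sup>2 * q i powr (- \<kappa>) * ((1 / q i - 2 * \<kappa>) * Q i - 2 * (cmod (\<mu> z))\<^sup>2 / \<kappa>)" for i
      have \<epsilon>p: "0 < \<epsilon> ^ Suc i" "\<epsilon> ^ Suc i \<le> 1" for i using con by (auto intro: power_le_one simp del: power_Suc)
      have q1: "1 \<le> q i" for i unfolding q_def by (auto intro!: add_nonneg_nonneg sum_nonneg)
      have 1: "cmod (\<Lambda> i) * \<rho> i = \<omega>" if i: "i \<le> K" for i
      proof (cases "i = 0")
        case True
        have "\<rho> i = cmod (g z) powr (1 + \<sigma>) * exp (- y z)"
          using True gp by (simp add: \<rho>_def x_def powr_def G_def flip: exp_add)
        also have "cmod (g z) powr (1 + \<sigma>) = cmod (g z) * cmod (g z) powr \<sigma>" using gp by (simp add: powr_add)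
        finally show ?thesis using True gp by (simp add: \<Lambda>_def lg_def \<omega>_def norm_divide)
      next
        case False
        then obtain j where j: "i = Suc j" by (cases i) auto
        have "\<rho> i = cmod (g z) powr (\<sigma> - real (m i)) * cmod (F i z) / cmod (F j z) * exp (- y z)"
        proof -
          have "cmod (g z) powr (\<sigma> - real (m i)) * cmod (F i z) / cmod (F j z) * exp (- y z)
             = exp ((\<sigma> - real (m i)) * G z) * exp (L i z) * exp (- L j z) * exp (- y z)"
            using gp Fp[of i] Fp[of j] i j by (simp add: powr_def G_def L_def exp_minus divide_inverse)
          also have "\<dots> = \<rho> i" unfolding \<rho>_def x_def using False j by (simp flip: exp_add)
          finally show ?thesis by simp
        qed
        also have "cmod (g z) powr (\<sigma> - real (m i)) = cmod (g z) powr \<sigma> / cmod (g z) ^ m i"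
          using gp by (simp add: powr_diff powr_realpow)
        finally have r: "\<rho> i = cmod (g z) powr \<sigma> / cmod (g z) ^ m i * cmod (F i z) / cmod (F j z) * exp (- y z)" .
        have "cmod (\<Lambda> i) = cmod (g z) ^ m i * cmod (deriv g z) * cmod (F j z) / cmod (F i z)"
          using False chain[of j z] i j z by (simp add: \<Lambda>_def la_def norm_mult norm_divide norm_power)
        then show ?thesis unfolding r \<omega>_def using gp Fp[of i] Fp[of j] i j by (simp add: field_simps)
      qed
      \<comment> \<open>The logarithms of \<open>F i\<close> telescope to those of
        \<open>F K\<close> and \<open>F 0\<close>, which cancel against K y, and the exponents of
        |g| sum to 0.\<close>
      have 2: "(\<Prod>i=1..K. \<rho> i) = 1"
      proof -
        have "(\<Sum>i=1..K. x i z) = (\<Sum>i=1..K. ((\<sigma> - real (m i)) * G z + (L i z - L (i - 1) z)) - y z)"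
          by (rule sum.cong) (auto simp: x_def)
        also have "\<dots> = (\<Sum>i=1..K. \<sigma> - real (m i)) * G z + (\<Sum>i=1..K. L i z - L (i - 1) z) - real K * y z"
          by (simp add: sum.distrib sum_subtractf flip: sum_distrib_right)
        also have "(\<Sum>i=1..K. \<sigma> - real (m i)) = 0" using m by (simp add: sum_subtractf)
        also have "(\<Sum>i=1..K. L i z - L (i - 1) z) = L K z - L 0 z"
          using sum_telescope''[of 0 K "\<lambda>i. L i z"] by (simp add: atLeastSucAtMost_greaterThanAtMost[symmetric])
        also have "0 * G z + (L K z - L 0 z) - real K * y z = 0" using K by (simp add: y_def)
        finally show ?thesis unfolding \<rho>_def by (simp flip: exp_sum)
      qed
      have 3: "\<Lambda> K = of_nat K * \<mu> z + la 0 z"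
        using K by (simp add: \<Lambda>_def \<mu>_def)
      have 4: "1 \<le> d i \<and> d i \<le> B" if "i < K" for i
        unfolding d_def B_def using \<sigma> by (auto intro!: add_nonneg_nonneg sum_nonneg add_increasing2)
      have 5: "cmod (\<Gamma> i z - of_real (d i) * \<Lambda> i) \<le> B * (\<Sum>l<i. cmod (\<Lambda> l)) + cmod (la 0 z) + cmod (\<mu> z)" if i: "i < K" for i
      proof -
        \<comment> \<open>For i = 1 the preceding function is \<open>F 0\<close>, whose logarithmic
          derivative is \<theta> and not \<open>\<Lambda> 0\<close>, the one of \<open>g\<close>.
          From i = 2 on the preceding one is \<open>\<Lambda> (i - 1)\<close>.\<close>
        consider "i = 0" | "i = 1" | "i \<ge> 2" by linarith
        then show ?thesis
        proof cases
          case 1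
          then show ?thesis by (simp add: \<Gamma>_def d_def \<Lambda>_def)
        next
          case 2
          have "cmod (\<Gamma> i z - of_real (d i) * \<Lambda> i) = cmod (of_real (\<sigma> - real (m 1)) * lg z - la 0 z - \<mu> z)"
            using 2 by (simp add: \<Gamma>_def d_def \<Lambda>_def algebra_simps)
          also have "\<dots> \<le> cmod (of_real (\<sigma> - real (m 1)) * lg z) + cmod (la 0 z) + cmod (\<mu> z)"
            by (meson norm_triangle_ineq4 norm_triangle_le_diff order_trans add_right_mono)
          also have "cmod (of_real (\<sigma> - real (m 1)) * lg z) \<le> B * cmod (lg z)"
          proof -
            have "\<bar>\<sigma> - real (m 1)\<bar> \<le> B" unfolding B_def using \<sigma> mB[of 1] K by auto
            then show ?thesis unfolding norm_mult norm_of_real by (intro mult_right_mono) auto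
          qed
          finally show ?thesis using 2 by (simp add: \<Lambda>_def)
        next
          case 3
          then have nz: "i \<noteq> 0" "i - 1 \<noteq> 0" by auto
          have "cmod (\<Gamma> i z - of_real (d i) * \<Lambda> i) = cmod (of_real (\<sigma> - real (m i)) * \<Lambda> 0 - \<Lambda> (i - 1) - \<mu> z)"
            using nz by (simp add: \<Gamma>_def d_def \<Lambda>_def algebra_simps)
          also have "\<dots> \<le> cmod (of_real (\<sigma> - real (m i)) * \<Lambda> 0) + cmod (\<Lambda> (i - 1)) + cmod (\<mu> z)"
            by (meson norm_triangle_ineq4 norm_triangle_le_diff order_trans add_right_mono)
          also have "cmod (of_real (\<sigma> - real (m i)) * \<Lambda> 0) \<le> B * cmod (\<Lambda> 0)"
          proof -
            have "\<bar>\<sigma> - real (m i)\<bar> \<le> B" unfolding B_def using \<sigma> mB[of i] nz i by auto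
            then show ?thesis unfolding norm_mult norm_of_real by (intro mult_right_mono) auto
          qed
          also have "cmod (\<Lambda> (i - 1)) \<le> B * cmod (\<Lambda> (i - 1))" using B1 by (simp add: mult_le_cancel_right1)
          also have "B * cmod (\<Lambda> 0) + B * cmod (\<Lambda> (i - 1)) + cmod (\<mu> z) = B * (\<Sum>l\<in>{0, i - 1}. cmod (\<Lambda> l)) + cmod (\<mu> z)"
            using nz by (simp add: algebra_simps)
          also have "\<dots> \<le> B * (\<Sum>l<i. cmod (\<Lambda> l)) + cmod (\<mu> z)"
            using nz B1 by (intro add_right_mono mult_left_mono sum_mono2) auto
          finally show ?thesis by (smt (verit) norm_ge_zero)
        qed
      qed
      have key: "c0 * \<omega>\<^sup>2 - C0 * (cmod (la 0 z))\<^sup>2 \<le> A0 * (cmod (\<mu> z))\<^sup>2 + (\<Sum>i<K. T i)"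
        unfolding T_def
        by (rule main[of \<rho> \<Lambda> \<omega> "\<mu> z" "la 0 z" d "\<lambda>i. \<Gamma> i z" q Q]) (use 1 2 3 4 5 q_def Q_def in \<open>auto simp: \<rho>_def \<omega>_def\<close>)
      \<comment> \<open>This is l^(-2/\<kappa>), the factor common to all exponentials.\<close>
      define y0 where "y0 = exp (- 2 * y z / \<kappa>)"
      have y0: "0 < y0" by (simp add: y0_def)
      have eX: "exp (2 * X i j z) = y0 * (if j < i then (\<epsilon> ^ Suc j / \<rho> j) powr (2 / \<kappa>) else if j = i then (\<rho> i / \<epsilon> ^ Suc i)\<^sup>2 else 1)" for i j
      proof -
        have "exp (2 * ((- 1 / \<kappa>) * (x j z + - ln (\<epsilon> ^ Suc j)))) = (\<epsilon> ^ Suc j / \<rho> j) powr (2 / \<kappa>)"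
        proof -
          have "exp (2 * ((- 1 / \<kappa>) * (r + - ln e))) = (e / exp r) powr (2 / \<kappa>)" if "e > 0" for e r :: real
          proof -
            have "ln (e / exp r) = ln e - r" using that by (simp add: ln_div)
            moreover have "2 * ((- 1 / \<kappa>) * (r + - ln e)) = 2 / \<kappa> * (ln e - r)" by (simp add: algebra_simps diff_divide_distrib)
            ultimately show ?thesis using that by (simp add: powr_def)
          qed
          from this[OF \<epsilon>p(1)] show ?thesis unfolding \<rho>_def .
        qed
        moreover have "exp (2 * (x i z + - ln (\<epsilon> ^ Suc i))) = (\<rho> i / \<epsilon> ^ Suc i)\<^sup>2"
        proof -
          have "exp (2 * (x i z + - ln (\<epsilon> ^ Suc i))) = (exp (x i z + - ln (\<epsilon> ^ Suc i)))\<^sup>2" by (rule exp_double)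
          also have "exp (x i z + - ln (\<epsilon> ^ Suc i)) = \<rho> i / \<epsilon> ^ Suc i"
            using \<epsilon>p(1)[of i] by (simp add: \<rho>_def exp_diff del: power_Suc)
          finally show ?thesis .
        qed
        moreover have "exp (2 * X i j z) = y0 * exp (2 * (if j < i then (- 1 / \<kappa>) * (x j z + - ln (\<epsilon> ^ Suc j)) else if j = i then x i z + - ln (\<epsilon> ^ Suc i) else 0))"
          unfolding X_def y0_def distrib_left exp_add by simp
        ultimately show ?thesis by (simp split: if_splits del: power_Suc)
      qed
      have sq: "(\<Sum>j<Suc (Suc i). (if j < i then f j else if j = i then u else v)) = (\<Sum>j<i. f j) + u + v" for f :: "nat \<Rightarrow> real" and u v i
        by simp
      have Eq: "E i z = y0 * q i" for i
        unfolding E_def eX sum_distrib_left[symmetric] sq by (simp add: q_def)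
      have Ep: "E i z powr - \<kappa> = exp (2 * y z) * q i powr - \<kappa>" for i
      proof -
        have "E i z powr - \<kappa> = y0 powr - \<kappa> * q i powr - \<kappa>" unfolding Eq using y0 q1[of i] by (intro powr_mult)
        also have "y0 powr - \<kappa> = exp (2 * y z)" using con by (simp add: y0_def powr_def)
        finally show ?thesis .
      qed
      have bT: "(\<epsilon> ^ Suc i)\<^sup>2 / \<kappa> * bl i z = 2 * exp (2 * y z) * T i" for i
      proof -
        have w: "exp (2 * X i j z) / E i z = (if j < i then (\<epsilon> ^ Suc j / \<rho> j) powr (2 / \<kappa>) else if j = i then (\<rho> i / \<epsilon> ^ Suc i)\<^sup>2 else 1) / q i" for j
          unfolding eX Eq using y0 by simp
        have bd: "(cmod (\<beta> i j z - \<beta> i (Suc i) z))\<^sup>2 = (if j < i then (cmod (\<Gamma> j z))\<^sup>2 / \<kappa>\<^sup>2 else if j = i then (cmod (\<Gamma> i z))\<^sup>2 else 0)" for j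
          unfolding \<beta>_def using con by (simp add: norm_mult norm_divide power_divide)
        have b0: "(cmod (\<beta> i (Suc i) z))\<^sup>2 = (cmod (\<mu> z))\<^sup>2 / \<kappa>\<^sup>2"
          unfolding \<beta>_def using con by (simp add: norm_mult norm_divide power_divide)
        have "(\<Sum>j<Suc (Suc i). exp (2 * X i j z) / E i z * (cmod (\<beta> i j z - \<beta> i (Suc i) z))\<^sup>2)
          = (\<Sum>j<Suc (Suc i). (if j < i then (\<epsilon> ^ Suc j / \<rho> j) powr (2 / \<kappa>) * ((cmod (\<Gamma> j z))\<^sup>2 / \<kappa>\<^sup>2) / q i else if j = i then (\<rho> i / \<epsilon> ^ Suc i)\<^sup>2 * (cmod (\<Gamma> i z))\<^sup>2 / q i else 0))"
          unfolding w bd by (rule sum.cong) auto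
        also have "\<dots> = Q i" unfolding sq by (simp add: Q_def add_divide_distrib sum_divide_distrib)
        finally have SQ: "(\<Sum>j<Suc (Suc i). exp (2 * X i j z) / E i z * (cmod (\<beta> i j z - \<beta> i (Suc i) z))\<^sup>2) = Q i" .
        have w1: "exp (2 * X i (Suc i) z) / E i z = 1 / q i" unfolding w by simp
        have kk: "2 * \<kappa> * ((cmod (\<mu> z))\<^sup>2 / \<kappa>\<^sup>2) = 2 * (cmod (\<mu> z))\<^sup>2 / \<kappa>" using con by (simp add: power2_eq_square)
        show ?thesis unfolding bl_def SQ w1 Ep b0 kk T_def using con by simp
      qed
      have bge: "b z \<ge> 2 * exp (2 * y z) * (A0 * (cmod (\<mu> z))\<^sup>2 + (\<Sum>i<K. T i))"
      proof -
        have "(\<Sum>i<K. (\<epsilon> ^ Suc i)\<^sup>2 / \<kappa> * bE i z) \<ge> (\<Sum>i<K. (\<epsilon> ^ Suc i)\<^sup>2 / \<kappa> * bl i z)"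
          using hE(2) z con by (intro sum_mono mult_left_mono) auto
        moreover have "(\<Sum>i<K. (\<epsilon> ^ Suc i)\<^sup>2 / \<kappa> * bl i z) = 2 * exp (2 * y z) * (\<Sum>i<K. T i)"
          unfolding bT by (simp add: sum_distrib_left)
        moreover have "A * (2 * exp (2 * y z) * (cmod (\<mu> z))\<^sup>2) \<ge> A0 * (2 * exp (2 * y z) * (cmod (\<mu> z))\<^sup>2)"
          using A by (intro mult_right_mono) auto
        ultimately show ?thesis unfolding b_def by (simp add: algebra_simps)
      qed
      have "2 * exp (2 * y z) * (c0 * \<omega>\<^sup>2 - C0 * (cmod (la 0 z))\<^sup>2) \<le> b z"
        using bge mult_left_mono[OF key, of "2 * exp (2 * y z)"] by (meson exp_ge_zero mult_nonneg_nonneg order_trans zero_le_numeral)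
      moreover have "exp (2 * y z) * \<omega>\<^sup>2 = (cmod (g z) powr \<sigma> * cmod (deriv g z))\<^sup>2"
      proof -
        have "exp (2 * y z) * (exp (- y z))\<^sup>2 = 1" by (simp add: power2_eq_square flip: exp_add)
        then show ?thesis unfolding \<omega>_def power_mult_distrib by (simp add: mult_ac)
      qed
      ultimately have P3: "2 * c0 * (cmod (g z) powr \<sigma> * cmod (deriv g z))\<^sup>2 - 2 * C0 * exp (2 * y z) * (cmod (la 0 z))\<^sup>2 \<le> b z"
        by (simp add: algebra_simps)
      have Er: "0 \<le> E i z powr - \<kappa>" "E i z powr - \<kappa> \<le> exp (2 * y z)" for i
      proof -
        have "q i powr - \<kappa> \<le> q i powr 0" using q1[of i] con by (intro powr_mono) auto
        then show "E i z powr - \<kappa> \<le> exp (2 * y z)" using q1[of i] unfolding Ep by simp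
      qed simp
      have s1: "(\<Sum>i<K. (\<epsilon> ^ Suc i)\<^sup>2 / \<kappa> * (- (E i z powr - \<kappa>))) \<le> 0"
        using Er con by (intro sum_nonpos) (auto intro!: divide_nonneg_nonneg mult_nonneg_nonneg)
      have s2: "(\<Sum>i<K. (\<epsilon> ^ Suc i)\<^sup>2 / \<kappa> * (- (E i z powr - \<kappa>))) \<ge> (\<Sum>i<K. - (exp (2 * y z) / \<kappa>))"
      proof (rule sum_mono)
        fix i
        have "(\<epsilon> ^ Suc i)\<^sup>2 / \<kappa> * (E i z powr - \<kappa>) \<le> 1 / \<kappa> * exp (2 * y z)"
          using Er[of i] \<epsilon>p[of i] con by (intro mult_mono divide_right_mono power_le_one) (auto simp del: power_Suc)
        then show "- (exp (2 * y z) / \<kappa>) \<le> (\<epsilon> ^ Suc i)\<^sup>2 / \<kappa> * (- (E i z powr - \<kappa>))" by simp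
      qed
      have "V z \<ge> (A0 + 1) * exp (2 * y z)" using s2 unfolding V_def A_def by (simp add: algebra_simps)
      moreover have "0 < (A0 + 1) * exp (2 * y z)" using con by (intro mult_pos_pos) auto
      ultimately have "0 < V z" by linarith
      moreover have "V z \<le> A * exp (2 * y z)" using s1 unfolding V_def by linarith
      ultimately show ?thesis using P3 unfolding e2y la_def by auto
    qed
    show "\<exists>V D a b. lap2 S V D a b \<and> (\<forall>z\<in>S. 0 < V z \<and> V z \<le> A * (cmod (F K z) / cmod (F 0 z)) powr (2 / K) \<and>
        2 * c0 * (cmod (g z) powr \<sigma> * cmod (deriv g z))\<^sup>2
          - 2 * C0 * (cmod (F K z) / cmod (F 0 z)) powr (2 / K) * (cmod (deriv (F 0) z / F 0 z))\<^sup>2 \<le> b z)"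
      by (intro exI, rule conjI, rule hV, intro ballI, rule pw)
  qed (use con A in auto)
  qed
qed

text \<open>Adding \<open>l\<^sup>2 exp (2 x)\<close> with \<open>x\<close> harmonic to the potential pays for the error \<open>l\<^sup>2 \<bar>f'/f\<bar>\<^sup>2\<close> wherever the gradient of \<open>x\<close> is
  comparable to \<open>f'/f\<close>.\<close>

lemma lap2_exp_perturbed:
  assumes y: "lap2 S y \<mu> a (\<lambda>z. 0)" and x: "lap2 S x \<beta> a' (\<lambda>z. 0)"
  shows "\<exists>D p b. lap2 S (\<lambda>z. exp (2 * y z) + exp (2 * (y z + x z))) D p b \<and>
    (\<forall>z\<in>S. 0 \<le> b z \<and> (x z \<ge> 0 \<longrightarrow> exp (2 * y z) * (cmod (\<beta> z))\<^sup>2 \<le> b z))"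
proof -
  have xy: "lap2 S (\<lambda>z. y z + x z) (\<lambda>z. \<mu> z + \<beta> z) (\<lambda>z. a z + a' z) (\<lambda>z. 0)"
    by (rule lap2_transform[OF lap2_add[OF y x]]) auto
  obtain p where p: "lap2 S (\<lambda>z. exp (2 * y z)) (\<lambda>z. of_real (2 * exp (2 * y z)) * \<mu> z) p
     (\<lambda>z. 2 * exp (2 * y z) * (cmod (\<mu> z))\<^sup>2 + 2 * exp (2 * y z) * 0)" using lap2_exp[OF y] ..
  obtain q where q: "lap2 S (\<lambda>z. exp (2 * (y z + x z))) (\<lambda>z. of_real (2 * exp (2 * (y z + x z))) * (\<mu> z + \<beta> z)) q
     (\<lambda>z. 2 * exp (2 * (y z + x z)) * (cmod (\<mu> z + \<beta> z))\<^sup>2 + 2 * exp (2 * (y z + x z)) * 0)" using lap2_exp[OF xy] ..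
  have "exp (2 * y z) * (cmod (\<beta> z))\<^sup>2 \<le> 2 * exp (2 * y z) * (cmod (\<mu> z))\<^sup>2 + 2 * exp (2 * (y z + x z)) * (cmod (\<mu> z + \<beta> z))\<^sup>2" if "x z \<ge> 0" for z
  proof -
    \<comment> \<open>The gradients \<mu> of y and \<mu> + \<beta> of y + x differ by \<beta>, so
      they cannot both be small. Since x is nonnegative here, both exponentials are at least
      l^2.\<close>
    have "(cmod (\<beta> z))\<^sup>2 \<le> (cmod (\<mu> z) + cmod (\<mu> z + \<beta> z))\<^sup>2"
      using norm_triangle_ineq4[of "\<mu> z + \<beta> z" "\<mu> z"] by (intro power_mono) auto
    also have "\<dots> \<le> 2 * (cmod (\<mu> z))\<^sup>2 + 2 * (cmod (\<mu> z + \<beta> z))\<^sup>2"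
      using zero_le_power2[of "cmod (\<mu> z) - cmod (\<mu> z + \<beta> z)"] by (simp add: power2_eq_square algebra_simps)
    finally have "exp (2 * y z) * (cmod (\<beta> z))\<^sup>2 \<le> exp (2 * y z) * (2 * (cmod (\<mu> z))\<^sup>2 + 2 * (cmod (\<mu> z + \<beta> z))\<^sup>2)"
      by (rule mult_left_mono) simp
    also have "\<dots> = 2 * exp (2 * y z) * (cmod (\<mu> z))\<^sup>2 + exp (2 * y z) * (2 * (cmod (\<mu> z + \<beta> z))\<^sup>2)" by (simp add: algebra_simps)
    also have "exp (2 * y z) * (2 * (cmod (\<mu> z + \<beta> z))\<^sup>2) \<le> exp (2 * (y z + x z)) * (2 * (cmod (\<mu> z + \<beta> z))\<^sup>2)"
      using that by (intro mult_right_mono) auto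
    finally show ?thesis by (simp add: algebra_simps)
  qed
  then show ?thesis
    by (rule_tac exI, rule_tac exI, rule_tac exI, rule_tac conjI, rule_tac lap2_add[OF p q]) auto
qed

section \<open>Green's formula for the potential\<close>

text \<open>The hypothesis bounds f'/f by the gradients of the harmonic functions
  \<open>x k\<close>, so the terms l^2 + l^2 exp(2 x k), added to the potential with weight
  \<open>C * C'\<close>, cancel its error. The result is free of the error but carries the factor 1
  + sum of exp(2 x k) on the right.\<close>

lemma chain_green:
  fixes K N :: nat and m :: "nat \<Rightarrow> nat" and \<sigma> :: real
  assumes K: "K \<ge> 2" and m: "(\<Sum>i=1..K. real (m i)) = \<sigma> * real K"
  obtains C0 :: real where "0 < C0"
    "\<And>S Z g F x \<beta> a C' M v Dv av bv m1 m2 P. open S \<Longrightarrow> finite Z \<Longrightarrow> cball 0 1 \<subseteq> S \<Longrightarrow> g holomorphic_on S \<Longrightarrow>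
      (\<And>i. i \<le> K \<Longrightarrow> F i holomorphic_on S) \<Longrightarrow>
      (\<And>z. z \<in> S - Z \<Longrightarrow> g z \<noteq> 0) \<Longrightarrow> (\<And>i z. i \<le> K \<Longrightarrow> z \<in> S - Z \<Longrightarrow> F i z \<noteq> 0) \<Longrightarrow>
      (\<And>i z. i < K \<Longrightarrow> z \<in> S \<Longrightarrow> deriv (F (Suc i)) z = g z ^ m (Suc i) * deriv g z * F i z) \<Longrightarrow>
      (\<And>k. k < N \<Longrightarrow> lap2 (S - Z) (x k) (\<beta> k) (a k) (\<lambda>z. 0)) \<Longrightarrow>
      (\<And>k z. k < N \<Longrightarrow> z \<in> cball 0 1 - Z \<Longrightarrow> x k z \<ge> 0) \<Longrightarrow>
      0 \<le> C' \<Longrightarrow>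
      (\<And>z. z \<in> cball 0 1 - Z \<Longrightarrow> (cmod (deriv (F 0) z / F 0 z))\<^sup>2 \<le> C' * (\<Sum>k<N. (cmod (\<beta> k z))\<^sup>2)) \<Longrightarrow>
      (\<And>z. z \<in> S - Z \<Longrightarrow> (cmod (F K z) / cmod (F 0 z)) powr (2 / K) * (1 + (\<Sum>k<N. exp (2 * x k z))) \<le> M) \<Longrightarrow>
      lap2 S v Dv av bv \<Longrightarrow> (\<And>z. z \<in> cball 0 1 \<Longrightarrow> 0 \<le> v z) \<Longrightarrow> (\<And>z. cmod z = 1 \<Longrightarrow> v z = 0) \<Longrightarrow>
      (\<And>z. z \<in> cball 0 1 \<Longrightarrow> 2 * bv z = m1 z - m2 z) \<Longrightarrow> (\<And>z. z \<in> cball 0 1 \<Longrightarrow> 0 \<le> m1 z) \<Longrightarrow>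
      (\<And>z. z \<in> cball 0 1 \<Longrightarrow> 0 \<le> m2 z) \<Longrightarrow> continuous_on (cball 0 1) m1 \<Longrightarrow> continuous_on (cball 0 1) m2 \<Longrightarrow>
      (\<And>t. 0 \<le> P t) \<Longrightarrow> (\<And>t. - Re (cis t * Dv (cis t)) = P t) \<Longrightarrow>
      (\<integral>\<^sup>+z\<in>cball 0 1. ennreal (v z * (cmod (g z) powr \<sigma> * cmod (deriv g z))\<^sup>2) \<partial>lborel) \<le>
        (\<integral>\<^sup>+z\<in>cball 0 1. ennreal (C0 * (1 + C') * ((cmod (F K z) / cmod (F 0 z)) powr (2 / K) * (1 + (\<Sum>k<N. exp (2 * x k z)))) * m1 z) \<partial>lborel)
      + (\<integral>\<^sup>+t\<in>{0..2*pi}. ennreal (P t * (C0 * (1 + C') * ((cmod (F K (cis t)) / cmod (F 0 (cis t))) powr (2 / K) * (1 + (\<Sum>k<N. exp (2 * x k (cis t))))))) \<partial>lborel)"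
proof (rule chain_potential[OF K m])
  fix c A C :: real
  assume c: "0 < c" "0 < A" "0 \<le> C" and
    pot: "\<And>S g F. open S \<Longrightarrow> g holomorphic_on S \<Longrightarrow> (\<And>i. i \<le> K \<Longrightarrow> F i holomorphic_on S) \<Longrightarrow>
      (\<And>z. z \<in> S \<Longrightarrow> g z \<noteq> 0) \<Longrightarrow> (\<And>i z. i \<le> K \<Longrightarrow> z \<in> S \<Longrightarrow> F i z \<noteq> 0) \<Longrightarrow>
      (\<And>i z. i < K \<Longrightarrow> z \<in> S \<Longrightarrow> deriv (F (Suc i)) z = g z ^ m (Suc i) * deriv g z * F i z) \<Longrightarrow>
      \<exists>V D a b. lap2 S V D a b \<and> (\<forall>z\<in>S. 0 < V z \<and> V z \<le> A * (cmod (F K z) / cmod (F 0 z)) powr (2 / K) \<and>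
        c * (cmod (g z) powr \<sigma> * cmod (deriv g z))\<^sup>2
          - C * (cmod (F K z) / cmod (F 0 z)) powr (2 / K) * (cmod (deriv (F 0) z / F 0 z))\<^sup>2 \<le> b z)"
  define B where "B = A + C * (real N + 1)"
  have B: "0 < B" "0 \<le> B" unfolding B_def using c by (auto simp: add_pos_nonneg)
  show thesis
  proof (rule that[of "B / (2 * c)"])
    fix S Z :: "complex set" and g :: "complex \<Rightarrow> complex" and F :: "nat \<Rightarrow> complex \<Rightarrow> complex" and x :: "nat \<Rightarrow> complex \<Rightarrow> real" and \<beta> a :: "nat \<Rightarrow> complex \<Rightarrow> complex" and C' M :: real
      and v :: "complex \<Rightarrow> real" and Dv av :: "complex \<Rightarrow> complex" and bv m1 m2 :: "complex \<Rightarrow> real" and P :: "real \<Rightarrow> real"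
    assume S: "open S" "finite Z" "cball 0 1 \<subseteq> S" and g: "g holomorphic_on S" and F: "\<And>i. i \<le> K \<Longrightarrow> F i holomorphic_on S"
      and gnz: "\<And>z. z \<in> S - Z \<Longrightarrow> g z \<noteq> 0" and Fnz: "\<And>i z. i \<le> K \<Longrightarrow> z \<in> S - Z \<Longrightarrow> F i z \<noteq> 0"
      and chain: "\<And>i z. i < K \<Longrightarrow> z \<in> S \<Longrightarrow> deriv (F (Suc i)) z = g z ^ m (Suc i) * deriv g z * F i z"
      and x: "\<And>k. k < N \<Longrightarrow> lap2 (S - Z) (x k) (\<beta> k) (a k) (\<lambda>z. 0)"
      and x0: "\<And>k z. k < N \<Longrightarrow> z \<in> cball 0 1 - Z \<Longrightarrow> x k z \<ge> 0"
      and C': "0 \<le> C'" "\<And>z. z \<in> cball 0 1 - Z \<Longrightarrow> (cmod (deriv (F 0) z / F 0 z))\<^sup>2 \<le> C' * (\<Sum>k<N. (cmod (\<beta> k z))\<^sup>2)"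
      and M: "\<And>z. z \<in> S - Z \<Longrightarrow> (cmod (F K z) / cmod (F 0 z)) powr (2 / K) * (1 + (\<Sum>k<N. exp (2 * x k z))) \<le> M"
      and v: "lap2 S v Dv av bv" "\<And>z. z \<in> cball 0 1 \<Longrightarrow> 0 \<le> v z" "\<And>z. cmod z = 1 \<Longrightarrow> v z = 0"
      and mm: "\<And>z. z \<in> cball 0 1 \<Longrightarrow> 2 * bv z = m1 z - m2 z" "\<And>z. z \<in> cball 0 1 \<Longrightarrow> 0 \<le> m1 z"
         "\<And>z. z \<in> cball 0 1 \<Longrightarrow> 0 \<le> m2 z" "continuous_on (cball 0 1) m1" "continuous_on (cball 0 1) m2"
      and P: "\<And>t. 0 \<le> P t" "\<And>t. - Re (cis t * Dv (cis t)) = P t"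
    have oSZ: "open (S - Z)" using S by (simp add: finite_imp_closed open_Diff)
    define y where "y z = (1 / real K) * (ln (cmod (F K z)) + (- 1) * ln (cmod (F 0 z)))" for z
    define \<l> where "\<l> z = (cmod (F K z) / cmod (F 0 z)) powr (2 / K)" for z
    have e2y: "exp (2 * y z) = \<l> z" if "z \<in> S - Z" for z
      using Fnz[of K z] Fnz[of 0 z] that by (simp add: powr_def y_def \<l>_def ln_div algebra_simps)
    have FK: "lap2 (S - Z) (\<lambda>z. ln (cmod (F i z))) (\<lambda>z. deriv (F i) z / F i z) (deriv (\<lambda>z. deriv (F i) z / F i z)) (\<lambda>z. 0)" if "i \<le> K" for i
      by (rule lap2_ln_cmod[OF holomorphic_on_subset[OF F[OF that]] oSZ Fnz[OF that]]) auto
    have "\<exists>\<mu> p. lap2 (S - Z) y \<mu> p (\<lambda>z. 0)"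
      unfolding y_def[abs_def]
      by (rule exI, rule exI, rule lap2_transform[OF lap2_cmult[OF lap2_add[OF FK[OF order.refl] lap2_cmult[OF FK[OF le0], where c="-1"]], where c="1 / real K"]]) auto
    then obtain \<mu> p where y: "lap2 (S - Z) y \<mu> p (\<lambda>z. 0)" by (elim exE)
    have "\<forall>k\<in>{..<N}. \<exists>t. lap2 (S - Z) (\<lambda>z. exp (2 * y z) + exp (2 * (y z + x k z))) (fst t) (fst (snd t)) (snd (snd t)) \<and>
      (\<forall>z\<in>S - Z. 0 \<le> snd (snd t) z \<and> (x k z \<ge> 0 \<longrightarrow> exp (2 * y z) * (cmod (\<beta> k z))\<^sup>2 \<le> snd (snd t) z))"
      using lap2_exp_perturbed[OF y x] by (simp only: split_paired_Ex fst_conv snd_conv lessThan_iff Ball_def) simp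
    from bchoice[OF this] obtain t where "\<forall>k\<in>{..<N}. lap2 (S - Z) (\<lambda>z. exp (2 * y z) + exp (2 * (y z + x k z))) (fst (t k)) (fst (snd (t k))) (snd (snd (t k))) \<and>
      (\<forall>z\<in>S - Z. 0 \<le> snd (snd (t k)) z \<and> (x k z \<ge> 0 \<longrightarrow> exp (2 * y z) * (cmod (\<beta> k z))\<^sup>2 \<le> snd (snd (t k)) z))" ..
    then have R: "\<And>k. k \<in> {..<N} \<Longrightarrow> lap2 (S - Z) (\<lambda>z. exp (2 * y z) + exp (2 * (y z + x k z))) (fst (t k)) (fst (snd (t k))) (snd (snd (t k)))"
      "\<And>k z. k < N \<Longrightarrow> z \<in> S - Z \<Longrightarrow> 0 \<le> snd (snd (t k)) z"
      "\<And>k z. k < N \<Longrightarrow> z \<in> S - Z \<Longrightarrow> x k z \<ge> 0 \<Longrightarrow> exp (2 * y z) * (cmod (\<beta> k z))\<^sup>2 \<le> snd (snd (t k)) z" by simp_all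
    define bR where "bR z = (\<Sum>k<N. snd (snd (t k)) z)" for z
    define RR where "RR z = (\<Sum>k<N. exp (2 * y z) + exp (2 * (y z + x k z)))" for z
    have "\<exists>V D a b. lap2 (S - Z) V D a b \<and> (\<forall>z\<in>S - Z. 0 < V z \<and> V z \<le> A * (cmod (F K z) / cmod (F 0 z)) powr (2 / K) \<and>
        c * (cmod (g z) powr \<sigma> * cmod (deriv g z))\<^sup>2
          - C * (cmod (F K z) / cmod (F 0 z)) powr (2 / K) * (cmod (deriv (F 0) z / F 0 z))\<^sup>2 \<le> b z)"
      by (rule pot[OF oSZ]) (use g F gnz Fnz chain in \<open>auto intro: holomorphic_on_subset\<close>)
    then obtain V D aV b where V: "lap2 (S - Z) V D aV b" and V': "\<forall>z\<in>S - Z. 0 < V z \<and> V z \<le> A * (cmod (F K z) / cmod (F 0 z)) powr (2 / K) \<and>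
        c * (cmod (g z) powr \<sigma> * cmod (deriv g z))\<^sup>2
          - C * (cmod (F K z) / cmod (F 0 z)) powr (2 / K) * (cmod (deriv (F 0) z / F 0 z))\<^sup>2 \<le> b z"
      by (elim exE conjE)
    \<comment> \<open>Normalised so that its Laplacian, twice the last component of
      \<open>lap2\<close>, is at least the square of \<open>u\<close>.\<close>
    define U where "U z = 1 / (2 * c) * (V z + (C * C') * RR z)" for z
    have "\<exists>D p. lap2 (S - Z) U D p (\<lambda>z. 1 / (2 * c) * (b z + (C * C') * bR z))"
      unfolding U_def[abs_def] RR_def bR_def
      by (rule exI, rule exI, rule lap2_cmult[OF lap2_add[OF V lap2_cmult[OF lap2_sum[OF oSZ finite_lessThan R(1)]]]])
    then obtain DU aU where U: "lap2 (S - Z) U DU aU (\<lambda>z. 1 / (2 * c) * (b z + (C * C') * bR z))" by (elim exE)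
    define Y where "Y z = B / (2 * c) * (1 + C') * (\<l> z * (1 + (\<Sum>k<N. exp (2 * x k z))))" for z
    have Y0: "0 \<le> Y z" for z
      unfolding Y_def \<l>_def using B C' c by (intro mult_nonneg_nonneg add_nonneg_nonneg sum_nonneg) auto
    have CC: "0 \<le> C * C'" using c C' by simp
    have RR: "0 \<le> RR z" for z unfolding RR_def by (intro sum_nonneg) (auto intro: add_nonneg_nonneg)
    have UY: "U z \<le> Y z" if z: "z \<in> S - Z" for z
    proof -
      have l0: "0 \<le> \<l> z" by (simp add: \<l>_def)
      let ?s = "\<Sum>k<N. exp (2 * x k z)"
      have s0: "0 \<le> ?s" by (intro sum_nonneg) auto
      have "RR z = \<l> z * (real N + ?s)"
        unfolding RR_def distrib_left exp_add e2y[OF z] by (simp add: sum.distrib sum_distrib_left algebra_simps)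
      also have "\<dots> \<le> \<l> z * ((real N + 1) * (1 + ?s))"
        using l0 s0 by (intro mult_left_mono) (auto simp: algebra_simps)
      finally have "(C * C') * RR z \<le> (C * C') * (\<l> z * ((real N + 1) * (1 + ?s)))" using CC by (rule mult_left_mono)
      moreover have "V z \<le> A * (\<l> z * (1 + ?s))"
      proof -
        have "V z \<le> A * (\<l> z * 1)" using V' z by (auto simp: \<l>_def)
        also have "\<dots> \<le> A * (\<l> z * (1 + ?s))" using c l0 s0 by (intro mult_left_mono) auto
        finally show ?thesis .
      qed
      moreover have "A * (\<l> z * (1 + ?s)) + (C * C') * (\<l> z * ((real N + 1) * (1 + ?s))) \<le> 2 * c * Y z"
      proof -
        have "2 * c * Y z = A * (\<l> z * (1 + ?s)) + (C * C') * (\<l> z * ((real N + 1) * (1 + ?s)))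
           + (C' * A * (\<l> z * (1 + ?s)) + C * (real N + 1) * (\<l> z * (1 + ?s)))"
          
        proof -
          have "2 * c * Y z = B * (1 + C') * (\<l> z * (1 + ?s))" unfolding Y_def using c by simp
          then show ?thesis unfolding B_def by (simp add: algebra_simps)
        qed
        moreover have "0 \<le> C' * A * (\<l> z * (1 + ?s)) + C * (real N + 1) * (\<l> z * (1 + ?s))"
          using c C' l0 s0 by (intro add_nonneg_nonneg mult_nonneg_nonneg) auto
        ultimately show ?thesis by linarith
      qed
      ultimately have "V z + (C * C') * RR z \<le> 2 * c * Y z" by linarith
      then show ?thesis unfolding U_def using c by (simp add: field_simps)
    qed
    have Upos: "0 < U z" if "z \<in> S - Z" for z
    proof -
      have "0 < V z" using V' that by blast
      then have "0 < V z + (C * C') * RR z" using mult_nonneg_nonneg[OF CC RR[of z]] by linarith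
      then show ?thesis unfolding U_def using c by simp
    qed
    have main: "(\<integral>\<^sup>+z\<in>cball 0 1. ennreal (v z * ((cmod (g z) powr \<sigma> * cmod (deriv g z))\<^sup>2) + U z * m2 z) \<partial>lborel)
       \<le> (\<integral>\<^sup>+z\<in>cball 0 1. ennreal (Y z * m1 z) \<partial>lborel) + (\<integral>\<^sup>+t\<in>{0..2*pi}. ennreal (P t * Y (cis t)) \<partial>lborel)"
    proof (rule green_disc_singular[OF S U, where M = "B / (2 * c) * (1 + C') * M"])
      show "0 < U z" if "z \<in> S - Z" for z using Upos[OF that] .
      show "U z \<le> B / (2 * c) * (1 + C') * M" if "z \<in> S - Z" for z
      proof -
        have "Y z \<le> B / (2 * c) * (1 + C') * M" unfolding Y_def \<l>_def using M[OF that] B C' c by (intro mult_left_mono) auto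
        then show ?thesis using UY[OF that] by linarith
      qed
      show "U z \<le> Y z" if "z \<in> cball 0 1 - Z" for z using UY that S by auto
      show "0 \<le> (cmod (g z) powr \<sigma> * cmod (deriv g z))\<^sup>2 \<and> (cmod (g z) powr \<sigma> * cmod (deriv g z))\<^sup>2 \<le> 2 * (1 / (2 * c) * (b z + C * C' * bR z))"
        if z: "z \<in> cball 0 1 - Z" for z
      proof -
        have zS: "z \<in> S - Z" using z S by auto
        have l0: "0 \<le> \<l> z" by (simp add: \<l>_def)
        have "\<l> z * (cmod (deriv (F 0) z / F 0 z))\<^sup>2 \<le> \<l> z * (C' * (\<Sum>k<N. (cmod (\<beta> k z))\<^sup>2))"
          using C'(2)[OF z] l0 by (intro mult_left_mono) auto
        also have "\<dots> = C' * (\<Sum>k<N. exp (2 * y z) * (cmod (\<beta> k z))\<^sup>2)" unfolding e2y[OF zS] by (simp add: sum_distrib_left mult_ac)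
        also have "\<dots> \<le> C' * bR z" unfolding bR_def using C'(1) R(3)[OF _ zS x0[OF _ z]] by (intro mult_left_mono sum_mono) auto
        finally have "C * (\<l> z * (cmod (deriv (F 0) z / F 0 z))\<^sup>2) \<le> C * (C' * bR z)" using c by (intro mult_left_mono) auto
        moreover have "c * (cmod (g z) powr \<sigma> * cmod (deriv g z))\<^sup>2 - C * \<l> z * (cmod (deriv (F 0) z / F 0 z))\<^sup>2 \<le> b z"
          using V' zS unfolding \<l>_def by blast
        ultimately have "c * (cmod (g z) powr \<sigma> * cmod (deriv g z))\<^sup>2 \<le> b z + C * C' * bR z" by (simp add: mult.assoc)
        then show ?thesis using c by (simp add: field_simps)
      qed
      show "lap2 S v Dv av bv" by (rule v)
    qed (use Y0 v mm P in auto)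
    have U0: "0 \<le> U z * m2 z" if "z \<in> cball 0 1 - Z" for z
      using Upos[of z] mm(3)[of z] that S by auto
    have aeZ: "AE z in lborel. z \<notin> Z"
      by (rule AE_not_in) (simp add: S(2) finite_imp_null_set_lborel)
    have "(\<integral>\<^sup>+z\<in>cball 0 1. ennreal (v z * (cmod (g z) powr \<sigma> * cmod (deriv g z))\<^sup>2) \<partial>lborel) \<le>
      (\<integral>\<^sup>+z\<in>cball 0 1. ennreal (v z * (cmod (g z) powr \<sigma> * cmod (deriv g z))\<^sup>2 + U z * m2 z) \<partial>lborel)"
      using aeZ by (intro nn_integral_mono_AE) (auto elim!: eventually_mono simp: indicator_def U0 intro!: ennreal_leI)
    from this[THEN order_trans, OF main]
    show "(\<integral>\<^sup>+z\<in>cball 0 1. ennreal (v z * (cmod (g z) powr \<sigma> * cmod (deriv g z))\<^sup>2) \<partial>lborel) \<le>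
        (\<integral>\<^sup>+z\<in>cball 0 1. ennreal (B / (2 * c) * (1 + C') * ((cmod (F K z) / cmod (F 0 z)) powr (2 / K) * (1 + (\<Sum>k<N. exp (2 * x k z)))) * m1 z) \<partial>lborel)
      + (\<integral>\<^sup>+t\<in>{0..2*pi}. ennreal (P t * (B / (2 * c) * (1 + C') * ((cmod (F K (cis t)) / cmod (F 0 (cis t))) powr (2 / K) * (1 + (\<Sum>k<N. exp (2 * x k (cis t))))))) \<partial>lborel)"
      unfolding Y_def \<l>_def .
  qed (use B c in auto)
qed

section \<open>Iterates of the operator\<close>

lemma primitive_linepath:
  assumes h: "h holomorphic_on disc" and z: "z \<in> disc"
  shows "((\<lambda>z. contour_integral (linepath 0 z) h) has_field_derivative h z) (at z)"
proof -
  obtain H where H: "\<And>w. w \<in> disc \<Longrightarrow> (H has_field_derivative h w) (at w within disc)"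
    using holomorphic_convex_primitive'[OF convex_ball open_ball h] by auto
  have H': "(H has_field_derivative h w) (at w)" if "w \<in> disc" for w
    using H[OF that] that by (simp add: at_within_open[OF that])
  have eq: "contour_integral (linepath 0 w) h = H w - H 0" if "w \<in> disc" for w
  proof -
    have "path_image (linepath 0 w) \<subseteq> disc"
      using that by (simp add: closed_segment_subset)
    then have "(h has_contour_integral H (pathfinish (linepath 0 w)) - H (pathstart (linepath 0 w))) (linepath 0 w)"
      by (intro contour_integral_primitive[OF H]) auto
    then show ?thesis by (simp add: contour_integral_unique)
  qed
  have "((\<lambda>z. H z - H 0) has_field_derivative h z) (at z)"
    using H'[OF z] by (auto intro!: derivative_eq_intros)
  then show ?thesis
    by (rule has_field_derivative_transform_within_open[OF _ open_ball z]) (simp add: eq)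
qed

lemma Tg_properties:
  assumes g: "g holomorphic_on disc" and f: "f holomorphic_on disc"
  shows "Tg g f holomorphic_on disc" "z \<in> disc \<Longrightarrow> deriv (Tg g f) z = f z * deriv g z" "Tg g f 0 = 0"
proof -
  have h: "(\<lambda>w. f w * deriv g w) holomorphic_on disc"
    using g f by (intro holomorphic_intros) auto
  have d: "(Tg g f has_field_derivative f z * deriv g z) (at z)" if "z \<in> disc" for z
    unfolding Tg_def[abs_def] using primitive_linepath[OF h that] .
  show "Tg g f holomorphic_on disc" unfolding holomorphic_on_open[OF open_ball] using d by blast
  show "deriv (Tg g f) z = f z * deriv g z" if "z \<in> disc" using DERIV_imp_deriv[OF d[OF that]] .
  show "Tg g f 0 = 0" by (simp add: Tg_def)
qed

lemma Sg_properties: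
  assumes g: "g holomorphic_on disc" and f: "f holomorphic_on disc"
  shows "Sg g f holomorphic_on disc" "z \<in> disc \<Longrightarrow> deriv (Sg g f) z = deriv f z * g z" "Sg g f 0 = 0"
proof -
  have h: "(\<lambda>w. deriv f w * g w) holomorphic_on disc"
    using g f by (intro holomorphic_intros) auto
  have d: "(Sg g f has_field_derivative deriv f z * g z) (at z)" if "z \<in> disc" for z
    unfolding Sg_def[abs_def] using primitive_linepath[OF h that] .
  show "Sg g f holomorphic_on disc" unfolding holomorphic_on_open[OF open_ball] using d by blast
  show "deriv (Sg g f) z = deriv f z * g z" if "z \<in> disc" using DERIV_imp_deriv[OF d[OF that]] .
  show "Sg g f 0 = 0" by (simp add: Sg_def)
qed

text \<open>Each application of \<open>Sg g\<close> multiplies the derivative by \<open>g\<close>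
  and keeps the value 0 at the origin, so k applications act on the derivative as multiplication by
  g^k.\<close>

lemma Sg_power_properties:
  assumes g: "g holomorphic_on disc" and f: "f holomorphic_on disc" and f0: "f 0 = 0"
  shows "(Sg g ^^ k) f holomorphic_on disc \<and> (\<forall>z\<in>disc. deriv ((Sg g ^^ k) f) z = g z ^ k * deriv f z) \<and> (Sg g ^^ k) f 0 = 0"
proof (induction k)
  case 0 then show ?case using f f0 by simp
next
  case (Suc k)
  then show ?case using Sg_properties[OF g, of "(Sg g ^^ k) f"] by (auto simp: mult_ac)
qed

lemma holomorphic_eq_if_deriv_eq:
  assumes "F holomorphic_on disc" "G holomorphic_on disc" "F 0 = G 0"
    "\<And>z. z \<in> disc \<Longrightarrow> deriv F z = deriv G z" and z: "z \<in> disc"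
  shows "F z = G z"
proof -
  have "((\<lambda>z. F z - G z) has_field_derivative 0) (at w within disc)" if "w \<in> disc" for w
  proof -
    have "((\<lambda>z. F z - G z) has_field_derivative deriv F w - deriv G w) (at w)"
      using assms that by (auto intro!: derivative_eq_intros holomorphic_derivI[OF _ open_ball])
    then show ?thesis using assms(4)[OF that] by (simp add: has_field_derivative_at_within)
  qed
  then obtain c where "\<And>w. w \<in> disc \<Longrightarrow> F w - G w = c"
    using has_field_derivative_zero_constant[of disc "\<lambda>z. F z - G z"] by auto
  from this[of 0] this[OF z] assms(3) show ?thesis by simp
qed

text \<open>The m applications of \<open>Sg g\<close> at the end of a block are merged with the last
  \<open>Tg g\<close> of that block: together they multiply the integrand by g^m g'. Thus every step
  is a single integration and a block has n steps.\<close>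

primrec iterate_chain :: "nat \<Rightarrow> nat \<Rightarrow> (complex \<Rightarrow> complex) \<Rightarrow> (complex \<Rightarrow> complex) \<Rightarrow> nat \<Rightarrow> complex \<Rightarrow> complex" where
  "iterate_chain n m g f 0 = f"
| "iterate_chain n m g f (Suc i) = (Sg g ^^ (if n dvd Suc i then m else 0)) (Tg g (iterate_chain n m g f i))"

lemma iterate_chain_properties:
  assumes g: "g holomorphic_on disc" and f: "f holomorphic_on disc"
  shows "iterate_chain n m g f i holomorphic_on disc"
    and "z \<in> disc \<Longrightarrow> deriv (iterate_chain n m g f (Suc i)) z = g z ^ (if n dvd Suc i then m else 0) * deriv g z * iterate_chain n m g f i z"
    and "iterate_chain n m g f (Suc i) 0 = 0"
proof -
  show hol: "iterate_chain n m g f i holomorphic_on disc" for i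
  proof (induction i)
    case (Suc i)
    then show ?case using Sg_power_properties[OF g Tg_properties(1,3)[OF g Suc]] by simp
  qed (simp add: f)
  show "z \<in> disc \<Longrightarrow> deriv (iterate_chain n m g f (Suc i)) z = g z ^ (if n dvd Suc i then m else 0) * deriv g z * iterate_chain n m g f i z"
    "iterate_chain n m g f (Suc i) 0 = 0"
    using Sg_power_properties[OF g Tg_properties(1,3)[OF g hol[of i]], of "if n dvd Suc i then m else 0"] Tg_properties(2)[OF g hol[of i], of z]
    by (auto simp: mult_ac)
qed

lemma iterate_chain_power:
  assumes n: "n \<ge> 1"
  shows "iterate_chain n m g f (n * j) = ((\<lambda>f. (Sg g ^^ m) ((Tg g ^^ n) f)) ^^ j) f"
proof (induction j)
  case (Suc j)
  have *: "iterate_chain n m g f (n * j + i) = (Tg g ^^ i) (iterate_chain n m g f (n * j))" if "i < n" for i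
    using that
  proof (induction i)
    case (Suc i)
    have "\<not> n dvd Suc (n * j + i)"
    proof
      assume "n dvd Suc (n * j + i)"
      then have "n dvd Suc i" using dvd_add_right_iff[of n "n * j" "Suc i"] by simp
      then show False using Suc.prems by (auto dest: dvd_imp_le)
    qed
    then show ?case using Suc by simp
  qed simp
  have e: "n * Suc j = Suc (n * j + (n - 1))" using n by simp
  have "n dvd Suc (n * j + (n - 1))" unfolding e[symmetric] by simp
  then have "iterate_chain n m g f (n * Suc j) = (Sg g ^^ m) (Tg g (iterate_chain n m g f (n * j + (n - 1))))"
    unfolding e by simp
  also have "iterate_chain n m g f (n * j + (n - 1)) = (Tg g ^^ (n - 1)) (iterate_chain n m g f (n * j))"
    using n by (intro *) simp
  also have "Tg g ((Tg g ^^ (n - 1)) (iterate_chain n m g f (n * j))) = (Tg g ^^ n) (iterate_chain n m g f (n * j))"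
    using n by (cases n) auto
  finally show ?case using Suc by simp
qed simp

text \<open>Proved by comparing derivatives, hence only on the disc. Homogeneity in the first
  function is what lets the operator norm, a supremum over the unit ball, act on functions of
  arbitrary size.\<close>

lemma iterate_chain_scale:
  assumes g: "g holomorphic_on disc" and f: "f holomorphic_on disc"
  shows "z \<in> disc \<Longrightarrow> iterate_chain n m g (\<lambda>z. c * f z) i z = c * iterate_chain n m g f i z"
proof (induction i arbitrary: z)
  case (Suc i)
  have cf: "(\<lambda>z. c * f z) holomorphic_on disc" using f by (intro holomorphic_intros)
  note P = iterate_chain_properties[OF g f] and Q = iterate_chain_properties[OF g cf]
  show ?case
  proof (rule holomorphic_eq_if_deriv_eq[OF _ _ _ _ Suc.prems])
    show "(\<lambda>z. c * iterate_chain n m g f (Suc i) z) holomorphic_on disc" by (intro holomorphic_intros P)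
    fix w :: complex assume w: "w \<in> disc"
    have "((\<lambda>z. c * iterate_chain n m g f (Suc i) z) has_field_derivative c * deriv (iterate_chain n m g f (Suc i)) w) (at w)"
      by (intro DERIV_cmult holomorphic_derivI[OF P(1) open_ball w])
    then have "deriv (\<lambda>z. c * iterate_chain n m g f (Suc i) z) w = c * deriv (iterate_chain n m g f (Suc i)) w"
      by (rule DERIV_imp_deriv)
    then show "deriv (iterate_chain n m g (\<lambda>z. c * f z) (Suc i)) w = deriv (\<lambda>z. c * iterate_chain n m g f (Suc i) z) w"
      using P(2)[OF w, of n m i] Q(2)[OF w, of n m i] Suc.IH[OF w] by (simp add: mult_ac del: iterate_chain.simps)
  qed (simp_all only: P(3) Q(1,3), simp)
qed simp

section \<open>Homogeneity and the norms of iterates\<close>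

lemma continuous_on_cmod_powr:
  assumes "continuous_on S f" "0 < p"
  shows "continuous_on S (\<lambda>z. cmod (f z) powr p)"
  using assms by (intro continuous_on_powr' continuous_intros) auto

lemma Apnorm_pow_scale:
  assumes h: "h holomorphic_on disc" and p: "0 < p" and r: "0 < r" and k: "\<And>z. z \<in> disc \<Longrightarrow> k z = of_real r * h z"
  shows "Apnorm_pow \<alpha> p k = ennreal (r powr p) * Apnorm_pow \<alpha> p h"
proof (cases "\<alpha> = -1")
  case True
  have "(\<integral>\<^sup>+ t \<in> {0..2*pi}. ennreal (cmod (k (of_real s * cis t)) powr p) \<partial>lborel)
      = ennreal (r powr p) * (\<integral>\<^sup>+ t \<in> {0..2*pi}. ennreal (cmod (h (of_real s * cis t)) powr p) \<partial>lborel)" if s: "s \<in> {0<..<1}" for s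
  proof -
    have d: "of_real s * cis t \<in> disc" for t using s by (simp add: norm_mult)
    have c: "continuous_on {0..2*pi} (\<lambda>t. cmod (h (of_real s * cis t)) powr p)"
      using d p by (intro continuous_on_cmod_powr continuous_on_compose2[OF holomorphic_on_imp_continuous_on[OF h]] continuous_intros) auto
    have "(\<lambda>t. ennreal (indicator {0..2*pi} t *\<^sub>R (cmod (h (of_real s * cis t)) powr p))) \<in> borel_measurable lborel"
      using borel_measurable_continuous_on_indicator[OF _ c] by simp
    moreover have "ennreal (indicator {0..2*pi} t *\<^sub>R (cmod (h (of_real s * cis t)) powr p))
        = ennreal (cmod (h (of_real s * cis t)) powr p) * indicator {0..2*pi} t" for t by (simp add: indicator_def)
    ultimately have m: "(\<lambda>t. ennreal (cmod (h (of_real s * cis t)) powr p) * indicator {0..2*pi} t) \<in> borel_measurable lborel" by (simp only:)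
    have "ennreal (cmod (k (of_real s * cis t)) powr p) * indicator {0..2*pi} t
       = ennreal (r powr p) * (ennreal (cmod (h (of_real s * cis t)) powr p) * indicator {0..2*pi} t)" for t
      using r unfolding k[OF d] by (simp add: norm_mult powr_mult ennreal_mult mult.assoc)
    then show ?thesis using nn_integral_cmult[OF m, of "ennreal (r powr p)"] by simp
  qed
  then show ?thesis unfolding Apnorm_pow_def hardy_pow_def if_P[OF True] SUP_mult_left_ennreal
    by (intro SUP_cong refl) (simp only: ennreal_times_divide)
next
  case False
  have c: "continuous_on disc (\<lambda>z. cmod (h z) powr p * (1 - (cmod z)\<^sup>2) powr \<alpha>)"
  proof (intro continuous_on_mult continuous_on_cmod_powr holomorphic_on_imp_continuous_on[OF h] p)
    show "continuous_on disc (\<lambda>z. (1 - (cmod z)\<^sup>2) powr \<alpha>)"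
    proof (intro continuous_on_powr continuous_intros ballI)
      fix z :: complex assume "z \<in> disc"
      then have "(cmod z)\<^sup>2 < 1" by (simp add: abs_square_less_1)
      then show "1 - (cmod z)\<^sup>2 \<noteq> 0" by simp
    qed
  qed
  have "(\<lambda>z. ennreal (indicator disc z *\<^sub>R (cmod (h z) powr p * (1 - (cmod z)\<^sup>2) powr \<alpha>))) \<in> borel_measurable lborel"
    using borel_measurable_continuous_on_indicator[OF _ c] by simp
  moreover have "ennreal (indicator disc z *\<^sub>R (cmod (h z) powr p * (1 - (cmod z)\<^sup>2) powr \<alpha>))
      = ennreal (cmod (h z) powr p * (1 - (cmod z)\<^sup>2) powr \<alpha>) * indicator disc z" for z by (simp add: indicator_def)
  ultimately have m: "(\<lambda>z. ennreal (cmod (h z) powr p * (1 - (cmod z)\<^sup>2) powr \<alpha>) * indicator disc z) \<in> borel_measurable lborel" by (simp only:)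
  have "ennreal (cmod (k z) powr p * (1 - (cmod z)\<^sup>2) powr \<alpha>) * indicator disc z
    = ennreal (r powr p) * (ennreal (cmod (h z) powr p * (1 - (cmod z)\<^sup>2) powr \<alpha>) * indicator disc z)" for z
  proof (cases "z \<in> disc")
    case True
    then show ?thesis using r unfolding k[OF True] by (simp add: norm_mult powr_mult mult.assoc flip: ennreal_mult)
  qed simp
  then show ?thesis using nn_integral_cmult[OF m, of "ennreal (r powr p)"] False
    by (simp add: Apnorm_pow_def bergman_pow_def ennreal_times_divide mult.left_commute)
qed

lemma Apnorm_le_iff:
  assumes "0 < p" "0 \<le> r"
  shows "Apnorm \<alpha> p f \<le> ennreal r \<longleftrightarrow> Apnorm_pow \<alpha> p f \<le> ennreal (r powr p)"
proof (cases "Apnorm_pow \<alpha> p f")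
  case (real x)
  have "x powr (1 / p) \<le> r \<longleftrightarrow> x \<le> r powr p"
  proof
    assume "x powr (1 / p) \<le> r"
    then have "(x powr (1 / p)) powr p \<le> r powr p" using assms by (intro powr_mono2) auto
    then show "x \<le> r powr p" using real assms by (simp add: powr_powr split: if_splits)
  next
    assume "x \<le> r powr p"
    then have "x powr (1 / p) \<le> (r powr p) powr (1 / p)" using assms real by (intro powr_mono2) auto
    then show "x powr (1 / p) \<le> r" using assms by (simp add: powr_powr split: if_splits)
  qed
  then show ?thesis using real assms by (simp add: Apnorm_def enn_powr_def)
next
  case top
  then show ?thesis by (simp add: Apnorm_def enn_powr_def top_unique)
qed

text \<open>Each iterate is divided by its known bound, so that it lies in the unit ball, and the
  definition of the operator norm is applied. Only homogeneity enters, which is why p < 1 is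
  harmless.\<close>

lemma opnorm_iterate:
  assumes g: "g holomorphic_on disc" and n: "n \<ge> 1" and p: "0 < p" and N: "0 < N"
    and op: "opnorm \<alpha> p (\<lambda>f. (Sg g ^^ m) ((Tg g ^^ n) f)) \<le> ennreal N"
    and f: "f holomorphic_on disc" "f 0 = 0" and \<tau>: "0 < \<tau>" "Apnorm_pow \<alpha> p f \<le> ennreal (\<tau> powr p)"
  shows "Apnorm_pow \<alpha> p (iterate_chain n m g f (n * j)) \<le> ennreal ((N ^ j * \<tau>) powr p)"
proof (induction j)
  case (Suc j)
  let ?L = "\<lambda>f. (Sg g ^^ m) ((Tg g ^^ n) f)"
  define h where "h = iterate_chain n m g f (n * j)"
  define t where "t = N ^ j * \<tau>"
  have t: "0 < t" using N \<tau> by (simp add: t_def)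
  have h: "h holomorphic_on disc" "h 0 = 0"
  proof -
    show "h holomorphic_on disc" unfolding h_def by (rule iterate_chain_properties[OF g f(1)])
    show "h 0 = 0" unfolding h_def using f(2) iterate_chain_properties(3)[OF g f(1)] by (cases "n * j") auto
  qed
  have L1: "?L k = iterate_chain n m g k n" for k using iterate_chain_power[OF n, of m g k 1] by simp
  define h1 where "h1 z = of_real (1 / t) * h z" for z
  have h1: "h1 holomorphic_on disc" "h1 0 = 0"
    unfolding h1_def[abs_def] using h by (auto intro!: holomorphic_intros)
  have "Apnorm_pow \<alpha> p h1 = ennreal ((1 / t) powr p) * Apnorm_pow \<alpha> p h"
    by (rule Apnorm_pow_scale[OF h(1) p]) (use t h1_def in auto)
  also have "\<dots> \<le> ennreal ((1 / t) powr p) * ennreal (t powr p)"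
    using Suc unfolding h_def t_def by (intro mult_left_mono) auto
  also have "\<dots> = 1" using t by (simp add: powr_divide flip: ennreal_mult)
  finally have n1: "Apnorm_pow \<alpha> p h1 \<le> 1" .
  then have "Apnorm \<alpha> p h1 \<le> 1" using Apnorm_le_iff[OF p, of 1 \<alpha> h1] by simp
  moreover have "h1 \<in> Ap0 \<alpha> p" using h1 n1 unfolding Ap0_def Ap_def by (auto simp: order.strict_trans1)
  ultimately have "Apnorm \<alpha> p (?L h1) \<le> opnorm \<alpha> p ?L"
    unfolding opnorm_def by (intro SUP_upper) auto
  then have "Apnorm \<alpha> p (?L h1) \<le> ennreal N" using op by (rule order_trans)
  then have "Apnorm_pow \<alpha> p (?L h1) \<le> ennreal (N powr p)" using Apnorm_le_iff[OF p, of N] N by simp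
  moreover have "Apnorm_pow \<alpha> p (?L h) = ennreal (t powr p) * Apnorm_pow \<alpha> p (?L h1)"
  proof (rule Apnorm_pow_scale[OF _ p t])
    show "?L h1 holomorphic_on disc" unfolding L1 by (rule iterate_chain_properties[OF g h1(1)])
    fix z :: complex assume z: "z \<in> disc"
    have "iterate_chain n m g h1 n z = of_real (1 / t) * iterate_chain n m g h n z"
      unfolding h1_def by (rule iterate_chain_scale[OF g h(1) z])
    then show "?L h z = of_real t * ?L h1 z" unfolding L1 using t by simp
  qed
  moreover have "iterate_chain n m g f (n * Suc j) = ?L h"
    unfolding h_def iterate_chain_power[OF n] by simp
  ultimately have "Apnorm_pow \<alpha> p (iterate_chain n m g f (n * Suc j)) \<le> ennreal (t powr p) * ennreal (N powr p)"
    by (simp add: mult_left_mono)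
  also have "\<dots> = ennreal ((N ^ Suc j * \<tau>) powr p)"
    using t N \<tau> by (simp add: t_def powr_mult mult_ac flip: ennreal_mult)
  finally show ?case .
qed (use \<tau> in simp)

section \<open>Integrals of kernels and the submean property\<close>

text \<open>The left chord has length 2 sin(|t|/2), and the cubic Taylor bound gives sin x at least
  x/3 for x up to 2.\<close>

lemma norm_one_minus_cis_ge: "\<bar>t\<bar> \<le> pi \<Longrightarrow> \<bar>t\<bar> \<le> 3 * cmod (1 - cis t)"
proof -
  assume t: "\<bar>t\<bar> \<le> pi"
  define x where "x = \<bar>t\<bar> / 2"
  have x: "0 \<le> x" "x \<le> 2" using t pi_less_4 by (auto simp: x_def)
  have "\<bar>sin x - (\<Sum>m<3. sin_coeff m * x ^ m)\<bar> \<le> inverse (fact 3) * \<bar>x\<bar> ^ 3" by (rule Maclaurin_sin_bound)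
  then have "\<bar>sin x - x\<bar> \<le> x ^ 3 / 6" using x by (simp add: sin_coeff_def eval_nat_numeral)
  moreover have "x ^ 3 / 6 \<le> x * (2 / 3)"
  proof -
    have "x\<^sup>2 \<le> 2\<^sup>2" using x by (intro power_mono) auto
    then have "x * x\<^sup>2 \<le> x * 4" using x by (intro mult_left_mono) auto
    then show ?thesis by (simp add: power3_eq_cube power2_eq_square)
  qed
  ultimately have s: "x / 3 \<le> sin x" by linarith
  have "(cmod (1 - cis t))\<^sup>2 = (1 - cos t)\<^sup>2 + (sin t)\<^sup>2" by (simp add: cmod_power2)
  also have "\<dots> = 2 - 2 * cos t" using sin_cos_squared_add[of t] by (simp add: power2_eq_square algebra_simps)
  also have "cos t = cos (2 * x)" by (simp add: x_def)
  also have "2 - 2 * cos (2 * x) = (2 * sin x)\<^sup>2" by (simp add: cos_double_sin power_mult_distrib)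
  finally have "cmod (1 - cis t) = 2 * sin x" using s x by (metis abs_norm_cancel abs_of_nonneg divide_nonneg_nonneg mult_nonneg_nonneg order_trans power2_eq_iff_nonneg zero_le_numeral norm_ge_zero)
  then show ?thesis using s by (simp add: x_def)
qed

lemma nn_integral_abs_powr:
  fixes b \<rho> :: real
  assumes b: "b > 1" and r: "\<rho> > 0"
  shows "(\<integral>\<^sup>+x. ennreal ((\<rho> + \<bar>x - \<tau>\<bar>) powr (- b)) \<partial>lborel) \<le> ennreal (2 * \<rho> powr (1 - b) / (b - 1))"
proof -
  define h where "h x = ennreal ((\<rho> + \<bar>x\<bar>) powr (- b))" for x
  have mh: "h \<in> borel_measurable borel" unfolding h_def[abs_def] by measurable
  have half: "(\<integral>\<^sup>+x. h x * indicator {0..} x \<partial>lborel) = ennreal (\<rho> powr (1 - b) / (b - 1))"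
  proof -
    have "(\<integral>\<^sup>+x. ennreal ((\<rho> + x) powr (- b)) * indicator {0..} x \<partial>lborel) = ennreal (0 - (- ((\<rho> + 0) powr (1 - b) / (b - 1))))"
    proof (rule nn_integral_FTC_atLeast)
      show "(\<lambda>x. (\<rho> + x) powr (- b)) \<in> borel_measurable borel" by measurable
      fix x :: real assume x: "0 \<le> x"
      have "((\<lambda>x. - ((\<rho> + x) powr (1 - b) / (b - 1))) has_real_derivative - ((1 - b) * (\<rho> + x) powr (1 - b - 1) / (b - 1))) (at x)"
        using x r b by (auto intro!: derivative_eq_intros)
      moreover have "- ((1 - b) * (\<rho> + x) powr (1 - b - 1) / (b - 1)) = (\<rho> + x) powr (- b)"
        using b by (simp add: field_simps)
      ultimately show "((\<lambda>x. - ((\<rho> + x) powr (1 - b) / (b - 1))) has_real_derivative (\<rho> + x) powr (- b)) (at x)" by simp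
    next
      have "((\<lambda>x. (\<rho> + x) powr (1 - b)) \<longlongrightarrow> 0) at_top"
        using b by (intro tendsto_neg_powr) (auto intro!: filterlim_tendsto_add_at_top[OF tendsto_const] filterlim_ident)
      then have "((\<lambda>x. - ((\<rho> + x) powr (1 - b) / (b - 1))) \<longlongrightarrow> - (0 / (b - 1))) at_top"
        using b by (intro tendsto_intros) auto
      then show "((\<lambda>x. - ((\<rho> + x) powr (1 - b) / (b - 1))) \<longlongrightarrow> 0) at_top" by simp
    qed auto
    moreover have "h x * indicator {0..} x = ennreal ((\<rho> + x) powr (- b)) * indicator {0..} x" for x
      by (simp add: h_def indicator_def)
    ultimately show ?thesis by simp
  qed
  have other: "(\<integral>\<^sup>+x. h x * indicator {..0} x \<partial>lborel) = ennreal (\<rho> powr (1 - b) / (b - 1))"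
  proof -
    have "(\<integral>\<^sup>+x. h x * indicator {..0} x \<partial>lborel) = ennreal \<bar>-1\<bar> * (\<integral>\<^sup>+x. h (0 + (-1) * x) * indicator {..0} (0 + (-1) * x) \<partial>lborel)"
      using mh by (intro nn_integral_real_affine) auto
    also have "\<dots> = (\<integral>\<^sup>+x. h x * indicator {0..} x \<partial>lborel)"
      by (simp add: h_def indicator_def)
    finally show ?thesis using half by simp
  qed
  have "(\<integral>\<^sup>+x. h (x - \<tau>) \<partial>lborel) = ennreal \<bar>1\<bar> * (\<integral>\<^sup>+x. h (\<tau> + 1 * x - \<tau>) \<partial>lborel)"
    using mh by (intro nn_integral_real_affine) auto
  also have "\<dots> = (\<integral>\<^sup>+x. h x \<partial>lborel)" by simp
  also have "\<dots> \<le> (\<integral>\<^sup>+x. h x * indicator {0..} x + h x * indicator {..0} x \<partial>lborel)"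
    by (intro nn_integral_mono) (auto simp: indicator_def)
  also have "\<dots> = ennreal (\<rho> powr (1 - b) / (b - 1)) + ennreal (\<rho> powr (1 - b) / (b - 1))"
    using mh half other by (subst nn_integral_add) auto
  also have "\<dots> = ennreal (2 * \<rho> powr (1 - b) / (b - 1))" using b by (simp flip: ennreal_plus)
  finally show ?thesis by (simp add: h_def)
qed

text \<open>The kernel is controlled by 1 - |w| plus the angular distance from t to the argument of
  w. That argument lies in ]-pi, pi] and t in [0, 2 pi], so the nearest copy of it is \<theta> or
  \<theta> + 2 pi, and two integrals over the line suffice.\<close>

lemma circle_kernel_integral:
  assumes b: "b > 1"
  obtains C :: real where "0 < C" "\<And>w. cmod w < 1 \<Longrightarrow>
     (\<integral>\<^sup>+t\<in>{0..2*pi}. ennreal (cmod (1 - cnj w * cis t) powr (- b)) \<partial>lborel) \<le> ennreal (C * (1 - cmod w) powr (1 - b))"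
proof (rule that)
  define C where "C = 7 powr b * (4 / (b - 1))"
  show "0 < C" using b by (simp add: C_def)
  fix w :: complex assume w: "cmod w < 1"
  define \<rho> where "\<rho> = cmod w"
  define \<theta> where "\<theta> = Arg w"
  have \<rho>: "0 \<le> \<rho>" "\<rho> < 1" using w by (auto simp: \<rho>_def)
  have wr: "cnj w * cis t = of_real \<rho> * cis (t - \<theta>)" for t
  proof -
    have "w = of_real \<rho> * cis \<theta>"
      using rcis_cmod_Arg[of w] by (simp add: rcis_def \<rho>_def \<theta>_def)
    then have "cnj w = of_real \<rho> * cis (- \<theta>)" by (metis cis_cnj complex_cnj_complex_of_real complex_cnj_mult)
    then show ?thesis by (simp add: cis_mult algebra_simps)
  qed
  \<comment> \<open>The distance to the circle accounts for one unit of the 7. The angle accounts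
    for six, being at most 3 times |1 - cis \<psi>|, which in turn is at most twice the kernel's
    modulus.\<close>
  have low: "(1 - \<rho>) + \<bar>\<psi>\<bar> \<le> 7 * cmod (1 - of_real \<rho> * cis \<psi>)" if "\<bar>\<psi>\<bar> \<le> pi" for \<psi>
  proof -
    have 1: "1 - \<rho> \<le> cmod (1 - of_real \<rho> * cis \<psi>)"
      using norm_triangle_ineq2[of 1 "of_real \<rho> * cis \<psi>"] \<rho> by (simp add: norm_mult)
    have "cmod (1 - cis \<psi>) \<le> cmod (1 - of_real \<rho> * cis \<psi>) + cmod (of_real (\<rho> - 1) * cis \<psi>)"
      using norm_triangle_ineq[of "1 - of_real \<rho> * cis \<psi>" "of_real (\<rho> - 1) * cis \<psi>"] by (simp add: algebra_simps)
    also have "cmod (of_real (\<rho> - 1) * cis \<psi>) = 1 - \<rho>" using \<rho> unfolding norm_mult norm_of_real by simp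
    finally show ?thesis using 1 norm_one_minus_cis_ge[OF that] by linarith
  qed
  have pw: "cmod (1 - cnj w * cis t) powr (- b) \<le> 7 powr b * (((1 - \<rho>) + \<bar>t - \<theta>\<bar>) powr (- b) + ((1 - \<rho>) + \<bar>t - (\<theta> + 2*pi)\<bar>) powr (- b))"
    if t: "t \<in> {0..2*pi}" for t
  proof -
    have bound: "cmod (1 - of_real \<rho> * cis \<psi>) powr (- b) \<le> 7 powr b * ((1 - \<rho>) + \<bar>\<psi>\<bar>) powr (- b)" if "\<bar>\<psi>\<bar> \<le> pi" for \<psi>
    proof -
      have "cmod (1 - of_real \<rho> * cis \<psi>) powr (- b) \<le> (((1 - \<rho>) + \<bar>\<psi>\<bar>) / 7) powr (- b)"
        using low[OF that] \<rho> b by (intro powr_mono2') auto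
      also have "\<dots> = 7 powr b * ((1 - \<rho>) + \<bar>\<psi>\<bar>) powr (- b)" using \<rho> by (simp add: powr_divide powr_minus field_simps)
      finally show ?thesis .
    qed
    have \<theta>: "- pi < \<theta>" "\<theta> \<le> pi" unfolding \<theta>_def using Arg_bounded[of w] by auto
    show ?thesis
    proof (cases "t - \<theta> \<le> pi")
      case True
      then have "cmod (1 - cnj w * cis t) powr (- b) \<le> 7 powr b * ((1 - \<rho>) + \<bar>t - \<theta>\<bar>) powr (- b)"
        unfolding wr using t \<theta> by (intro bound) auto
      then show ?thesis by (simp add: distrib_left add_increasing2)
    next
      case False
      have "cis (t - \<theta>) = cis (t - (\<theta> + 2*pi))" by (simp add: complex_eq_iff sin_diff cos_diff sin_add cos_add)
      then have "cmod (1 - cnj w * cis t) powr (- b) \<le> 7 powr b * ((1 - \<rho>) + \<bar>t - (\<theta> + 2*pi)\<bar>) powr (- b)"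
        unfolding wr using t \<theta> False by (simp only:) (intro bound, auto)
      then show ?thesis by (simp add: distrib_left add_increasing)
    qed
  qed
  define I where "I \<tau> x = ennreal (((1 - \<rho>) + \<bar>x - \<tau>\<bar>) powr (- b))" for \<tau> x
  have mI: "I \<tau> \<in> borel_measurable lborel" for \<tau> unfolding I_def[abs_def] by measurable
  have "(\<integral>\<^sup>+t\<in>{0..2*pi}. ennreal (cmod (1 - cnj w * cis t) powr (- b)) \<partial>lborel)
     \<le> (\<integral>\<^sup>+t. ennreal (7 powr b) * (I \<theta> t + I (\<theta> + 2*pi) t) \<partial>lborel)"
  proof (intro nn_integral_mono)
    fix t
    show "ennreal (cmod (1 - cnj w * cis t) powr (- b)) * indicator {0..2*pi} t \<le> ennreal (7 powr b) * (I \<theta> t + I (\<theta> + 2*pi) t)"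
    proof (cases "t \<in> {0..2*pi}")
      case True
      then show ?thesis using pw[OF True] by (simp add: I_def ennreal_leI flip: ennreal_mult ennreal_plus)
    qed simp
  qed
  also have "\<dots> = ennreal (7 powr b) * ((\<integral>\<^sup>+t. I \<theta> t \<partial>lborel) + (\<integral>\<^sup>+t. I (\<theta> + 2*pi) t \<partial>lborel))"
    using mI by (subst nn_integral_cmult) (auto simp: nn_integral_add)
  also have "\<dots> \<le> ennreal (7 powr b) * (ennreal (2 * (1 - \<rho>) powr (1 - b) / (b - 1)) + ennreal (2 * (1 - \<rho>) powr (1 - b) / (b - 1)))"
    unfolding I_def using \<rho> by (intro mult_left_mono add_mono nn_integral_abs_powr b) auto
  also have "\<dots> = ennreal (C * (1 - cmod w) powr (1 - b))"
    using b by (simp add: C_def \<rho>_def flip: ennreal_mult ennreal_plus)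
  finally show "(\<integral>\<^sup>+t\<in>{0..2*pi}. ennreal (cmod (1 - cnj w * cis t) powr (- b)) \<partial>lborel) \<le> ennreal (C * (1 - cmod w) powr (1 - b))" .
qed

section \<open>The Moebius kernel, area integrals and the submean property\<close>

lemma lap2_cmod_holomorphic_square:
  assumes h: "h holomorphic_on S" and S: "open S"
  shows "lap2 S (\<lambda>z. (cmod (h z))\<^sup>2) (\<lambda>z. 2 * cnj (h z) * deriv h z) (\<lambda>z. 2 * cnj (h z) * deriv (deriv h) z) (\<lambda>z. 2 * (cmod (deriv h z))\<^sup>2)"
proof -
  have h': "deriv h holomorphic_on S" and h'': "deriv (deriv h) holomorphic_on S"
    using h S by (auto intro!: holomorphic_deriv)
  have 1: "((\<lambda>z. (cmod (h z))\<^sup>2) has_derivative (\<lambda>e. Re (e * (2 * cnj (h z) * deriv h z)))) (at z)" if "z \<in> S" for z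
  proof -
    have d: "(h has_derivative (\<lambda>e. deriv h z * e)) (at z)"
      using holomorphic_derivI[OF h S that] by (simp add: has_field_derivative_def)
    have "((\<lambda>z. h z \<bullet> h z) has_derivative (\<lambda>e. h z \<bullet> (deriv h z * e) + (deriv h z * e) \<bullet> h z)) (at z)"
      by (rule derivative_eq_intros d refl)+
    then show ?thesis unfolding power2_norm_eq_inner
      by (rule has_derivative_eq_rhs) (auto simp: fun_eq_iff inner_complex_def algebra_simps)
  qed
  have 2: "((\<lambda>z. 2 * cnj (h z) * deriv h z) has_derivative (\<lambda>e. 2 * cnj (h z) * deriv (deriv h) z * e + of_real (2 * (cmod (deriv h z))\<^sup>2) * cnj e)) (at z)" if "z \<in> S" for z
  proof -
    have d: "(h has_derivative (\<lambda>e. deriv h z * e)) (at z)"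
      using holomorphic_derivI[OF h S that] by (simp add: has_field_derivative_def)
    have d': "(deriv h has_derivative (\<lambda>e. deriv (deriv h) z * e)) (at z)"
      using holomorphic_derivI[OF h' S that] by (simp add: has_field_derivative_def)
    have c: "((\<lambda>z. cnj (h z)) has_derivative (\<lambda>e. cnj (deriv h z * e))) (at z)"
      by (rule has_derivative_cnj[OF d])
    have "((\<lambda>z. 2 * (cnj (h z) * deriv h z)) has_derivative (\<lambda>e. 2 * (cnj (h z) * (deriv (deriv h) z * e) + cnj (deriv h z * e) * deriv h z))) (at z)"
      by (intro has_derivative_mult_right has_derivative_mult c d')
    then have "((\<lambda>z. 2 * cnj (h z) * deriv h z) has_derivative (\<lambda>e. 2 * (cnj (h z) * (deriv (deriv h) z * e) + cnj (deriv h z * e) * deriv h z))) (at z)"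
      by (simp add: mult.assoc)
    moreover have "2 * (cnj (h z) * (deriv (deriv h) z * e) + cnj (deriv h z * e) * deriv h z)
        = 2 * cnj (h z) * deriv (deriv h) z * e + of_real (2 * (cmod (deriv h z))\<^sup>2) * cnj e" for e
    proof -
      have 1: "complex_of_real (2 * (cmod (deriv h z))\<^sup>2) = 2 * (deriv h z * cnj (deriv h z))" unfolding of_real_mult complex_norm_square by simp
      show ?thesis unfolding 1 by (simp add: algebra_simps)
    qed
    ultimately show ?thesis by (simp only:)
  qed
  note c = h[THEN holomorphic_on_imp_continuous_on] h'[THEN holomorphic_on_imp_continuous_on] h''[THEN holomorphic_on_imp_continuous_on]
  show ?thesis unfolding lap2_def
    using S 1 2 by (auto intro!: continuous_intros c)
qed

text \<open>1 - |phi_a|^2 vanishes on the circle, its Laplacian is -4 |phi_a'|^2, and its inward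
  normal derivative is twice the Poisson kernel of \<open>a\<close>. The domain is taken larger than
  the disc because Green's formula needs a neighbourhood of the closed disc.\<close>

lemma mobius_kernel:
  assumes a: "cmod a < 1"
  defines "S \<equiv> {z. cmod (cnj a * z) < 1}"
  obtains D p where "open S" "cball 0 1 \<subseteq> S"
    "lap2 S (\<lambda>z. 1 - (cmod (phi a z))\<^sup>2) D p (\<lambda>z. - 2 * ((1 - (cmod a)\<^sup>2) / (cmod (1 - cnj a * z))\<^sup>2)\<^sup>2)"
    "\<And>t. - Re (cis t * D (cis t)) = 2 * (1 - (cmod a)\<^sup>2) / (cmod (1 - cnj a * cis t))\<^sup>2"
    "\<And>z. z \<in> cball 0 1 \<Longrightarrow> 0 \<le> 1 - (cmod (phi a z))\<^sup>2" "\<And>z. cmod z = 1 \<Longrightarrow> 1 - (cmod (phi a z))\<^sup>2 = 0"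
proof
  show S: "open S" unfolding S_def by (intro open_Collect_less continuous_intros)
  show cb: "cball 0 1 \<subseteq> S"
  proof
    fix z :: complex assume "z \<in> cball 0 1"
    then have "cmod a * cmod z \<le> cmod a * 1" by (intro mult_left_mono) auto
    then show "z \<in> S" using a by (simp add: S_def norm_mult)
  qed
  have nz: "1 - cnj a * z \<noteq> 0" if "z \<in> S" for z
    using that unfolding S_def by auto
  have a2: "0 \<le> 1 - (cmod a)\<^sup>2" using a by (simp add: abs_square_le_1)
  have hol: "phi a holomorphic_on S"
    unfolding phi_def[abs_def] using nz by (intro holomorphic_intros) auto
  have der: "deriv (phi a) z = - of_real (1 - (cmod a)\<^sup>2) / (1 - cnj a * z)\<^sup>2" if "z \<in> S" for z
  proof -
    have "(phi a has_field_derivative ((-1) * (1 - cnj a * z) - (a - z) * (- cnj a)) / ((1 - cnj a * z) * (1 - cnj a * z))) (at z)"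
      unfolding phi_def[abs_def] using nz[OF that] by (auto intro!: derivative_eq_intros)
    then have "deriv (phi a) z = ((-1) * (1 - cnj a * z) - (a - z) * (- cnj a)) / ((1 - cnj a * z) * (1 - cnj a * z))"
      by (rule DERIV_imp_deriv)
    also have "(-1) * (1 - cnj a * z) - (a - z) * (- cnj a) = - of_real (1 - (cmod a)\<^sup>2)"
    proof -
      have 1: "complex_of_real (1 - (cmod a)\<^sup>2) = 1 - a * cnj a" unfolding of_real_diff complex_norm_square by simp
      show ?thesis unfolding 1 by (simp add: algebra_simps)
    qed
    finally show ?thesis by (simp add: power2_eq_square)
  qed
  let ?D = "\<lambda>z. of_real (-1) * (2 * cnj (phi a z) * deriv (phi a) z)"
  let ?p = "\<lambda>z. of_real (-1) * (2 * cnj (phi a z) * deriv (deriv (phi a)) z)"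
  show "lap2 S (\<lambda>z. 1 - (cmod (phi a z))\<^sup>2) ?D ?p (\<lambda>z. - 2 * ((1 - (cmod a)\<^sup>2) / (cmod (1 - cnj a * z))\<^sup>2)\<^sup>2)"
  proof (rule lap2_transform[OF lap2_add[OF lap2_const[OF S, of 1] lap2_cmult[OF lap2_cmod_holomorphic_square[OF hol S], where c="-1"]]])
    fix z assume z: "z \<in> S"
    have "cmod (deriv (phi a) z) = (1 - (cmod a)\<^sup>2) / (cmod (1 - cnj a * z))\<^sup>2"
      unfolding der[OF z] using a by (simp add: norm_divide norm_power norm_minus_cancel del: of_real_diff of_real_power) (use a2 in \<open>simp add: abs_if\<close>)
    then show "- 2 * ((1 - (cmod a)\<^sup>2) / (cmod (1 - cnj a * z))\<^sup>2)\<^sup>2 = 0 + - 1 * (2 * (cmod (deriv (phi a) z))\<^sup>2)" by simp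
  qed auto
  have num: "(cmod (1 - cnj a * z))\<^sup>2 - (cmod (a - z))\<^sup>2 = (1 - (cmod a)\<^sup>2) * (1 - (cmod z)\<^sup>2)" for z
  proof -
    have "complex_of_real ((cmod (1 - cnj a * z))\<^sup>2 - (cmod (a - z))\<^sup>2) = of_real ((1 - (cmod a)\<^sup>2) * (1 - (cmod z)\<^sup>2))"
      unfolding of_real_diff of_real_mult of_real_1 complex_norm_square by (simp add: algebra_simps)
    then show ?thesis by (simp only: of_real_eq_iff)
  qed
  have v: "1 - (cmod (phi a z))\<^sup>2 = (1 - (cmod a)\<^sup>2) * (1 - (cmod z)\<^sup>2) / (cmod (1 - cnj a * z))\<^sup>2" if "z \<in> S" for z
  proof -
    have "cmod (1 - cnj a * z) \<noteq> 0" using nz[OF that] by simp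
    moreover have "(cmod (phi a z))\<^sup>2 = (cmod (a - z))\<^sup>2 / (cmod (1 - cnj a * z))\<^sup>2"
      by (simp only: phi_def norm_divide power_divide)
    ultimately have "1 - (cmod (phi a z))\<^sup>2 = ((cmod (1 - cnj a * z))\<^sup>2 - (cmod (a - z))\<^sup>2) / (cmod (1 - cnj a * z))\<^sup>2"
      by (simp add: diff_divide_distrib)
    then show ?thesis unfolding num .
  qed
  show "0 \<le> 1 - (cmod (phi a z))\<^sup>2" if "z \<in> cball 0 1" for z
  proof -
    have "(cmod z)\<^sup>2 \<le> 1" using that by (simp add: abs_square_le_1)
    moreover have "z \<in> S" using that cb by blast
    ultimately show ?thesis using a2 by (simp only: v) (intro divide_nonneg_nonneg mult_nonneg_nonneg, auto)
  qed
  show "1 - (cmod (phi a z))\<^sup>2 = 0" if "cmod z = 1" for z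
    using v[of z] subsetD[OF cb, of z] that by simp
  show "- Re (cis t * ?D (cis t)) = 2 * (1 - (cmod a)\<^sup>2) / (cmod (1 - cnj a * cis t))\<^sup>2" for t
  proof -
    let ?z = "cis t"
    have zS: "?z \<in> S" using cb by auto
    let ?q = "1 - cnj a * ?z"
    have q: "?q \<noteq> 0" using nz[OF zS] .
    have zz: "?z * cnj ?z = 1" by (simp add: cis_cnj cis_mult)
    have "cnj (a - ?z) * ?z = - ?q" using zz by (simp add: algebra_simps)
    then have c: "?z * cnj (phi a ?z) = - ?q / cnj ?q" by (simp add: phi_def mult.commute)
    have "?z * (cnj (phi a ?z) * deriv (phi a) ?z) = (- ?q / cnj ?q) * (- of_real (1 - (cmod a)\<^sup>2) / ?q\<^sup>2)"
      unfolding der[OF zS] c[symmetric] by simp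
    also have "\<dots> = of_real (1 - (cmod a)\<^sup>2) / (?q * cnj ?q)"
    proof -
      have "(- x / y) * (- k / x\<^sup>2) = k / (x * y)" if "x \<noteq> 0" for x y k :: complex
        using that by (simp add: power2_eq_square)
      then show ?thesis using q by blast
    qed
    also have "?q * cnj ?q = of_real ((cmod ?q)\<^sup>2)" by (rule complex_norm_square[symmetric])
    finally have "?z * (cnj (phi a ?z) * deriv (phi a) ?z) = of_real ((1 - (cmod a)\<^sup>2) / (cmod ?q)\<^sup>2)" by simp
    then have "of_real (- 2) * (?z * (cnj (phi a ?z) * deriv (phi a) ?z)) = of_real (- 2 * ((1 - (cmod a)\<^sup>2) / (cmod ?q)\<^sup>2))"
      by (simp only: of_real_mult)
    moreover have "?z * ?D ?z = of_real (- 2) * (?z * (cnj (phi a ?z) * deriv (phi a) ?z))" by simp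
    ultimately have "?z * ?D ?z = of_real (- 2 * ((1 - (cmod a)\<^sup>2) / (cmod ?q)\<^sup>2))" by (simp only:)
    then have "Re (?z * ?D ?z) = - 2 * ((1 - (cmod a)\<^sup>2) / (cmod ?q)\<^sup>2)" by (simp only: Re_complex_of_real)
    then show ?thesis by (simp only: minus_mult_left[symmetric] minus_minus times_divide_eq_right)
  qed
qed

lemma cball_nn_integral_cmult:
  fixes h :: "complex \<Rightarrow> real"
  assumes h: "continuous_on (cball 0 1) h" and c: "0 \<le> c"
  shows "(\<integral>\<^sup>+z\<in>cball 0 1. ennreal (c * h z) \<partial>lborel) = ennreal c * (\<integral>\<^sup>+z\<in>cball 0 1. ennreal (h z) \<partial>lborel)"
proof -
  have "(\<lambda>z. ennreal (indicator (cball 0 1) z * h z)) \<in> borel_measurable lborel"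
    using disc_integral_chords(3)[OF h] by simp
  moreover have "ennreal (indicator (cball 0 1) z * h z) = ennreal (h z) * indicator (cball 0 1) z" for z
    by (simp add: indicator_def)
  ultimately have m: "(\<lambda>z. ennreal (h z) * indicator (cball 0 1) z) \<in> borel_measurable lborel" by (simp only:)
  show ?thesis using c by (subst nn_integral_cmult[OF m, symmetric]) (simp add: ennreal_mult' mult.assoc)
qed

lemma one_minus_cnj_mult:
  assumes "cmod a < 1" "z \<in> cball 0 1"
  shows "1 - cmod a \<le> cmod (1 - cnj a * z)" "1 - cmod z \<le> cmod (1 - cnj a * z)" "cmod (1 - cnj a * z) \<le> 2"
    "0 < cmod (1 - cnj a * z)"
proof -
  have z: "cmod z \<le> 1" using assms by simp
  have p: "cmod (cnj a * z) \<le> cmod a" "cmod (cnj a * z) \<le> cmod z"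
    using assms z by (auto simp: norm_mult mult_left_le mult_left_le_one_le)
  have "1 - cmod (cnj a * z) \<le> cmod (1 - cnj a * z)" using norm_triangle_ineq2[of 1 "cnj a * z"] by simp
  then show "1 - cmod a \<le> cmod (1 - cnj a * z)" "1 - cmod z \<le> cmod (1 - cnj a * z)" using p by linarith+
  then show "0 < cmod (1 - cnj a * z)" using assms(1) by linarith
  show "cmod (1 - cnj a * z) \<le> 2" using norm_triangle_ineq4[of 1 "cnj a * z"] p assms by simp
qed

lemma continuous_on_kernel_powr:
  assumes "cmod a < 1"
  shows "continuous_on (cball 0 1) (\<lambda>z. cmod (1 - cnj a * z) powr b)"
  using one_minus_cnj_mult(4)[OF assms] by (intro continuous_intros) force

text \<open>Green's formula for the constant 1 against the Moebius kernel turns the area integral of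
  the power -4 into the circle integral of the power -2.\<close>

lemma disc_kernel_integral:
  obtains C :: real where "0 < C" "\<And>a. cmod a < 1 \<Longrightarrow>
    (\<integral>\<^sup>+z\<in>cball 0 1. ennreal (cmod (1 - cnj a * z) powr (- 4)) \<partial>lborel) \<le> ennreal (C / (1 - cmod a)\<^sup>2)"
proof (rule circle_kernel_integral[of 2])
  fix C :: real
  assume C: "0 < C" and CI: "\<And>w. cmod w < 1 \<Longrightarrow>
     (\<integral>\<^sup>+t\<in>{0..2*pi}. ennreal (cmod (1 - cnj w * cis t) powr (- 2)) \<partial>lborel) \<le> ennreal (C * (1 - cmod w) powr (1 - 2))"
  show thesis
  proof (rule that[OF C])
    fix a :: complex assume a: "cmod a < 1"
    define S where "S = {z. cmod (cnj a * z) < 1}"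
    define r where "r = 1 - (cmod a)\<^sup>2"
    have r: "0 < r" "1 - cmod a \<le> r" "r \<le> 2 * (1 - cmod a)"
    proof -
      have "r = (1 - cmod a) * (1 + cmod a)" by (simp add: r_def power2_eq_square algebra_simps)
      moreover have "(1 - cmod a) * 1 \<le> (1 - cmod a) * (1 + cmod a)" "(1 - cmod a) * (1 + cmod a) \<le> (1 - cmod a) * 2"
        using a by (intro mult_left_mono; simp)+
      ultimately show "1 - cmod a \<le> r" "r \<le> 2 * (1 - cmod a)" by simp_all
      then show "0 < r" using a by linarith
    qed
    show "(\<integral>\<^sup>+z\<in>cball 0 1. ennreal (cmod (1 - cnj a * z) powr (- 4)) \<partial>lborel) \<le> ennreal (C / (1 - cmod a)\<^sup>2)"
    proof (rule mobius_kernel[OF a])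
      fix D p
      assume S: "open {z. cmod (cnj a * z) < 1}" "cball 0 1 \<subseteq> {z. cmod (cnj a * z) < 1}"
        and v: "lap2 {z. cmod (cnj a * z) < 1} (\<lambda>z. 1 - (cmod (phi a z))\<^sup>2) D p (\<lambda>z. - 2 * ((1 - (cmod a)\<^sup>2) / (cmod (1 - cnj a * z))\<^sup>2)\<^sup>2)"
        and P: "\<And>t. - Re (cis t * D (cis t)) = 2 * (1 - (cmod a)\<^sup>2) / (cmod (1 - cnj a * cis t))\<^sup>2"
        and v0: "\<And>z. z \<in> cball 0 1 \<Longrightarrow> 0 \<le> 1 - (cmod (phi a z))\<^sup>2" "\<And>z. cmod z = 1 \<Longrightarrow> 1 - (cmod (phi a z))\<^sup>2 = 0"
      define m2 where "m2 z = (4 * r\<^sup>2) * cmod (1 - cnj a * z) powr (- 4)" for z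
      have kz: "cmod (1 - cnj a * z) powr (- 4) = 1 / (cmod (1 - cnj a * z)) ^ 4" if "z \<in> cball 0 1" for z
        using one_minus_cnj_mult(4)[OF a that] by (simp add: powr_minus_divide)
      have kt: "cmod (1 - cnj a * cis t) powr (- 2) = 1 / (cmod (1 - cnj a * cis t))\<^sup>2" for t
        using one_minus_cnj_mult(4)[OF a, of "cis t"] by (simp add: powr_minus_divide)
      have "(\<integral>\<^sup>+z\<in>cball 0 1. ennreal ((1 - (cmod (phi a z))\<^sup>2) * 0 + 1 * m2 z) \<partial>lborel)
        \<le> (\<integral>\<^sup>+z\<in>cball (0::complex) 1. ennreal (1 * 0) \<partial>lborel) + (\<integral>\<^sup>+t\<in>{0..2*pi}. ennreal (2 * r * cmod (1 - cnj a * cis t) powr (- 2) * 1) \<partial>lborel)"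
      proof (rule green_disc_singular[OF S(1) finite.emptyI S(2), where V="\<lambda>z. 1" and w="\<lambda>z. 0" and Y="\<lambda>z. 1" and ?m1.0="\<lambda>z. 0"
            and P="\<lambda>t. 2 * r * cmod (1 - cnj a * cis t) powr (- 2)"])
        show "lap2 ({z. cmod (cnj a * z) < 1} - {}) (\<lambda>z. 1) (\<lambda>z. 0) (\<lambda>z. 0) (\<lambda>z. 0)" using lap2_const[OF S(1)] by simp
        show "2 * (- 2 * ((1 - (cmod a)\<^sup>2) / (cmod (1 - cnj a * z))\<^sup>2)\<^sup>2) = 0 - m2 z" if "z \<in> cball 0 1" for z
          unfolding m2_def kz[OF that] r_def by (simp add: power_divide flip: power_mult)
        show "continuous_on (cball 0 1) m2" unfolding m2_def[abs_def] by (intro continuous_intros continuous_on_kernel_powr a)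
        show "- Re (cis t * D (cis t)) = 2 * r * cmod (1 - cnj a * cis t) powr (- 2)" for t unfolding P kt r_def by simp
      qed (use v v0 r in \<open>auto simp: m2_def\<close>)
      then have "ennreal (4 * r\<^sup>2) * (\<integral>\<^sup>+z\<in>cball 0 1. ennreal (cmod (1 - cnj a * z) powr (- 4)) \<partial>lborel)
         \<le> (\<integral>\<^sup>+t\<in>{0..2*pi}. ennreal (2 * r * cmod (1 - cnj a * cis t) powr (- 2)) \<partial>lborel)"
        using cball_nn_integral_cmult[OF continuous_on_kernel_powr[OF a], of "4 * r\<^sup>2" "- 4"] by (simp add: m2_def)
      also have "\<dots> = (\<integral>\<^sup>+t. ennreal (2 * r) * (ennreal (cmod (1 - cnj a * cis t) powr (- 2)) * indicator {0..2*pi} t) \<partial>lborel)"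
        using r by (intro nn_integral_cong) (simp add: ennreal_mult' mult.assoc)
      also have "\<dots> = ennreal (2 * r) * (\<integral>\<^sup>+t\<in>{0..2*pi}. ennreal (cmod (1 - cnj a * cis t) powr (- 2)) \<partial>lborel)"
      proof (rule nn_integral_cmult)
        have "continuous_on UNIV (\<lambda>t. cmod (1 - cnj a * cis t) powr (- 2))"
          using one_minus_cnj_mult(4)[OF a, of "cis _"] by (intro continuous_intros) auto
        then have "(\<lambda>t. cmod (1 - cnj a * cis t) powr (- 2)) \<in> borel_measurable borel" by (rule borel_measurable_continuous_onI)
        then show "(\<lambda>t. ennreal (cmod (1 - cnj a * cis t) powr (- 2)) * indicator {0..2*pi} t) \<in> borel_measurable lborel" by simp
      qed
      also have "\<dots> \<le> ennreal (2 * r) * ennreal (C * (1 - cmod a) powr (1 - 2))" by (intro mult_left_mono CI a) simp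
      also have "\<dots> = ennreal (2 * r * (C / (1 - cmod a)))" using r a C by (simp add: powr_minus_divide flip: ennreal_mult)
      also have "\<dots> \<le> ennreal (4 * C)" 
      proof (intro ennreal_leI)
        have "r / (1 - cmod a) \<le> 2" using r a by (simp add: divide_le_eq)
        then have "2 * C * (r / (1 - cmod a)) \<le> 2 * C * 2" using C by (intro mult_left_mono) auto
        then show "2 * r * (C / (1 - cmod a)) \<le> 4 * C" by (simp add: mult_ac)
      qed
      finally have 1: "ennreal (4 * r\<^sup>2) * (\<integral>\<^sup>+z\<in>cball 0 1. ennreal (cmod (1 - cnj a * z) powr (- 4)) \<partial>lborel) \<le> ennreal (4 * C)" .
      have "(\<integral>\<^sup>+z\<in>cball 0 1. ennreal (cmod (1 - cnj a * z) powr (- 4)) \<partial>lborel)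
         = ennreal (1 / (4 * r\<^sup>2)) * (ennreal (4 * r\<^sup>2) * (\<integral>\<^sup>+z\<in>cball 0 1. ennreal (cmod (1 - cnj a * z) powr (- 4)) \<partial>lborel))"
        using r by (simp add: mult.assoc[symmetric] flip: ennreal_mult)
      also have "\<dots> \<le> ennreal (1 / (4 * r\<^sup>2)) * ennreal (4 * C)" using 1 by (rule mult_left_mono) simp
      also have "\<dots> = ennreal (C / r\<^sup>2)" using r C by (simp flip: ennreal_mult)
      also have "\<dots> \<le> ennreal (C / (1 - cmod a)\<^sup>2)"
        using r a C by (intro ennreal_leI divide_left_mono power_mono mult_pos_pos) auto
      finally show ?thesis .
    qed
  qed
qed simp

text \<open>Green's formula with a regularised Green function of the disc as kernel.\<close>

lemma submean_powr:
  assumes h: "h holomorphic_on ball 0 R" and R: "R > 1" and q: "q > 0"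
  shows "ennreal (cmod (h 0) powr q) \<le> (\<integral>\<^sup>+z\<in>cball 0 1. ennreal (cmod (h z) powr q) \<partial>lborel)"
proof (cases "h 0 = 0")
  case False
  define \<rho> where "\<rho> = (1 + R) / 2"
  have \<rho>: "1 < \<rho>" "\<rho> < R" using R by (auto simp: \<rho>_def)
  define S where "S = ball (0::complex) \<rho>"
  define Z where "Z = {z \<in> cball 0 \<rho>. h z = 0}"
  have fin: "finite Z"
  proof (cases "h constant_on ball 0 R")
    case True
    then obtain c where c: "\<And>z. z \<in> ball 0 R \<Longrightarrow> h z = c" by (auto simp: constant_on_def)
    have "h z \<noteq> 0" if "z \<in> cball 0 \<rho>" for z using c[of z] c[of 0] that \<rho> False by auto
    then have "Z = {}" by (auto simp: Z_def)
    then show ?thesis by simp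
  next
    case nonconst: False
    show ?thesis unfolding Z_def
      by (rule holomorphic_compact_finite_zeros[OF h open_ball connected_ball _ _ nonconst]) (use \<rho> in auto)
  qed
  have S: "open S" "cball 0 1 \<subseteq> S" using \<rho> by (auto simp: S_def)
  have oSZ: "open (S - Z)" using S fin by (simp add: finite_imp_closed open_Diff)
  have hS: "h holomorphic_on (S - Z)" using h \<rho> by (auto simp: S_def intro: holomorphic_on_subset)
  have hc: "continuous_on (cball 0 \<rho>) h" using h \<rho> by (auto intro!: holomorphic_on_imp_continuous_on holomorphic_on_subset[OF h])
  define V where "V z = cmod (h z) powr q" for z
  have Vc: "continuous_on (cball 0 \<rho>) V" unfolding V_def[abs_def] using hc q by (intro continuous_on_powr' continuous_intros) auto
  have Vc1: "continuous_on (cball 0 1) V" using Vc by (rule continuous_on_subset) (use \<rho> in auto)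
  obtain M where M: "\<And>z. z \<in> cball 0 \<rho> \<Longrightarrow> V z \<le> M"
  proof -
    have "bounded (V ` cball 0 \<rho>)" by (intro compact_imp_bounded compact_continuous_image Vc compact_cball)
    then obtain M where "\<forall>z\<in>cball 0 \<rho>. norm (V z) \<le> M" by (auto simp: bounded_iff)
    then show thesis using that[of M] by (auto simp: abs_le_iff)
  qed
  have nz: "h z \<noteq> 0" if "z \<in> S - Z" for z using that by (auto simp: S_def Z_def)
  note l1 = lap2_cmult[OF lap2_ln_cmod[OF hS oSZ nz], where c="q/2"]
  have "\<exists>D a b. lap2 (S - Z) V D a b \<and> (\<forall>z. 0 \<le> b z)"
  proof -
    from l1 have l2: "lap2 (S - Z) (\<lambda>z. q / 2 * ln (cmod (h z))) (\<lambda>z. of_real (q / 2) * (deriv h z / h z)) (\<lambda>z. of_real (q / 2) * deriv (\<lambda>z. deriv h z / h z) z) (\<lambda>z. q / 2 * 0)" .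
    obtain a where l3: "lap2 (S - Z) (\<lambda>z. exp (2 * (q / 2 * ln (cmod (h z))))) (\<lambda>z. of_real (2 * exp (2 * (q / 2 * ln (cmod (h z))))) * (of_real (q / 2) * (deriv h z / h z))) a
      (\<lambda>z. 2 * exp (2 * (q / 2 * ln (cmod (h z)))) * (cmod (of_real (q / 2) * (deriv h z / h z)))\<^sup>2 + 2 * exp (2 * (q / 2 * ln (cmod (h z)))) * (q / 2 * 0))"
      using lap2_exp[OF l2] ..
    show ?thesis
      by (rule exI, rule exI, rule exI, rule conjI, rule lap2_transform[OF l3, where V'=V])
        (use nz in \<open>auto simp: V_def powr_def\<close>)
  qed
  then obtain DV aV bV where lV: "lap2 (S - Z) V DV aV bV" "\<And>z. 0 \<le> bV z" by (elim exE conjE) blast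
  have "V 0 > 0" using False by (simp add: V_def)
  have "isCont V 0" using Vc \<rho> by (intro continuous_on_interior[of "cball 0 \<rho>"]) auto
  then obtain \<eta> where \<eta>: "0 < \<eta>" "\<eta> \<le> 1" "\<And>z. cmod z \<le> \<eta> \<Longrightarrow> V z \<ge> V 0 / 2"
  proof -
    assume "isCont V 0"
    then obtain d where d: "d > 0" "\<And>z. cmod z < d \<Longrightarrow> \<bar>V z - V 0\<bar> < V 0 / 2"
      using \<open>V 0 > 0\<close> unfolding continuous_at_eps_delta by (metis half_gt_zero dist_norm real_norm_def diff_zero)
    show thesis
    proof (rule that[of "min 1 (d / 2)"])
      fix z assume "cmod z \<le> min 1 (d / 2)"
      then have "cmod z < d" using d(1) by auto
      from d(2)[OF this] show "V z \<ge> V 0 / 2" by (simp add: abs_if split: if_splits)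
    qed (use d in auto)
  qed
  \<comment> \<open>Makes \<open>m2\<close> at most 1/2 wherever |z| exceeds \<eta>, that is,
    outside the region where \<open>V\<close> is at least half its value at 0.\<close>
  define \<delta> where "\<delta> = \<eta> ^ 4 / 8"
  have \<delta>: "0 < \<delta>" "\<delta> \<le> 1 / 8" using \<eta> by (auto simp: \<delta>_def power_le_one)
  define m2 where "m2 z = 4 * \<delta> / ((cmod z)\<^sup>2 + \<delta>)\<^sup>2" for z :: complex
  \<comment> \<open>The logarithm is the regularised Green function. The subtracted quadratic
    vanishes on the circle too and cancels the normal derivative there, so no boundary integral
    arises; its price is the constant 4/(1 + \<delta>) in the Laplacian.\<close>
  define v where "v z = ln ((1 + \<delta>) / ((cmod z)\<^sup>2 + \<delta>)) - (1 - (cmod z)\<^sup>2) / (1 + \<delta>)" for z :: complex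
  have sd: "0 < (cmod z)\<^sup>2 + \<delta>" for z using \<delta> by (simp add: add_nonneg_pos)
  have lv: "\<exists>p. lap2 S v (\<lambda>z. of_real (- 1 / ((cmod z)\<^sup>2 + \<delta>) + 1 / (1 + \<delta>)) * (2 * cnj z)) p
     (\<lambda>z. 1 / ((cmod z)\<^sup>2 + \<delta>)\<^sup>2 * (cmod (2 * cnj z))\<^sup>2 / 2 + (- 1 / ((cmod z)\<^sup>2 + \<delta>) + 1 / (1 + \<delta>)) * 2)"
    unfolding v_def[abs_def]
  proof (rule exI, rule lap2_compose[OF lap2_cmod_square[OF S(1)], where I="{-\<delta><..}"])
    fix t assume t: "t \<in> {-\<delta><..}"
    have "((\<lambda>s. ln (1 + \<delta>) - ln (s + \<delta>) - (1 - s) * k) has_real_derivative (- 1 / (t + \<delta>) + k)) (at t)" for k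
      using t \<delta> by (auto intro!: derivative_eq_intros)
    from this[of "1 / (1 + \<delta>)"]
    have "((\<lambda>s. ln (1 + \<delta>) - ln (s + \<delta>) - (1 - s) / (1 + \<delta>)) has_real_derivative (- 1 / (t + \<delta>) + 1 / (1 + \<delta>))) (at t)"
      by simp
    then show "((\<lambda>s. ln ((1 + \<delta>) / (s + \<delta>)) - (1 - s) / (1 + \<delta>)) has_real_derivative (- 1 / (t + \<delta>) + 1 / (1 + \<delta>))) (at t)"
      by (rule has_field_derivative_transform_within_open[where S="{-\<delta><..}"]) (use t \<delta> in \<open>auto simp: ln_div\<close>)
    show "((\<lambda>s. - 1 / (s + \<delta>) + 1 / (1 + \<delta>)) has_real_derivative 1 / (t + \<delta>)\<^sup>2) (at t)"
      using t \<delta> by (auto intro!: derivative_eq_intros simp: power2_eq_square)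
  next
    show "continuous_on {-\<delta><..} (\<lambda>s. 1 / (s + \<delta>)\<^sup>2)" using \<delta> by (intro continuous_intros) auto
    show "(cmod z)\<^sup>2 \<in> {-\<delta><..}" for z using sd[of z] by simp
  qed
  then obtain p where lv: "lap2 S v (\<lambda>z. of_real (- 1 / ((cmod z)\<^sup>2 + \<delta>) + 1 / (1 + \<delta>)) * (2 * cnj z)) p
     (\<lambda>z. 1 / ((cmod z)\<^sup>2 + \<delta>)\<^sup>2 * (cmod (2 * cnj z))\<^sup>2 / 2 + (- 1 / ((cmod z)\<^sup>2 + \<delta>) + 1 / (1 + \<delta>)) * 2)" ..
  have bv: "2 * (1 / ((cmod z)\<^sup>2 + \<delta>)\<^sup>2 * (cmod (2 * cnj z))\<^sup>2 / 2 + (- 1 / ((cmod z)\<^sup>2 + \<delta>) + 1 / (1 + \<delta>)) * 2) = 4 / (1 + \<delta>) - m2 z" for z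
  proof -
    have "2 * (1 / (s + d)\<^sup>2 * (4 * s) / 2 + (- 1 / (s + d) + 1 / e) * 2) = 4 / e - 4 * d / (s + d)\<^sup>2" if "0 < s + d" for s d e :: real
    proof -
      have "(x - d) / x\<^sup>2 = 1 / x - d / x\<^sup>2" if "0 < x" for x :: real
        using that by (simp add: diff_divide_distrib power2_eq_square)
      from this[OF that] have "s / (s + d)\<^sup>2 = 1 / (s + d) - d / (s + d)\<^sup>2" by simp
      moreover have "2 * (1 / (s + d)\<^sup>2 * (4 * s) / 2 + (- 1 / (s + d) + 1 / e) * 2) = 4 * (s / (s + d)\<^sup>2) - 4 * (1 / (s + d)) + 4 / e"
        by (simp add: algebra_simps)
      ultimately show ?thesis by simp
    qed
    from this[OF sd[of z], of "1 + \<delta>"] show ?thesis by (simp add: m2_def norm_mult power_mult_distrib)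
  qed
  have m2c: "continuous_on (cball 0 1) m2" 
  proof -
    have "((cmod z)\<^sup>2 + \<delta>)\<^sup>2 \<noteq> 0" for z :: complex using sd[of z] by simp
    then show ?thesis unfolding m2_def[abs_def] by (intro continuous_intros) auto
  qed
  have m20: "0 \<le> m2 z" for z using \<delta> by (simp add: m2_def)
  have v1: "v z = 0" if "cmod z = 1" for z using that \<delta> by (simp add: v_def)
  have v0: "0 \<le> v z" if "z \<in> cball 0 1" for z
  proof -
    let ?x = "((cmod z)\<^sup>2 + \<delta>) / (1 + \<delta>)"
    have x: "0 < ?x" using sd[of z] \<delta> by simp
    have "ln ?x \<le> ?x - 1" by (rule ln_le_minus_one[OF x])
    moreover have "ln ((1 + \<delta>) / ((cmod z)\<^sup>2 + \<delta>)) = - ln ?x" using sd[of z] \<delta> by (simp add: ln_div)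
    moreover have "?x - 1 = - ((1 - (cmod z)\<^sup>2) / (1 + \<delta>))" using \<delta> by (simp add: field_simps)
    ultimately show ?thesis unfolding v_def by linarith
  qed
  have bd: "- Re (cis t * (of_real (- 1 / ((cmod (cis t))\<^sup>2 + \<delta>) + 1 / (1 + \<delta>)) * (2 * cnj (cis t)))) = 0" for t by simp
  have "(\<integral>\<^sup>+z\<in>cball 0 1. ennreal (v z * 0 + V z * m2 z) \<partial>lborel)
     \<le> (\<integral>\<^sup>+z\<in>cball 0 1. ennreal (V z * (4 / (1 + \<delta>))) \<partial>lborel) + (\<integral>\<^sup>+t\<in>{0..2*pi}. ennreal (0 * V (cis t)) \<partial>lborel)"
  proof (rule green_disc_singular[OF S(1) fin S(2) lV(1), where w="\<lambda>z. 0" and Y=V and ?m1.0="\<lambda>z. 4 / (1 + \<delta>)" and P="\<lambda>t. 0"])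
    show "0 < V z" if "z \<in> S - Z" for z using nz[OF that] by (simp add: V_def)
    show "V z \<le> M" if "z \<in> S - Z" for z using that by (intro M) (auto simp: S_def)
    show "lap2 S v (\<lambda>z. of_real (- 1 / ((cmod z)\<^sup>2 + \<delta>) + 1 / (1 + \<delta>)) * (2 * cnj z)) p
     (\<lambda>z. 1 / ((cmod z)\<^sup>2 + \<delta>)\<^sup>2 * (cmod (2 * cnj z))\<^sup>2 / 2 + (- 1 / ((cmod z)\<^sup>2 + \<delta>) + 1 / (1 + \<delta>)) * 2)" by (rule lv)
  qed (use lV v0 v1 bv m2c m20 \<delta> bd in \<open>auto simp: V_def\<close>)
  then have I1: "(\<integral>\<^sup>+z\<in>cball 0 1. ennreal (V z * m2 z) \<partial>lborel) \<le> (\<integral>\<^sup>+z\<in>cball 0 1. ennreal (V z * (4 / (1 + \<delta>))) \<partial>lborel)" by simp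
  let ?I = "\<lambda>f. (\<integral>z. indicator (cball (0::complex) 1) z * f z \<partial>lborel)"
  have V0: "0 \<le> V z" for z by (simp add: V_def)
  have int: "integrable lborel (\<lambda>z. indicator (cball 0 1) z * f z)" if "continuous_on (cball 0 1) f" for f :: "complex \<Rightarrow> real"
    by (rule disc_integral_chords(3)[OF that])
  have "ennreal (?I (\<lambda>z. V z * m2 z)) \<le> ennreal (?I (\<lambda>z. V z * (4 / (1 + \<delta>))))"
    using I1 integral_cball_eq_nn_integral[of "\<lambda>z. V z * m2 z"] integral_cball_eq_nn_integral[of "\<lambda>z. V z * (4 / (1 + \<delta>))"]
      Vc1 m2c V0 m20 \<delta> by (simp add: continuous_intros)
  moreover have "0 \<le> ?I (\<lambda>z. V z * (4 / (1 + \<delta>)))"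
    using V0 \<delta> by (intro Bochner_Integration.integral_nonneg) (auto simp: indicator_def)
  ultimately have I2: "?I (\<lambda>z. V z * m2 z) \<le> ?I (\<lambda>z. V z * (4 / (1 + \<delta>)))" by (simp add: ennreal_le_iff)
  have "?I (\<lambda>z. V z * (4 / (1 + \<delta>))) \<le> ?I (\<lambda>z. 4 * V z)"
  proof (rule Bochner_Integration.integral_mono)
    show "indicator (cball 0 1) z * (V z * (4 / (1 + \<delta>))) \<le> indicator (cball 0 1) z * (4 * V z)" for z
      using V0[of z] \<delta> by (auto simp: indicator_def field_simps)
  qed (intro int continuous_intros Vc1)+
  then have I3: "?I (\<lambda>z. V z * m2 z) \<le> 4 * ?I V" using I2 by (simp add: mult.left_commute)
  \<comment> \<open>Green's formula with the constant 1 computes the mass of \<open>m2\<close>: it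
    equals that of the constant 4/(1 + \<delta>).\<close>
  have I4: "?I m2 = 4 * pi / (1 + \<delta>)"
  proof -
    have "?I (\<lambda>z. 2 * (v z * 0 - 1 * (1 / ((cmod z)\<^sup>2 + \<delta>)\<^sup>2 * (cmod (2 * cnj z))\<^sup>2 / 2 + (- 1 / ((cmod z)\<^sup>2 + \<delta>) + 1 / (1 + \<delta>)) * 2)))
      = - integral {0..2*pi} (\<lambda>t. Re (cis t * (of_real (- 1 / ((cmod (cis t))\<^sup>2 + \<delta>) + 1 / (1 + \<delta>)) * (2 * cnj (cis t)))) * 1)"
      by (rule green_disc[OF lap2_const[OF S(1), of 1] lv S(2) v1])
    also have "\<dots> = 0" by simp
    also have "(\<lambda>z. 2 * (v z * 0 - 1 * (1 / ((cmod z)\<^sup>2 + \<delta>)\<^sup>2 * (cmod (2 * cnj z))\<^sup>2 / 2 + (- 1 / ((cmod z)\<^sup>2 + \<delta>) + 1 / (1 + \<delta>)) * 2))) = (\<lambda>z. m2 z - 4 / (1 + \<delta>))"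
    proof
      fix z show "2 * (v z * 0 - 1 * (1 / ((cmod z)\<^sup>2 + \<delta>)\<^sup>2 * (cmod (2 * cnj z))\<^sup>2 / 2 + (- 1 / ((cmod z)\<^sup>2 + \<delta>) + 1 / (1 + \<delta>)) * 2)) = m2 z - 4 / (1 + \<delta>)"
      proof -
        have e: "2 * (v z * 0 - 1 * y) = - (2 * y)" for y by simp
        show ?thesis unfolding e using bv[of z] by simp
      qed
    qed
    finally have "?I (\<lambda>z. m2 z - 4 / (1 + \<delta>)) = 0" .
    moreover have "?I (\<lambda>z. m2 z - 4 / (1 + \<delta>)) = ?I m2 - ?I (\<lambda>z. 4 / (1 + \<delta>))"
      unfolding right_diff_distrib by (rule Bochner_Integration.integral_diff[OF int[OF m2c] int[OF continuous_on_const]])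
    moreover have "?I (\<lambda>z. 4 / (1 + \<delta>)) = pi * (4 / (1 + \<delta>))"
      by (simp add: content_cball unit_ball_vol_2)
    ultimately show ?thesis by simp
  qed
  have "?I (\<lambda>z. V 0 / 2 * m2 z - V 0 / 2 * (4 * \<delta> / \<eta> ^ 4)) \<le> ?I (\<lambda>z. V z * m2 z)"
  proof (rule Bochner_Integration.integral_mono)
    show "indicator (cball 0 1) z * (V 0 / 2 * m2 z - V 0 / 2 * (4 * \<delta> / \<eta> ^ 4)) \<le> indicator (cball 0 1) z * (V z * m2 z)" for z
    proof (cases "cmod z \<le> \<eta>")
      case True
      have "V 0 / 2 * m2 z \<le> V z * m2 z" using \<eta>(3)[OF True] m20 by (intro mult_right_mono) auto
      moreover have "0 \<le> V 0 / 2 * (4 * \<delta> / \<eta> ^ 4)" using \<delta> V0 by simp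
      ultimately show ?thesis by (simp add: indicator_def)
    next
      case False
      have "\<eta>\<^sup>2 \<le> (cmod z)\<^sup>2 + \<delta>" 
      proof -
        have "\<eta>\<^sup>2 \<le> (cmod z)\<^sup>2" using False \<eta>(1) by (intro power_mono) auto
        then show ?thesis using \<delta> by linarith
      qed
      then have "(\<eta>\<^sup>2)\<^sup>2 \<le> ((cmod z)\<^sup>2 + \<delta>)\<^sup>2" by (intro power_mono) auto
      then have "m2 z \<le> 4 * \<delta> / \<eta> ^ 4" unfolding m2_def using \<delta> \<eta>(1) sd[of z] by (intro divide_left_mono) (auto simp flip: power_mult)
      then have "V 0 / 2 * m2 z \<le> V 0 / 2 * (4 * \<delta> / \<eta> ^ 4)" using V0 by (intro mult_left_mono) auto
      moreover have "0 \<le> V z * m2 z" using V0 m20 by simp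
      ultimately show ?thesis by (simp add: indicator_def)
    qed
  qed (intro int continuous_intros Vc1 m2c)+
  moreover have "?I (\<lambda>z. V 0 / 2 * m2 z - V 0 / 2 * (4 * \<delta> / \<eta> ^ 4)) = V 0 / 2 * ?I m2 - V 0 / 2 * (4 * \<delta> / \<eta> ^ 4) * pi"
  proof -
    have "?I (\<lambda>z. V 0 / 2 * m2 z - V 0 / 2 * (4 * \<delta> / \<eta> ^ 4)) = ?I (\<lambda>z. V 0 / 2 * m2 z) - ?I (\<lambda>z. V 0 / 2 * (4 * \<delta> / \<eta> ^ 4))"
      unfolding right_diff_distrib[of "indicator (cball 0 1) _"] by (intro Bochner_Integration.integral_diff int m2c continuous_intros)
    moreover have "?I (\<lambda>z. V 0 / 2 * m2 z) = V 0 / 2 * ?I m2" by (simp add: mult.left_commute)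
    ultimately show ?thesis by (simp add: content_cball unit_ball_vol_2)
  qed
  moreover have "4 * \<delta> / \<eta> ^ 4 = 1 / 2" using \<eta>(1) by (simp add: \<delta>_def)
  ultimately have a: "V 0 / 2 * (4 * pi / (1 + \<delta>)) - V 0 / 2 * (1 / 2) * pi \<le> 4 * ?I V"
    using I3 I4 by (simp only:)
  \<comment> \<open>With \<delta> at most 1/8 the mass of \<open>m2\<close> is at least 7 pi/2.
    Removing the part outside radius \<eta> leaves \<open>V 0\<close> times 3 pi/2 below 4 times the
    integral, and 3 pi/2 exceeds 4.\<close>
  have "7 / 2 * pi \<le> 4 * pi / (1 + \<delta>)"
    using \<delta> by (simp add: field_simps)
  then have "V 0 / 2 * (7 / 2 * pi) \<le> V 0 / 2 * (4 * pi / (1 + \<delta>))" using V0[of 0] by (intro mult_left_mono) auto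
  with a have "V 0 / 2 * (7 / 2 * pi) - V 0 / 2 * (1 / 2) * pi \<le> 4 * ?I V" by linarith
  then have "V 0 * (3 / 2 * pi) \<le> 4 * ?I V" by (simp add: algebra_simps)
  moreover have "V 0 * 4 \<le> V 0 * (3 / 2 * pi)" using pi_gt3 V0[of 0] by (intro mult_left_mono) auto
  ultimately have "V 0 \<le> ?I V" by linarith
  then have "ennreal (V 0) \<le> ennreal (?I V)" by (rule ennreal_leI)
  also have "\<dots> = (\<integral>\<^sup>+z\<in>cball 0 1. ennreal (V z) \<partial>lborel)" by (rule integral_cball_eq_nn_integral[OF Vc1 V0])
  finally show ?thesis by (simp add: V_def)
qed simp

section \<open>The gradient of a power of the modulus\<close>

lemma powr_diff_le:
  fixes x y s :: real
  assumes "0 \<le> x" "0 \<le> y" "1 \<le> s"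
  shows "\<bar>x powr s - y powr s\<bar> \<le> s * max x y powr (s - 1) * \<bar>x - y\<bar>"
proof -
  have *: "x powr s - y powr s \<le> s * x powr (s - 1) * (x - y)" if "0 \<le> y" "y < x" for x y
  proof -
    have "\<exists>l z. y < z \<and> z < x \<and> ((\<lambda>t. t powr s) has_real_derivative l) (at z) \<and> x powr s - y powr s = (x - y) * l"
    proof (rule MVT)
      show "continuous_on {y..x} (\<lambda>t. t powr s)" using that assms(3) by (intro continuous_on_powr' continuous_intros) auto
      fix t assume "y < t" "t < x"
      then show "(\<lambda>t. t powr s) differentiable (at t)"
        using that has_real_derivative_powr[of t s] by (auto simp: real_differentiable_def)
    qed (use that in auto)
    then obtain l z where z: "y < z" "z < x" "((\<lambda>t. t powr s) has_real_derivative l) (at z)" "x powr s - y powr s = (x - y) * l" by blast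
    have "l = s * z powr (s - 1)" using z that by (intro DERIV_unique[OF z(3)] has_real_derivative_powr) auto
    also have "\<dots> \<le> s * x powr (s - 1)" using z that assms by (intro mult_left_mono powr_mono2) auto
    finally have "(x - y) * l \<le> (x - y) * (s * x powr (s - 1))" using that by (intro mult_left_mono) auto
    then show ?thesis unfolding z(4) by (simp add: mult_ac)
  qed
  consider "x = y" | "y < x" | "x < y" by linarith
  then show ?thesis
  proof cases
    case 2
    have "y powr s \<le> x powr s" using 2 assms by (intro powr_mono2) auto
    then show ?thesis using *[of y x] 2 assms by (simp add: max_def)
  next
    case 3
    have "x powr s \<le> y powr s" using 3 assms by (intro powr_mono2) auto
    then show ?thesis using *[of x y] 3 assms by (simp add: max_def)
  qed simp
qed

text \<open>The mean value bound with the larger of the two moduli never divides by |g|, so zeros of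
  \<open>g\<close> need no separate treatment; s > 1 makes the power s - 1 continuous at 0.\<close>

lemma grad_abs_cmod_powr_le:
  assumes g: "g holomorphic_on S" "open S" "z \<in> S" and s: "1 < s"
  shows "grad_abs (\<lambda>w. cmod (g w) powr s) z \<le> ennreal (s * cmod (g z) powr (s - 1) * cmod (deriv g z))"
proof -
  let ?h = "\<lambda>w. s * max (cmod (g w)) (cmod (g z)) powr (s - 1) * cmod ((g w - g z) / (w - z))"
  have cg: "(g \<longlongrightarrow> g z) (at z)"
    using holomorphic_on_imp_continuous_on[OF g(1)] g(2,3) by (simp add: continuous_on_eq_continuous_at isCont_def)
  have "((\<lambda>w. (g w - g z) / (w - z)) \<longlongrightarrow> deriv g z) (at z)"
    using holomorphic_derivI[OF g] by (simp add: has_field_derivative_iff)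
  then have "(?h \<longlongrightarrow> s * max (cmod (g z)) (cmod (g z)) powr (s - 1) * cmod (deriv g z)) (at z)"
    using s cg by (intro tendsto_intros tendsto_powr') auto
  then have "((\<lambda>w. ennreal (?h w)) \<longlongrightarrow> ennreal (s * cmod (g z) powr (s - 1) * cmod (deriv g z))) (at z)"
    by (intro tendsto_ennrealI) simp
  then have "Limsup (at z) (\<lambda>w. ennreal (?h w)) = ennreal (s * cmod (g z) powr (s - 1) * cmod (deriv g z))"
    by (intro lim_imp_Limsup) auto
  moreover have "grad_abs (\<lambda>w. cmod (g w) powr s) z \<le> Limsup (at z) (\<lambda>w. ennreal (?h w))"
    unfolding grad_abs_def
  proof (intro Limsup_mono always_eventually allI ennreal_leI)
    fix w
    have "\<bar>cmod (g w) powr s - cmod (g z) powr s\<bar> \<le> s * max (cmod (g w)) (cmod (g z)) powr (s - 1) * \<bar>cmod (g w) - cmod (g z)\<bar>"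
      using s by (intro powr_diff_le) auto
    also have "\<dots> \<le> s * max (cmod (g w)) (cmod (g z)) powr (s - 1) * cmod (g w - g z)"
      using s by (intro mult_left_mono norm_triangle_ineq3) auto
    finally show "\<bar>cmod (g w) powr s - cmod (g z) powr s\<bar> / cmod (w - z) \<le> ?h w"
      by (simp add: norm_divide divide_right_mono)
  qed
  ultimately show ?thesis by simp
qed

text \<open>For negative \<open>\<alpha>\<close> the weight is unbounded. It is part of the Laplacian of \<open>(1 + \<epsilon> - \<bar>z\<bar>\<^sup>2)^(\<alpha> + 2) - \<epsilon>^(\<alpha> + 2)\<close>, and Green's
  formula bounds its integral uniformly in \<open>\<epsilon>\<close>.\<close>

lemma disc_kernel_weighted:
  assumes \<alpha>: "\<alpha> > -1"
  obtains C :: real where "0 < C" "\<And>a. cmod a < 1 \<Longrightarrow>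
    (\<integral>\<^sup>+z\<in>disc. ennreal ((1 - (cmod z)\<^sup>2) powr \<alpha> * cmod (1 - cnj a * z) powr (- (\<alpha> + 5))) \<partial>lborel) \<le> ennreal (C / (1 - cmod a) ^ 3)"
proof (rule disc_kernel_integral)
  fix C4 :: real
  assume C4: "0 < C4" and I4: "\<And>a. cmod a < 1 \<Longrightarrow>
    (\<integral>\<^sup>+z\<in>cball 0 1. ennreal (cmod (1 - cnj a * z) powr (- 4)) \<partial>lborel) \<le> ennreal (C4 / (1 - cmod a)\<^sup>2)"
  have I5: "(\<integral>\<^sup>+z\<in>cball 0 1. ennreal (k * cmod (1 - cnj a * z) powr (- 5)) \<partial>lborel) \<le> ennreal (k * C4 / (1 - cmod a) ^ 3)"
    if a: "cmod a < 1" and k: "0 \<le> k" for a k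
  proof -
    have "(\<integral>\<^sup>+z\<in>cball 0 1. ennreal (k * cmod (1 - cnj a * z) powr (- 5)) \<partial>lborel)
      \<le> (\<integral>\<^sup>+z\<in>cball 0 1. ennreal ((k / (1 - cmod a)) * cmod (1 - cnj a * z) powr (- 4)) \<partial>lborel)"
    proof (intro nn_integral_mono)
      fix z
      show "ennreal (k * cmod (1 - cnj a * z) powr (- 5)) * indicator (cball 0 1) z \<le> ennreal ((k / (1 - cmod a)) * cmod (1 - cnj a * z) powr (- 4)) * indicator (cball 0 1) z"
      proof (cases "z \<in> cball 0 1")
        case True
        note o = one_minus_cnj_mult[OF a True]
        have "cmod (1 - cnj a * z) powr (- 5) = cmod (1 - cnj a * z) powr (- 1) * cmod (1 - cnj a * z) powr (- 4)"
          by (simp only: powr_add[symmetric]) simp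
        also have "\<dots> \<le> (1 - cmod a) powr (- 1) * cmod (1 - cnj a * z) powr (- 4)"
          using o a by (intro mult_right_mono powr_mono2') auto
        also have "(1 - cmod a) powr (- 1) = 1 / (1 - cmod a)" using a by (simp add: powr_minus_divide)
        finally have "k * cmod (1 - cnj a * z) powr (- 5) \<le> k * (1 / (1 - cmod a) * cmod (1 - cnj a * z) powr (- 4))"
          using k by (rule mult_left_mono)
        then show ?thesis using True by (simp add: ennreal_leI)
      qed simp
    qed
    also have "\<dots> = ennreal (k / (1 - cmod a)) * (\<integral>\<^sup>+z\<in>cball 0 1. ennreal (cmod (1 - cnj a * z) powr (- 4)) \<partial>lborel)"
      using a k by (intro cball_nn_integral_cmult continuous_on_kernel_powr) auto
    also have "\<dots> \<le> ennreal (k / (1 - cmod a)) * ennreal (C4 / (1 - cmod a)\<^sup>2)" by (intro mult_left_mono I4 a) simp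
    also have "\<dots> = ennreal (k * C4 / (1 - cmod a) ^ 3)"
      using a k C4 by (simp add: power3_eq_cube power2_eq_square flip: ennreal_mult)
    finally show ?thesis .
  qed
  have ball_cball: "(\<integral>\<^sup>+z\<in>disc. f z \<partial>lborel) \<le> (\<integral>\<^sup>+z\<in>cball 0 1. f z \<partial>lborel)" for f :: "complex \<Rightarrow> ennreal"
    by (intro nn_integral_mono) (auto simp: indicator_def)
  show thesis
  proof (cases "\<alpha> \<ge> 0")
    case True
    show thesis
    proof (rule that[of "2 powr \<alpha> * C4"])
      fix a :: complex assume a: "cmod a < 1"
      have "(\<integral>\<^sup>+z\<in>disc. ennreal ((1 - (cmod z)\<^sup>2) powr \<alpha> * cmod (1 - cnj a * z) powr (- (\<alpha> + 5))) \<partial>lborel)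
         \<le> (\<integral>\<^sup>+z\<in>disc. ennreal (2 powr \<alpha> * cmod (1 - cnj a * z) powr (- 5)) \<partial>lborel)"
      proof (intro nn_integral_mono)
        fix z
        show "ennreal ((1 - (cmod z)\<^sup>2) powr \<alpha> * cmod (1 - cnj a * z) powr (- (\<alpha> + 5))) * indicator disc z \<le> ennreal (2 powr \<alpha> * cmod (1 - cnj a * z) powr (- 5)) * indicator disc z"
        proof (cases "z \<in> disc")
          case z: True
          then have zc: "z \<in> cball 0 1" and z1: "cmod z < 1" by auto
          note o = one_minus_cnj_mult[OF a zc]
          \<comment> \<open>For nonnegative \<alpha> the weight is bounded by a power of the kernel
            and lowers the exponent \<alpha> + 5 to 5.\<close>
          have "1 - (cmod z)\<^sup>2 = (1 - cmod z) * (1 + cmod z)" by (simp add: power2_eq_square algebra_simps)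
          also have "\<dots> \<le> cmod (1 - cnj a * z) * 2" using o z1 by (intro mult_mono) auto
          finally have "(1 - (cmod z)\<^sup>2) powr \<alpha> \<le> (2 * cmod (1 - cnj a * z)) powr \<alpha>"
            using True z1 by (intro powr_mono2) (auto simp: abs_square_le_1 mult.commute)
          also have "\<dots> = 2 powr \<alpha> * cmod (1 - cnj a * z) powr \<alpha>" by (simp add: powr_mult)
          finally have "(1 - (cmod z)\<^sup>2) powr \<alpha> * cmod (1 - cnj a * z) powr (- (\<alpha> + 5)) \<le> 2 powr \<alpha> * cmod (1 - cnj a * z) powr \<alpha> * cmod (1 - cnj a * z) powr (- (\<alpha> + 5))"
            by (intro mult_right_mono) auto
          also have "\<dots> = 2 powr \<alpha> * cmod (1 - cnj a * z) powr (- 5)" by (simp add: mult.assoc flip: powr_add)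
          finally show ?thesis using z by (simp add: ennreal_leI)
        qed simp
      qed
      also have "\<dots> \<le> (\<integral>\<^sup>+z\<in>cball 0 1. ennreal (2 powr \<alpha> * cmod (1 - cnj a * z) powr (- 5)) \<partial>lborel)" by (rule ball_cball)
      also have "\<dots> \<le> ennreal (2 powr \<alpha> * C4 / (1 - cmod a) ^ 3)" using a by (intro I5) auto
      finally show "(\<integral>\<^sup>+z\<in>disc. ennreal ((1 - (cmod z)\<^sup>2) powr \<alpha> * cmod (1 - cnj a * z) powr (- (\<alpha> + 5))) \<partial>lborel) \<le> ennreal (2 powr \<alpha> * C4 / (1 - cmod a) ^ 3)" .
    qed (use C4 in auto)
  next
    case False
    define c where "c = \<alpha> + 5"
    define \<kappa> where "\<kappa> = 4 * (\<alpha> + 2) * (\<alpha> + 1)"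
    have \<kappa>: "0 < \<kappa>" using \<alpha> by (simp add: \<kappa>_def)
    \<comment> \<open>The first summand comes from the Laplacian of the kernel power times the
      weight function, the second from the part of the weight's Laplacian with exponent \<alpha> +
      1.\<close>
    define C1 where "C1 = c\<^sup>2 * 3 powr (\<alpha> + 2) + 8 * (\<alpha> + 2)\<^sup>2 * 3 powr (\<alpha> + 1)"
    have C1: "0 < C1" unfolding C1_def using \<alpha> by (intro add_pos_pos mult_pos_pos) (auto simp: c_def)
    have main: "(\<integral>\<^sup>+z\<in>cball 0 1. ennreal ((1 + \<epsilon> - (cmod z)\<^sup>2) powr \<alpha> * cmod (1 - cnj a * z) powr (- c)) \<partial>lborel) \<le> ennreal (C1 / \<kappa> * C4 / (1 - cmod a) ^ 3)"
      if a: "cmod a < 1" and \<epsilon>: "0 < \<epsilon>" "\<epsilon> \<le> 1 - cmod a" for a \<epsilon>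
    proof -
      define S where "S = {z. cmod (cnj a * z) < 1} \<inter> {z. (cmod z)\<^sup>2 < 1 + \<epsilon>}"
      have S: "open S" unfolding S_def by (intro open_Int open_Collect_less continuous_intros)
      have cS: "cball 0 1 \<subseteq> S"
      proof
        fix z :: complex assume z: "z \<in> cball 0 1"
        then have "cmod a * cmod z \<le> cmod a * 1" by (intro mult_left_mono) auto
        moreover have "(cmod z)\<^sup>2 \<le> 1" using z by (simp add: abs_square_le_1)
        ultimately show "z \<in> S" using a \<epsilon> by (simp add: S_def norm_mult)
      qed
      have nz: "1 - cnj a * z \<noteq> 0" if "z \<in> S" for z using that unfolding S_def by auto
      have hol: "(\<lambda>z. 1 - cnj a * z) holomorphic_on S" by (intro holomorphic_intros)
      have lx: "lap2 S (\<lambda>z. - c / 2 * ln (cmod (1 - cnj a * z))) (\<lambda>z. of_real (- c / 2) * (deriv (\<lambda>z. 1 - cnj a * z) z / (1 - cnj a * z)))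
          (\<lambda>z. of_real (- c / 2) * deriv (\<lambda>z. deriv (\<lambda>z. 1 - cnj a * z) z / (1 - cnj a * z)) z) (\<lambda>z. - c / 2 * 0)"
        by (rule lap2_cmult[OF lap2_ln_cmod[OF hol S nz]])
      define U where "U z = exp (2 * (- c / 2 * ln (cmod (1 - cnj a * z))))" for z
      define bU where "bU z = 2 * U z * (c\<^sup>2 / 4 * ((cmod a)\<^sup>2 / (cmod (1 - cnj a * z))\<^sup>2))" for z
      obtain DU aU where lU: "lap2 S U DU aU bU"
      proof -
        obtain p where p: "lap2 S U (\<lambda>z. of_real (2 * U z) * (of_real (- c / 2) * (deriv (\<lambda>z. 1 - cnj a * z) z / (1 - cnj a * z)))) p
          (\<lambda>z. 2 * U z * (cmod (of_real (- c / 2) * (deriv (\<lambda>z. 1 - cnj a * z) z / (1 - cnj a * z))))\<^sup>2 + 2 * U z * (- c / 2 * 0))"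
          using lap2_exp[OF lx] unfolding U_def ..
        have d: "deriv (\<lambda>z. 1 - cnj a * z) z = - cnj a" for z
          by (rule DERIV_imp_deriv) (auto intro!: derivative_eq_intros)
        have e: "(cmod (of_real (- c / 2) * (- cnj a / y)))\<^sup>2 = c\<^sup>2 / 4 * ((cmod a)\<^sup>2 / (cmod y)\<^sup>2)" for y
          by (simp add: norm_mult norm_divide power_mult_distrib power_divide)
        have "(\<lambda>z. 2 * U z * (cmod (of_real (- c / 2) * (deriv (\<lambda>z. 1 - cnj a * z) z / (1 - cnj a * z))))\<^sup>2 + 2 * U z * (- c / 2 * 0)) = bU"
          unfolding d e bU_def[abs_def] by simp
        with p show thesis by (intro that) simp
      qed
      have Upw: "U z = cmod (1 - cnj a * z) powr (- c)" if "z \<in> S" for z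
        using nz[OF that] by (simp add: U_def powr_def)
      define v where "v z = (1 + \<epsilon> - (cmod z)\<^sup>2) powr (\<alpha> + 2) - \<epsilon> powr (\<alpha> + 2)" for z :: complex
      define bv where "bv z = (\<alpha> + 2) * (\<alpha> + 1) * (1 + \<epsilon> - (cmod z)\<^sup>2) powr \<alpha> * (cmod (2 * cnj z))\<^sup>2 / 2 + - (\<alpha> + 2) * (1 + \<epsilon> - (cmod z)\<^sup>2) powr (\<alpha> + 1) * 2" for z
      obtain pv where lv: "lap2 S v (\<lambda>z. of_real (- (\<alpha> + 2) * (1 + \<epsilon> - (cmod z)\<^sup>2) powr (\<alpha> + 1)) * (2 * cnj z)) pv bv"
      proof (rule that, unfold v_def[abs_def] bv_def[abs_def], rule lap2_compose[OF lap2_cmod_square[OF S], where I="{..<1+\<epsilon>}"])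
        fix t assume t: "t \<in> {..<1+\<epsilon>}"
        have "((\<lambda>s. (1 + \<epsilon> - s) powr (\<alpha> + 2)) has_real_derivative (\<alpha> + 2) * (1 + \<epsilon> - t) powr (\<alpha> + 2 - 1) * (-1)) (at t)"
          using t by (intro DERIV_chain2[OF has_real_derivative_powr]) (auto intro!: derivative_eq_intros)
        then have "((\<lambda>s. (1 + \<epsilon> - s) powr (\<alpha> + 2)) has_real_derivative - (\<alpha> + 2) * (1 + \<epsilon> - t) powr (\<alpha> + 1)) (at t)"
          by (rule DERIV_cong) (simp add: algebra_simps)
        then show "((\<lambda>s. (1 + \<epsilon> - s) powr (\<alpha> + 2) - \<epsilon> powr (\<alpha> + 2)) has_real_derivative - (\<alpha> + 2) * (1 + \<epsilon> - t) powr (\<alpha> + 1)) (at t)"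
          using DERIV_diff[OF _ DERIV_const[of "\<epsilon> powr (\<alpha> + 2)"]] by simp
        have "((\<lambda>s. (1 + \<epsilon> - s) powr (\<alpha> + 1)) has_real_derivative (\<alpha> + 1) * (1 + \<epsilon> - t) powr (\<alpha> + 1 - 1) * (-1)) (at t)"
          using t by (intro DERIV_chain2[OF has_real_derivative_powr]) (auto intro!: derivative_eq_intros)
        from DERIV_cmult[OF this, of "- (\<alpha> + 2)"]
        show "((\<lambda>s. - (\<alpha> + 2) * (1 + \<epsilon> - s) powr (\<alpha> + 1)) has_real_derivative (\<alpha> + 2) * (\<alpha> + 1) * (1 + \<epsilon> - t) powr \<alpha>) (at t)"
          by (simp add: algebra_simps)
      next
        show "continuous_on {..<1+\<epsilon>} (\<lambda>t. (\<alpha> + 2) * (\<alpha> + 1) * (1 + \<epsilon> - t) powr \<alpha>)" by (intro continuous_intros) auto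
        show "(cmod z)\<^sup>2 \<in> {..<1+\<epsilon>}" if "z \<in> S" for z using that by (simp add: S_def)
      qed
      \<comment> \<open>This is the Green integrand. Its integral equals a boundary term that is
        nonnegative, so adding it to the wanted integrand can only increase the integral.\<close>
      define G where "G z = 2 * (v z * bU z - U z * bv z)" for z
      have v1: "v z = 0" if "cmod z = 1" for z using that by (simp add: v_def)
      have "(\<integral>z. indicator (cball 0 1) z * G z \<partial>lborel) =
         - integral {0..2*pi} (\<lambda>t. Re (cis t * (of_real (- (\<alpha> + 2) * (1 + \<epsilon> - (cmod (cis t))\<^sup>2) powr (\<alpha> + 1)) * (2 * cnj (cis t)))) * U (cis t))"
        unfolding G_def by (rule green_disc[OF lU lv cS v1])
      also have "\<dots> = integral {0..2*pi} (\<lambda>t. 2 * (\<alpha> + 2) * \<epsilon> powr (\<alpha> + 1) * U (cis t))"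
      proof -
        have "cis t * (of_real (- (\<alpha> + 2) * (1 + \<epsilon> - (cmod (cis t))\<^sup>2) powr (\<alpha> + 1)) * (2 * cnj (cis t))) = of_real (- 2 * (\<alpha> + 2) * \<epsilon> powr (\<alpha> + 1))" for t
        proof -
          have "cis t * (of_real x * (2 * cnj (cis t))) = of_real (2 * x)" for x
            using complex_norm_square[of "cis t"] by (simp add: mult_ac)
          moreover have "1 + \<epsilon> - (cmod (cis t))\<^sup>2 = \<epsilon>" by simp
          moreover have "2 * (- (\<alpha> + 2) * \<epsilon> powr (\<alpha> + 1)) = - 2 * (\<alpha> + 2) * \<epsilon> powr (\<alpha> + 1)" by simp
          ultimately show ?thesis by (simp only:)
        qed
        then show ?thesis unfolding Henstock_Kurzweil_Integration.integral_neg[symmetric]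
          by (simp only: Re_complex_of_real) (simp, simp add: algebra_simps)
      qed
      also have "\<dots> \<ge> 0"
      proof (rule Henstock_Kurzweil_Integration.integral_nonneg)
        have "cis ` {0..2*pi} \<subseteq> S" using cS by auto
        then have "continuous_on {0..2*pi} (\<lambda>t. U (cis t))"
          by (intro continuous_on_compose2[OF lap2_continuous(1)[OF lU]] continuous_intros)
        then show "(\<lambda>t. 2 * (\<alpha> + 2) * \<epsilon> powr (\<alpha> + 1) * U (cis t)) integrable_on {0..2*pi}"
          by (intro integrable_continuous_real continuous_intros)
        show "0 \<le> 2 * (\<alpha> + 2) * \<epsilon> powr (\<alpha> + 1) * U (cis t)" for t using \<alpha> by (simp add: U_def)
      qed
      finally have G0: "0 \<le> (\<integral>z. indicator (cball 0 1) z * G z \<partial>lborel)" .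
      define H where "H z = (1 + \<epsilon> - (cmod z)\<^sup>2) powr \<alpha> * U z" for z
      \<comment> \<open>\<open>\<kappa>\<close> is chosen so that the singular power t^\<alpha> in
        \<open>H\<close> cancels against the Laplacian of the weight in \<open>G\<close>. What
        remains has exponents \<alpha> + 1 and \<alpha> + 2 in t = 1 + \<epsilon> - |z|^2, and t is
        at most 3 |1 - cnj a z| because \<epsilon> is at most 1 - |a|.\<close>
      have pw: "\<kappa> * H z + G z \<le> C1 * cmod (1 - cnj a * z) powr (- 5)" if z: "z \<in> cball 0 1" for z
      proof -
        define r where "r = cmod (1 - cnj a * z)"
        define s where "s = (cmod z)\<^sup>2"
        define t where "t = 1 + \<epsilon> - s"
        note o = one_minus_cnj_mult[OF a z, folded r_def]
        have s: "0 \<le> s" "s \<le> 1" using z by (auto simp: s_def abs_square_le_1)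
        have t0: "0 < t" "1 - s \<le> t" using s \<epsilon> by (auto simp: t_def)
        have "1 - s = (1 - cmod z) * (1 + cmod z)" by (simp add: s_def power2_eq_square algebra_simps)
        also have "\<dots> \<le> r * 2" using o z by (intro mult_mono) auto
        finally have t3: "t \<le> 3 * r" using o \<epsilon> by (simp add: t_def)
        have Ur: "U z = r powr (- c)" using Upw z cS by (auto simp: r_def)
        have U0: "0 < U z" by (simp add: U_def)
        have tp: "t powr (\<alpha> + 1) = t * t powr \<alpha>" using t0 by (simp add: powr_add mult.commute)
        have bvz: "bv z = 2 * (\<alpha> + 2) * ((\<alpha> + 1) * s * t powr \<alpha> - t powr (\<alpha> + 1))"
          unfolding bv_def t_def s_def by (simp add: norm_mult power_mult_distrib algebra_simps)
        have "t powr \<alpha> \<le> s * t powr \<alpha> + t powr (\<alpha> + 1)"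
        proof -
          have "(1 - s) * t powr \<alpha> \<le> t * t powr \<alpha>" using t0 by (intro mult_right_mono) auto
          then show ?thesis unfolding tp by (simp add: algebra_simps)
        qed
        then have "\<kappa> * (t powr \<alpha>) \<le> \<kappa> * (s * t powr \<alpha> + t powr (\<alpha> + 1))" using \<kappa> by (intro mult_left_mono) auto
        also have "\<dots> = 2 * bv z + 4 * (\<alpha> + 2)\<^sup>2 * t powr (\<alpha> + 1)"
          unfolding bvz \<kappa>_def by (simp add: power2_eq_square algebra_simps)
        finally have "U z * (\<kappa> * t powr \<alpha>) \<le> U z * (2 * bv z + 4 * (\<alpha> + 2)\<^sup>2 * t powr (\<alpha> + 1))" using U0 by (intro mult_left_mono) auto
        then have "\<kappa> * H z + G z \<le> 2 * (v z * bU z) + 4 * (\<alpha> + 2)\<^sup>2 * (t powr (\<alpha> + 1) * U z)"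
          unfolding H_def G_def t_def s_def by (simp add: algebra_simps)
        also have "t powr (\<alpha> + 1) * U z \<le> 3 powr (\<alpha> + 1) * (2 * r powr (- 5))"
        proof -
          have "t powr (\<alpha> + 1) \<le> (3 * r) powr (\<alpha> + 1)" using t0 t3 \<alpha> by (intro powr_mono2) auto
          then have "t powr (\<alpha> + 1) * U z \<le> (3 * r) powr (\<alpha> + 1) * r powr (- c)" unfolding Ur by (intro mult_right_mono) auto
          also have "\<dots> = 3 powr (\<alpha> + 1) * (r powr (\<alpha> + 1) * r powr (- c))" by (simp add: powr_mult)
          also have "r powr (\<alpha> + 1) * r powr (- c) = r powr 1 * r powr (- 5)" by (simp only: powr_add[symmetric] c_def) simp
          also have "3 powr (\<alpha> + 1) * (r powr 1 * r powr (- 5)) \<le> 3 powr (\<alpha> + 1) * (2 * r powr (- 5))"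
            using o by (intro mult_left_mono mult_right_mono) auto
          finally show ?thesis .
        qed
        also have "v z * bU z \<le> 3 powr (\<alpha> + 2) * (c\<^sup>2 / 2 * r powr (- 5))"
        proof -
          have "v z \<le> t powr (\<alpha> + 2)" by (simp add: v_def t_def s_def)
          also have "\<dots> \<le> (3 * r) powr (\<alpha> + 2)" using t0 t3 \<alpha> by (intro powr_mono2) auto
          also have "\<dots> = 3 powr (\<alpha> + 2) * r powr (\<alpha> + 2)" by (simp add: powr_mult)
          finally have v3: "v z \<le> 3 powr (\<alpha> + 2) * r powr (\<alpha> + 2)" .
          have bu: "bU z \<le> 2 * U z * (c\<^sup>2 / 4 * (1 / r\<^sup>2))"
            unfolding bU_def r_def[symmetric] using U0 a by (intro mult_left_mono divide_right_mono) (auto simp: abs_square_le_1)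
          have bu0: "0 \<le> bU z" unfolding bU_def using U0 by simp
          have "v z * bU z \<le> 3 powr (\<alpha> + 2) * r powr (\<alpha> + 2) * (2 * U z * (c\<^sup>2 / 4 * (1 / r\<^sup>2)))"
            by (rule mult_mono[OF v3 bu _ bu0]) simp
          also have "\<dots> = 3 powr (\<alpha> + 2) * (c\<^sup>2 / 2 * (r powr (\<alpha> + 2) * r powr (- c) * (1 / r\<^sup>2)))" unfolding Ur by simp
          also have "1 / r\<^sup>2 = r powr (- 2)" using o by (simp add: powr_minus_divide)
          also have "r powr (\<alpha> + 2) * r powr (- c) * r powr (- 2) = r powr (- 5)" unfolding c_def by (simp flip: powr_add)
          finally show ?thesis .
        qed
        finally show ?thesis unfolding C1_def r_def[symmetric] using \<alpha> by (simp add: algebra_simps)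
      qed
      have Hc: "continuous_on (cball 0 1) H"
      proof -
        have "continuous_on (cball 0 1) U" using lap2_continuous(1)[OF lU] cS by (rule continuous_on_subset)
        moreover have "1 + \<epsilon> - (cmod z)\<^sup>2 \<noteq> 0" if "z \<in> cball 0 1" for z
          using that \<epsilon> abs_square_le_1[of "cmod z"] by auto
        ultimately show ?thesis unfolding H_def[abs_def] by (intro continuous_intros) auto
      qed
      have Gc: "continuous_on (cball 0 1) G"
        unfolding G_def[abs_def]
        by (intro continuous_intros lap2_continuous(1,4)[OF lU, THEN continuous_on_subset, OF cS] lap2_continuous(1,4)[OF lv, THEN continuous_on_subset, OF cS])
      let ?I = "\<lambda>f. (\<integral>z. indicator (cball (0::complex) 1) z * f z \<partial>lborel)"
      let ?k = "\<lambda>z. C1 * cmod (1 - cnj a * z) powr (- 5)"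
      have kc: "continuous_on (cball 0 1) ?k" by (intro continuous_intros continuous_on_kernel_powr a)
      have "?I (\<lambda>z. \<kappa> * H z) \<le> ?I (\<lambda>z. \<kappa> * H z) + ?I G" using G0 by simp
      also have "\<dots> = ?I (\<lambda>z. \<kappa> * H z + G z)"
        unfolding distrib_left by (intro Bochner_Integration.integral_add[symmetric] disc_integral_chords(3) continuous_intros Hc Gc)
      also have "\<dots> \<le> ?I ?k"
        by (intro Bochner_Integration.integral_mono disc_integral_chords(3) continuous_intros Hc Gc kc) (use pw in \<open>auto simp: indicator_def\<close>)
      finally have i: "ennreal (?I (\<lambda>z. \<kappa> * H z)) \<le> ennreal (?I ?k)" by (rule ennreal_leI)
      have "ennreal (?I (\<lambda>z. \<kappa> * H z)) = (\<integral>\<^sup>+z\<in>cball 0 1. ennreal (\<kappa> * H z) \<partial>lborel)"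
        using \<kappa> by (intro integral_cball_eq_nn_integral continuous_intros Hc) (auto simp: H_def U_def)
      moreover have "\<dots> = ennreal \<kappa> * (\<integral>\<^sup>+z\<in>cball 0 1. ennreal (H z) \<partial>lborel)"
        using \<kappa> by (intro cball_nn_integral_cmult Hc) auto
      moreover have "ennreal (?I ?k) = (\<integral>\<^sup>+z\<in>cball 0 1. ennreal (?k z) \<partial>lborel)"
        using C1 by (intro integral_cball_eq_nn_integral kc) auto
      moreover have "\<dots> \<le> ennreal (C1 * C4 / (1 - cmod a) ^ 3)" using C1 a by (intro I5) auto
      ultimately have "ennreal \<kappa> * (\<integral>\<^sup>+z\<in>cball 0 1. ennreal (H z) \<partial>lborel) \<le> ennreal (C1 * C4 / (1 - cmod a) ^ 3)" using i by simp
      then have "ennreal (1 / \<kappa>) * (ennreal \<kappa> * (\<integral>\<^sup>+z\<in>cball 0 1. ennreal (H z) \<partial>lborel)) \<le> ennreal (1 / \<kappa>) * ennreal (C1 * C4 / (1 - cmod a) ^ 3)"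
        by (rule mult_left_mono) simp
      moreover have "ennreal (1 / \<kappa>) * (ennreal \<kappa> * x) = x" for x
        using \<kappa> by (simp add: mult.assoc[symmetric] flip: ennreal_mult)
      moreover have "ennreal (1 / \<kappa>) * ennreal (C1 * C4 / (1 - cmod a) ^ 3) = ennreal (C1 / \<kappa> * C4 / (1 - cmod a) ^ 3)"
        using \<kappa> C1 C4 a by (simp flip: ennreal_mult)
      ultimately have "(\<integral>\<^sup>+z\<in>cball 0 1. ennreal (H z) \<partial>lborel) \<le> ennreal (C1 / \<kappa> * C4 / (1 - cmod a) ^ 3)" by simp
      moreover have "(\<integral>\<^sup>+z\<in>cball 0 1. ennreal ((1 + \<epsilon> - (cmod z)\<^sup>2) powr \<alpha> * cmod (1 - cnj a * z) powr (- c)) \<partial>lborel) = (\<integral>\<^sup>+z\<in>cball 0 1. ennreal (H z) \<partial>lborel)"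
        using Upw cS by (intro nn_integral_cong) (auto simp: indicator_def H_def)
      ultimately show ?thesis by simp
    qed
    show thesis
    proof (rule that[of "C1 / \<kappa> * C4"])
      fix a :: complex assume a: "cmod a < 1"
      \<comment> \<open>A sequence tending to 0 inside the range where \<open>main\<close> holds;
        Fatou then removes the regularisation.\<close>
      define \<epsilon> where "\<epsilon> k = (1 - cmod a) * (1 / real (Suc k))" for k
      have \<epsilon>: "0 < \<epsilon> k" "\<epsilon> k \<le> 1 - cmod a" for k
      proof -
        show "0 < \<epsilon> k" using a by (simp add: \<epsilon>_def)
        have "(1 - cmod a) * (1 / real (Suc k)) \<le> (1 - cmod a) * 1" using a by (intro mult_left_mono) auto
        then show "\<epsilon> k \<le> 1 - cmod a" by (simp add: \<epsilon>_def)
      qed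
      have "(\<lambda>k. (1 - cmod a) * (1 / real (Suc k))) \<longlonglongrightarrow> (1 - cmod a) * 0"
        by (intro tendsto_intros LIMSEQ_Suc[OF lim_1_over_n])
      then have \<epsilon>0: "\<epsilon> \<longlonglongrightarrow> 0" by (simp add: \<epsilon>_def[abs_def])
      define f where "f k z = ennreal ((1 + \<epsilon> k - (cmod z)\<^sup>2) powr \<alpha> * cmod (1 - cnj a * z) powr (- c)) * indicator (cball 0 1) z" for k z
      have meas: "f k \<in> borel_measurable lborel" for k
      proof -
        have "continuous_on (cball 0 1) (\<lambda>z. (1 + \<epsilon> k - (cmod z)\<^sup>2) powr \<alpha> * cmod (1 - cnj a * z) powr (- c))"
        proof (rule continuous_on_mult[OF _ continuous_on_kernel_powr[OF a]])
          have "1 + \<epsilon> k - (cmod z)\<^sup>2 \<noteq> 0" if "z \<in> cball 0 1" for z :: complex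
            using that \<epsilon>(1)[of k] abs_square_le_1[of "cmod z"] by auto
          then show "continuous_on (cball 0 1) (\<lambda>z::complex. (1 + \<epsilon> k - (cmod z)\<^sup>2) powr \<alpha>)"
            by (intro continuous_intros) auto
        qed
        from borel_measurable_continuous_on_indicator[OF _ this]
        have "(\<lambda>z. ennreal (indicator (cball 0 1) z *\<^sub>R ((1 + \<epsilon> k - (cmod z)\<^sup>2) powr \<alpha> * cmod (1 - cnj a * z) powr (- c)))) \<in> borel_measurable lborel" by simp
        moreover have "ennreal (indicator (cball 0 1) z *\<^sub>R ((1 + \<epsilon> k - (cmod z)\<^sup>2) powr \<alpha> * cmod (1 - cnj a * z) powr (- c))) = f k z" for z
          by (simp add: f_def indicator_def)
        ultimately show ?thesis by (simp only:)
      qed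
      have "(\<integral>\<^sup>+z\<in>disc. ennreal ((1 - (cmod z)\<^sup>2) powr \<alpha> * cmod (1 - cnj a * z) powr (- (\<alpha> + 5))) \<partial>lborel) \<le> (\<integral>\<^sup>+z. liminf (\<lambda>k. f k z) \<partial>lborel)"
      proof (intro nn_integral_mono)
        fix z
        show "ennreal ((1 - (cmod z)\<^sup>2) powr \<alpha> * cmod (1 - cnj a * z) powr (- (\<alpha> + 5))) * indicator disc z \<le> liminf (\<lambda>k. f k z)"
        proof (cases "z \<in> disc")
          case True
          have "(cmod z)\<^sup>2 < 1" using True by (simp add: abs_square_less_1)
          then have "(\<lambda>k. (1 + \<epsilon> k - (cmod z)\<^sup>2) powr \<alpha> * cmod (1 - cnj a * z) powr (- c)) \<longlonglongrightarrow> (1 + 0 - (cmod z)\<^sup>2) powr \<alpha> * cmod (1 - cnj a * z) powr (- c)"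
            by (intro tendsto_intros \<epsilon>0) auto
          then have "(\<lambda>k. ennreal ((1 + \<epsilon> k - (cmod z)\<^sup>2) powr \<alpha> * cmod (1 - cnj a * z) powr (- c))) \<longlonglongrightarrow> ennreal ((1 - (cmod z)\<^sup>2) powr \<alpha> * cmod (1 - cnj a * z) powr (- c))"
            by (intro tendsto_ennrealI) simp
          then have "(\<lambda>k. f k z) \<longlonglongrightarrow> ennreal ((1 - (cmod z)\<^sup>2) powr \<alpha> * cmod (1 - cnj a * z) powr (- c))"
            using True by (simp add: f_def)
          then have "liminf (\<lambda>k. f k z) = ennreal ((1 - (cmod z)\<^sup>2) powr \<alpha> * cmod (1 - cnj a * z) powr (- c))"
            by (intro lim_imp_Liminf) auto
          then show ?thesis using True by (simp add: c_def)
        qed simp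
      qed
      also have "\<dots> \<le> liminf (\<lambda>k. \<integral>\<^sup>+z. f k z \<partial>lborel)" by (rule nn_integral_liminf[OF meas])
      also have "\<dots> \<le> ennreal (C1 / \<kappa> * C4 / (1 - cmod a) ^ 3)"
        unfolding f_def by (intro Liminf_le always_eventually allI main a \<epsilon>) simp
      finally show "(\<integral>\<^sup>+z\<in>disc. ennreal ((1 - (cmod z)\<^sup>2) powr \<alpha> * cmod (1 - cnj a * z) powr (- (\<alpha> + 5))) \<partial>lborel) \<le> ennreal (C1 / \<kappa> * C4 / (1 - cmod a) ^ 3)" .
    qed (use C1 C4 \<kappa> in auto)
  qed
qed

section \<open>Chains on the disc and test functions\<close>

lemma finite_zeros_cball:
  assumes h: "h holomorphic_on ball 0 R" and z0: "z0 \<in> ball 0 R" "h z0 \<noteq> 0" and \<rho>: "\<rho> < R"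
  shows "finite {z \<in> cball (0::complex) \<rho>. h z = 0}"
proof (cases "h constant_on ball 0 R")
  case True
  then obtain c where c: "\<And>z. z \<in> ball 0 R \<Longrightarrow> h z = c" unfolding constant_on_def by blast
  have "{z \<in> cball (0::complex) \<rho>. h z = 0} = {}"
  proof -
    have "h z \<noteq> 0" if "z \<in> cball 0 \<rho>" for z using c[of z] c[OF z0(1)] z0(2) that \<rho> by auto
    then show ?thesis by auto
  qed
  then show ?thesis by (simp only: finite.emptyI)
next
  case False
  show ?thesis
    by (rule holomorphic_compact_finite_zeros[OF h _ _ _ _ False]) (use \<rho> in auto)
qed

text \<open>Supplies the finite exceptional set, namely 0 and the zeros of \<open>g\<close> and of
  all \<open>F i\<close>. If g' vanishes identically the left side is 0; otherwise none of these
  functions vanishes identically.\<close>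

lemma chain_disc_estimate:
  fixes K N :: nat and m :: "nat \<Rightarrow> nat" and \<sigma> :: real
  assumes K: "K \<ge> 2" and m: "(\<Sum>i=1..K. real (m i)) = \<sigma> * real K"
  obtains C0 :: real where "0 < C0"
    "\<And>R g F x \<beta> a C' M S v Dv av bv m1 m2 P. 1 < R \<Longrightarrow> g holomorphic_on ball 0 R \<Longrightarrow>
      (\<And>i. i \<le> K \<Longrightarrow> F i holomorphic_on ball 0 R) \<Longrightarrow>
      (\<And>z. z \<in> ball 0 R - {0} \<Longrightarrow> F 0 z \<noteq> 0) \<Longrightarrow>
      (\<And>i z. i < K \<Longrightarrow> z \<in> ball 0 R \<Longrightarrow> deriv (F (Suc i)) z = g z ^ m (Suc i) * deriv g z * F i z) \<Longrightarrow>
      (\<And>k. k < N \<Longrightarrow> lap2 (ball 0 R - {0}) (x k) (\<beta> k) (a k) (\<lambda>z. 0)) \<Longrightarrow>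
      (\<And>k z. k < N \<Longrightarrow> z \<in> cball 0 1 - {0} \<Longrightarrow> x k z \<ge> 0) \<Longrightarrow>
      0 \<le> C' \<Longrightarrow>
      (\<And>z. z \<in> cball 0 1 - {0} \<Longrightarrow> (cmod (deriv (F 0) z / F 0 z))\<^sup>2 \<le> C' * (\<Sum>k<N. (cmod (\<beta> k z))\<^sup>2)) \<Longrightarrow>
      (\<And>z. z \<in> ball 0 R - {0} \<Longrightarrow> (cmod (F K z) / cmod (F 0 z)) powr (2 / K) * (1 + (\<Sum>k<N. exp (2 * x k z))) \<le> M) \<Longrightarrow>
      cball 0 1 \<subseteq> S \<Longrightarrow>
      lap2 S v Dv av bv \<Longrightarrow> (\<And>z. z \<in> cball 0 1 \<Longrightarrow> 0 \<le> v z) \<Longrightarrow> (\<And>z. cmod z = 1 \<Longrightarrow> v z = 0) \<Longrightarrow>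
      (\<And>z. z \<in> cball 0 1 \<Longrightarrow> 2 * bv z = m1 z - m2 z) \<Longrightarrow> (\<And>z. z \<in> cball 0 1 \<Longrightarrow> 0 \<le> m1 z) \<Longrightarrow>
      (\<And>z. z \<in> cball 0 1 \<Longrightarrow> 0 \<le> m2 z) \<Longrightarrow> continuous_on (cball 0 1) m1 \<Longrightarrow> continuous_on (cball 0 1) m2 \<Longrightarrow>
      (\<And>t. 0 \<le> P t) \<Longrightarrow> (\<And>t. - Re (cis t * Dv (cis t)) = P t) \<Longrightarrow>
      (\<integral>\<^sup>+z\<in>cball 0 1. ennreal (v z * (cmod (g z) powr \<sigma> * cmod (deriv g z))\<^sup>2) \<partial>lborel) \<le>
        (\<integral>\<^sup>+z\<in>cball 0 1. ennreal (C0 * (1 + C') * ((cmod (F K z) / cmod (F 0 z)) powr (2 / K) * (1 + (\<Sum>k<N. exp (2 * x k z)))) * m1 z) \<partial>lborel)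
      + (\<integral>\<^sup>+t\<in>{0..2*pi}. ennreal (P t * (C0 * (1 + C') * ((cmod (F K (cis t)) / cmod (F 0 (cis t))) powr (2 / K) * (1 + (\<Sum>k<N. exp (2 * x k (cis t))))))) \<partial>lborel)"
proof -
  show thesis
  proof (rule chain_green[where N=N, OF K m], goal_cases)
    case (1 C0)
    note C0 = 1(1) and est = 1(2)
    show thesis
    proof (rule that[OF C0])
      fix R :: real and g :: "complex \<Rightarrow> complex" and F :: "nat \<Rightarrow> complex \<Rightarrow> complex" and x :: "nat \<Rightarrow> complex \<Rightarrow> real" and \<beta> a :: "nat \<Rightarrow> complex \<Rightarrow> complex" and C' M :: real
        and S :: "complex set" and v :: "complex \<Rightarrow> real" and Dv av :: "complex \<Rightarrow> complex" and bv m1 m2 :: "complex \<Rightarrow> real" and P :: "real \<Rightarrow> real"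
      assume R: "1 < R" and g: "g holomorphic_on ball 0 R" and F: "\<And>i. i \<le> K \<Longrightarrow> F i holomorphic_on ball 0 R"
        and F0: "\<And>z. z \<in> ball 0 R - {0} \<Longrightarrow> F 0 z \<noteq> 0"
        and chain: "\<And>i z. i < K \<Longrightarrow> z \<in> ball 0 R \<Longrightarrow> deriv (F (Suc i)) z = g z ^ m (Suc i) * deriv g z * F i z"
        and x: "\<And>k. k < N \<Longrightarrow> lap2 (ball 0 R - {0}) (x k) (\<beta> k) (a k) (\<lambda>z. 0)"
        and x0: "\<And>k z. k < N \<Longrightarrow> z \<in> cball 0 1 - {0} \<Longrightarrow> x k z \<ge> 0"
        and C': "0 \<le> C'" "\<And>z. z \<in> cball 0 1 - {0} \<Longrightarrow> (cmod (deriv (F 0) z / F 0 z))\<^sup>2 \<le> C' * (\<Sum>k<N. (cmod (\<beta> k z))\<^sup>2)"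
        and M: "\<And>z. z \<in> ball 0 R - {0} \<Longrightarrow> (cmod (F K z) / cmod (F 0 z)) powr (2 / K) * (1 + (\<Sum>k<N. exp (2 * x k z))) \<le> M"
        and S: "cball 0 1 \<subseteq> S"
        and v: "lap2 S v Dv av bv" "\<And>z. z \<in> cball 0 1 \<Longrightarrow> 0 \<le> v z" "\<And>z. cmod z = 1 \<Longrightarrow> v z = 0"
        and mm: "\<And>z. z \<in> cball 0 1 \<Longrightarrow> 2 * bv z = m1 z - m2 z" "\<And>z. z \<in> cball 0 1 \<Longrightarrow> 0 \<le> m1 z"
           "\<And>z. z \<in> cball 0 1 \<Longrightarrow> 0 \<le> m2 z" "continuous_on (cball 0 1) m1" "continuous_on (cball 0 1) m2"
        and P: "\<And>t. 0 \<le> P t" "\<And>t. - Re (cis t * Dv (cis t)) = P t"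
      define rhs where "rhs = (\<integral>\<^sup>+z\<in>cball 0 1. ennreal (C0 * (1 + C') * ((cmod (F K z) / cmod (F 0 z)) powr (2 / K) * (1 + (\<Sum>k<N. exp (2 * x k z)))) * m1 z) \<partial>lborel)
        + (\<integral>\<^sup>+t\<in>{0..2*pi}. ennreal (P t * (C0 * (1 + C') * ((cmod (F K (cis t)) / cmod (F 0 (cis t))) powr (2 / K) * (1 + (\<Sum>k<N. exp (2 * x k (cis t))))))) \<partial>lborel)"
      have "(\<integral>\<^sup>+z\<in>cball 0 1. ennreal (v z * (cmod (g z) powr \<sigma> * cmod (deriv g z))\<^sup>2) \<partial>lborel) \<le> rhs"
      proof (cases "\<forall>z\<in>ball 0 R. deriv g z = 0")
        case True
        have "(\<integral>\<^sup>+z\<in>cball 0 1. ennreal (v z * (cmod (g z) powr \<sigma> * cmod (deriv g z))\<^sup>2) \<partial>lborel) = (\<integral>\<^sup>+z. 0 \<partial>(lborel :: complex measure))"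
          using True R by (intro nn_integral_cong) (auto simp: indicator_def)
        then show ?thesis by simp
      next
        case False
        then obtain z1 where z1: "z1 \<in> ball 0 R" "deriv g z1 \<noteq> 0" by blast
        \<comment> \<open>Zeros may accumulate at the boundary of \<open>ball 0 R\<close>, so they
          are collected in a closed disc of an intermediate radius.\<close>
        define \<rho> where "\<rho> = (1 + R) / 2"
        have \<rho>: "1 < \<rho>" "\<rho> < R" using R by (auto simp: \<rho>_def)
        have zero_deriv: "deriv h z = 0" if "\<And>w. w \<in> ball 0 R \<Longrightarrow> h w = 0" "z \<in> ball 0 R" for h :: "complex \<Rightarrow> complex" and z
        proof -
          have "(h has_field_derivative 0) (at z)"
            by (rule has_field_derivative_transform_within_open[OF DERIV_const[of 0], where S="ball 0 R"]) (use that in auto)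
          then show ?thesis by (rule DERIV_imp_deriv)
        qed
        obtain z2 where z2: "z2 \<in> ball 0 R" "g z2 \<noteq> 0" using zero_deriv[of g z1] z1 by blast
        have dg: "deriv g holomorphic_on ball 0 R" by (rule holomorphic_deriv[OF g]) simp
        have fg: "finite {z \<in> cball 0 \<rho>. g z = 0}" and fdg: "finite {z \<in> cball 0 \<rho>. deriv g z = 0}"
          by (rule finite_zeros_cball[OF g z2 \<rho>(2)], rule finite_zeros_cball[OF dg z1 \<rho>(2)])
        \<comment> \<open>Inductively, g, g' and \<open>F i\<close> have a common nonzero point
          because each has finitely many zeros in an infinite disc; there the derivative of the next
          function is nonzero.\<close>
        have nz: "\<exists>z\<in>ball 0 R. F i z \<noteq> 0" if "i \<le> K" for i
          using that
        proof (induction i)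
          case 0
          show ?case by (rule bexI[of _ 1], rule F0) (use R in auto)
        next
          case (Suc i)
          then obtain z0 where z0: "z0 \<in> ball 0 R" "F i z0 \<noteq> 0" by auto
          have "finite {z \<in> cball 0 \<rho>. F i z = 0}" by (rule finite_zeros_cball[OF F z0 \<rho>(2)]) (use Suc in simp)
          then have "finite ({z \<in> cball 0 \<rho>. g z = 0} \<union> {z \<in> cball 0 \<rho>. deriv g z = 0} \<union> {z \<in> cball 0 \<rho>. F i z = 0})"
            using fg fdg by simp
          moreover have "infinite (cball (0::complex) \<rho>)"
            using \<rho> uncountable_cball[of \<rho> "0::complex"] countable_finite by auto
          ultimately obtain z where z: "z \<in> cball 0 \<rho>" "g z \<noteq> 0" "deriv g z \<noteq> 0" "F i z \<noteq> 0"
            using finite_subset[of "cball 0 \<rho>" "{z \<in> cball 0 \<rho>. g z = 0} \<union> {z \<in> cball 0 \<rho>. deriv g z = 0} \<union> {z \<in> cball 0 \<rho>. F i z = 0}"] by blast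
          then have zR: "z \<in> ball 0 R" using \<rho> by auto
          have "deriv (F (Suc i)) z \<noteq> 0" using chain[OF _ zR, of i] Suc z by simp
          then show ?case using zero_deriv[of "F (Suc i)" z] zR by blast
        qed
        define Z where "Z = insert 0 ({z \<in> cball 0 \<rho>. g z = 0} \<union> (\<Union>i\<le>K. {z \<in> cball 0 \<rho>. F i z = 0}))"
        define T where "T = ball 0 \<rho> \<inter> S"
        have oT: "open T" unfolding T_def using lap2_continuous(5)[OF v(1)] by auto
        have "finite {z \<in> cball 0 \<rho>. F i z = 0}" if i: "i \<le> K" for i
        proof -
          obtain z0 where z0: "z0 \<in> ball 0 R" "F i z0 \<noteq> 0" using nz[OF i] by blast
          show ?thesis by (rule finite_zeros_cball[OF F[OF i] z0 \<rho>(2)])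
        qed
        then have fZ: "finite Z" unfolding Z_def using fg by auto
        have TR: "T \<subseteq> ball 0 R" using \<rho> by (auto simp: T_def)
        have Z0: "0 \<in> Z" by (simp add: Z_def)
        have TZ: "T - Z \<subseteq> ball 0 R - {0}" using TR Z0 by auto
        have cT: "cball 0 1 \<subseteq> T" using S \<rho> by (auto simp: T_def)
        have cZ: "z \<in> cball 0 1 - {0}" if "z \<in> cball 0 1 - Z" for z using that Z0 by auto
        show ?thesis unfolding rhs_def
        proof (rule est[where S=T and Z=Z and \<beta>=\<beta> and a=a and ?m2.0=m2 and M=M])
          show "g holomorphic_on T" "\<And>i. i \<le> K \<Longrightarrow> F i holomorphic_on T"
            using g F TR by (auto intro: holomorphic_on_subset)
          show "g z \<noteq> 0" if "z \<in> T - Z" for z using that by (auto simp: T_def Z_def)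
          show "F i z \<noteq> 0" if "i \<le> K" "z \<in> T - Z" for i z using that by (auto simp: T_def Z_def)
          show "deriv (F (Suc i)) z = g z ^ m (Suc i) * deriv g z * F i z" if "i < K" "z \<in> T" for i z
            using chain that TR by auto
          show "lap2 (T - Z) (x k) (\<beta> k) (a k) (\<lambda>z. 0)" if "k < N" for k
            by (rule lap2_subset[OF x[OF that] _ TZ]) (intro open_Diff oT finite_imp_closed fZ)
          show "lap2 T v Dv av bv" by (rule lap2_subset[OF v(1) oT]) (simp add: T_def)
          show "(cmod (F K z) / cmod (F 0 z)) powr (2 / K) * (1 + (\<Sum>k<N. exp (2 * x k z))) \<le> M" if "z \<in> T - Z" for z
            using that TZ by (intro M) auto
          show "(cmod (deriv (F 0) z / F 0 z))\<^sup>2 \<le> C' * (\<Sum>k<N. (cmod (\<beta> k z))\<^sup>2)" if "z \<in> cball 0 1 - Z" for z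
            by (rule C'(2)[OF cZ[OF that]])
          show "x k z \<ge> 0" if "k < N" "z \<in> cball 0 1 - Z" for k z by (rule x0[OF that(1) cZ[OF that(2)]])
        qed (fact oT fZ cT C'(1) v(2) v(3) mm P)+
      qed
      then show "(\<integral>\<^sup>+z\<in>cball 0 1. ennreal (v z * (cmod (g z) powr \<sigma> * cmod (deriv g z))\<^sup>2) \<partial>lborel) \<le>
          (\<integral>\<^sup>+z\<in>cball 0 1. ennreal (C0 * (1 + C') * ((cmod (F K z) / cmod (F 0 z)) powr (2 / K) * (1 + (\<Sum>k<N. exp (2 * x k z)))) * m1 z) \<partial>lborel)
        + (\<integral>\<^sup>+t\<in>{0..2*pi}. ennreal (P t * (C0 * (1 + C') * ((cmod (F K (cis t)) / cmod (F 0 (cis t))) powr (2 / K) * (1 + (\<Sum>k<N. exp (2 * x k (cis t))))))) \<partial>lborel)"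
        unfolding rhs_def .
    qed
  qed
qed

text \<open>Each of the j blocks contributes m exactly once, which identifies the average exponent
  \<sigma> of the chain as m/n.\<close>

lemma sum_if_dvd:
  assumes "n \<ge> 1"
  shows "(\<Sum>i=1..n * j. real (if n dvd i then m else 0)) = real m / real n * real (n * j)"
proof (induction j)
  case (Suc j)
  have "(\<Sum>i=1..n * Suc j. real (if n dvd i then m else 0)) =
      (\<Sum>i=1..n * j. real (if n dvd i then m else 0)) + (\<Sum>i=n * j + 1..n * j + n. real (if n dvd i then m else 0))"
    by (subst sum.ub_add_nat[symmetric]) (simp_all add: add.commute)
  also have "(\<Sum>i=n * j + 1..n * j + n. real (if n dvd i then m else 0)) = (\<Sum>i\<in>{n * j + n}. real m)"
  proof (rule sum.mono_neutral_cong_right)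
    show "\<forall>i\<in>{n * j + 1..n * j + n} - {n * j + n}. real (if n dvd i then m else 0) = 0"
    proof
      fix i assume "i \<in> {n * j + 1..n * j + n} - {n * j + n}"
      then have "n * j < i" "i < n * Suc j" by auto
      have "\<not> n dvd i"
      proof
        assume "n dvd i"
        then obtain k where "i = n * k" by (elim dvdE)
        then have "n * j < n * k" "n * k < n * Suc j" using \<open>n * j < i\<close> \<open>i < n * Suc j\<close> by simp_all
        then have "j < k" "k < Suc j" by (simp_all only: mult_less_cancel1)
        then show False by simp
      qed
      then show "real (if n dvd i then m else 0) = 0" by simp
    qed
  qed (use assms in auto)
  finally show ?case using Suc assms by (simp add: field_simps)
qed simp

text \<open>For x at most t the first summand suffices; beyond t the lower power is bounded by the
  higher one. It is applied with t = N^j, which balances the two sides.\<close>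

lemma powr_le_young:
  fixes x t p q :: real
  assumes "0 < q" "q \<le> p" "0 < t" "0 \<le> x"
  shows "x powr q \<le> t powr q + t powr (q - p) * x powr p"
proof (cases "x \<le> t")
  case True
  then have "x powr q \<le> t powr q" using assms by (intro powr_mono2) auto
  then show ?thesis by (simp add: add_increasing2)
next
  case False
  then have "x powr (q - p) \<le> t powr (q - p)" using assms by (intro powr_mono2') auto
  then have "x powr (q - p) * x powr p \<le> t powr (q - p) * x powr p" by (intro mult_right_mono) auto
  moreover have "x powr (q - p) * x powr p = x powr q" by (simp flip: powr_add)
  ultimately show ?thesis by (simp add: add_increasing)
qed

lemma nn_integral_cball_affine:
  fixes \<phi> :: "complex \<Rightarrow> real"
  assumes \<phi>: "continuous_on (cball c \<rho>) \<phi>" and \<rho>: "0 < \<rho>"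
  shows "(\<integral>\<^sup>+z\<in>cball c \<rho>. ennreal (\<phi> z) \<partial>lborel) = ennreal (\<rho>\<^sup>2) * (\<integral>\<^sup>+w\<in>cball 0 1. ennreal (\<phi> (c + of_real \<rho> * w)) \<partial>lborel)"
proof -
  define h where "h z = ennreal (\<phi> z) * indicator (cball c \<rho>) z" for z
  have "(\<lambda>z. ennreal (indicator (cball c \<rho>) z *\<^sub>R \<phi> z)) \<in> borel_measurable borel"
    using borel_measurable_continuous_on_indicator[OF _ \<phi>] by simp
  moreover have "ennreal (indicator (cball c \<rho>) z *\<^sub>R \<phi> z) = h z" for z by (simp add: h_def indicator_def)
  ultimately have hm: "h \<in> borel_measurable borel" by (simp only:)
  have "(\<integral>\<^sup>+z. h z \<partial>lborel) = (\<integral>\<^sup>+z. h z \<partial>density (distr lborel borel (\<lambda>w. c + \<rho> *\<^sub>R w)) (\<lambda>_. ennreal (\<bar>\<rho> ^ DIM(complex)\<bar>)))"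
    using lborel_affine[of \<rho> c] \<rho> by simp
  also have "\<dots> = (\<integral>\<^sup>+w. ennreal (\<rho>\<^sup>2) * h (c + \<rho> *\<^sub>R w) \<partial>lborel)"
    using hm \<rho> by (simp add: nn_integral_density nn_integral_distr)
  also have "\<dots> = ennreal (\<rho>\<^sup>2) * (\<integral>\<^sup>+w. h (c + \<rho> *\<^sub>R w) \<partial>lborel)"
    using hm by (intro nn_integral_cmult) simp
  also have "(\<integral>\<^sup>+w. h (c + \<rho> *\<^sub>R w) \<partial>lborel) = (\<integral>\<^sup>+w\<in>cball 0 1. ennreal (\<phi> (c + of_real \<rho> * w)) \<partial>lborel)"
  proof (intro nn_integral_cong)
    fix w
    have "dist c (c + of_real \<rho> * w) = \<rho> * cmod w" using \<rho> by (simp add: dist_norm norm_mult)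
    then have "c + of_real \<rho> * w \<in> cball c \<rho> \<longleftrightarrow> w \<in> cball 0 1" using \<rho> by (simp add: mult_le_cancel_left1)
    then show "h (c + \<rho> *\<^sub>R w) = ennreal (\<phi> (c + of_real \<rho> * w)) * indicator (cball 0 1) w"
      by (simp add: h_def indicator_def scaleR_conv_of_real)
  qed
  finally show ?thesis by (simp add: h_def)
qed

section \<open>Test functions\<close>

text \<open>The branch of (1 - cnj b z)^(-c) given by the principal logarithm; where |cnj b z| < 1
  the base has positive real part.\<close>

definition power_kernel :: "complex \<Rightarrow> real \<Rightarrow> complex \<Rightarrow> complex" where
  "power_kernel b c z = exp (- of_real c * Ln (1 - cnj b * z))"

lemma power_kernel_properties:
  assumes z: "cmod (cnj b * z) < 1"
  shows "(power_kernel b c has_field_derivative power_kernel b c z * (of_real c * cnj b / (1 - cnj b * z))) (at z)"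
    and "cmod (power_kernel b c z) = cmod (1 - cnj b * z) powr (- c)"
    and "power_kernel b c z \<noteq> 0"
proof -
  have "Re (cnj b * z) < 1" using complex_Re_le_cmod[of "cnj b * z"] z by linarith
  then have re: "0 < Re (1 - cnj b * z)" by simp
  then have "1 - cnj b * z \<notin> \<real>\<^sub>\<le>\<^sub>0" by (simp add: complex_nonpos_Reals_iff)
  have "1 - cnj b * z \<noteq> 0"
  proof
    assume "1 - cnj b * z = 0"
    with re show False by (simp only: zero_complex.simps less_irrefl)
  qed
  note nz = \<open>1 - cnj b * z \<notin> \<real>\<^sub>\<le>\<^sub>0\<close> this
  show "(power_kernel b c has_field_derivative power_kernel b c z * (of_real c * cnj b / (1 - cnj b * z))) (at z)"
    unfolding power_kernel_def[abs_def] using nz by (auto intro!: derivative_eq_intros simp: field_simps)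
  show "cmod (power_kernel b c z) = cmod (1 - cnj b * z) powr (- c)"
    using nz(2) by (simp add: power_kernel_def powr_def)
  show "power_kernel b c z \<noteq> 0" by (simp add: power_kernel_def)
qed

lemma holomorphic_power_kernel: "cmod b < 1 \<Longrightarrow> power_kernel b c holomorphic_on disc"
proof -
  assume b: "cmod b < 1"
  have "cmod (cnj b * z) < 1" if "z \<in> disc" for z
  proof -
    have "cmod b * cmod z \<le> 1 * cmod z" using b by (intro mult_right_mono) auto
    then show ?thesis using that by (simp add: norm_mult)
  qed
  then show ?thesis unfolding holomorphic_on_open[OF open_ball] using power_kernel_properties(1) by blast
qed

lemma norm_le_of_deriv_bound:
  assumes F: "F holomorphic_on ball 0 R" "F 0 = 0" and z: "z \<in> ball 0 R"
    and d: "\<And>w. cmod w \<le> cmod z \<Longrightarrow> cmod (deriv F w) \<le> B"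
  shows "cmod (F z) \<le> B * cmod z"
proof -
  have "cmod (F z - F 0) \<le> B * cmod (z - 0)"
  proof (rule field_differentiable_bound[of "cball 0 (cmod z)"])
    fix w :: complex assume w: "w \<in> cball 0 (cmod z)"
    then have "w \<in> ball 0 R" using z by auto
    then show "(F has_field_derivative deriv F w) (at w within cball 0 (cmod z))"
      using holomorphic_derivI[OF F(1) open_ball] has_field_derivative_at_within by blast
    show "cmod (deriv F w) \<le> B" using d w by simp
  qed auto
  then show ?thesis using F by simp
qed

lemma divide_ennreal_le_iff:
  assumes "0 < c" "0 \<le> y"
  shows "X / ennreal c \<le> ennreal y \<longleftrightarrow> X \<le> ennreal (c * y)"
proof (cases X)
  case (real x)
  then show ?thesis using assms by (simp add: divide_ennreal ennreal_le_iff divide_le_eq mult.commute)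
next
  case top
  then show ?thesis using assms by (simp add: ennreal_top_divide top_unique)
qed

lemma nn_integral_lincomb:
  fixes u v :: "'a \<Rightarrow> real"
  assumes m: "(\<lambda>t. indicator A t * u t) \<in> borel_measurable M" "(\<lambda>t. indicator A t * v t) \<in> borel_measurable M"
    and nn: "\<And>t. 0 \<le> u t" "\<And>t. 0 \<le> v t" "0 \<le> c" "0 \<le> d"
  shows "(\<integral>\<^sup>+t\<in>A. ennreal (c * u t + d * v t) \<partial>M) = ennreal c * (\<integral>\<^sup>+t\<in>A. ennreal (u t) \<partial>M) + ennreal d * (\<integral>\<^sup>+t\<in>A. ennreal (v t) \<partial>M)"
proof -
  have e: "ennreal (w t) * indicator A t = ennreal (indicator A t * w t)" for w :: "'a \<Rightarrow> real" and t by (simp add: indicator_def)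
  have "(\<integral>\<^sup>+t\<in>A. ennreal (c * u t + d * v t) \<partial>M) = (\<integral>\<^sup>+t. ennreal c * ennreal (indicator A t * u t) + ennreal d * ennreal (indicator A t * v t) \<partial>M)"
    using nn by (intro nn_integral_cong) (simp add: indicator_def ennreal_mult')
  also have "\<dots> = ennreal c * (\<integral>\<^sup>+t. ennreal (indicator A t * u t) \<partial>M) + ennreal d * (\<integral>\<^sup>+t. ennreal (indicator A t * v t) \<partial>M)"
    using m by (simp add: nn_integral_add nn_integral_cmult)
  finally show ?thesis unfolding e .
qed

lemma lap2_scaled_ln_cmod:
  assumes "h holomorphic_on S" "open S" "\<And>z. z \<in> S \<Longrightarrow> h z \<noteq> 0"
  shows "lap2 S (\<lambda>z. k * ln (cmod (h z))) (\<lambda>z. of_real k * (deriv h z / h z)) (\<lambda>z. of_real k * deriv (\<lambda>z. deriv h z / h z) z) (\<lambda>z. 0)"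
  using lap2_cmult[OF lap2_ln_cmod[OF assms], of k] by simp

text \<open>The function of index i + 1 vanishes at 0, hence is O(|z|); it is a factor of the next
  derivative, and integration gains another power. The test function vanishes only simply, so the
  ratio to it still vanishes at 0 and can absorb a negative power of |z|.\<close>

lemma iterate_chain_double_zero:
  assumes g: "g holomorphic_on disc" and f: "f holomorphic_on disc" and \<rho>: "\<rho> < 1"
  obtains B :: real where "0 \<le> B" "\<And>z. z \<in> cball 0 \<rho> \<Longrightarrow> cmod (iterate_chain n m g f (Suc (Suc i)) z) \<le> B * (cmod z)\<^sup>2"
proof -
  note P = iterate_chain_properties[OF g f, where n=n and m=m]
  define F where "F = iterate_chain n m g f (Suc i)"
  define G where "G z = g z ^ (if n dvd Suc (Suc i) then m else 0) * deriv g z" for z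
  have dg: "deriv g holomorphic_on disc" "deriv F holomorphic_on disc" unfolding F_def by (intro holomorphic_deriv g P(1) open_ball)+
  have bnd: "\<exists>B\<ge>0. \<forall>z\<in>cball 0 \<rho>. cmod (h z) \<le> B" if h: "h holomorphic_on disc" for h
  proof -
    have "compact (h ` cball 0 \<rho>)"
      by (intro compact_continuous_image compact_cball continuous_on_subset[OF holomorphic_on_imp_continuous_on[OF h]]) (use \<rho> in auto)
    then obtain B where "\<forall>y\<in>h ` cball 0 \<rho>. cmod y \<le> B" using compact_imp_bounded bounded_iff by metis
    then have "\<forall>z\<in>cball 0 \<rho>. cmod (h z) \<le> max B 0" by force
    then show ?thesis by (intro exI[of _ "max B 0"]) simp
  qed
  obtain B1 where B1: "0 \<le> B1" "\<And>z. z \<in> cball 0 \<rho> \<Longrightarrow> cmod (deriv F z) \<le> B1" using bnd[OF dg(2)] by blast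
  have "G holomorphic_on disc" unfolding G_def by (intro holomorphic_intros g dg)
  then obtain B2 where B2: "0 \<le> B2" "\<And>z. z \<in> cball 0 \<rho> \<Longrightarrow> cmod (G z) \<le> B2" using bnd by blast
  have F1: "cmod (F z) \<le> B1 * cmod z" if z: "z \<in> cball 0 \<rho>" for z
    by (rule norm_le_of_deriv_bound[of _ 1]) (use z \<rho> B1(2) P(1,3) in \<open>auto simp: F_def simp del: iterate_chain.simps\<close>)
  show thesis
  proof (rule that)
    show "0 \<le> B2 * B1" using B1 B2 by simp
    fix z :: complex assume z: "z \<in> cball 0 \<rho>"
    have "cmod (iterate_chain n m g f (Suc (Suc i)) z) \<le> (B2 * (B1 * cmod z)) * cmod z"
    proof (rule norm_le_of_deriv_bound[of _ 1])
      fix w assume w: "cmod w \<le> cmod z"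
      then have w': "w \<in> cball 0 \<rho>" "w \<in> disc" using z \<rho> by auto
      have "cmod (deriv (iterate_chain n m g f (Suc (Suc i))) w) = cmod (G w) * cmod (F w)"
        unfolding P(2)[OF w'(2)] by (simp add: G_def F_def norm_mult)
      also have "\<dots> \<le> B2 * (B1 * cmod w)" using B1 B2 F1[OF w'(1)] w' by (intro mult_mono) auto
      also have "\<dots> \<le> B2 * (B1 * cmod z)" using w B1 B2 by (intro mult_left_mono) auto
      finally show "cmod (deriv (iterate_chain n m g f (Suc (Suc i))) w) \<le> B2 * (B1 * cmod z)" .
    qed (use z \<rho> in \<open>auto intro: P(1) P(3) simp del: iterate_chain.simps\<close>)
    then show "cmod (iterate_chain n m g f (Suc (Suc i)) z) \<le> B2 * B1 * (cmod z)\<^sup>2" by (simp add: power2_eq_square mult_ac)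
  qed
qed

text \<open>Here y is |1 - cnj a z| on the circle, d is 1 - |a|, and
  \<open>r * y powr (- 3 / (2 * p))\<close> is the modulus of the test function. After Young's
  inequality the p-th power carries y^(-2) from the Poisson weight, y^(3/2) from the test function
  and y^(1/2) from the perturbation, whose exponents sum to 0.\<close>

lemma circle_test_pointwise:
  fixes y d r q p F t P :: real
  assumes d: "0 < d" "d \<le> y" and r: "1 / 2 \<le> r" and q: "0 < q" "q \<le> p" and t: "0 < t" and F: "0 \<le> F"
    and P: "0 \<le> P" "P \<le> 4 * d / y\<^sup>2"
  shows "P * ((F / (r * y powr (- 3 / (2 * p)))) powr q * (2 + (y / d) powr (q / (2 * p))))
      \<le> 3 * (t powr q * (4 * d)) * y powr (- 2) + 3 * (t powr (q - p) * (4 * 2 powr p * d powr (1 / 2))) * F powr p"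
proof -
  \<comment> \<open>As X is at least 1, the factor 2 + X is at most 3 X, and X is moved into the
    q-th power before Young's inequality is applied.\<close>
  define X where "X = (y / d) powr (q / (2 * p))"
  define w where "w = F / (r * y powr (- 3 / (2 * p)))"
  define x where "x = w * X powr (1 / q)"
  have y: "0 < y" and p: "0 < p" and r0: "0 < r" using d q r by linarith+
  have yd: "1 \<le> y / d" using d by simp
  have X1: "1 \<le> X" unfolding X_def using yd q p by (intro ge_one_powr_ge_zero) auto
  have w0: "0 \<le> w" unfolding w_def using F r0 by simp
  have x0: "0 \<le> x" unfolding x_def using w0 by simp
  have "(X powr (1 / q)) powr q = X" using X1 q by (simp add: powr_powr)
  then have xq: "x powr q = w powr q * X" unfolding x_def using w0 by (simp add: powr_mult)
  have Py: "P \<le> 4 * d * y powr (- 2)" using P(2) y by (simp add: powr_minus_divide)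
  have xp: "4 * d * y powr (- 2) * x powr p \<le> 4 * 2 powr p * d powr (1 / 2) * F powr p"
  proof -
    have "X powr (p / q) = (y / d) powr (1 / 2)" unfolding X_def using p q by (simp add: powr_powr)
    then have e1: "x powr p = w powr p * (y powr (1 / 2) * d powr (- 1 / 2))"
      unfolding x_def using w0 X1 y d by (simp add: powr_mult powr_powr powr_divide powr_minus_divide)
    have "(r * y powr (- 3 / (2 * p))) powr p = r powr p * y powr (- 3 / 2)" using r0 y p by (simp add: powr_mult powr_powr)
    then have "w powr p = F powr p * (1 / r) powr p * y powr (3 / 2)"
      unfolding w_def using r0 y F by (simp add: powr_divide powr_mult powr_minus_divide)
    also have "\<dots> \<le> F powr p * 2 powr p * y powr (3 / 2)"
      using r r0 p by (intro mult_right_mono mult_left_mono powr_mono2) (auto simp: divide_le_eq)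
    finally have "x powr p \<le> F powr p * 2 powr p * y powr (3 / 2) * (y powr (1 / 2) * d powr (- 1 / 2))"
      unfolding e1 by (intro mult_right_mono) auto
    then have "4 * d * y powr (- 2) * x powr p \<le> 4 * d * y powr (- 2) * (F powr p * 2 powr p * y powr (3 / 2) * (y powr (1 / 2) * d powr (- 1 / 2)))"
      using d by (intro mult_left_mono) auto
    also have "\<dots> = 4 * 2 powr p * F powr p * (d powr 1 * d powr (- 1 / 2)) * (y powr (- 2) * y powr (3 / 2) * y powr (1 / 2))"
      using d by simp
    also have "y powr (- 2) * y powr (3 / 2) * y powr (1 / 2) = 1" using y by (simp only: powr_add[symmetric]) simp
    also have "d powr 1 * d powr (- 1 / 2) = d powr (1 / 2)" by (simp only: powr_add[symmetric]) simp
    finally show ?thesis by (simp add: mult_ac)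
  qed
  have "P * (w powr q * (2 + X)) \<le> P * (3 * x powr q)"
  proof (rule mult_left_mono[OF _ P(1)])
    have "w powr q * (2 + X) \<le> w powr q * (3 * X)" using X1 by (intro mult_left_mono) auto
    then show "w powr q * (2 + X) \<le> 3 * x powr q" unfolding xq by (simp add: mult_ac)
  qed
  also have "\<dots> \<le> (4 * d * y powr (- 2)) * (3 * x powr q)" using Py by (intro mult_right_mono) auto
  also have "\<dots> \<le> (4 * d * y powr (- 2)) * (3 * (t powr q + t powr (q - p) * x powr p))"
    using d by (intro mult_left_mono powr_le_young[OF q t x0]) auto
  also have "\<dots> = 3 * (t powr q * (4 * d)) * y powr (- 2) + 3 * t powr (q - p) * (4 * d * y powr (- 2) * x powr p)"
    by (simp add: algebra_simps)
  also have "\<dots> \<le> 3 * (t powr q * (4 * d)) * y powr (- 2) + 3 * t powr (q - p) * (4 * 2 powr p * d powr (1 / 2) * F powr p)"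
    using xp by (intro add_left_mono mult_left_mono) auto
  finally show ?thesis unfolding w_def X_def by (simp add: mult_ac)
qed

text \<open>On the circle of radius \<rho> the kernel of b becomes that of \<rho> b, so the circle
  estimate with exponent 3/2 bounds all means at once by the value at |b|.\<close>

lemma hardy_pow_test_function:
  assumes p: "0 < p"
  obtains C :: real where "0 < C" "\<And>b. cmod b < 1 \<Longrightarrow> hardy_pow p (\<lambda>z. z * power_kernel b (3 / (2 * p)) z) \<le> ennreal (C * (1 - cmod b) powr (- 1 / 2))"
proof (rule circle_kernel_integral[of "3 / 2"])
  fix C1 :: real
  assume C1: "0 < C1" and I1: "\<And>w. cmod w < 1 \<Longrightarrow>
     (\<integral>\<^sup>+t\<in>{0..2*pi}. ennreal (cmod (1 - cnj w * cis t) powr (- (3 / 2))) \<partial>lborel) \<le> ennreal (C1 * (1 - cmod w) powr (1 - 3 / 2))"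
  show thesis
  proof (rule that[of "C1 / (2 * pi)"])
    fix b :: complex assume b: "cmod b < 1"
    show "hardy_pow p (\<lambda>z. z * power_kernel b (3 / (2 * p)) z) \<le> ennreal (C1 / (2 * pi) * (1 - cmod b) powr (- 1 / 2))"
      unfolding hardy_pow_def
    proof (rule SUP_least)
      fix \<rho> :: real assume \<rho>: "\<rho> \<in> {0<..<1}"
      define w where "w = of_real \<rho> * b"
      have wb: "cmod w \<le> cmod b" using \<rho> by (simp add: w_def norm_mult mult_left_le_one_le)
      then have w1: "cmod w < 1" using b by simp
      have pt: "cmod (of_real \<rho> * cis t * power_kernel b (3 / (2 * p)) (of_real \<rho> * cis t)) powr p \<le> cmod (1 - cnj w * cis t) powr (- (3 / 2))" for t
      proof -
        have e: "cnj b * (of_real \<rho> * cis t) = cnj w * cis t" by (simp add: w_def mult_ac)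
        have "cmod (cnj b * (of_real \<rho> * cis t)) < 1" unfolding e using w1 by (simp add: norm_mult)
        then have "cmod (power_kernel b (3 / (2 * p)) (of_real \<rho> * cis t)) = cmod (1 - cnj w * cis t) powr (- (3 / (2 * p)))"
          using power_kernel_properties(2) e by metis
        then have "cmod (of_real \<rho> * cis t * power_kernel b (3 / (2 * p)) (of_real \<rho> * cis t)) powr p
            = \<rho> powr p * cmod (1 - cnj w * cis t) powr (- (3 / 2))"
          using \<rho> p by (simp add: norm_mult powr_mult powr_powr)
        also have "\<dots> \<le> 1 * cmod (1 - cnj w * cis t) powr (- (3 / 2))"
          using \<rho> p powr_mono2[of p \<rho> 1] by (intro mult_right_mono) auto
        finally show ?thesis by simp
      qed
      have "(\<integral>\<^sup>+t\<in>{0..2*pi}. ennreal (cmod (of_real \<rho> * cis t * power_kernel b (3 / (2 * p)) (of_real \<rho> * cis t)) powr p) \<partial>lborel)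
        \<le> (\<integral>\<^sup>+t\<in>{0..2*pi}. ennreal (cmod (1 - cnj w * cis t) powr (- (3 / 2))) \<partial>lborel)"
        by (intro nn_integral_mono mult_right_mono ennreal_leI pt) simp
      also have "\<dots> \<le> ennreal (C1 * (1 - cmod w) powr (1 - 3 / 2))" by (rule I1[OF w1])
      also have "\<dots> \<le> ennreal (C1 * (1 - cmod b) powr (- 1 / 2))"
        using C1 b wb by (intro ennreal_leI mult_left_mono) (auto intro!: powr_mono2')
      also have "C1 * (1 - cmod b) powr (- 1 / 2) = 2 * pi * (C1 / (2 * pi) * (1 - cmod b) powr (- 1 / 2))" by simp
      finally show "(\<integral>\<^sup>+t\<in>{0..2*pi}. ennreal (cmod (of_real \<rho> * cis t * power_kernel b (3 / (2 * p)) (of_real \<rho> * cis t)) powr p) \<partial>lborel) / ennreal (2 * pi)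
         \<le> ennreal (C1 / (2 * pi) * (1 - cmod b) powr (- 1 / 2))"
        using C1 by (subst divide_ennreal_le_iff) auto
    qed
  qed (use C1 in auto)
qed simp

section \<open>The Hardy case\<close>

text \<open>With K = n j, Young's inequality requires 2/K to be at most p, and the chain inequality
  requires K to be at least 2.\<close>

lemma exponent_choice:
  fixes p :: real
  assumes p: "0 < p" and n: "n \<ge> 1"
  obtains j :: nat where "j \<ge> 1" "2 / real (n * j) \<le> p" "2 \<le> n * j"
proof -
  obtain k :: nat where k: "2 / p \<le> real k" using real_arch_simple by blast
  have "2 / p \<le> real (n * (k + 2))"
  proof -
    have "real k \<le> real (n * (k + 2))" using mult_le_mono[OF n, of k "k + 2"] by (intro of_nat_mono) simp
    with k show ?thesis by linarith
  qed
  moreover have "0 < real (n * (k + 2))"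
  proof -
    have "0 < n * (k + 2)" using n by simp
    then show ?thesis by (rule of_nat_0_less_iff[THEN iffD2])
  qed
  ultimately have "2 / real (n * (k + 2)) \<le> p" using p by (simp only: pos_divide_le_eq mult.commute)
  then show thesis using n by (intro that[of "k + 2"]) (auto simp: Suc_le_eq)
qed

text \<open>Of the two harmonic functions in the proof, \<open>x 0\<close> compensates for the zero of the test function at the origin and \<open>x 1\<close> for the
  size of its logarithmic derivative near \<open>a\<close>.\<close>

lemma hardy_test_estimate:
  fixes m n :: nat and p :: real
  assumes p: "0 < p" and n: "n \<ge> 1"
  obtains D :: real where "0 < D" "\<And>g N a r. g holomorphic_on disc \<Longrightarrow> 0 < N \<Longrightarrow>
      opnorm (-1) p (\<lambda>f. (Sg g ^^ m) ((Tg g ^^ n) f)) \<le> ennreal N \<Longrightarrow> cmod a < 1 \<Longrightarrow> (1 + cmod a) / 2 \<le> r \<Longrightarrow> r < 1 \<Longrightarrow>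
      (\<integral>\<^sup>+w\<in>cball 0 1. ennreal ((1 - (cmod (phi a w))\<^sup>2) * (cmod (g (of_real r * w)) powr (real m / real n) * (r * cmod (deriv g (of_real r * w))))\<^sup>2) \<partial>lborel)
        \<le> ennreal (D * N powr (2 / real n))"
proof -
  obtain j where j: "j \<ge> 1" "2 / real (n * j) \<le> p" "2 \<le> n * j" using exponent_choice[OF p n] by blast
  define K where "K = n * j"
  define q where "q = 2 / real K"
  have K2: "2 \<le> K" using j by (simp add: K_def)
  have q: "0 < q" "q \<le> p" using j(2) K2 unfolding q_def K_def[symmetric] by auto
  \<comment> \<open>The p-th power of the test function then has exponent 3/2: above 1, so that the
    circle estimate applies, and below the exponent 2 of the Poisson kernel, which leaves room for
    the perturbation. \<open>\<eta>\<close> uses up exactly this room.\<close>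
  define c where "c = 3 / (2 * p)"
  define \<eta> where "\<eta> = q / (4 * p)"
  have \<eta>: "0 < \<eta>" and c: "0 < c" using p q by (auto simp: \<eta>_def c_def)
  \<comment> \<open>The logarithmic derivative of the test function is 1/w plus c cnj a / (1 - cnj a
    w). Squaring costs a factor 2, and the two pieces are multiples of \<beta> 0 and \<beta> 1 with
    factors 2/q and c/\<eta> in modulus.\<close>
  define C' where "C' = 8 / q\<^sup>2 + 2 * c\<^sup>2 / \<eta>\<^sup>2"
  have C': "0 \<le> C'" by (simp add: C'_def)
  show thesis
  proof (rule chain_disc_estimate[where N=2 and m="\<lambda>i. if n dvd i then m else 0" and \<sigma>="real m / real n", OF j(3) sum_if_dvd[OF n], folded K_def], goal_cases)
    case (1 C0)
    note C0 = 1(1) and est = 1(2)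
    obtain C1 where C1: "0 < C1" and tf: "\<And>b. cmod b < 1 \<Longrightarrow> hardy_pow p (\<lambda>z. z * power_kernel b c z) \<le> ennreal (C1 * (1 - cmod b) powr (- 1 / 2))"
      using hardy_pow_test_function[OF p] unfolding c_def by blast
    obtain C2 where C2: "0 < C2" and k2: "\<And>w. cmod w < 1 \<Longrightarrow>
       (\<integral>\<^sup>+t\<in>{0..2*pi}. ennreal (cmod (1 - cnj w * cis t) powr (- 2)) \<partial>lborel) \<le> ennreal (C2 * (1 - cmod w) powr (1 - 2))"
      using circle_kernel_integral[of 2] by auto
    define E where "E = C0 * (1 + C')"
    define D where "D = C0 * (1 + C') * 3 * (4 * C2 + 4 * 2 powr p * (2 * pi) * C1 * 2 powr (1 / 2))"
    have D: "0 < D"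
    proof -
      have c1: "0 < 1 + C'" using C' by simp
      have c2: "0 < 4 * C2 + 4 * 2 powr p * (2 * pi) * C1 * 2 powr (1 / 2)" using C1 C2 by (intro add_pos_pos mult_pos_pos) auto
      show ?thesis unfolding D_def by (intro mult_pos_pos C0 c1 c2) simp
    qed
    show thesis
    proof (rule that[OF D])
      fix g :: "complex \<Rightarrow> complex" and N r :: real and a :: complex
      assume g: "g holomorphic_on disc" and N: "0 < N" and op: "opnorm (-1) p (\<lambda>f. (Sg g ^^ m) ((Tg g ^^ n) f)) \<le> ennreal N"
        and a: "cmod a < 1" and r: "(1 + cmod a) / 2 \<le> r" "r < 1"
      have ra: "1 + cmod a \<le> 2 * r" using r by simp
      have r2: "1 / 2 \<le> r" using ra by (smt (verit) norm_ge_zero field_sum_of_halves)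
      have "0 < r" using r2 by simp
      moreover have "cmod a < r" using ra a by linarith
      ultimately have r2: "1 / 2 \<le> r" "0 < r" "cmod a < r" using r2 by simp_all
      define d where "d = 1 - cmod a"
      have d: "0 < d" "d \<le> 1" using a by (auto simp: d_def)
      define t where "t = N ^ j"
      have t: "0 < t" using N by (simp add: t_def)
      \<comment> \<open>The parameter is enlarged so that the test function, dilated by r, has the
        kernel of \<open>a\<close> itself and fits the Moebius kernel; the lower bound on r keeps 1
        - |b| at least (1 - |a|)/2.\<close>
      define b where "b = a / of_real r"
      have b: "cmod b < 1" using r2 by (simp add: b_def norm_divide)
      have br: "cnj b * (of_real r * w) = cnj a * w" for w using r2 by (simp add: b_def)
      have pk: "power_kernel b c (of_real r * w) = power_kernel a c w" for w unfolding power_kernel_def br ..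
      have bd: "d / 2 \<le> 1 - cmod b"
      proof -
        have "d / 2 \<le> (r - cmod a) * 1" using ra by (simp add: d_def)
        also have "\<dots> \<le> (r - cmod a) * (1 / r)" using r r2 by (intro mult_left_mono) auto
        also have "\<dots> = 1 - cmod b" using r2 by (simp add: b_def norm_divide field_simps)
        finally show ?thesis .
      qed
      define f where "f z = z * power_kernel b c z" for z
      have f: "f holomorphic_on disc" "f 0 = 0" unfolding f_def by (auto intro!: holomorphic_intros holomorphic_power_kernel b)
      define G where "G = iterate_chain n m g f"
      note GP = iterate_chain_properties[OF g f(1), where n=n and m=m, folded G_def]
      define F where "F i w = G i (of_real r * w)" for i w
      define gr where "gr w = g (of_real r * w)" for w
      \<comment> \<open>Midway between 1 and 1/r, so the dilated functions live on a neighbourhood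
        of the closed unit disc, and r R = (1 + r)/2 stays below 1.\<close>
      define R where "R = (1 + 1 / r) / 2"
      have R: "1 < R" "R \<le> 2" "r * R = (1 + r) / 2"
        using r2 r by (auto simp: R_def field_simps)
      have in_disc: "of_real r * w \<in> disc" "cmod (of_real r * w) \<le> (1 + r) / 2" "cmod w \<le> 2" if "w \<in> ball 0 R" for w :: complex
      proof -
        have w: "cmod w < R" using that by simp
        then have "r * cmod w \<le> r * R" using r2 by (intro mult_left_mono) auto
        then show "cmod (of_real r * w) \<le> (1 + r) / 2" using R r2 by (simp add: norm_mult)
        then show "of_real r * w \<in> disc" using r by simp
        show "cmod w \<le> 2" using w R by linarith
      qed
      have dil: "(\<lambda>w. h (of_real r * w)) holomorphic_on ball 0 R"
        "w \<in> ball 0 R \<Longrightarrow> deriv (\<lambda>w. h (of_real r * w)) w = of_real r * deriv h (of_real r * w)" if h: "h holomorphic_on disc" for h :: "complex \<Rightarrow> complex" and w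
      proof -
        have ch: "((\<lambda>w. h (of_real r * w)) has_field_derivative deriv h (of_real r * w) * of_real r) (at w)" if "w \<in> ball 0 R" for w
        proof (rule DERIV_chain2[where f=h and g="\<lambda>w. of_real r * w"])
          show "(h has_field_derivative deriv h (of_real r * w)) (at (of_real r * w))" by (rule holomorphic_derivI[OF h open_ball in_disc(1)[OF that]])
          show "((\<lambda>w. of_real r * w) has_field_derivative of_real r) (at w)" by (auto intro!: derivative_eq_intros)
        qed
        then show "(\<lambda>w. h (of_real r * w)) holomorphic_on ball 0 R" unfolding holomorphic_on_open[OF open_ball] by blast
        show "deriv (\<lambda>w. h (of_real r * w)) w = of_real r * deriv h (of_real r * w)" if "w \<in> ball 0 R"
          using DERIV_imp_deriv[OF ch[OF that]] by (simp add: mult.commute)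
      qed
      have aw1: "cmod (cnj a * w) < 1" if "w \<in> ball 0 R" for w
      proof -
        have "cmod a * cmod w \<le> r * cmod w" using r2 by (intro mult_right_mono) auto
        then show ?thesis using in_disc(2)[OF that] r r2 by (simp add: norm_mult)
      qed
      have nz1: "1 - cnj a * w \<noteq> 0" if "w \<in> ball 0 R" for w using aw1[OF that] by auto
      have F0e: "F 0 = (\<lambda>w. of_real r * w * power_kernel a c w)" by (auto simp: F_def G_def f_def pk)
      have F0n: "cmod (F 0 w) = r * cmod w * cmod (1 - cnj a * w) powr (- c)" if "w \<in> ball 0 R" for w
        unfolding F0e using power_kernel_properties(2)[OF aw1[OF that]] r2 by (simp add: norm_mult)
      define h1 where "h1 w = (1 - cnj a * w) / of_real d" for w
      \<comment> \<open>Both are nonnegative on the closed disc: |w| is at most 1, and |1 - cnj a w|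
        is at least d. Their gradients are multiples of the two terms of f'/f.\<close>
      define x where "x k w = (if k = 0 then - (q / 2) * ln (cmod w) else \<eta> * ln (cmod (h1 w)))" for k :: nat and w
      define \<beta> where "\<beta> k w = (if k = 0 then of_real (- (q / 2)) * (deriv (\<lambda>z. z) w / w) else of_real \<eta> * (deriv h1 w / h1 w))" for k :: nat and w
      define al where "al k w = (if k = 0 then of_real (- (q / 2)) * deriv (\<lambda>z. deriv (\<lambda>z. z) z / z) w else of_real \<eta> * deriv (\<lambda>z. deriv h1 z / h1 z) w)" for k :: nat and w
      have h1d: "deriv h1 w = - cnj a / of_real d" for w
        unfolding h1_def[abs_def] using d by (intro DERIV_imp_deriv) (auto intro!: derivative_eq_intros)
      have h1r: "deriv h1 w / h1 w = - (cnj a / (1 - cnj a * w))" for w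
        unfolding h1d h1_def using d by simp
      have h1n: "cmod (h1 w) = cmod (1 - cnj a * w) / d" for w using d by (simp add: h1_def norm_divide)
      have lx: "lap2 (ball 0 R - {0}) (x k) (\<beta> k) (al k) (\<lambda>z. 0)" for k
      proof (cases "k = 0")
        case True
        have "lap2 (ball 0 R - {0}) (\<lambda>w. - (q / 2) * ln (cmod w)) (\<lambda>w. of_real (- (q / 2)) * (deriv (\<lambda>z. z) w / w)) (\<lambda>w. of_real (- (q / 2)) * deriv (\<lambda>z. deriv (\<lambda>z. z) z / z) w) (\<lambda>z. 0)"
          by (rule lap2_scaled_ln_cmod) (auto intro!: holomorphic_intros)
        then show ?thesis using True unfolding x_def[abs_def] \<beta>_def[abs_def] al_def[abs_def] by (simp only: refl if_True)
      next
        case False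
        have "lap2 (ball 0 R - {0}) (\<lambda>w. \<eta> * ln (cmod (h1 w))) (\<lambda>w. of_real \<eta> * (deriv h1 w / h1 w)) (\<lambda>w. of_real \<eta> * deriv (\<lambda>z. deriv h1 z / h1 z) w) (\<lambda>z. 0)"
        proof (rule lap2_scaled_ln_cmod)
          show "h1 w \<noteq> 0" if "w \<in> ball 0 R - {0}" for w using nz1[of w] that d by (auto simp: h1_def)
          show "h1 holomorphic_on ball 0 R - {0}" unfolding h1_def using d by (intro holomorphic_intros) auto
        qed auto
        then show ?thesis using False unfolding x_def[abs_def] \<beta>_def[abs_def] al_def[abs_def] by (simp only: if_False)
      qed
      have ex0: "exp (2 * x 0 w) = cmod w powr (- q)" if "w \<noteq> 0" for w using that by (simp add: x_def powr_def)
      have ex1: "exp (2 * x 1 w) = (cmod (1 - cnj a * w) / d) powr (q / (2 * p))" if "w \<in> ball 0 R" for w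
      proof -
        have "cmod (h1 w) \<noteq> 0" using nz1[OF that] d by (simp add: h1n)
        then have "exp (2 * x 1 w) = cmod (h1 w) powr (2 * \<eta>)" by (simp add: x_def powr_def)
        then show ?thesis by (simp add: h1n \<eta>_def)
      qed
      have sum2: "(\<Sum>k<2. u k) = u 0 + u 1" for u :: "nat \<Rightarrow> real" by (simp add: numeral_2_eq_2)
      \<comment> \<open>The double zero makes the ratio of \<open>F K\<close> to \<open>F 0\<close>
        of order |w|, which outweighs exp(2 x 0) = |w|^(-q) at the origin; hence \<open>M\<close> is
        finite.\<close>
      obtain B where B: "0 \<le> B" "\<And>z. z \<in> cball 0 ((1 + r) / 2) \<Longrightarrow> cmod (G K z) \<le> B * (cmod z)\<^sup>2"
      proof -
        obtain i where i: "K = Suc (Suc i)" using j(3) unfolding K_def by (metis Suc_le_D numeral_2_eq_2 Suc_le_mono)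
        have "(1 + r) / 2 < 1" using r by simp
        from iterate_chain_double_zero[OF g f(1) this] show thesis using that unfolding G_def i by blast
      qed
      define B' where "B' = B * 3 powr c"
      have ratio: "cmod (F K w) / cmod (F 0 w) \<le> B' * cmod w" if w: "w \<in> ball 0 R - {0}" for w
      proof -
        have wR: "w \<in> ball 0 R" and w0: "0 < cmod w" using w by auto
        have y: "0 < cmod (1 - cnj a * w)" using nz1[OF wR] by simp
        have y3: "cmod (1 - cnj a * w) \<le> 3" using norm_triangle_ineq4[of 1 "cnj a * w"] aw1[OF wR] by simp
        have "cmod (F K w) \<le> B * (cmod (of_real r * w))\<^sup>2" unfolding F_def using in_disc(2)[OF wR] by (intro B) simp
        then have "cmod (F K w) / cmod (F 0 w) \<le> B * (cmod (of_real r * w))\<^sup>2 / cmod (F 0 w)" by (rule divide_right_mono) simp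
        also have "\<dots> = B * (r * cmod w) * cmod (1 - cnj a * w) powr c"
          using r2 w0 y by (simp add: F0n[OF wR] norm_mult powr_minus_divide power2_eq_square)
        also have "\<dots> \<le> B * (1 * cmod w) * 3 powr c"
          using B r r2 y3 c by (intro mult_mono powr_mono2 mult_nonneg_nonneg) auto
        finally show ?thesis by (simp add: B'_def mult_ac)
      qed
      define M where "M = B' powr q * (2 powr q * (1 + (3 / d) powr (q / (2 * p))) + 1)"
      have Mb: "(cmod (F K w) / cmod (F 0 w)) powr (2 / real K) * (1 + (\<Sum>k<2. exp (2 * x k w))) \<le> M" if w: "w \<in> ball 0 R - {0}" for w
      proof -
        have wR: "w \<in> ball 0 R" and w0: "0 < cmod w" using w by auto
        have B'0: "0 \<le> B'" using B by (simp add: B'_def)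
        have y3: "cmod (1 - cnj a * w) \<le> 3" using norm_triangle_ineq4[of 1 "cnj a * w"] aw1[OF wR] by simp
        have "(cmod (F K w) / cmod (F 0 w)) powr q \<le> (B' * cmod w) powr q" using ratio[OF w] q by (intro powr_mono2) auto
        also have "\<dots> = B' powr q * cmod w powr q" using B'0 by (simp add: powr_mult)
        finally have r1: "(cmod (F K w) / cmod (F 0 w)) powr q \<le> B' powr q * cmod w powr q" .
        have X: "exp (2 * x 1 w) \<le> (3 / d) powr (q / (2 * p))"
          unfolding ex1[OF wR] using y3 d q p by (intro powr_mono2 divide_right_mono) auto
        have "(cmod (F K w) / cmod (F 0 w)) powr q * (1 + (\<Sum>k<2. exp (2 * x k w))) \<le> (B' powr q * cmod w powr q) * (1 + (cmod w powr (- q) + (3 / d) powr (q / (2 * p))))"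
          unfolding sum2 using r1 X ex0[of w] w by (intro mult_mono add_left_mono add_mono) auto
        also have "\<dots> = B' powr q * (cmod w powr q * (1 + (3 / d) powr (q / (2 * p))) + cmod w powr q * cmod w powr (- q))" by (simp add: algebra_simps)
        also have "cmod w powr q * cmod w powr (- q) = 1" using w0 by (simp flip: powr_add)
        also have "B' powr q * (cmod w powr q * (1 + (3 / d) powr (q / (2 * p))) + 1) \<le> M"
          unfolding M_def using in_disc(3)[OF wR] q by (intro mult_left_mono add_right_mono mult_right_mono powr_mono2) auto
        finally show ?thesis by (simp add: q_def)
      qed
      have \<theta>: "(cmod (deriv (F 0) w / F 0 w))\<^sup>2 \<le> C' * (\<Sum>k<2. (cmod (\<beta> k w))\<^sup>2)" if w: "w \<in> cball 0 1 - {0}" for w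
      proof -
        have wR: "w \<in> ball 0 R" and w0: "w \<noteq> 0" using w R by auto
        define y where "y = 1 - cnj a * w"
        note PK = power_kernel_properties[OF aw1[OF wR], where c=c, folded y_def]
        have y: "y \<noteq> 0" using nz1[OF wR] by (simp add: y_def)
        have "(F 0 has_field_derivative (of_real r * power_kernel a c w + of_real r * w * (power_kernel a c w * (of_real c * cnj a / y)))) (at w)"
          unfolding F0e by (rule derivative_eq_intros PK(1) refl)+ (simp add: mult_ac)
        then have "deriv (F 0) w / F 0 w = (of_real r * power_kernel a c w + of_real r * w * (power_kernel a c w * (of_real c * cnj a / y))) / (of_real r * w * power_kernel a c w)"
          by (simp add: DERIV_imp_deriv F0e)
        also have "\<dots> = 1 / w + of_real c * cnj a / y"
          using r2 w0 y PK(3) by (simp add: field_simps)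
        finally have e: "deriv (F 0) w / F 0 w = 1 / w + of_real c * cnj a / y" .
        have sq: "(u + v)\<^sup>2 \<le> 2 * u\<^sup>2 + 2 * v\<^sup>2" for u v :: real using sum_squares_bound[of u v] by (simp add: power2_sum)
        have "cmod (1 / w + of_real c * cnj a / y) \<le> cmod (1 / w) + cmod (of_real c * cnj a / y)" by (rule norm_triangle_ineq)
        then have "(cmod (deriv (F 0) w / F 0 w))\<^sup>2 \<le> (cmod (1 / w) + cmod (of_real c * cnj a / y))\<^sup>2" unfolding e by (intro power_mono) auto
        also have "\<dots> \<le> 2 * (cmod (1 / w))\<^sup>2 + 2 * (cmod (of_real c * cnj a / y))\<^sup>2" by (rule sq)
        also have "\<dots> = 8 / q\<^sup>2 * (cmod (\<beta> 0 w))\<^sup>2 + 2 * c\<^sup>2 / \<eta>\<^sup>2 * (cmod (\<beta> 1 w))\<^sup>2"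
        proof -
          have b0: "(cmod (\<beta> 0 w))\<^sup>2 = (q / 2)\<^sup>2 * (cmod (1 / w))\<^sup>2" using q by (simp add: \<beta>_def norm_mult norm_divide power_mult_distrib power_divide)
          have "\<beta> 1 w = - (of_real \<eta> * (cnj a / y))" unfolding \<beta>_def h1r y_def by simp
          then have b1: "(cmod (\<beta> 1 w))\<^sup>2 = \<eta>\<^sup>2 * (cmod (cnj a / y))\<^sup>2" by (simp only: norm_minus_cancel norm_mult power_mult_distrib norm_of_real power2_abs)
          have b2: "(cmod (of_real c * cnj a / y))\<^sup>2 = c\<^sup>2 * (cmod (cnj a / y))\<^sup>2" by (simp add: norm_mult norm_divide power_mult_distrib power_divide)
          show ?thesis unfolding b0 b1 b2 using q \<eta> by (simp add: power_divide)
        qed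
        also have "\<dots> \<le> C' * (cmod (\<beta> 0 w))\<^sup>2 + C' * (cmod (\<beta> 1 w))\<^sup>2"
          unfolding C'_def by (intro add_mono mult_right_mono) auto
        finally show ?thesis unfolding sum2 by (simp add: distrib_left)
      qed
      obtain Dv pv where mk: "open {z. cmod (cnj a * z) < 1}" "cball 0 1 \<subseteq> {z. cmod (cnj a * z) < 1}"
        and lv: "lap2 {z. cmod (cnj a * z) < 1} (\<lambda>z. 1 - (cmod (phi a z))\<^sup>2) Dv pv (\<lambda>z. - 2 * ((1 - (cmod a)\<^sup>2) / (cmod (1 - cnj a * z))\<^sup>2)\<^sup>2)"
        and bv: "\<And>t. - Re (cis t * Dv (cis t)) = 2 * (1 - (cmod a)\<^sup>2) / (cmod (1 - cnj a * cis t))\<^sup>2"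
        and v0: "\<And>z. z \<in> cball 0 1 \<Longrightarrow> 0 \<le> 1 - (cmod (phi a z))\<^sup>2" and v1: "\<And>z. cmod z = 1 \<Longrightarrow> 1 - (cmod (phi a z))\<^sup>2 = 0"
        using mobius_kernel[OF a] by blast
      define P where "P s = 2 * (1 - (cmod a)\<^sup>2) / (cmod (1 - cnj a * cis s))\<^sup>2" for s
      have a2: "0 \<le> 1 - (cmod a)\<^sup>2" using a by (simp add: abs_square_le_1)
      have P0: "0 \<le> P s" for s using a2 by (simp add: P_def)
      have P4: "P s \<le> 4 * d / (cmod (1 - cnj a * cis s))\<^sup>2" for s
      proof -
        have "1 - (cmod a)\<^sup>2 = d * (1 + cmod a)" by (simp add: d_def power2_eq_square algebra_simps)
        also have "\<dots> \<le> d * 2" using d a by (intro mult_left_mono) auto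
        finally show ?thesis unfolding P_def by (intro divide_right_mono) auto
      qed
      have dgr: "deriv gr w = of_real r * deriv g (of_real r * w)" if "w \<in> ball 0 R" for w
        unfolding gr_def[abs_def] by (rule dil(2)[OF g that])
      let ?X = "\<lambda>F0 w. (cmod (F K w) / F0) powr (2 / real K) * (1 + (\<Sum>k<2. exp (2 * x k w)))"
      have "(\<integral>\<^sup>+w\<in>cball 0 1. ennreal ((1 - (cmod (phi a w))\<^sup>2) * (cmod (gr w) powr (real m / real n) * cmod (deriv gr w))\<^sup>2) \<partial>lborel)
        \<le> (\<integral>\<^sup>+z\<in>cball 0 1. ennreal (C0 * (1 + C') * ?X (cmod (F 0 z)) z * 0) \<partial>lborel)
          + (\<integral>\<^sup>+t\<in>{0..2*pi}. ennreal (P t * (C0 * (1 + C') * ?X (cmod (F 0 (cis t))) (cis t))) \<partial>lborel)"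
      \<comment> \<open>The Moebius kernel is superharmonic, so \<open>m1\<close> is 0 and only the
        boundary integral with the Poisson kernel is left on the right.\<close>
      proof (rule est[where S="{z. cmod (cnj a * z) < 1}" and ?m2.0="\<lambda>z. 4 * ((1 - (cmod a)\<^sup>2) / (cmod (1 - cnj a * z))\<^sup>2)\<^sup>2" and ?m1.0="\<lambda>z. 0", OF R(1)])
        show "gr holomorphic_on ball 0 R" unfolding gr_def[abs_def] by (rule dil(1)[OF g])
        show "F i holomorphic_on ball 0 R" for i unfolding F_def[abs_def] by (rule dil(1)[OF GP(1)])
        show "F 0 z \<noteq> 0" if "z \<in> ball 0 R - {0}" for z
          using that r2 power_kernel_properties(3)[OF aw1[of z]] by (auto simp: F0e)
        show "deriv (F (Suc i)) z = gr z ^ (if n dvd Suc i then m else 0) * deriv gr z * F i z" if "z \<in> ball 0 R" for i z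
        proof -
          have "deriv (F (Suc i)) z = of_real r * deriv (G (Suc i)) (of_real r * z)"
            unfolding F_def[abs_def] by (rule dil(2)[OF GP(1) that])
          then show ?thesis unfolding GP(2)[OF in_disc(1)[OF that]] dgr[OF that] by (simp add: F_def gr_def mult_ac)
        qed
        show "0 \<le> x k z" if "z \<in> cball 0 1 - {0}" for k z
        proof (cases "k = 0")
          case True
          have "ln (cmod z) \<le> 0" using that by simp
          then show ?thesis using True q by (simp add: x_def mult_nonneg_nonpos)
        next
          case False
          have "1 \<le> cmod (h1 z)" unfolding h1n using one_minus_cnj_mult(1)[OF a, of z] that d by (simp add: d_def)
          then show ?thesis using False \<eta> by (simp add: x_def)
        qed
        show "continuous_on (cball 0 1) (\<lambda>z. 4 * ((1 - (cmod a)\<^sup>2) / (cmod (1 - cnj a * z))\<^sup>2)\<^sup>2)"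
          using one_minus_cnj_mult(4)[OF a] by (intro continuous_intros) force
        show "- Re (cis t * Dv (cis t)) = P t" for t unfolding bv P_def ..
        show "lap2 {z. cmod (cnj a * z) < 1} (\<lambda>z. 1 - (cmod (phi a z))\<^sup>2) Dv pv (\<lambda>z. - 2 * ((1 - (cmod a)\<^sup>2) / (cmod (1 - cnj a * z))\<^sup>2)\<^sup>2)" by (rule lv)
        show "cball 0 1 \<subseteq> {z. cmod (cnj a * z) < 1}" by (rule mk(2))
        show "(cmod (F K z) / cmod (F 0 z)) powr (2 / real K) * (1 + (\<Sum>k<2. exp (2 * x k z))) \<le> M" if "z \<in> ball 0 R - {0}" for z
          by (rule Mb[OF that])
        show "(cmod (deriv (F 0) z / F 0 z))\<^sup>2 \<le> C' * (\<Sum>k<2. (cmod (\<beta> k z))\<^sup>2)" if "z \<in> cball 0 1 - {0}" for z by (rule \<theta>[OF that])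
        show "lap2 (ball 0 R - {0}) (x k) (\<beta> k) (al k) (\<lambda>z. 0)" for k by (rule lx)
      qed (use v0 v1 P0 C' in auto)
      also have "\<dots> = (\<integral>\<^sup>+t\<in>{0..2*pi}. ennreal (P t * (C0 * (1 + C') * ?X (cmod (F 0 (cis t))) (cis t))) \<partial>lborel)" by simp
      also have "\<dots> \<le> (\<integral>\<^sup>+s\<in>{0..2*pi}. ennreal ((C0 * (1 + C') * (3 * (t powr q * (4 * d)))) * cmod (1 - cnj a * cis s) powr (- 2)
          + (C0 * (1 + C') * (3 * (t powr (q - p) * (4 * 2 powr p * d powr (1 / 2))))) * cmod (F K (cis s)) powr p) \<partial>lborel)"
      proof (intro nn_integral_mono mult_right_mono ennreal_leI)
        fix s
        have cR: "cis s \<in> ball 0 R" using R by simp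
        have "?X (cmod (F 0 (cis s))) (cis s) = (cmod (F K (cis s)) / (r * cmod (1 - cnj a * cis s) powr (- 3 / (2 * p)))) powr q * (2 + (cmod (1 - cnj a * cis s) / d) powr (q / (2 * p)))"
          unfolding sum2 F0n[OF cR] ex1[OF cR] using ex0[of "cis s"] by (simp add: q_def c_def)
        then have "P s * ?X (cmod (F 0 (cis s))) (cis s) \<le> 3 * (t powr q * (4 * d)) * cmod (1 - cnj a * cis s) powr (- 2)
           + 3 * (t powr (q - p) * (4 * 2 powr p * d powr (1 / 2))) * cmod (F K (cis s)) powr p"
          using circle_test_pointwise[OF d(1) _ r2(1) q t norm_ge_zero P0 P4] one_minus_cnj_mult(1)[OF a, of "cis s"] by (simp add: d_def)
        then have "C0 * (1 + C') * (P s * ?X (cmod (F 0 (cis s))) (cis s)) \<le> C0 * (1 + C') * (3 * (t powr q * (4 * d)) * cmod (1 - cnj a * cis s) powr (- 2)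
           + 3 * (t powr (q - p) * (4 * 2 powr p * d powr (1 / 2))) * cmod (F K (cis s)) powr p)"
          using C0 C' by (intro mult_left_mono) auto
        then show "P s * (C0 * (1 + C') * ?X (cmod (F 0 (cis s))) (cis s)) \<le> (C0 * (1 + C') * (3 * (t powr q * (4 * d)))) * cmod (1 - cnj a * cis s) powr (- 2)
          + (C0 * (1 + C') * (3 * (t powr (q - p) * (4 * 2 powr p * d powr (1 / 2))))) * cmod (F K (cis s)) powr p"
          unfolding E_def[symmetric] by (simp only: algebra_simps)
      qed simp
      also have "\<dots> = ennreal (C0 * (1 + C') * (3 * (t powr q * (4 * d)))) * (\<integral>\<^sup>+s\<in>{0..2*pi}. ennreal (cmod (1 - cnj a * cis s) powr (- 2)) \<partial>lborel)
          + ennreal (C0 * (1 + C') * (3 * (t powr (q - p) * (4 * 2 powr p * d powr (1 / 2))))) * (\<integral>\<^sup>+s\<in>{0..2*pi}. ennreal (cmod (F K (cis s)) powr p) \<partial>lborel)"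
      proof (rule nn_integral_lincomb)
        have m: "(\<lambda>s. indicator {0..2*pi} s * u s) \<in> borel_measurable lborel" if "continuous_on {0..2*pi} u" for u :: "real \<Rightarrow> real"
          using borel_measurable_continuous_on_indicator[OF _ that] by simp
        have "1 - cnj a * cis s \<noteq> 0" for s using nz1[of "cis s"] R by simp
        then show "(\<lambda>s. indicator {0..2*pi} s * cmod (1 - cnj a * cis s) powr (- 2)) \<in> borel_measurable lborel"
          by (intro m continuous_intros) auto
        have "continuous_on (ball 0 R) (F K)"
          unfolding F_def[abs_def] by (rule holomorphic_on_imp_continuous_on[OF dil(1)[OF GP(1)]])
        then have "continuous_on {0..2*pi} (\<lambda>s. F K (cis s))"
          by (rule continuous_on_compose2) (use R in \<open>auto intro!: continuous_intros\<close>)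
        then show "(\<lambda>s. indicator {0..2*pi} s * cmod (F K (cis s)) powr p) \<in> borel_measurable lborel"
          using p by (intro m continuous_on_cmod_powr) auto
      qed (use C0 C' d in auto)
      also have "\<dots> \<le> ennreal (C0 * (1 + C') * (3 * (t powr q * (4 * d)))) * ennreal (C2 * d powr (- 1))
          + ennreal (C0 * (1 + C') * (3 * (t powr (q - p) * (4 * 2 powr p * d powr (1 / 2))))) * ennreal (2 * pi * (t powr p * (C1 * (2 powr (1 / 2) * d powr (- 1 / 2)))))"
      proof (intro add_mono mult_left_mono)
        show "(\<integral>\<^sup>+s\<in>{0..2*pi}. ennreal (cmod (1 - cnj a * cis s) powr (- 2)) \<partial>lborel) \<le> ennreal (C2 * d powr (- 1))"
          using k2[OF a] by (simp add: d_def)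
        define A where "A = C1 * (1 - cmod b) powr (- 1 / 2)"
        have A: "0 < A" unfolding A_def using C1 b by simp
        define \<tau> where "\<tau> = A powr (1 / p)"
        have \<tau>: "0 < \<tau>" "\<tau> powr p = A" using A p by (auto simp: \<tau>_def powr_powr)
        have "Apnorm_pow (-1) p f \<le> ennreal (\<tau> powr p)" unfolding \<tau>(2) using tf[OF b] by (simp add: Apnorm_pow_def A_def f_def[abs_def])
        from opnorm_iterate[OF g n p N op f \<tau>(1) this, of j]
        have "hardy_pow p (G K) \<le> ennreal ((t * \<tau>) powr p)" by (simp add: Apnorm_pow_def G_def K_def t_def)
        moreover have "(\<integral>\<^sup>+s\<in>{0..2*pi}. ennreal (cmod (F K (cis s)) powr p) \<partial>lborel) / ennreal (2 * pi) \<le> hardy_pow p (G K)"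
          unfolding hardy_pow_def F_def by (rule SUP_upper2[of r]) (use r r2 in auto)
        ultimately have "(\<integral>\<^sup>+s\<in>{0..2*pi}. ennreal (cmod (F K (cis s)) powr p) \<partial>lborel) / ennreal (2 * pi) \<le> ennreal ((t * \<tau>) powr p)" by (rule order_trans[rotated])
        then have "(\<integral>\<^sup>+s\<in>{0..2*pi}. ennreal (cmod (F K (cis s)) powr p) \<partial>lborel) \<le> ennreal (2 * pi * (t * \<tau>) powr p)"
          by (subst (asm) divide_ennreal_le_iff) auto
        also have "(t * \<tau>) powr p = t powr p * A" using t \<tau> by (simp add: powr_mult)
        also have "2 * pi * (t powr p * A) \<le> 2 * pi * (t powr p * (C1 * (2 powr (1 / 2) * d powr (- 1 / 2))))"
        proof (intro mult_left_mono, unfold A_def, intro mult_left_mono)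
          have "(1 - cmod b) powr (- 1 / 2) \<le> (d / 2) powr (- 1 / 2)" using bd d by (intro powr_mono2') auto
          also have "\<dots> = 2 powr (1 / 2) * d powr (- 1 / 2)" using d by (simp add: powr_divide powr_minus_divide)
          finally show "(1 - cmod b) powr (- 1 / 2) \<le> 2 powr (1 / 2) * d powr (- 1 / 2)" .
        qed (use C1 in auto)
        finally show "(\<integral>\<^sup>+s\<in>{0..2*pi}. ennreal (cmod (F K (cis s)) powr p) \<partial>lborel) \<le> ennreal (2 * pi * (t powr p * (C1 * (2 powr (1 / 2) * d powr (- 1 / 2)))))"
          by (simp add: ennreal_leI)
      qed auto
      also have "\<dots> = ennreal (D * t powr q)"
      proof -
        \<comment> \<open>All powers of d cancel: the mass of the squared kernel is of order 1/d and
          the norm of the test function of order d^(-1/2).\<close>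
        have e1: "d * d powr (- 1) = 1" using d by (simp add: powr_minus_divide)
        have e2: "d powr (1 / 2) * d powr (- 1 / 2) = 1" using d by (simp only: powr_add[symmetric]) simp
        have e3: "t powr (q - p) * t powr p = t powr q" by (simp flip: powr_add)
        have "C0 * (1 + C') * (3 * (t powr q * (4 * d))) * (C2 * d powr (- 1)) + C0 * (1 + C') * (3 * (t powr (q - p) * (4 * 2 powr p * d powr (1 / 2)))) * (2 * pi * (t powr p * (C1 * (2 powr (1 / 2) * d powr (- 1 / 2)))))
          = C0 * (1 + C') * 3 * (4 * C2 * (d * d powr (- 1)) * t powr q + 4 * 2 powr p * (2 * pi) * C1 * 2 powr (1 / 2) * (d powr (1 / 2) * d powr (- 1 / 2)) * (t powr (q - p) * t powr p))"
          unfolding E_def[symmetric] by (simp only: algebra_simps)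
        also have "\<dots> = D * t powr q" unfolding e1 e2 e3 D_def by (simp add: algebra_simps)
        finally show ?thesis using C0 C' C1 C2 d t by (subst ennreal_mult[symmetric], simp, simp, subst ennreal_mult[symmetric], simp, simp, subst ennreal_plus[symmetric], simp_all)
      qed
      \<comment> \<open>t = N^j and q = 2/(n j).\<close>
      also have "t powr q = N powr (2 / real n)"
        using N n j by (simp add: t_def q_def K_def powr_powr flip: powr_realpow)
      finally have "(\<integral>\<^sup>+w\<in>cball 0 1. ennreal ((1 - (cmod (phi a w))\<^sup>2) * (cmod (gr w) powr (real m / real n) * cmod (deriv gr w))\<^sup>2) \<partial>lborel) \<le> ennreal (D * N powr (2 / real n))" .
      moreover have "(\<integral>\<^sup>+w\<in>cball 0 1. ennreal ((1 - (cmod (phi a w))\<^sup>2) * (cmod (gr w) powr (real m / real n) * cmod (deriv gr w))\<^sup>2) \<partial>lborel)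
        = (\<integral>\<^sup>+w\<in>cball 0 1. ennreal ((1 - (cmod (phi a w))\<^sup>2) * (cmod (g (of_real r * w)) powr (real m / real n) * (r * cmod (deriv g (of_real r * w))))\<^sup>2) \<partial>lborel)"
        using dgr R r2 by (intro nn_integral_cong) (auto simp: indicator_def gr_def norm_mult)
      ultimately show "(\<integral>\<^sup>+w\<in>cball 0 1. ennreal ((1 - (cmod (phi a w))\<^sup>2) * (cmod (g (of_real r * w)) powr (real m / real n) * (r * cmod (deriv g (of_real r * w))))\<^sup>2) \<partial>lborel)
          \<le> ennreal (D * N powr (2 / real n))" by simp
    qed
  qed
qed

text \<open>The bound for the dilations is uniform in r, and Fatou lets r tend to 1. The upper bound
  for the gradient of |g|^s then costs the factor s^2.\<close>

lemma bmoa_estimate: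
  fixes m n :: nat and p :: real
  assumes p: "0 < p" and n: "n \<ge> 1" and m: "m \<ge> 1"
  obtains C :: real where "0 < C" "\<And>g N. g holomorphic_on disc \<Longrightarrow> 0 < N \<Longrightarrow>
      opnorm (-1) p (\<lambda>f. (Sg g ^^ m) ((Tg g ^^ n) f)) \<le> ennreal N \<Longrightarrow> bmoa_pow (real m / real n + 1) g \<le> ennreal (C * N powr (2 / real n))"
proof (rule hardy_test_estimate[OF p n, of m])
  fix D :: real
  assume D: "0 < D" and est: "\<And>g N a r. g holomorphic_on disc \<Longrightarrow> 0 < N \<Longrightarrow>
      opnorm (-1) p (\<lambda>f. (Sg g ^^ m) ((Tg g ^^ n) f)) \<le> ennreal N \<Longrightarrow> cmod a < 1 \<Longrightarrow> (1 + cmod a) / 2 \<le> r \<Longrightarrow> r < 1 \<Longrightarrow>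
      (\<integral>\<^sup>+w\<in>cball 0 1. ennreal ((1 - (cmod (phi a w))\<^sup>2) * (cmod (g (of_real r * w)) powr (real m / real n) * (r * cmod (deriv g (of_real r * w))))\<^sup>2) \<partial>lborel)
        \<le> ennreal (D * N powr (2 / real n))"
  define \<sigma> where "\<sigma> = real m / real n"
  have \<sigma>: "0 < \<sigma>" using m n by (simp add: \<sigma>_def)
  define s where "s = \<sigma> + 1"
  have s: "1 < s" using \<sigma> by (simp add: s_def)
  show thesis
  proof (rule that[of "s\<^sup>2 * D / pi"])
    show "0 < s\<^sup>2 * D / pi" using s D by simp
    fix g :: "complex \<Rightarrow> complex" and N :: real
    assume g: "g holomorphic_on disc" and N: "0 < N" and op: "opnorm (-1) p (\<lambda>f. (Sg g ^^ m) ((Tg g ^^ n) f)) \<le> ennreal N"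
    have dg: "deriv g holomorphic_on disc" by (rule holomorphic_deriv[OF g open_ball])
    have cg: "isCont g w" "isCont (deriv g) w" if "w \<in> disc" for w
      using holomorphic_on_imp_continuous_on[OF g] holomorphic_on_imp_continuous_on[OF dg] that
      by (simp_all add: continuous_on_eq_continuous_at)
    show "bmoa_pow (real m / real n + 1) g \<le> ennreal (s\<^sup>2 * D / pi * N powr (2 / real n))"
      unfolding bmoa_pow_def \<sigma>_def[symmetric] s_def[symmetric]
    proof (rule SUP_least)
      fix a :: complex assume "a \<in> disc"
      then have a: "cmod a < 1" by simp
      define h where "h w = (1 - (cmod (phi a w))\<^sup>2) * (cmod (g w) powr \<sigma> * cmod (deriv g w))\<^sup>2" for w
      \<comment> \<open>Increases to 1 while staying in the range, dependent on \<open>a\<close>,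
        for which the estimate was proved.\<close>
      define r where "r k = 1 - (1 - cmod a) / 2 * (1 / real (Suc k))" for k
      have r: "(1 + cmod a) / 2 \<le> r k" "r k < 1" "0 < r k" for k
      proof -
        have "(1 - cmod a) / 2 * (1 / real (Suc k)) \<le> (1 - cmod a) / 2 * 1" using a by (intro mult_left_mono) auto
        then show "(1 + cmod a) / 2 \<le> r k" by (simp add: r_def field_simps)
        then show "0 < r k" using norm_ge_zero[of a] by (smt (verit) half_gt_zero)
        show "r k < 1" using a by (simp add: r_def)
      qed
      have "(\<lambda>k. 1 - (1 - cmod a) / 2 * (1 / real (Suc k))) \<longlonglongrightarrow> 1 - (1 - cmod a) / 2 * 0"
        by (intro tendsto_intros LIMSEQ_Suc[OF lim_1_over_n])
      then have r1: "r \<longlonglongrightarrow> 1" by (simp add: r_def[abs_def])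
      define hk where "hk k w = (1 - (cmod (phi a w))\<^sup>2) * (cmod (g (of_real (r k) * w)) powr \<sigma> * (r k * cmod (deriv g (of_real (r k) * w))))\<^sup>2" for k w
      have nz: "1 - cnj a * w \<noteq> 0" if "w \<in> cball 0 1" for w using one_minus_cnj_mult(4)[OF a that] by auto
      have phic: "continuous_on (cball 0 1) (phi a)"
        unfolding phi_def[abs_def] using nz by (intro continuous_intros) auto
      have rin: "of_real (r k) * w \<in> disc" if "w \<in> cball 0 1" for k w
      proof -
        have "r k * cmod w \<le> r k * 1" using r[of k] that by (intro mult_left_mono) auto
        then have "cmod (of_real (r k) * w) \<le> r k" using r(3)[of k] by (simp add: norm_mult)
        then have "cmod (of_real (r k) * w) < 1" using r(2)[of k] by (rule le_less_trans)
        then show ?thesis by simp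
      qed
      have meas: "(\<lambda>w. ennreal (hk k w) * indicator (cball 0 1) w) \<in> borel_measurable lborel" for k
      proof -
        have "continuous_on (cball 0 1) (\<lambda>w. g (of_real (r k) * w))" "continuous_on (cball 0 1) (\<lambda>w. deriv g (of_real (r k) * w))"
          by (rule continuous_on_compose2[OF holomorphic_on_imp_continuous_on[OF g]] continuous_on_compose2[OF holomorphic_on_imp_continuous_on[OF dg]],
              auto intro!: continuous_intros rin)+
        then have "continuous_on (cball 0 1) (hk k)"
          unfolding hk_def[abs_def] using \<sigma> by (intro continuous_intros phic continuous_on_cmod_powr)
        from borel_measurable_continuous_on_indicator[OF _ this]
        have "(\<lambda>w. ennreal (indicator (cball 0 1) w *\<^sub>R hk k w)) \<in> borel_measurable lborel" by simp
        moreover have "ennreal (indicator (cball 0 1) w *\<^sub>R hk k w) = ennreal (hk k w) * indicator (cball 0 1) w" for w by (simp add: indicator_def)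
        ultimately show ?thesis by (simp only:)
      qed
      have "(\<integral>\<^sup>+w\<in>disc. ennreal (h w) \<partial>lborel) \<le> (\<integral>\<^sup>+w. liminf (\<lambda>k. ennreal (hk k w) * indicator (cball 0 1) w) \<partial>lborel)"
      proof (intro nn_integral_mono)
        fix w
        show "ennreal (h w) * indicator disc w \<le> liminf (\<lambda>k. ennreal (hk k w) * indicator (cball 0 1) w)"
        proof (cases "w \<in> disc")
          case True
          have "(\<lambda>k. of_real (r k) * w) \<longlonglongrightarrow> of_real 1 * w" by (intro tendsto_intros r1)
          then have l: "(\<lambda>k. of_real (r k) * w) \<longlonglongrightarrow> w" by simp
          have "(\<lambda>k. hk k w) \<longlonglongrightarrow> (1 - (cmod (phi a w))\<^sup>2) * (cmod (g w) powr \<sigma> * (1 * cmod (deriv g w)))\<^sup>2"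
            unfolding hk_def using \<sigma>
            by (intro tendsto_intros tendsto_powr' r1 isCont_tendsto_compose[OF cg(1)[OF True] l] isCont_tendsto_compose[OF cg(2)[OF True] l]) auto
          then have "(\<lambda>k. ennreal (hk k w)) \<longlonglongrightarrow> ennreal (h w)" by (intro tendsto_ennrealI) (simp add: h_def)
          then have "(\<lambda>k. ennreal (hk k w) * indicator (cball 0 1) w) \<longlonglongrightarrow> ennreal (h w)" using True by simp
          then have "liminf (\<lambda>k. ennreal (hk k w) * indicator (cball 0 1) w) = ennreal (h w)" by (intro lim_imp_Liminf) auto
          then show ?thesis using True by simp
        qed simp
      qed
      also have "\<dots> \<le> liminf (\<lambda>k. \<integral>\<^sup>+w. ennreal (hk k w) * indicator (cball 0 1) w \<partial>lborel)" by (rule nn_integral_liminf[OF meas])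
      also have "\<dots> \<le> ennreal (D * N powr (2 / real n))"
        unfolding hk_def \<sigma>_def by (intro Liminf_le always_eventually allI est[OF g N op a r(1) r(2)]) simp
      finally have H: "(\<integral>\<^sup>+w\<in>disc. ennreal (h w) \<partial>lborel) \<le> ennreal (D * N powr (2 / real n))" .
      have hm: "(\<lambda>w. ennreal (h w) * indicator disc w) \<in> borel_measurable lborel"
      proof -
        have "continuous_on disc h"
          unfolding h_def[abs_def] using \<sigma>
          by (intro continuous_intros continuous_on_subset[OF phic] continuous_on_cmod_powr holomorphic_on_imp_continuous_on g dg) auto
        from borel_measurable_continuous_on_indicator[OF _ this]
        have "(\<lambda>w. ennreal (indicator disc w *\<^sub>R h w)) \<in> borel_measurable lborel" by simp
        moreover have "ennreal (indicator disc w *\<^sub>R h w) = ennreal (h w) * indicator disc w" for w by (simp add: indicator_def)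
        ultimately show ?thesis by (simp only:)
      qed
      have "(\<integral>\<^sup>+ z \<in> disc. ennreal (1 - (cmod (phi a z))\<^sup>2) * (grad_abs (\<lambda>w. cmod (g w) powr s) z)\<^sup>2 \<partial>lborel)
        \<le> (\<integral>\<^sup>+w. ennreal (s\<^sup>2) * (ennreal (h w) * indicator disc w) \<partial>lborel)"
      proof (intro nn_integral_mono)
        fix w
        show "ennreal (1 - (cmod (phi a w))\<^sup>2) * (grad_abs (\<lambda>w. cmod (g w) powr s) w)\<^sup>2 * indicator disc w \<le> ennreal (s\<^sup>2) * (ennreal (h w) * indicator disc w)"
        proof (cases "w \<in> disc")
          case True
          define u where "u = s * cmod (g w) powr \<sigma> * cmod (deriv g w)"
          have u: "0 \<le> u" using s by (simp add: u_def)
          have "grad_abs (\<lambda>w. cmod (g w) powr s) w \<le> ennreal u"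
            using grad_abs_cmod_powr_le[OF g open_ball True s] by (simp add: u_def s_def)
          then have "(grad_abs (\<lambda>w. cmod (g w) powr s) w)\<^sup>2 \<le> (ennreal u)\<^sup>2" by (rule power_mono) simp
          also have "\<dots> = ennreal (u\<^sup>2)" using u by (simp add: ennreal_power)
          finally have "ennreal (1 - (cmod (phi a w))\<^sup>2) * (grad_abs (\<lambda>w. cmod (g w) powr s) w)\<^sup>2 \<le> ennreal (1 - (cmod (phi a w))\<^sup>2) * ennreal (u\<^sup>2)"
            by (rule mult_left_mono) simp
          also have "\<dots> = ennreal ((1 - (cmod (phi a w))\<^sup>2) * u\<^sup>2)" by (simp add: ennreal_mult'')
          also have "(1 - (cmod (phi a w))\<^sup>2) * u\<^sup>2 = s\<^sup>2 * h w" by (simp add: u_def h_def power_mult_distrib mult_ac)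
          also have "ennreal (s\<^sup>2 * h w) = ennreal (s\<^sup>2) * ennreal (h w)" by (simp add: ennreal_mult')
          finally show ?thesis using True by simp
        qed simp
      qed
      also have "\<dots> = ennreal (s\<^sup>2) * (\<integral>\<^sup>+w\<in>disc. ennreal (h w) \<partial>lborel)" by (rule nn_integral_cmult[OF hm])
      also have "\<dots> \<le> ennreal (s\<^sup>2) * ennreal (D * N powr (2 / real n))" by (intro mult_left_mono H) simp
      also have "\<dots> = ennreal (pi * (s\<^sup>2 * D / pi * N powr (2 / real n)))" by (simp add: ennreal_mult'[symmetric] mult_ac)
      finally show "(\<integral>\<^sup>+ z \<in> disc. ennreal (1 - (cmod (phi a z))\<^sup>2) * (grad_abs (\<lambda>w. cmod (g w) powr s) z)\<^sup>2 \<partial>lborel) / ennreal pi \<le> ennreal (s\<^sup>2 * D / pi * N powr (2 / real n))"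
        using s D by (subst divide_ennreal_le_iff) auto
    qed
  qed
qed

section \<open>The Bergman case\<close>

lemma ennreal_mult_leD:
  assumes "ennreal c * X \<le> ennreal y" "0 < c" "0 \<le> y"
  shows "X \<le> ennreal (y / c)"
proof (cases X)
  case (real x)
  then have "ennreal (c * x) \<le> ennreal y" using assms by (simp add: ennreal_mult)
  then have "c * x \<le> y" using assms by (simp add: ennreal_le_iff)
  then show ?thesis using real assms by (simp add: ennreal_leI le_divide_eq mult.commute)
next
  case top
  then show ?thesis using assms by (simp add: ennreal_mult_top top_unique)
qed

text \<open>The exponent is chosen so that the p-th power of the test function is at most the kernel
  power \<alpha> + 5 of the weighted kernel estimate, as |z| < 1.\<close>

lemma bergman_pow_test_function:
  assumes \<alpha>: "-1 < \<alpha>" and p: "0 < p"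
  obtains C :: real where "0 < C" "\<And>b. cmod b < 1 \<Longrightarrow> bergman_pow \<alpha> p (\<lambda>z. z * power_kernel b ((\<alpha> + 5) / p) z) \<le> ennreal (C / (1 - cmod b) ^ 3)"
proof (rule disc_kernel_weighted[OF \<alpha>])
  fix C :: real
  assume C: "0 < C" and I: "\<And>a. cmod a < 1 \<Longrightarrow>
    (\<integral>\<^sup>+z\<in>disc. ennreal ((1 - (cmod z)\<^sup>2) powr \<alpha> * cmod (1 - cnj a * z) powr (- (\<alpha> + 5))) \<partial>lborel) \<le> ennreal (C / (1 - cmod a) ^ 3)"
  show thesis
  proof (rule that[of "(\<alpha> + 1) * C / pi"])
    show "0 < (\<alpha> + 1) * C / pi" using \<alpha> C by simp
    fix b :: complex assume b: "cmod b < 1"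
    have "(\<integral>\<^sup>+z\<in>disc. ennreal (cmod (z * power_kernel b ((\<alpha> + 5) / p) z) powr p * (1 - (cmod z)\<^sup>2) powr \<alpha>) \<partial>lborel)
      \<le> (\<integral>\<^sup>+z\<in>disc. ennreal ((1 - (cmod z)\<^sup>2) powr \<alpha> * cmod (1 - cnj b * z) powr (- (\<alpha> + 5))) \<partial>lborel)"
    proof (intro nn_integral_mono)
      fix z
      show "ennreal (cmod (z * power_kernel b ((\<alpha> + 5) / p) z) powr p * (1 - (cmod z)\<^sup>2) powr \<alpha>) * indicator disc z
        \<le> ennreal ((1 - (cmod z)\<^sup>2) powr \<alpha> * cmod (1 - cnj b * z) powr (- (\<alpha> + 5))) * indicator disc z"
      proof (cases "z \<in> disc")
        case True
        have "cmod b * cmod z \<le> 1 * cmod z" using b by (intro mult_right_mono) auto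
        then have bz: "cmod (cnj b * z) < 1" using True by (simp add: norm_mult)
        have "cmod (z * power_kernel b ((\<alpha> + 5) / p) z) powr p = cmod z powr p * cmod (1 - cnj b * z) powr (- (\<alpha> + 5))"
          unfolding norm_mult power_kernel_properties(2)[OF bz] using p by (simp add: powr_mult powr_powr)
        also have "\<dots> \<le> 1 * cmod (1 - cnj b * z) powr (- (\<alpha> + 5))"
          using True p powr_mono2[of p "cmod z" 1] by (intro mult_right_mono) auto
        finally have "cmod (z * power_kernel b ((\<alpha> + 5) / p) z) powr p * (1 - (cmod z)\<^sup>2) powr \<alpha> \<le> 1 * cmod (1 - cnj b * z) powr (- (\<alpha> + 5)) * (1 - (cmod z)\<^sup>2) powr \<alpha>"
          by (rule mult_right_mono) simp
        then show ?thesis using True by (simp add: ennreal_leI mult.commute)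
      qed simp
    qed
    also have "\<dots> \<le> ennreal (C / (1 - cmod b) ^ 3)" by (rule I[OF b])
    finally have "ennreal (\<alpha> + 1) * (\<integral>\<^sup>+z\<in>disc. ennreal (cmod (z * power_kernel b ((\<alpha> + 5) / p) z) powr p * (1 - (cmod z)\<^sup>2) powr \<alpha>) \<partial>lborel)
       \<le> ennreal (\<alpha> + 1) * ennreal (C / (1 - cmod b) ^ 3)" by (rule mult_left_mono) simp
    also have "\<dots> = ennreal (pi * ((\<alpha> + 1) * C / pi / (1 - cmod b) ^ 3))"
      using \<alpha> by (simp add: ennreal_mult'[symmetric])
    finally show "bergman_pow \<alpha> p (\<lambda>z. z * power_kernel b ((\<alpha> + 5) / p) z) \<le> ennreal ((\<alpha> + 1) * C / pi / (1 - cmod b) ^ 3)"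
      unfolding bergman_pow_def using \<alpha> C b by (subst divide_ennreal_le_iff) auto
  qed
qed

text \<open>On the disc of radius (1 - |a|)/2 about \<open>a\<close> the weight is comparable to its
  size at \<open>a\<close>, which gives the power -\<alpha>; rescaling the area gives the power
  -2.\<close>

lemma bergman_pow_local:
  fixes \<alpha> p :: real
  assumes \<alpha>: "-1 < \<alpha>" and p: "0 < p"
  obtains \<kappa> :: real where "0 < \<kappa>" "\<And>F a T. F holomorphic_on disc \<Longrightarrow> cmod a < 1 \<Longrightarrow> 0 \<le> T \<Longrightarrow> bergman_pow \<alpha> p F \<le> ennreal T \<Longrightarrow>
     (\<integral>\<^sup>+w\<in>cball 0 1. ennreal (cmod (F (a + of_real ((1 - cmod a) / 2) * w)) powr p) \<partial>lborel) \<le> ennreal (\<kappa> * (1 - cmod a) powr (- \<alpha> - 2) * T)"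
proof (rule that)
  \<comment> \<open>On that disc 1 - |z|^2 lies between d/2 and 3 d. The first summand serves
    nonnegative \<alpha>, the second negative \<alpha>.\<close>
  define \<kappa>1 where "\<kappa>1 = 2 powr \<alpha> + 3 powr (- \<alpha>)"
  have \<kappa>1: "0 < \<kappa>1" unfolding \<kappa>1_def by (intro add_pos_pos) auto
  show "0 < 4 * \<kappa>1 * pi / (\<alpha> + 1)" using \<kappa>1 \<alpha> by simp
  fix F :: "complex \<Rightarrow> complex" and a :: complex and T :: real
  assume F: "F holomorphic_on disc" and a: "cmod a < 1" and T: "0 \<le> T" "bergman_pow \<alpha> p F \<le> ennreal T"
  define d where "d = 1 - cmod a"
  have d: "0 < d" "d \<le> 1" using a by (auto simp: d_def)
  define \<rho> where "\<rho> = d / 2"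
  have \<rho>: "0 < \<rho>" using d by (simp add: \<rho>_def)
  let ?W = "\<lambda>z. cmod (F z) powr p * (1 - (cmod z)\<^sup>2) powr \<alpha>"
  have Fc: "continuous_on disc F" by (rule holomorphic_on_imp_continuous_on[OF F])
  have sub: "cball a \<rho> \<subseteq> disc" "\<And>z. z \<in> cball a \<rho> \<Longrightarrow> d / 2 \<le> 1 - (cmod z)\<^sup>2" "\<And>z. z \<in> cball a \<rho> \<Longrightarrow> 1 - (cmod z)\<^sup>2 \<le> 3 * d"
  proof -
    have z: "cmod z \<le> 1 - d / 2 \<and> 1 - cmod z \<le> 3 / 2 * d" if "z \<in> cball a \<rho>" for z
    proof -
      have z1: "cmod (z - a) \<le> d / 2" using that by (simp add: dist_norm norm_minus_commute \<rho>_def)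
      have z2: "cmod z \<le> cmod a + cmod (z - a)" using norm_triangle_ineq[of a "z - a"] by simp
      have z3: "cmod a \<le> cmod z + cmod (z - a)" using norm_triangle_ineq[of z "a - z"] by (simp add: norm_minus_commute)
      have ad: "cmod a = 1 - d" by (simp add: d_def)
      have "cmod z \<le> 1 - d / 2" using z1 z2 unfolding ad by simp
      moreover have "1 - cmod z \<le> 3 / 2 * d" using z1 z3 unfolding ad by simp
      ultimately show ?thesis ..
    qed
    then show "cball a \<rho> \<subseteq> disc" using d by fastforce
    fix z assume zb: "z \<in> cball a \<rho>"
    note z[OF zb]
    moreover have e: "1 - (cmod z)\<^sup>2 = (1 - cmod z) * (1 + cmod z)" by (simp add: power2_eq_square algebra_simps)
    ultimately have "(d / 2) * 1 \<le> (1 - cmod z) * (1 + cmod z)" using d by (intro mult_mono) auto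
    then show "d / 2 \<le> 1 - (cmod z)\<^sup>2" unfolding e by simp
    have "(1 - cmod z) * (1 + cmod z) \<le> (3 / 2 * d) * 2" using z[OF zb] d by (intro mult_mono) auto
    then show "1 - (cmod z)\<^sup>2 \<le> 3 * d" unfolding e by simp
  qed
  have wt: "1 \<le> \<kappa>1 * d powr (- \<alpha>) * (1 - (cmod z)\<^sup>2) powr \<alpha>" if z: "z \<in> cball a \<rho>" for z
  proof -
    define v where "v = (1 - (cmod z)\<^sup>2) / d"
    have v: "1 / 2 \<le> v" "v \<le> 3" using sub(2,3)[OF z] d by (auto simp: v_def field_simps)
    have "1 \<le> \<kappa>1 * v powr \<alpha>"
    proof (cases "0 \<le> \<alpha>")
      case True
      have "1 = 2 powr \<alpha> * (1 / 2) powr \<alpha>" by (simp add: powr_divide)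
      also have "\<dots> \<le> \<kappa>1 * v powr \<alpha>" unfolding \<kappa>1_def using v True by (intro mult_mono powr_mono2) auto
      finally show ?thesis .
    next
      case False
      have "1 = 3 powr (- \<alpha>) * 3 powr \<alpha>" by (simp flip: powr_add)
      also have "\<dots> \<le> \<kappa>1 * v powr \<alpha>" unfolding \<kappa>1_def using v False by (intro mult_mono powr_mono2') auto
      finally show ?thesis .
    qed
    also have "v powr \<alpha> = d powr (- \<alpha>) * (1 - (cmod z)\<^sup>2) powr \<alpha>"
      using d sub(2)[OF z] unfolding v_def by (simp add: powr_divide powr_minus_divide)
    finally show ?thesis by (simp add: mult.assoc)
  qed
  have Wm: "(\<lambda>z. ennreal (?W z) * indicator disc z) \<in> borel_measurable lborel"
  proof -
    have "1 - (cmod z)\<^sup>2 \<noteq> 0" if "z \<in> disc" for z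
    proof -
      have "(cmod z)\<^sup>2 < 1" using that by (simp add: abs_square_less_1)
      then show ?thesis by simp
    qed
    then have "continuous_on disc (\<lambda>z. (1 - (cmod z)\<^sup>2) powr \<alpha>)" by (intro continuous_intros) auto
    then have "continuous_on disc ?W" using continuous_on_cmod_powr[OF Fc p] by (rule continuous_on_mult[rotated])
    from borel_measurable_continuous_on_indicator[OF _ this]
    have "(\<lambda>z. ennreal (indicator disc z *\<^sub>R ?W z)) \<in> borel_measurable lborel" by simp
    moreover have "ennreal (indicator disc z *\<^sub>R ?W z) = ennreal (?W z) * indicator disc z" for z by (simp add: indicator_def)
    ultimately show ?thesis by (simp only:)
  qed
  have "ennreal (\<alpha> + 1) * (\<integral>\<^sup>+z\<in>disc. ennreal (?W z) \<partial>lborel) \<le> ennreal (pi * T)"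
    using T unfolding bergman_pow_def by (subst (asm) divide_ennreal_le_iff) auto
  then have I: "(\<integral>\<^sup>+z\<in>disc. ennreal (?W z) \<partial>lborel) \<le> ennreal (pi * T / (\<alpha> + 1))"
    using \<alpha> T by (intro ennreal_mult_leD) auto
  have "ennreal (\<rho>\<^sup>2) * (\<integral>\<^sup>+w\<in>cball 0 1. ennreal (cmod (F (a + of_real \<rho> * w)) powr p) \<partial>lborel) = (\<integral>\<^sup>+z\<in>cball a \<rho>. ennreal (cmod (F z) powr p) \<partial>lborel)"
    by (rule nn_integral_cball_affine[symmetric, OF _ \<rho>]) (intro continuous_on_cmod_powr continuous_on_subset[OF Fc] sub p)
  also have "\<dots> \<le> (\<integral>\<^sup>+z. ennreal (\<kappa>1 * d powr (- \<alpha>)) * (ennreal (?W z) * indicator disc z) \<partial>lborel)"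
  proof (intro nn_integral_mono)
    fix z
    show "ennreal (cmod (F z) powr p) * indicator (cball a \<rho>) z \<le> ennreal (\<kappa>1 * d powr (- \<alpha>)) * (ennreal (?W z) * indicator disc z)"
    proof (cases "z \<in> cball a \<rho>")
      case True
      have "cmod (F z) powr p * 1 \<le> cmod (F z) powr p * (\<kappa>1 * d powr (- \<alpha>) * (1 - (cmod z)\<^sup>2) powr \<alpha>)" by (rule mult_left_mono[OF wt[OF True]]) simp
      then have "cmod (F z) powr p \<le> \<kappa>1 * d powr (- \<alpha>) * ?W z" by (simp add: mult_ac)
      then have "ennreal (cmod (F z) powr p) \<le> ennreal (\<kappa>1 * d powr (- \<alpha>)) * ennreal (?W z)"
        using \<kappa>1 by (simp add: ennreal_leI flip: ennreal_mult')
      then show ?thesis using True sub(1) by auto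
    qed simp
  qed
  also have "\<dots> = ennreal (\<kappa>1 * d powr (- \<alpha>)) * (\<integral>\<^sup>+z\<in>disc. ennreal (?W z) \<partial>lborel)" by (rule nn_integral_cmult[OF Wm])
  also have "\<dots> \<le> ennreal (\<kappa>1 * d powr (- \<alpha>)) * ennreal (pi * T / (\<alpha> + 1))" by (intro mult_left_mono I) simp
  also have "\<dots> = ennreal (\<kappa>1 * d powr (- \<alpha>) * (pi * T / (\<alpha> + 1)))" using \<kappa>1 by (intro ennreal_mult'[symmetric]) simp
  finally have "(\<integral>\<^sup>+w\<in>cball 0 1. ennreal (cmod (F (a + of_real \<rho> * w)) powr p) \<partial>lborel) \<le> ennreal (\<kappa>1 * d powr (- \<alpha>) * (pi * T / (\<alpha> + 1)) / \<rho>\<^sup>2)"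
    using \<rho> \<kappa>1 \<alpha> T by (intro ennreal_mult_leD) auto
  also have "\<kappa>1 * d powr (- \<alpha>) * (pi * T / (\<alpha> + 1)) / \<rho>\<^sup>2 = 4 * \<kappa>1 * pi / (\<alpha> + 1) * (d powr (- \<alpha>) * d powr (- 2)) * T"
    using d by (simp add: \<rho>_def power_divide powr_minus_divide mult_ac)
  also have "d powr (- \<alpha>) * d powr (- 2) = d powr (- \<alpha> - 2)" by (simp flip: powr_add)
  finally show "(\<integral>\<^sup>+w\<in>cball 0 1. ennreal (cmod (F (a + of_real ((1 - cmod a) / 2) * w)) powr p) \<partial>lborel) \<le> ennreal (4 * \<kappa>1 * pi / (\<alpha> + 1) * (1 - cmod a) powr (- \<alpha> - 2) * T)"
    by (simp add: \<rho>_def d_def)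
qed

lemma power_mult_powr_eq:
  fixes x y :: real
  assumes "0 \<le> x" "0 \<le> y" "m \<ge> 1" "n \<ge> 1"
  shows "(x ^ m * y ^ n) powr (1 / real n) = x powr (real m / real n) * y"
proof (cases "x = 0 \<or> y = 0")
  case True
  then show ?thesis using assms by (auto simp: power_0_left)
next
  case False
  then have "0 < x" "0 < y" using assms by auto
  then have "(x ^ m * y ^ n) powr (1 / real n) = (x powr real m) powr (1 / real n) * (y powr real n) powr (1 / real n)"
    by (simp add: powr_mult powr_realpow)
  then show ?thesis using \<open>0 < x\<close> \<open>0 < y\<close> assms by (simp add: powr_powr)
qed

text \<open>Squaring makes the normal derivative vanish on the circle as well, so that Green's
  formula leaves area integrals only.\<close>

lemma lap2_one_minus_square_kernel:
  obtains Dv av where "lap2 UNIV (\<lambda>z. (1 - (cmod z)\<^sup>2)\<^sup>2) Dv av (\<lambda>z. 8 * (cmod z)\<^sup>2 - 4)" "\<And>z. cmod z = 1 \<Longrightarrow> Dv z = 0"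
proof -
  have "\<exists>p. lap2 UNIV (\<lambda>z. (1 - (cmod z)\<^sup>2)\<^sup>2) (\<lambda>z. of_real (- 2 * (1 - (cmod z)\<^sup>2)) * (2 * cnj z)) p
      (\<lambda>z. 2 * (cmod (2 * cnj z))\<^sup>2 / 2 + (- 2 * (1 - (cmod z)\<^sup>2)) * 2)"
    by (rule exI, rule lap2_compose[OF lap2_cmod_square[OF open_UNIV], where I=UNIV])
      (auto intro!: derivative_eq_intros continuous_intros)
  then obtain p where l: "lap2 UNIV (\<lambda>z. (1 - (cmod z)\<^sup>2)\<^sup>2) (\<lambda>z. of_real (- 2 * (1 - (cmod z)\<^sup>2)) * (2 * cnj z)) p
      (\<lambda>z. 2 * (cmod (2 * cnj z))\<^sup>2 / 2 + (- 2 * (1 - (cmod z)\<^sup>2)) * 2)" by (elim exE)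
  have e: "2 * (cmod (2 * cnj z))\<^sup>2 / 2 + (- 2 * (1 - (cmod z)\<^sup>2)) * 2 = 8 * (cmod z)\<^sup>2 - 4" for z :: complex
    by (simp add: norm_mult power_mult_distrib)
  show thesis by (rule that[OF l[unfolded e]]) simp
qed

lemma enn_powr_le:
  assumes "X \<le> ennreal (C * N powr e)" "0 < C" "0 < N" "0 < u" "0 < v" "e * u * v = 1"
  shows "enn_powr (enn_powr X u) v \<le> ennreal (C powr (u * v) * N)"
proof -
  have "X < \<infinity>" using assms(1) by (simp add: le_less_trans)
  then obtain x where x: "X = ennreal x" "0 \<le> x" by (cases X) auto
  have le: "x \<le> C * N powr e" using assms(1) x assms(2,3) by (simp add: ennreal_le_iff)
  have "enn_powr (enn_powr X u) v = ennreal (x powr (u * v))"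
    unfolding enn_powr_def x using x(2) by (simp add: powr_powr)
  also have "\<dots> \<le> ennreal ((C * N powr e) powr (u * v))"
    using x(2) le assms by (intro ennreal_leI powr_mono2) auto
  also have "(C * N powr e) powr (u * v) = C powr (u * v) * N"
    using assms by (simp add: powr_mult powr_powr mult.assoc)
  finally show ?thesis .
qed

text \<open>The estimates assume a positive real bound \<open>N\<close> for the operator norm
  because they divide by powers of it. Approaching the norm from above covers norm 0, and an
  infinite norm makes the claim trivial.\<close>

lemma le_mult_ennreal_if:
  assumes C: "0 < C" and le: "\<And>N. 0 < N \<Longrightarrow> T \<le> ennreal N \<Longrightarrow> X \<le> ennreal (C * N)"
  shows "X \<le> ennreal C * T"
proof (cases T)
  case (real x)
  show ?thesis
  proof (rule ennreal_le_epsilon)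
    fix e :: real assume e: "0 < e"
    have "X \<le> ennreal (C * (x + e / C))"
      using real e C by (intro le add_nonneg_pos) (auto intro!: ennreal_leI)
    also have "C * (x + e / C) = C * x + e" using C by (simp add: distrib_left)
    also have "ennreal (C * x + e) = ennreal C * T + ennreal e"
      using real e C by (simp add: ennreal_mult')
    finally show "X \<le> ennreal C * T + ennreal e" .
  qed
next
  case top
  then show ?thesis using C by (simp add: ennreal_mult_top)
qed

text \<open>The chain is pulled back from the disc of radius (1 - |a|)/2 about \<open>a\<close>.
  Green's formula bounds the mean of u^2 there, and the submean property turns this into a bound at
  \<open>a\<close>. Keeping |a| at least 1/2 keeps that disc away from the zero of the test
  function.\<close>

lemma bergman_test_estimate:
  fixes m n :: nat and \<alpha> p :: real
  assumes \<alpha>: "-1 < \<alpha>" and p: "0 < p" and n: "n \<ge> 1" and m: "m \<ge> 1"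
  obtains D :: real where "0 < D" "\<And>g N a. g holomorphic_on disc \<Longrightarrow> 0 < N \<Longrightarrow>
      opnorm \<alpha> p (\<lambda>f. (Sg g ^^ m) ((Tg g ^^ n) f)) \<le> ennreal N \<Longrightarrow> 1 / 2 \<le> cmod a \<Longrightarrow> cmod a < 1 \<Longrightarrow>
      (1 - cmod a) * (cmod (g a) powr (real m / real n) * cmod (deriv g a)) \<le> D * N powr (1 / real n)"
proof -
  obtain j where j: "j \<ge> 1" "2 / real (n * j) \<le> p" "2 \<le> n * j" using exponent_choice[OF p n] by blast
  define K where "K = n * j"
  define q where "q = 2 / real K"
  have K2: "2 \<le> K" using j by (simp add: K_def)
  have q: "0 < q" "q \<le> p" using j(2) K2 unfolding q_def K_def[symmetric] by auto
  \<comment> \<open>With this exponent the p-th power of 1/f is of order d^(\<alpha> + 5) on the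
    small disc. It cancels d^(-\<alpha> - 2) from localisation and d^(-3) from the norm of
    f.\<close>
  define c where "c = (\<alpha> + 5) / p"
  have c: "0 < c" using p \<alpha> by (simp add: c_def)
  define C' where "C' = (1 + c)\<^sup>2"
  have C': "0 \<le> C'" by (simp add: C'_def)
  obtain C5 where C5: "0 < C5" and tf: "\<And>b. cmod b < 1 \<Longrightarrow> bergman_pow \<alpha> p (\<lambda>z. z * power_kernel b c z) \<le> ennreal (C5 / (1 - cmod b) ^ 3)"
    using bergman_pow_test_function[OF \<alpha> p] unfolding c_def by blast
  obtain \<kappa> :: real where \<kappa>: "0 < \<kappa>" and loc: "\<And>F a T. F holomorphic_on disc \<Longrightarrow> cmod a < 1 \<Longrightarrow> 0 \<le> T \<Longrightarrow> bergman_pow \<alpha> p F \<le> ennreal T \<Longrightarrow>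
     (\<integral>\<^sup>+w\<in>cball 0 1. ennreal (cmod (F (a + of_real ((1 - cmod a) / 2) * w)) powr p) \<partial>lborel) \<le> ennreal (\<kappa> * (1 - cmod a) powr (- \<alpha> - 2) * T)"
    using bergman_pow_local[OF \<alpha> p] by blast
  obtain Dv av where lv: "lap2 UNIV (\<lambda>z. (1 - (cmod z)\<^sup>2)\<^sup>2) Dv av (\<lambda>z. 8 * (cmod z)\<^sup>2 - 4)" and Dv0: "\<And>z. cmod z = 1 \<Longrightarrow> Dv z = 0"
    using lap2_one_minus_square_kernel by blast
  show thesis
  proof (rule chain_disc_estimate[where N=1 and m="\<lambda>i. if n dvd i then m else 0" and \<sigma>="real m / real n", OF j(3) sum_if_dvd[OF n], folded K_def], goal_cases)
    case (1 C0)
    note C0 = 1(1) and est = 1(2)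
    define E where "E = C0 * (1 + C') * ((1 + exp 4) * 16)"
    have E: "0 < E" unfolding E_def using C0 C' by (intro mult_pos_pos add_pos_nonneg add_pos_pos) auto
    define D2 where "D2 = 4 * (16 / 9) * (E * (pi + 4 powr p * 3 powr (\<alpha> + 5) * \<kappa> * C5))"
    have D2: "0 < D2" unfolding D2_def using E \<kappa> C5 by (intro mult_pos_pos add_pos_pos) auto
    show thesis
    proof (rule that[of "2 * sqrt D2"])
      show "0 < 2 * sqrt D2" using D2 by simp
      fix g :: "complex \<Rightarrow> complex" and N :: real and a :: complex
      assume g: "g holomorphic_on disc" and N: "0 < N" and op: "opnorm \<alpha> p (\<lambda>f. (Sg g ^^ m) ((Tg g ^^ n) f)) \<le> ennreal N"
        and a2: "1 / 2 \<le> cmod a" and a: "cmod a < 1"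
      define d where "d = 1 - cmod a"
      have d: "0 < d" "d \<le> 1 / 2" using a a2 by (auto simp: d_def)
      define \<rho> where "\<rho> = d / 2"
      have \<rho>: "0 < \<rho>" "\<rho> \<le> 1 / 4" using d by (auto simp: \<rho>_def)
      define t where "t = N ^ j"
      have t: "0 < t" using N by (simp add: t_def)
      \<comment> \<open>Maps \<open>ball 0 2\<close> into the unit disc, since 2 \<rho> = 1 - |a|,
        which provides the neighbourhood of the closed unit disc required by Green's
        formula.\<close>
      define L where "L w = a + of_real \<rho> * w" for w
      have Lb: "cmod (L w) \<le> cmod a + \<rho> * cmod w" "cmod a - \<rho> * cmod w \<le> cmod (L w)" for w
        using norm_triangle_ineq[of a "of_real \<rho> * w"] norm_diff_ineq[of a "of_real \<rho> * w"] \<rho> by (auto simp: L_def norm_mult)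
      have Ld: "L w \<in> disc" if "w \<in> ball 0 2" for w
      proof -
        have "\<rho> * cmod w < \<rho> * 2" using that \<rho> by (intro mult_strict_left_mono) auto
        then show ?thesis using Lb(1)[of w] by (simp add: \<rho>_def d_def)
      qed
      define f where "f z = z * power_kernel a c z" for z
      have f: "f holomorphic_on disc" "f 0 = 0" unfolding f_def by (auto intro!: holomorphic_intros holomorphic_power_kernel a)
      define G where "G = iterate_chain n m g f"
      note GP = iterate_chain_properties[OF g f(1), where n=n and m=m, folded G_def]
      define F where "F i w = G i (L w)" for i w
      define gr where "gr w = g (L w)" for w
      have ch: "((\<lambda>w. h (L w)) has_field_derivative deriv h (L w) * of_real \<rho>) (at w)" if "h holomorphic_on disc" "w \<in> ball 0 2" for h w
      proof (rule DERIV_chain2[where f=h and g=L])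
        show "(h has_field_derivative deriv h (L w)) (at (L w))" by (rule holomorphic_derivI[OF that(1) open_ball Ld[OF that(2)]])
        show "(L has_field_derivative of_real \<rho>) (at w)" unfolding L_def[abs_def] by (auto intro!: derivative_eq_intros)
      qed
      have dil: "(\<lambda>w. h (L w)) holomorphic_on ball 0 2" if "h holomorphic_on disc" for h
        unfolding holomorphic_on_open[OF open_ball] using ch[OF that] by blast
      have dild: "deriv (\<lambda>w. h (L w)) w = of_real \<rho> * deriv h (L w)" if "h holomorphic_on disc" "w \<in> ball 0 2" for h w
        using DERIV_imp_deriv[OF ch[OF that]] by (simp add: mult.commute)
      have dgr: "deriv gr w = of_real \<rho> * deriv g (L w)" if "w \<in> ball 0 2" for w
        unfolding gr_def[abs_def] by (rule dild[OF g that])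
      have grh: "gr holomorphic_on ball 0 2" unfolding gr_def[abs_def] by (rule dil[OF g])
      have Fh: "F i holomorphic_on ball 0 2" for i unfolding F_def[abs_def] by (rule dil[OF GP(1)])
      have aL: "cmod (cnj a * L w) < 1" if "w \<in> ball 0 2" for w
      proof -
        have "cmod a * cmod (L w) \<le> 1 * cmod (L w)" using a by (intro mult_right_mono) auto
        then show ?thesis using Ld[OF that] by (simp add: norm_mult)
      qed
      have L8: "1 / 8 \<le> cmod (L w)" if "w \<in> cball 0 (3 / 2)" for w
      proof -
        have "\<rho> * cmod w \<le> 1 / 4 * (3 / 2)" using that \<rho> by (intro mult_mono) auto
        then show ?thesis using Lb(2)[of w] a2 by linarith
      qed
      have L4: "1 / 4 \<le> cmod (L w)" if "w \<in> cball 0 1" for w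
      proof -
        have "\<rho> * cmod w \<le> 1 / 4 * 1" using that \<rho> by (intro mult_mono) auto
        then show ?thesis using Lb(2)[of w] a2 by linarith
      qed
      have F0nz: "F 0 w \<noteq> 0" if "w \<in> cball 0 (3 / 2)" for w
      proof -
        have "w \<in> ball 0 2" using that by auto
        then show ?thesis using L8[OF that] power_kernel_properties(3)[OF aL[of w], of c] by (auto simp: F_def G_def f_def)
      qed
      \<comment> \<open>At this scale the logarithmic derivative of the test function is bounded, so
        any harmonic function with gradient 1 pays for it. The shift by 1 makes it nonnegative on
        the closed disc, and exp(2 x) is at most exp 4 there.\<close>
      define x where "x k w = 1 + Re w" for k :: nat and w
      define M0 where "M0 w = (cmod (F K w) / cmod (F 0 w)) powr (2 / real K) * (1 + (\<Sum>k<(1::nat). exp (2 * x k w)))" for w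
      obtain M where M: "\<And>w. w \<in> cball 0 (3 / 2) \<Longrightarrow> M0 w \<le> M"
      proof -
        have cF: "continuous_on (cball 0 (3 / 2)) (F i)" for i
          by (rule continuous_on_subset[OF holomorphic_on_imp_continuous_on[OF Fh]]) auto
        have cq: "continuous_on (cball 0 (3 / 2)) (\<lambda>w. F K w / F 0 w)"
          by (intro continuous_intros cF ballI F0nz)
        have "continuous_on (cball 0 (3 / 2)) (\<lambda>w. cmod (F K w / F 0 w) powr q)"
          using q by (intro continuous_on_cmod_powr cq) auto
        then have "continuous_on (cball 0 (3 / 2)) (\<lambda>w. cmod (F K w / F 0 w) powr q * (1 + (\<Sum>k<(1::nat). exp (2 * x k w))))"
          by (rule continuous_on_mult) (unfold x_def, intro continuous_intros)
        then have "continuous_on (cball 0 (3 / 2)) M0" unfolding M0_def[abs_def] norm_divide q_def .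
        then have "compact (M0 ` cball 0 (3 / 2))" by (intro compact_continuous_image compact_cball)
        then have "bdd_above (M0 ` cball 0 (3 / 2))" by (intro bounded_imp_bdd_above compact_imp_bounded)
        then obtain M where "\<forall>w\<in>cball 0 (3 / 2). M0 w \<le> M" unfolding bdd_above_def by auto
        then show thesis using that by blast
      qed
      have lx: "lap2 (ball 0 (3 / 2) - {0}) (x k) (\<lambda>z. 1) (\<lambda>z. 0) (\<lambda>z. 0)" for k
        unfolding lap2_def x_def by (auto intro!: derivative_eq_intros)
      \<comment> \<open>The chain rule gives the factor \<rho>, which is at most |L w| and at most
        |1 - cnj a * L w|; hence the bound 1 + c.\<close>
      have \<theta>: "(cmod (deriv (F 0) w / F 0 w))\<^sup>2 \<le> C' * (\<Sum>k<(1::nat). (cmod 1)\<^sup>2)" if w: "w \<in> cball 0 1 - {0}" for w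
      proof -
        have wR: "w \<in> ball 0 2" and w1: "cmod w \<le> 1" and wc: "w \<in> cball 0 1" using w by auto
        define z where "z = L w"
        define y where "y = 1 - cnj a * z"
        note PK = power_kernel_properties[OF aL[OF wR], where c=c, folded z_def, folded y_def]
        have z4: "1 / 4 \<le> cmod z" unfolding z_def by (rule L4[OF wc])
        have zd: "cmod z \<le> 1 - \<rho>"
        proof -
          have "\<rho> * cmod w \<le> \<rho> * 1" using w1 \<rho> by (intro mult_left_mono) auto
          moreover have "cmod a + \<rho> = 1 - \<rho>" by (simp add: \<rho>_def d_def field_simps)
          ultimately show ?thesis using Lb(1)[of w] unfolding z_def by simp
        qed
        have yr: "\<rho> \<le> cmod y" unfolding y_def using one_minus_cnj_mult(2)[OF a, of z] zd \<rho> by simp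
        have y: "y \<noteq> 0" "z \<noteq> 0" using yr \<rho> z4 by auto
        have "(f has_field_derivative (power_kernel a c z + z * (power_kernel a c z * (of_real c * cnj a / y)))) (at z)"
          unfolding f_def[abs_def] by (rule derivative_eq_intros PK(1) refl)+ (simp add: mult_ac)
        then have "deriv f z = power_kernel a c z + z * (power_kernel a c z * (of_real c * cnj a / y))" by (rule DERIV_imp_deriv)
        moreover have "F 0 = (\<lambda>w. f (L w))" by (simp add: F_def[abs_def] G_def)
        ultimately have "deriv (F 0) w / F 0 w = of_real \<rho> * (power_kernel a c z + z * (power_kernel a c z * (of_real c * cnj a / y))) / (z * power_kernel a c z)"
          using dild[OF f(1) wR] by (simp add: z_def[symmetric] f_def)
        also have "\<dots> = of_real \<rho> * (1 / z + of_real c * cnj a / y)"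
          using y PK(3) by (simp add: field_simps)
        finally have e: "deriv (F 0) w / F 0 w = of_real \<rho> * (1 / z + of_real c * cnj a / y)" .
        have "cmod (deriv (F 0) w / F 0 w) = \<rho> * cmod (1 / z + of_real c * cnj a / y)" unfolding e norm_mult using \<rho> by simp
        also have "\<dots> \<le> \<rho> * (cmod (1 / z) + cmod (of_real c * cnj a / y))" using \<rho> by (intro mult_left_mono norm_triangle_ineq) auto
        also have "\<dots> = \<rho> / cmod z + c * cmod a * (\<rho> / cmod y)" using c by (simp add: norm_mult norm_divide distrib_left)
        also have "\<dots> \<le> (1 / 4) / (1 / 4) + c * 1 * 1"
          using \<rho> z4 yr y a c by (intro add_mono mult_mono frac_le) auto
        finally have "cmod (deriv (F 0) w / F 0 w) \<le> 1 + c" by simp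
        then have "(cmod (deriv (F 0) w / F 0 w))\<^sup>2 \<le> (1 + c)\<^sup>2" by (rule power_mono) simp
        then show ?thesis by (simp add: C'_def)
      qed
      \<comment> \<open>Young's inequality with t = N^j, together with the lower bound for the test
        function: |L w| is at least 1/4 and |1 - cnj a * L w| at most 3 d.\<close>
      have ratio: "(cmod (F K w) / cmod (F 0 w)) powr q \<le> t powr q * 1 + t powr (q - p) * (4 powr p * (3 * d) powr (\<alpha> + 5)) * cmod (F K w) powr p"
        if wc: "w \<in> cball 0 1" for w
      proof -
        have wR: "w \<in> ball 0 2" and w1: "cmod w \<le> 1" using wc by auto
        define y where "y = cmod (1 - cnj a * L w)"
        have y0: "0 < y" unfolding y_def using aL[OF wR] by (auto simp del: norm_mult complex_mod_cnj)
        have y3: "y \<le> 3 * d"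
        proof -
          have "1 - cnj a * L w = of_real (1 - (cmod a)\<^sup>2) - cnj a * (of_real \<rho> * w)"
            using complex_norm_square[of a] by (simp add: L_def algebra_simps)
          then have "y \<le> cmod (of_real (1 - (cmod a)\<^sup>2)) + cmod (cnj a * (of_real \<rho> * w))" unfolding y_def by (metis norm_triangle_ineq4)
          also have "cmod (of_real (1 - (cmod a)\<^sup>2)) = (1 - cmod a) * (1 + cmod a)"
          proof -
            have "(cmod a)\<^sup>2 \<le> 1" using a by (simp add: abs_square_le_1)
            then have "cmod (of_real (1 - (cmod a)\<^sup>2)) = 1 - (cmod a)\<^sup>2" by (simp only: norm_of_real abs_of_nonneg diff_ge_0_iff_ge)
            then show ?thesis by (simp add: power2_eq_square algebra_simps)
          qed
          also have "(1 - cmod a) * (1 + cmod a) \<le> d * 2" unfolding d_def using a by (intro mult_left_mono) auto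
          also have "cmod (cnj a * (of_real \<rho> * w)) \<le> 1 * (\<rho> * 1)" unfolding norm_mult using a \<rho> w1 by (intro mult_mono) auto
          finally show ?thesis using \<rho>_def d by simp
        qed
        have F0: "cmod (F 0 w) = cmod (L w) * y powr (- c)"
          unfolding F_def G_def y_def using power_kernel_properties(2)[OF aL[OF wR]] by (simp add: f_def norm_mult)
        have F0p: "(cmod (F K w) / cmod (F 0 w)) powr p \<le> 4 powr p * (3 * d) powr (\<alpha> + 5) * cmod (F K w) powr p"
        proof -
          have "1 / cmod (F 0 w) = 1 / cmod (L w) * y powr c"
            unfolding F0 using y0 by (simp add: powr_minus_divide)
          also have "\<dots> \<le> 4 * (3 * d) powr c"
            using L4[OF wc] y0 y3 c by (intro mult_mono powr_mono2) (auto simp: divide_le_eq)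
          finally have "cmod (F K w) * (1 / cmod (F 0 w)) \<le> cmod (F K w) * (4 * (3 * d) powr c)" by (rule mult_left_mono) simp
          then have "(cmod (F K w) / cmod (F 0 w)) powr p \<le> (cmod (F K w) * (4 * (3 * d) powr c)) powr p" using p by (intro powr_mono2) auto
          also have "\<dots> = 4 powr p * (3 * d) powr (\<alpha> + 5) * cmod (F K w) powr p"
            using p by (simp add: powr_mult powr_powr c_def)
          finally show ?thesis .
        qed
        have "(cmod (F K w) / cmod (F 0 w)) powr q \<le> t powr q + t powr (q - p) * (cmod (F K w) / cmod (F 0 w)) powr p"
          by (rule powr_le_young[OF q t]) simp
        also have "\<dots> \<le> t powr q + t powr (q - p) * (4 powr p * (3 * d) powr (\<alpha> + 5) * cmod (F K w) powr p)"
          by (intro add_left_mono mult_left_mono F0p) simp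
        finally show ?thesis by (simp add: mult.assoc)
      qed
      have intF: "(\<integral>\<^sup>+w\<in>cball 0 1. ennreal (cmod (F K w) powr p) \<partial>lborel) \<le> ennreal (\<kappa> * d powr (- \<alpha> - 2) * (t powr p * (C5 / d ^ 3)))"
      proof -
        define \<tau> where "\<tau> = (C5 / d ^ 3) powr (1 / p)"
        have \<tau>: "0 < \<tau>" "\<tau> powr p = C5 / d ^ 3" using C5 d p by (auto simp: \<tau>_def powr_powr)
        have "Apnorm_pow \<alpha> p f \<le> ennreal (\<tau> powr p)" unfolding \<tau>(2) using tf[OF a] \<alpha> by (simp add: Apnorm_pow_def f_def[abs_def] d_def)
        from opnorm_iterate[OF g n p N op f \<tau>(1) this, of j]
        have "bergman_pow \<alpha> p (G K) \<le> ennreal ((t * \<tau>) powr p)" using \<alpha> by (simp add: Apnorm_pow_def G_def K_def t_def)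
        also have "(t * \<tau>) powr p = t powr p * (C5 / d ^ 3)" using t \<tau> by (simp add: powr_mult)
        finally have "bergman_pow \<alpha> p (G K) \<le> ennreal (t powr p * (C5 / d ^ 3))" .
        from loc[OF GP(1) a _ this] show ?thesis using C5 d by (simp add: F_def L_def \<rho>_def d_def)
      qed
      let ?P = "\<lambda>w. cmod (gr w) powr (real m / real n) * cmod (deriv gr w)"
      have "(\<integral>\<^sup>+w\<in>cball 0 1. ennreal ((1 - (cmod w)\<^sup>2)\<^sup>2 * (?P w)\<^sup>2) \<partial>lborel)
        \<le> (\<integral>\<^sup>+z\<in>cball 0 1. ennreal (C0 * (1 + C') * ((cmod (F K z) / cmod (F 0 z)) powr (2 / real K) * (1 + (\<Sum>k<1. exp (2 * x k z)))) * (16 * (cmod z)\<^sup>2)) \<partial>lborel)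
          + (\<integral>\<^sup>+t\<in>{0..2*pi}. ennreal (0 * (C0 * (1 + C') * ((cmod (F K (cis t)) / cmod (F 0 (cis t))) powr (2 / real K) * (1 + (\<Sum>k<1. exp (2 * x k (cis t))))))) \<partial>lborel)"
      proof (rule est[where S=UNIV and R="3/2" and ?m2.0="\<lambda>z. 8" and ?m1.0="\<lambda>z. 16 * (cmod z)\<^sup>2" and P="\<lambda>t. 0" and M=M])
        show "gr holomorphic_on ball 0 (3 / 2)" by (rule holomorphic_on_subset[OF grh]) auto
        show "F i holomorphic_on ball 0 (3 / 2)" for i by (rule holomorphic_on_subset[OF Fh]) auto
        show "F 0 z \<noteq> 0" if "z \<in> ball 0 (3 / 2) - {0}" for z using that by (intro F0nz) auto
        show "deriv (F (Suc i)) z = gr z ^ (if n dvd Suc i then m else 0) * deriv gr z * F i z" if "z \<in> ball 0 (3 / 2)" for i z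
        proof -
          have z2: "z \<in> ball 0 2" using that by auto
          have "deriv (F (Suc i)) z = of_real \<rho> * deriv (G (Suc i)) (L z)"
            unfolding F_def[abs_def] by (rule dild[OF GP(1) z2])
          then show ?thesis unfolding GP(2)[OF Ld[OF z2]] dgr[OF z2] by (simp add: F_def gr_def mult_ac)
        qed
        show "lap2 (ball 0 (3 / 2) - {0}) (x k) (\<lambda>z. 1) (\<lambda>z. 0) (\<lambda>z. 0)" for k by (rule lx)
        show "0 \<le> x k z" if "z \<in> cball 0 1 - {0}" for k z
          using that abs_Re_le_cmod[of z] unfolding x_def by auto
        show "(cmod (deriv (F 0) z / F 0 z))\<^sup>2 \<le> C' * (\<Sum>k<(1::nat). (cmod 1)\<^sup>2)" if "z \<in> cball 0 1 - {0}" for z by (rule \<theta>[OF that])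
        show "(cmod (F K z) / cmod (F 0 z)) powr (2 / real K) * (1 + (\<Sum>k<1. exp (2 * x k z))) \<le> M" if "z \<in> ball 0 (3 / 2) - {0}" for z
          using M[of z] that by (simp add: M0_def)
        show "lap2 UNIV (\<lambda>z. (1 - (cmod z)\<^sup>2)\<^sup>2) Dv av (\<lambda>z. 8 * (cmod z)\<^sup>2 - 4)" by (rule lv)
        show "- Re (cis t * Dv (cis t)) = 0" for t using Dv0[of "cis t"] by simp
      qed (use C' in \<open>auto intro!: continuous_intros\<close>)
      also have "\<dots> = (\<integral>\<^sup>+z\<in>cball 0 1. ennreal (C0 * (1 + C') * ((cmod (F K z) / cmod (F 0 z)) powr (2 / real K) * (1 + (\<Sum>k<1. exp (2 * x k z)))) * (16 * (cmod z)\<^sup>2)) \<partial>lborel)" by simp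
      also have "\<dots> \<le> (\<integral>\<^sup>+w\<in>cball 0 1. ennreal (E * t powr q * 1 + E * (t powr (q - p) * (4 powr p * (3 * d) powr (\<alpha> + 5))) * cmod (F K w) powr p) \<partial>lborel)"
      proof (intro nn_integral_mono)
        fix w
        show "ennreal (C0 * (1 + C') * ((cmod (F K w) / cmod (F 0 w)) powr (2 / real K) * (1 + (\<Sum>k<1. exp (2 * x k w)))) * (16 * (cmod w)\<^sup>2)) * indicator (cball 0 1) w
          \<le> ennreal (E * t powr q * 1 + E * (t powr (q - p) * (4 powr p * (3 * d) powr (\<alpha> + 5))) * cmod (F K w) powr p) * indicator (cball 0 1) w"
        proof (cases "w \<in> cball 0 1")
          case True
          define Q where "Q = (cmod (F K w) / cmod (F 0 w)) powr q"
          have "exp (2 * x 0 w) \<le> exp 4" using True complex_Re_le_cmod[of w] by (simp add: x_def)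
          moreover have "16 * (cmod w)\<^sup>2 \<le> 16" using True by (simp add: abs_square_le_1)
          ultimately have "(1 + exp (2 * x 0 w)) * (16 * (cmod w)\<^sup>2) \<le> (1 + exp 4) * 16" by (intro mult_mono) auto
          then have "(C0 * (1 + C') * Q) * ((1 + exp (2 * x 0 w)) * (16 * (cmod w)\<^sup>2)) \<le> (C0 * (1 + C') * Q) * ((1 + exp 4) * 16)"
            using C0 C' by (intro mult_left_mono) (auto simp: Q_def)
          also have "\<dots> = E * Q" by (simp add: E_def mult_ac)
          also have "\<dots> \<le> E * (t powr q * 1 + t powr (q - p) * (4 powr p * (3 * d) powr (\<alpha> + 5)) * cmod (F K w) powr p)"
            unfolding Q_def using E by (intro mult_left_mono ratio[OF True]) auto
          also have "E * (t powr q * 1 + t powr (q - p) * (4 powr p * (3 * d) powr (\<alpha> + 5)) * cmod (F K w) powr p)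
            = E * t powr q * 1 + E * (t powr (q - p) * (4 powr p * (3 * d) powr (\<alpha> + 5))) * cmod (F K w) powr p"
            by (simp only: distrib_left mult.assoc)
          also have "C0 * (1 + C') * Q * ((1 + exp (2 * x 0 w)) * (16 * (cmod w)\<^sup>2)) = C0 * (1 + C') * (Q * (1 + exp (2 * x 0 w))) * (16 * (cmod w)\<^sup>2)"
            by (simp only: mult.assoc)
          finally have "C0 * (1 + C') * (Q * (1 + exp (2 * x 0 w))) * (16 * (cmod w)\<^sup>2) \<le> E * t powr q * 1 + E * (t powr (q - p) * (4 powr p * (3 * d) powr (\<alpha> + 5))) * cmod (F K w) powr p" .
          then show ?thesis using True by (simp add: Q_def q_def ennreal_leI)
        qed simp
      qed
      also have "\<dots> = ennreal (E * t powr q) * (\<integral>\<^sup>+w\<in>cball (0::complex) 1. ennreal 1 \<partial>lborel)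
          + ennreal (E * (t powr (q - p) * (4 powr p * (3 * d) powr (\<alpha> + 5)))) * (\<integral>\<^sup>+w\<in>cball 0 1. ennreal (cmod (F K w) powr p) \<partial>lborel)"
      proof (rule nn_integral_lincomb)
        have "continuous_on (cball 0 1) (F K)" by (rule continuous_on_subset[OF holomorphic_on_imp_continuous_on[OF Fh]]) auto
        then have "continuous_on (cball 0 1) (\<lambda>w. cmod (F K w) powr p)" using p by (rule continuous_on_cmod_powr)
        from borel_measurable_continuous_on_indicator[OF _ this]
        show "(\<lambda>w. indicator (cball 0 1) w * cmod (F K w) powr p) \<in> borel_measurable lborel" by simp
        show "(\<lambda>w::complex. indicator (cball 0 1) w * (1::real)) \<in> borel_measurable lborel"
          using borel_measurable_continuous_on_indicator[OF _ continuous_on_const[of "cball (0::complex) 1" "1::real"]] by simp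
      qed (use E in auto)
      also have "(\<integral>\<^sup>+w\<in>cball (0::complex) 1. ennreal 1 \<partial>lborel) = ennreal pi"
        by (simp add: emeasure_cball unit_ball_vol_2)
      also have "ennreal (E * t powr q) * ennreal pi + ennreal (E * (t powr (q - p) * (4 powr p * (3 * d) powr (\<alpha> + 5)))) * (\<integral>\<^sup>+w\<in>cball 0 1. ennreal (cmod (F K w) powr p) \<partial>lborel)
        \<le> ennreal (E * t powr q) * ennreal pi + ennreal (E * (t powr (q - p) * (4 powr p * (3 * d) powr (\<alpha> + 5)))) * ennreal (\<kappa> * d powr (- \<alpha> - 2) * (t powr p * (C5 / d ^ 3)))"
        by (intro add_left_mono mult_left_mono intF) simp
      also have "\<dots> = ennreal (E * (pi + 4 powr p * 3 powr (\<alpha> + 5) * \<kappa> * C5) * t powr q)"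
      proof -
        have e1: "(3 * d) powr (\<alpha> + 5) = 3 powr (\<alpha> + 5) * d powr (\<alpha> + 5)" using d by (simp add: powr_mult)
        have e2: "1 / d ^ 3 = d powr (- 3)" using d by (simp add: powr_minus_divide)
        have e3: "d powr (\<alpha> + 5) * d powr (- \<alpha> - 2) * d powr (- 3) = 1" using d by (simp only: powr_add[symmetric]) simp
        have e4: "t powr (q - p) * t powr p = t powr q" by (simp flip: powr_add)
        have "E * t powr q * pi + E * (t powr (q - p) * (4 powr p * (3 * d) powr (\<alpha> + 5))) * (\<kappa> * d powr (- \<alpha> - 2) * (t powr p * (C5 / d ^ 3)))
          = E * t powr q * pi + E * (4 powr p * 3 powr (\<alpha> + 5)) * \<kappa> * C5 * (t powr (q - p) * t powr p) * (d powr (\<alpha> + 5) * d powr (- \<alpha> - 2) * (1 / d ^ 3))"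
          unfolding e1 by (simp add: mult_ac)
        also have "\<dots> = E * (pi + 4 powr p * 3 powr (\<alpha> + 5) * \<kappa> * C5) * t powr q"
          unfolding e2 e3 e4 by (simp add: algebra_simps)
        finally show ?thesis using E \<kappa> C5 d by (subst ennreal_mult[symmetric], simp, simp, subst ennreal_mult[symmetric], simp, simp, subst ennreal_plus[symmetric], simp_all)
      qed
      finally have main: "(\<integral>\<^sup>+w\<in>cball 0 1. ennreal ((1 - (cmod w)\<^sup>2)\<^sup>2 * (?P w)\<^sup>2) \<partial>lborel) \<le> ennreal (E * (pi + 4 powr p * 3 powr (\<alpha> + 5) * \<kappa> * C5) * t powr q)" .
      \<comment> \<open>u is a fractional power of the modulus of this holomorphic function, to
        which the submean property applies without choosing a root of \<open>g\<close>.\<close>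
      define h where "h w = gr w ^ m * deriv gr w ^ n" for w
      have dgrh: "deriv gr holomorphic_on ball 0 2" by (rule holomorphic_deriv[OF grh open_ball])
      have hh: "h holomorphic_on ball 0 2" unfolding h_def by (intro holomorphic_intros grh dgrh)
      have hP: "cmod (h w) powr (2 / real n) = (?P w)\<^sup>2" for w
      proof -
        have "(?P w)\<^sup>2 = ((cmod (gr w) ^ m * cmod (deriv gr w) ^ n) powr (1 / real n))\<^sup>2"
          using m n by (simp add: power_mult_powr_eq)
        also have "\<dots> = (cmod (h w) powr (1 / real n))\<^sup>2" by (simp add: h_def norm_mult norm_power)
        also have "\<dots> = cmod (h w) powr (2 / real n)" by (simp add: power2_eq_square flip: powr_add)
        finally show ?thesis ..
      qed
      have hc: "continuous_on (cball 0 1) (\<lambda>w. cmod (h w) powr (2 / real n))"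
        using n by (intro continuous_on_cmod_powr continuous_on_subset[OF holomorphic_on_imp_continuous_on[OF hh]]) auto
      \<comment> \<open>Restricting to radius 1/2, where the kernel (1 - |w|^2)^2 is at least 9/16,
        removes the weight before the submean property is used.\<close>
      have "ennreal ((1/2)\<^sup>2) * (\<integral>\<^sup>+w\<in>cball 0 1. ennreal (cmod (h (0 + of_real (1 / 2) * w)) powr (2 / real n)) \<partial>lborel)
        = (\<integral>\<^sup>+w\<in>cball 0 (1 / 2). ennreal (cmod (h w) powr (2 / real n)) \<partial>lborel)"
        by (rule nn_integral_cball_affine[symmetric], rule continuous_on_subset[OF hc]) auto
      also have "\<dots> \<le> (\<integral>\<^sup>+w\<in>cball 0 1. ennreal (16 / 9 * ((1 - (cmod w)\<^sup>2)\<^sup>2 * cmod (h w) powr (2 / real n))) \<partial>lborel)"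
      proof (intro nn_integral_mono)
        fix w :: complex
        show "ennreal (cmod (h w) powr (2 / real n)) * indicator (cball 0 (1 / 2)) w
          \<le> ennreal (16 / 9 * ((1 - (cmod w)\<^sup>2)\<^sup>2 * cmod (h w) powr (2 / real n))) * indicator (cball 0 1) w"
        proof (cases "w \<in> cball 0 (1 / 2)")
          case True
          have "(cmod w)\<^sup>2 \<le> (1 / 2)\<^sup>2" using True by (intro power_mono) auto
          then have "3 / 4 \<le> 1 - (cmod w)\<^sup>2" by (simp add: power2_eq_square)
          then have "(3 / 4)\<^sup>2 \<le> (1 - (cmod w)\<^sup>2)\<^sup>2" by (rule power_mono) simp
          then have "1 \<le> 16 / 9 * (1 - (cmod w)\<^sup>2)\<^sup>2" by (simp add: power2_eq_square)
          then have "1 * cmod (h w) powr (2 / real n) \<le> 16 / 9 * (1 - (cmod w)\<^sup>2)\<^sup>2 * cmod (h w) powr (2 / real n)" by (rule mult_right_mono) simp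
          then show ?thesis using True by (simp add: ennreal_leI mult.assoc)
        qed simp
      qed
      also have "\<dots> = ennreal (16 / 9) * (\<integral>\<^sup>+w\<in>cball 0 1. ennreal ((1 - (cmod w)\<^sup>2)\<^sup>2 * cmod (h w) powr (2 / real n)) \<partial>lborel)"
        by (intro cball_nn_integral_cmult continuous_intros hc) simp
      also have "\<dots> \<le> ennreal (16 / 9) * ennreal (E * (pi + 4 powr p * 3 powr (\<alpha> + 5) * \<kappa> * C5) * t powr q)"
        unfolding hP by (intro mult_left_mono main) simp
      also have "\<dots> = ennreal (16 / 9 * (E * (pi + 4 powr p * 3 powr (\<alpha> + 5) * \<kappa> * C5) * t powr q))"
        by (rule ennreal_mult'[symmetric]) simp
      finally have "(\<integral>\<^sup>+w\<in>cball 0 1. ennreal (cmod (h (0 + of_real (1 / 2) * w)) powr (2 / real n)) \<partial>lborel)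
        \<le> ennreal (16 / 9 * (E * (pi + 4 powr p * 3 powr (\<alpha> + 5) * \<kappa> * C5) * t powr q) / (1/2)\<^sup>2)"
        using E \<kappa> C5 by (intro ennreal_mult_leD) (auto intro!: mult_nonneg_nonneg add_nonneg_nonneg)
      also have "16 / 9 * (E * (pi + 4 powr p * 3 powr (\<alpha> + 5) * \<kappa> * C5) * t powr q) / (1/2)\<^sup>2 = D2 * t powr q"
        by (simp add: D2_def power2_eq_square)
      finally have I: "(\<integral>\<^sup>+w\<in>cball 0 1. ennreal (cmod (h (0 + of_real (1 / 2) * w)) powr (2 / real n)) \<partial>lborel) \<le> ennreal (D2 * t powr q)" .
      have "ennreal (cmod (h (0 + of_real (1 / 2) * 0)) powr (2 / real n)) \<le> (\<integral>\<^sup>+w\<in>cball 0 1. ennreal (cmod (h (0 + of_real (1 / 2) * w)) powr (2 / real n)) \<partial>lborel)"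
      proof (rule submean_powr[of "\<lambda>w. h (0 + of_real (1 / 2) * w)" 2])
        have "(h \<circ> (\<lambda>w. 0 + of_real (1 / 2) * w)) holomorphic_on ball 0 2"
          by (rule holomorphic_on_compose_gen[OF _ hh]) (auto intro!: holomorphic_intros simp: norm_mult)
        then show "(\<lambda>w. h (0 + of_real (1 / 2) * w)) holomorphic_on ball 0 2" by (simp add: o_def)
      qed (use n in auto)
      also note I
      also have "t powr q = (N powr (1 / real n))\<^sup>2"
        using N n j by (simp add: t_def q_def K_def powr_powr power2_eq_square flip: powr_realpow powr_add)
      finally have "(?P 0)\<^sup>2 \<le> D2 * (N powr (1 / real n))\<^sup>2"
        using D2 by (simp add: hP[of 0] ennreal_le_iff)
      then have "sqrt ((?P 0)\<^sup>2) \<le> sqrt (D2 * (N powr (1 / real n))\<^sup>2)" by (rule real_sqrt_le_mono)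
      then have "?P 0 \<le> sqrt D2 * N powr (1 / real n)" by (simp add: real_sqrt_mult)
      moreover have "?P 0 = \<rho> * (cmod (g a) powr (real m / real n) * cmod (deriv g a))"
        using dgr[of 0] \<rho> by (simp add: gr_def L_def norm_mult)
      ultimately show "(1 - cmod a) * (cmod (g a) powr (real m / real n) * cmod (deriv g a)) \<le> 2 * sqrt D2 * N powr (1 / real n)"
        by (simp add: \<rho>_def d_def)
    qed
  qed
qed

text \<open>Points with |a| at least 1/2 are covered by the test estimate. The inner disc follows
  from the maximum principle for g^m g'^n, whose modulus is the n-th power of u.\<close>

lemma bloch_estimate:
  fixes m n :: nat and \<alpha> p :: real
  assumes \<alpha>: "-1 < \<alpha>" and p: "0 < p" and n: "n \<ge> 1" and m: "m \<ge> 1"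
  obtains C :: real where "0 < C" "\<And>g N. g holomorphic_on disc \<Longrightarrow> 0 < N \<Longrightarrow>
      opnorm \<alpha> p (\<lambda>f. (Sg g ^^ m) ((Tg g ^^ n) f)) \<le> ennreal N \<Longrightarrow> bloch_pow (real m / real n + 1) g \<le> ennreal (C * N powr (1 / real n))"
proof (rule bergman_test_estimate[OF \<alpha> p n m])
  fix D :: real
  assume D: "0 < D" and est: "\<And>g N a. g holomorphic_on disc \<Longrightarrow> 0 < N \<Longrightarrow>
      opnorm \<alpha> p (\<lambda>f. (Sg g ^^ m) ((Tg g ^^ n) f)) \<le> ennreal N \<Longrightarrow> 1 / 2 \<le> cmod a \<Longrightarrow> cmod a < 1 \<Longrightarrow>
      (1 - cmod a) * (cmod (g a) powr (real m / real n) * cmod (deriv g a)) \<le> D * N powr (1 / real n)"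
  define s where "s = real m / real n + 1"
  have s: "1 < s" using m n by (simp add: s_def)
  show thesis
  proof (rule that[of "s * (2 * D)"])
    show "0 < s * (2 * D)" using s D by simp
    fix g :: "complex \<Rightarrow> complex" and N :: real
    assume g: "g holomorphic_on disc" and N: "0 < N" and op: "opnorm \<alpha> p (\<lambda>f. (Sg g ^^ m) ((Tg g ^^ n) f)) \<le> ennreal N"
    define u where "u z = cmod (g z) powr (real m / real n) * cmod (deriv g z)" for z
    define B where "B = D * N powr (1 / real n)"
    have B: "0 < B" using D N by (simp add: B_def)
    have u0: "0 \<le> u z" for z by (simp add: u_def)
    have big: "(1 - cmod z) * u z \<le> B" if "1 / 2 \<le> cmod z" "cmod z < 1" for z
      using est[OF g N op that] by (simp add: u_def B_def)
    define h where "h z = g z ^ m * deriv g z ^ n" for z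
    have hh: "h holomorphic_on disc" unfolding h_def by (intro holomorphic_intros g holomorphic_deriv[OF g open_ball])
    have uh: "u z = cmod (h z) powr (1 / real n)" for z
      unfolding u_def h_def norm_mult norm_power using m n by (simp add: power_mult_powr_eq)
    \<comment> \<open>On the circle |w| = 1/2 the factor 1 - |w| is 1/2, whence the bound 2 B, which
      the maximum principle carries inside.\<close>
    have small: "u z \<le> 2 * B" if z: "cmod z < 1 / 2" for z
    proof -
      have hB: "cmod (h w) \<le> (2 * B) powr real n" if "cmod w = 1 / 2" for w
      proof -
        have "u w \<le> 2 * B" using big[of w] that by simp
        then have "u w powr real n \<le> (2 * B) powr real n" using u0 by (intro powr_mono2) auto
        moreover have "u w powr real n = cmod (h w)" unfolding uh using n by (simp add: powr_powr)
        ultimately show ?thesis by simp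
      qed
      have "cmod (h z) \<le> (2 * B) powr real n"
      proof (rule maximum_modulus_frontier[of h "ball 0 (1 / 2)"])
        show "h holomorphic_on interior (ball 0 (1 / 2))" by (rule holomorphic_on_subset[OF hh]) auto
        show "continuous_on (closure (ball 0 (1 / 2))) h"
          by (rule continuous_on_subset[OF holomorphic_on_imp_continuous_on[OF hh]]) auto
        show "cmod (h w) \<le> (2 * B) powr real n" if "w \<in> frontier (ball 0 (1 / 2))" for w
          using that by (intro hB) (simp add: dist_norm)
      qed (use z in auto)
      then have "u z \<le> ((2 * B) powr real n) powr (1 / real n)" unfolding uh by (intro powr_mono2) auto
      also have "\<dots> = 2 * B" using B n by (simp add: powr_powr)
      finally show ?thesis .
    qed
    have all: "(1 - (cmod z)\<^sup>2) * u z \<le> 2 * B" if z: "cmod z < 1" for z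
    proof (cases "1 / 2 \<le> cmod z")
      case True
      have "(1 - (cmod z)\<^sup>2) * u z = (1 + cmod z) * ((1 - cmod z) * u z)" by (simp add: power2_eq_square algebra_simps)
      also have "\<dots> \<le> 2 * B" using z True big[OF True z] u0[of z] by (intro mult_mono) auto
      finally show ?thesis .
    next
      case False
      have "(1 - (cmod z)\<^sup>2) * u z \<le> 1 * u z" using u0 by (intro mult_right_mono) auto
      also have "\<dots> \<le> 2 * B" using small[of z] False by simp
      finally show ?thesis .
    qed
    show "bloch_pow (real m / real n + 1) g \<le> ennreal (s * (2 * D) * N powr (1 / real n))"
      unfolding bloch_pow_def s_def[symmetric]
    proof (rule SUP_least)
      fix z :: complex assume z: "z \<in> disc"
      have "ennreal (1 - (cmod z)\<^sup>2) * grad_abs (\<lambda>w. cmod (g w) powr s) z \<le> ennreal (1 - (cmod z)\<^sup>2) * ennreal (s * u z)"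
        using grad_abs_cmod_powr_le[OF g open_ball z s] by (intro mult_left_mono) (simp_all add: u_def s_def mult.assoc)
      also have "\<dots> = ennreal ((1 - (cmod z)\<^sup>2) * (s * u z))" using s u0 by (simp add: ennreal_mult'')
      also have "(1 - (cmod z)\<^sup>2) * (s * u z) = s * ((1 - (cmod z)\<^sup>2) * u z)" by simp
      also have "ennreal (s * ((1 - (cmod z)\<^sup>2) * u z)) \<le> ennreal (s * (2 * B))" using z s by (intro ennreal_leI mult_left_mono all) auto
      also have "s * (2 * B) = s * (2 * D) * N powr (1 / real n)" by (simp add: B_def)
      finally show "ennreal (1 - (cmod z)\<^sup>2) * grad_abs (\<lambda>w. cmod (g w) powr s) z \<le> ennreal (s * (2 * D) * N powr (1 / real n))" .
    qed
  qed
qed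

theorem theorem7p1:
  fixes \<alpha> p :: real and m n :: nat
  assumes "\<alpha> \<ge> -1" and "0 < p" and "m \<ge> 1" and "n \<ge> 2"
  defines "s \<equiv> real m / real n + 1"
  shows "\<exists>C>0. \<forall>g. g holomorphic_on disc \<longrightarrow>
           enn_powr (Bq_alpha_norm \<alpha> s g) (s * real n)
             \<le> ennreal C * opnorm \<alpha> p (\<lambda>f. (Sg g ^^ m) ((Tg g ^^ n) f))"
proof -
  have n: "1 \<le> n" and n0: "0 < real n" using assms(4) by auto
  have s: "0 < s" unfolding s_def by (intro add_nonneg_pos) auto
  show ?thesis
  proof (cases "\<alpha> = -1")
    case True
    obtain C where C: "0 < C" and est: "\<And>g N. g holomorphic_on disc \<Longrightarrow> 0 < N \<Longrightarrow>
      opnorm (-1) p (\<lambda>f. (Sg g ^^ m) ((Tg g ^^ n) f)) \<le> ennreal N \<Longrightarrow> bmoa_pow s g \<le> ennreal (C * N powr (2 / real n))"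
      using bmoa_estimate[OF assms(2) n assms(3)] unfolding s_def by blast
    \<comment> \<open>The exponents are matched: the square integral scales like N^(2/n), the norm
      takes its root of order 2 s, and the power s n brings N back to exponent 1.\<close>
    define v where "v = 1 / (2 * s) * (s * real n)"
    have "enn_powr (Bq_alpha_norm \<alpha> s g) (s * real n) \<le> ennreal (C powr v) * opnorm \<alpha> p (\<lambda>f. (Sg g ^^ m) ((Tg g ^^ n) f))"
      if g: "g holomorphic_on disc" for g
    proof (rule le_mult_ennreal_if)
      fix N :: real assume N: "0 < N" "opnorm \<alpha> p (\<lambda>f. (Sg g ^^ m) ((Tg g ^^ n) f)) \<le> ennreal N"
      have "bmoa_pow s g \<le> ennreal (C * N powr (2 / real n))" using N True by (intro est g) simp_all
      moreover have "2 / real n * (1 / (2 * s)) * (s * real n) = 1" using s n0 by (simp add: field_simps)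
      ultimately have "enn_powr (enn_powr (bmoa_pow s g) (1 / (2 * s))) (s * real n) \<le> ennreal (C powr v * N)"
        unfolding v_def using s n0 by (intro enn_powr_le[OF _ C N(1)]) (assumption | simp)+
      then show "enn_powr (Bq_alpha_norm \<alpha> s g) (s * real n) \<le> ennreal (C powr v * N)"
        using True by (simp add: Bq_alpha_norm_def)
    qed (use C in simp)
    then show ?thesis using C by (intro exI[of _ "C powr v"]) simp
  next
    case False
    then have \<alpha>: "-1 < \<alpha>" using assms(1) by simp
    obtain C where C: "0 < C" and est: "\<And>g N. g holomorphic_on disc \<Longrightarrow> 0 < N \<Longrightarrow>
      opnorm \<alpha> p (\<lambda>f. (Sg g ^^ m) ((Tg g ^^ n) f)) \<le> ennreal N \<Longrightarrow> bloch_pow s g \<le> ennreal (C * N powr (1 / real n))"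
      using bloch_estimate[OF \<alpha> assms(2) n assms(3)] unfolding s_def by blast
    define v where "v = 1 / s * (s * real n)"
    have "enn_powr (Bq_alpha_norm \<alpha> s g) (s * real n) \<le> ennreal (C powr v) * opnorm \<alpha> p (\<lambda>f. (Sg g ^^ m) ((Tg g ^^ n) f))"
      if g: "g holomorphic_on disc" for g
    proof (rule le_mult_ennreal_if)
      fix N :: real assume N: "0 < N" "opnorm \<alpha> p (\<lambda>f. (Sg g ^^ m) ((Tg g ^^ n) f)) \<le> ennreal N"
      have "bloch_pow s g \<le> ennreal (C * N powr (1 / real n))" using N by (intro est g)
      moreover have "1 / real n * (1 / s) * (s * real n) = 1" using s n0 by (simp add: field_simps)
      ultimately have "enn_powr (enn_powr (bloch_pow s g) (1 / s)) (s * real n) \<le> ennreal (C powr v * N)"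
        unfolding v_def using s n0 by (intro enn_powr_le[OF _ C N(1)]) (assumption | simp)+
      then show "enn_powr (Bq_alpha_norm \<alpha> s g) (s * real n) \<le> ennreal (C powr v * N)"
        using False by (simp add: Bq_alpha_norm_def)
    qed (use C in simp)
    then show ?thesis using C by (intro exI[of _ "C powr v"]) simp
  qed
qed

end
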